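(* Fix $T>0$, $N\in\mathbb N$. Assume (for each dimension $D$): $X$ satisfies Condition (C4)$_{\tilde p}$ with some $\tilde p>2$; there are maps $f_n$ as in item (1) of Condition (C3) with $(\mathbb E|\mathrm{Growth}(f_n(\cdot,\omega))|^p)^{1/p}\le cD^q$ for some $p\ge2$ and $\|x_0\|\le cD^q$; $g$ satisfies Condition (C5). Suppose moreover that for every $n=0,\dots,N-1$ there exist constants $c_{n+1},q_{n+1},\tau_{n+1}\in[1,\infty)$ independent of $D$ such that for every $\varepsilon>0$ and $N_0\in\mathbb N$ there is a ReLU network $\hat V_{n+1}:\mathbb R^D\to\mathbb R$ with $\big(\int|V_{n+1}-\hat V_{n+1}|^2d\tilde\rho^{N_0}_{n+1}\big)^{1/2}\le\varepsilon$, $\mathrm{Growth}(\hat V_{n+1})\le c_{n+1}D^{q_{n+1}}\varepsilon^{-\tau_{n+1}}$ and $\mathrm{size}(\hat V_{n+1})\le c_{n+1}D^{q_{n+1}}\varepsilon^{-\tau_{n+1}}$. Then for every $n=0,\dots,N-1$ there exist constants $\hat c_n,\hat q_n,\hat\tau_n,\hat m_n\in[1,\infty)$, independent of $D$, such that for every $\varepsilon>0$ and $N_0\in\mathbb N$ there exist ReLU networks $\gamma^n_k:\mathbb R^D\to\mathbb R^D$, $k=0,\dots,N_0-1$, and a function $\hat z_n:\mathbb R^{1+D}\to\mathbb R^D$ with $\hat z_n(t^n_k,x)=\gamma^n_k(x)$, such that $$\Big(\int_{\mathbb R^{1+D}}\|Z^*_n(t,x)-\hat z_n(t,x)\|^2\,d\mu^{N_0}_n\Big)^{1/2}\le\varepsilon,$$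 and for all $k=0,\dots,N_0-1$, $$\mathrm{Growth}(\gamma^n_k)\le\hat c_nD^{\hat q_n}\varepsilon^{-\hat\tau_n}N_0^{\hat m_n},\qquad \mathrm{size}(\gamma^n_k)\le\hat c_nD^{\hat q_n}\varepsilon^{-\hat\tau_n}N_0^{\hat m_n}.$$
   Context: Dimension convention: $D$ varies; "independent of $D$" means uniform over all $D$. Setting: $W$ is a $D$-dimensional Brownian motion with augmented filtration $\mathbb F$; $X$ solves $dX_t=a(t,X_t)dt+b(t,X_t)dW_t$, $X_0=x_0$, $a,b$ Lipschitz in $x$, $\tfrac12$-Hölder in $t$. $t_n=nT/N$, $\mathbb F^{dis}=(\mathcal F_{t_n})_n$. Payoff $g$ with $\mathbb E|g(t_n,X_{t_n})|^2<\infty$; $Y^*_n=\operatorname{ess\,sup}_\tau\mathbb E[g(\tau,X_\tau)\mid\mathcal F_{t_n}]$ over $\mathbb F^{dis}$-stopping times with values in $\{t_n,\dots,t_N\}$; $V_{n+1}$ is the Borel function with $Y^*_{n+1}=V_{n+1}(X_{t_{n+1}})$ ($V_N=g(t_N,\cdot)$, $V_n(x)=\max(g(t_n,x),\mathbb E[V_{n+1}(X^{t_n,x}_{t_{n+1}})])$). For $N_0\in\mathbb N$: $\Delta t=T/(NN_0)$, $t^n_k=t_n+k\Delta t$, $\Delta W_{t^n_k}=W_{t^n_{k+1}}-W_{t^n_k}$; $\hat Z^*_{t^n_k}=\frac1{\Delta t}\mathbb E[Y^*_{n+1}\Delta W_{t^n_k}\mid\mathcal F_{t^n_k}]$; $Z^*_n$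 is a Borel function with $\hat Z^*_{t^n_k}=Z^*_n(t^n_k,X_{t^n_k})$ a.s. for all $k$; $\mu^{N_0}_n(A)=\mathbb E[\sum_{k=0}^{N_0-1}1_A(t^n_k,X_{t^n_k})\Delta t]$ on $\mathbb R^{1+D}$; $\tilde\rho^{N_0}_{n+1}(A)=\mathbb E[\sum_{k=0}^{N_0-1}\|\Delta W_{t^n_k}\|^21_A(X_{t_{n+1}})]$ on $\mathbb R^D$. Neural networks: finite feed-forward ReLU networks; size = number of nonzero weights and biases; $\mathrm{Growth}(f)=\sup_x\|f(x)\|/(1+\|x\|)$; $\mathrm{Lip}$ = minimal Lipschitz constant. RanNN: with $\sigma$ componentwise ReLU, an infinite-width network of depth $I$ is $f=f_{I+1}\circ\cdots\circ f_1$ with hidden spaces $\ell^2(\mathbb N)$, $f_1(x)=W^1x+b^1$, $f_{i+1}(y)=W^{i+1}\sigma(y)+b^{i+1}$, layer parameters $\mu_i=\sum_{m\ge0}w^{i+1}_m\delta_m$ ($b^{i+1}=w^{i+1}_0$, $W^{i+1}x=\sum_{m\ge1}w^{i+1}_mx_{m-1}$) of finite total variation $\sum_m\|w^{i+1}_m\|$; a RanNN is $\tilde f(x,\omega)=f(x,\mu(\omega))$ with random parameter $\mu$; its size counts nonzero scalar entries of all $w^{i+1}_m(\omega)$, and $\mathrm{Growth}(\tilde f)(\omega)=\sup_x\|\tilde f(x,\omega)\|/(1+\|x\|)$. Condition (C3), item (1): $X$ is $\mathbb F^{dis}$-Markov and $f_n:\mathbb R^D\times\Omega\to\mathbb R^D$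 are $\mathcal B(\mathbb R^D)\otimes\mathcal F_{t_{n+1}}$-measurable with $X_{t_{n+1}}=f_n(X_{t_n},\cdot)$ a.s., $f_n(x,\cdot)$ independent of $\mathcal F_{t_n}$, and $\mathbb E[X_{t_{n+1}}\mid\mathcal F_{t_n}]=\mathbb E[X_{t_{n+1}}\mid X_{t_n}]=\mathbb E[f_n(x,\cdot)]|_{x=X_{t_n}}$. Constants $c,q>0$ are independent of $D$. Condition (C4)$_{\tilde p}$: writing $X^{s,x}_t=f(x,s,t,\omega)$ for the solution started at $x$ at time $s$, with $(x,s,t)\mapsto f$ Borel, and $f^t_s(x,\omega)=f(x,s,t,\omega)$, there are $\bar c,\bar q>0$ independent of $D$ such that for all $n$ and $t_n\le s<t\le t_{n+1}$: $(\mathbb E|\mathrm{Growth}(f^t_s)|^{\tilde p})^{1/\tilde p}\le\bar cD^{\bar q}$; there is a RanNN $\hat f^t_s$ of depth $\le\bar cD^{\bar q}$ with $f^t_s=\hat f^t_s$ for all $x$, a.s.; $\mathbb E[\mathrm{size}(\hat f^t_s)]\le\bar cD^{\bar q}$. Condition (C5) (constants $c,q,r>0$ independent of $D$): for every $\varepsilon>0$, $n=0,\dots,N$ there is a ReLU network $\hat g_n$ with $|\hat g_n(x)-g(t_n,x)|\le\varepsilon cD^q(1+\|x\|)$, $\mathrm{size}(\hat g_n)\le cD^q\varepsilon^{-r}$, $\mathrm{Lip}(\hat g_n)\le cD^q$, $|g(t_n,0)|\le cD^q$. *)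

theory Defs
  imports "HOL-Probability.Probability"
begin

section \<open>Vectors of R^D, represented as functions nat => real vanishing from index D on\<close>

type_synonym vec = "nat \<Rightarrow> real"

definition vspace :: "nat \<Rightarrow> vec set" where
  "vspace D = {x. \<forall>i\<ge>D. x i = 0}"

definition vnorm :: "nat \<Rightarrow> vec \<Rightarrow> real" where
  "vnorm D x = sqrt (\<Sum>i<D. (x i)^2)"

definition relu :: "real \<Rightarrow> real" where
  "relu y = max 0 y"

text \<open>A network is a list of layer widths [d0, d1, ..., dL] together with a list of
  L affine layers (weight matrix, bias); ReLU is applied after every layer but the last.\<close>

type_synonym relu_net = "nat list \<times> ((nat \<Rightarrow> nat \<Rightarrow> real) \<times> (nat \<Rightarrow> real)) list"

definition affine :: "nat \<Rightarrow> nat \<Rightarrow> (nat \<Rightarrow> nat \<Rightarrow> real) \<times> (nat \<Rightarrow> real) \<Rightarrow> vec \<Rightarrow> vec" where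
  "affine din dout L x = (\<lambda>j. if j < dout then (\<Sum>i<din. fst L j i * x i) + snd L j else 0)"

fun eval_net :: "nat list \<Rightarrow> ((nat \<Rightarrow> nat \<Rightarrow> real) \<times> (nat \<Rightarrow> real)) list \<Rightarrow> vec \<Rightarrow> vec" where
  "eval_net (d0 # d1 # ds) [L] x = affine d0 d1 L x"
| "eval_net (d0 # d1 # ds) (L # L' # Ls) x =
     eval_net (d1 # ds) (L' # Ls) (\<lambda>j. relu (affine d0 d1 L x j))"
| "eval_net _ _ x = (\<lambda>_. 0)"

definition realize :: "relu_net \<Rightarrow> vec \<Rightarrow> vec" where
  "realize \<Phi> = eval_net (fst \<Phi>) (snd \<Phi>)"

definition valid_net :: "nat \<Rightarrow> nat \<Rightarrow> relu_net \<Rightarrow> bool" where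
  "valid_net din dout \<Phi> \<longleftrightarrow> snd \<Phi> \<noteq> [] \<and> length (fst \<Phi>) = length (snd \<Phi>) + 1
     \<and> hd (fst \<Phi>) = din \<and> last (fst \<Phi>) = dout"

definition net_size :: "relu_net \<Rightarrow> nat" where
  "net_size \<Phi> = (\<Sum>l<length (snd \<Phi>).
      card {(j, i). j < fst \<Phi> ! (l+1) \<and> i < fst \<Phi> ! l \<and> fst (snd \<Phi> ! l) j i \<noteq> 0}
    + card {j. j < fst \<Phi> ! (l+1) \<and> snd (snd \<Phi> ! l) j \<noteq> 0})"

definition growth :: "nat \<Rightarrow> nat \<Rightarrow> (vec \<Rightarrow> vec) \<Rightarrow> ennreal" where
  "growth din dout f = (SUP x\<in>vspace din. ennreal (vnorm dout (f x) / (1 + vnorm din x)))"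

definition ennpow :: "ennreal \<Rightarrow> real \<Rightarrow> ennreal" where
  "ennpow x p = (if x = \<infinity> then \<infinity> else ennreal (enn2real x powr p))"

text \<open>Parameters: w l m is the vector w^{l+1}_m of layer l (l = 0..I); hidden spaces l^2(N).\<close>

definition ran_layer :: "(nat \<Rightarrow> vec) \<Rightarrow> vec \<Rightarrow> vec" where
  "ran_layer w y = (\<lambda>j. w 0 j + (\<Sum>m. w (Suc m) j * y m))"

fun ran_eval :: "(nat \<Rightarrow> nat \<Rightarrow> vec) \<Rightarrow> nat \<Rightarrow> vec \<Rightarrow> vec" where
  "ran_eval w 0 x = ran_layer (w 0) x"
| "ran_eval w (Suc l) x = ran_layer (w (Suc l)) (\<lambda>m. relu (ran_eval w l x m))"

definition ran_valid :: "nat \<Rightarrow> nat \<Rightarrow> (nat \<Rightarrow> nat \<Rightarrow> vec) \<Rightarrow> bool" where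
  "ran_valid D I w \<longleftrightarrow>
     (\<forall>l\<le>I. \<forall>m. summable (\<lambda>j. (w l m j)^2))
   \<and> (\<forall>l\<le>I. summable (\<lambda>m. sqrt (\<Sum>j. (w l m j)^2)))
   \<and> (\<forall>m. w I m \<in> vspace D)"

definition ran_size :: "nat \<Rightarrow> (nat \<Rightarrow> nat \<Rightarrow> vec) \<Rightarrow> ennreal" where
  "ran_size I w = (let S = {(l, m, j). l \<le> I \<and> w l m j \<noteq> 0} in
      if finite S then ennreal (real (card S)) else \<infinity>)"

definition tgrid :: "real \<Rightarrow> nat \<Rightarrow> nat \<Rightarrow> real" where
  "tgrid T N n = real n * T / real N"

definition dt :: "real \<Rightarrow> nat \<Rightarrow> nat \<Rightarrow> real" where
  "dt T N N0 = T / (real N * real N0)"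

definition tsub :: "real \<Rightarrow> nat \<Rightarrow> nat \<Rightarrow> nat \<Rightarrow> nat \<Rightarrow> real" where
  "tsub T N N0 n k = tgrid T N n + real k * dt T N N0"

definition hist :: "'w measure \<Rightarrow> nat \<Rightarrow> (real \<Rightarrow> 'w \<Rightarrow> vec) \<Rightarrow> real \<Rightarrow> 'w set set" where
  "hist M D W s = (\<Union>u\<in>{0..s}. \<Union>i\<in>{..<D}.
      {(\<lambda>\<omega>. W u \<omega> i) -` B \<inter> space M | B. B \<in> sets (borel :: real measure)})"

definition Fm :: "'w measure \<Rightarrow> nat \<Rightarrow> (real \<Rightarrow> 'w \<Rightarrow> vec) \<Rightarrow> real \<Rightarrow> 'w measure" where
  "Fm M D W t = measure_of (space M) (hist M D W t \<union> null_sets M) (emeasure M)"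

definition sigX :: "'w measure \<Rightarrow> ('w \<Rightarrow> vec) \<Rightarrow> 'w measure" where
  "sigX M Y = measure_of (space M) {Y -` B \<inter> space M | B. B \<in> sets (borel :: vec measure)} (emeasure M)"

definition is_BM :: "'w measure \<Rightarrow> nat \<Rightarrow> real \<Rightarrow> (real \<Rightarrow> 'w \<Rightarrow> vec) \<Rightarrow> bool" where
  "is_BM M D T W \<longleftrightarrow> prob_space M
   \<and> (\<forall>t \<omega>. W t \<omega> \<in> vspace D)
   \<and> (\<forall>\<omega>\<in>space M. W 0 \<omega> = (\<lambda>_. 0))
   \<and> (\<forall>\<omega>\<in>space M. continuous_on {0..T} (\<lambda>t. W t \<omega>))
   \<and> (\<forall>t\<in>{0..T}. \<forall>i. (\<lambda>\<omega>. W t \<omega> i) \<in> borel_measurable M)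
   \<and> (\<forall>s t. 0 \<le> s \<and> s < t \<and> t \<le> T \<longrightarrow>
        (\<forall>i<D. distributed M lborel (\<lambda>\<omega>. W t \<omega> i - W s \<omega> i)
                   (\<lambda>x. ennreal (normal_density 0 (sqrt (t - s)) x)))
      \<and> prob_space.indep_sets M
          (\<lambda>j. case j of None \<Rightarrow> sigma_sets (space M) (hist M D W s)
                | Some i \<Rightarrow> {(\<lambda>\<omega>. W t \<omega> i - W s \<omega> i) -` B \<inter> space M | B. B \<in> sets (borel :: real measure)})
          (insert None (Some ` {..<D})))"

definition sde_coeffs :: "nat \<Rightarrow> real \<Rightarrow> (real \<Rightarrow> vec \<Rightarrow> vec) \<Rightarrow> (real \<Rightarrow> vec \<Rightarrow> nat \<Rightarrow> nat \<Rightarrow> real) \<Rightarrow> bool" where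
  "sde_coeffs D T a b \<longleftrightarrow>
     (\<forall>t x. a t x \<in> vspace D) \<and> (\<forall>t x i j. (i \<ge> D \<or> j \<ge> D) \<longrightarrow> b t x i j = 0)
   \<and> (\<exists>L. \<forall>t\<in>{0..T}. \<forall>x\<in>vspace D. \<forall>y\<in>vspace D.
         vnorm D (a t x - a t y) \<le> L * vnorm D (x - y)
       \<and> sqrt (\<Sum>i<D. \<Sum>j<D. (b t x i j - b t y i j)^2) \<le> L * vnorm D (x - y))
   \<and> (\<forall>x\<in>vspace D. \<exists>C. \<forall>s\<in>{0..T}. \<forall>t\<in>{0..T}.
         vnorm D (a t x - a s x) \<le> C * \<bar>t - s\<bar> powr (1/2)
       \<and> sqrt (\<Sum>i<D. \<Sum>j<D. (b t x i j - b s x i j)^2) \<le> C * \<bar>t - s\<bar> powr (1/2))"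

text \<open>Y is a (strong) solution on [s,T] of dY = a dt + b dW, Y_s = x. The Ito integral of the
  continuous adapted integrand b(u,Y_u) is given as the limit in probability of left Riemann sums
  along uniform partitions.\<close>
definition sde_sol :: "'w measure \<Rightarrow> nat \<Rightarrow> (real \<Rightarrow> 'w \<Rightarrow> vec) \<Rightarrow> (real \<Rightarrow> vec \<Rightarrow> vec)
    \<Rightarrow> (real \<Rightarrow> vec \<Rightarrow> nat \<Rightarrow> nat \<Rightarrow> real) \<Rightarrow> real \<Rightarrow> vec \<Rightarrow> real \<Rightarrow> (real \<Rightarrow> 'w \<Rightarrow> vec) \<Rightarrow> bool" where
  "sde_sol M D W a b s x T Y \<longleftrightarrow>
     (\<forall>t\<in>{s..T}. \<forall>\<omega>\<in>space M. Y t \<omega> \<in> vspace D)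
   \<and> (\<forall>\<omega>\<in>space M. continuous_on {s..T} (\<lambda>t. Y t \<omega>))
   \<and> (\<forall>t\<in>{s..T}. \<forall>i. (\<lambda>\<omega>. Y t \<omega> i) \<in> borel_measurable (Fm M D W t))
   \<and> (\<forall>t\<in>{s..T}. \<forall>i<D. \<forall>\<delta>>0.
        (\<lambda>m. measure M {\<omega>\<in>space M.
           \<bar>Y t \<omega> i - x i - integral {s..t} (\<lambda>u. a u (Y u \<omega>) i)
            - (\<Sum>l<Suc m. \<Sum>j<D.
                 b (s + real l * (t - s) / real (Suc m)) (Y (s + real l * (t - s) / real (Suc m)) \<omega>) i j
                 * (W (s + real (Suc l) * (t - s) / real (Suc m)) \<omega> j
                    - W (s + real l * (t - s) / real (Suc m)) \<omega> j))\<bar> > \<delta>})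
        \<longlonglongrightarrow> 0)"

definition cond_C3_1 :: "'w measure \<Rightarrow> nat \<Rightarrow> (real \<Rightarrow> 'w \<Rightarrow> vec) \<Rightarrow> (real \<Rightarrow> 'w \<Rightarrow> vec)
    \<Rightarrow> real \<Rightarrow> nat \<Rightarrow> (nat \<Rightarrow> vec \<Rightarrow> 'w \<Rightarrow> vec) \<Rightarrow> bool" where
  "cond_C3_1 M D W X T N f \<longleftrightarrow>
     \<comment> \<open>X is F^dis-Markov\<close>
     (\<forall>n<N. \<forall>h::vec \<Rightarrow> real. h \<in> borel_measurable borel \<and> bounded (range h) \<longrightarrow>
        (AE \<omega> in M. real_cond_exp M (Fm M D W (tgrid T N n)) (\<lambda>\<omega>. h (X (tgrid T N (Suc n)) \<omega>)) \<omega>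
                   = real_cond_exp M (sigX M (X (tgrid T N n))) (\<lambda>\<omega>. h (X (tgrid T N (Suc n)) \<omega>)) \<omega>))
   \<and> (\<forall>n<N.
        (\<forall>i. (\<lambda>(x, \<omega>). f n x \<omega> i) \<in> borel_measurable (borel \<Otimes>\<^sub>M Fm M D W (tgrid T N (Suc n))))
      \<and> (\<forall>x \<omega>. f n x \<omega> \<in> vspace D)
      \<and> (AE \<omega> in M. X (tgrid T N (Suc n)) \<omega> = f n (X (tgrid T N n) \<omega>) \<omega>)
      \<and> (\<forall>x\<in>vspace D. prob_space.indep_set M (sets (Fm M D W (tgrid T N n)))
           {(f n x) -` B \<inter> space M | B. B \<in> sets (borel :: vec measure)})
      \<and> (\<forall>i<D. AE \<omega> in M.
           real_cond_exp M (Fm M D W (tgrid T N n)) (\<lambda>\<omega>. X (tgrid T N (Suc n)) \<omega> i) \<omega>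
             = real_cond_exp M (sigX M (X (tgrid T N n))) (\<lambda>\<omega>. X (tgrid T N (Suc n)) \<omega> i) \<omega>
         \<and> real_cond_exp M (sigX M (X (tgrid T N n))) (\<lambda>\<omega>. X (tgrid T N (Suc n)) \<omega> i) \<omega>
             = (\<integral>\<omega>'. f n (X (tgrid T N n) \<omega>) \<omega>' i \<partial>M)))"

definition cond_C4 :: "'w measure \<Rightarrow> nat \<Rightarrow> (real \<Rightarrow> 'w \<Rightarrow> vec) \<Rightarrow> (real \<Rightarrow> vec \<Rightarrow> vec)
    \<Rightarrow> (real \<Rightarrow> vec \<Rightarrow> nat \<Rightarrow> nat \<Rightarrow> real) \<Rightarrow> real \<Rightarrow> nat \<Rightarrow> (vec \<Rightarrow> real \<Rightarrow> real \<Rightarrow> 'w \<Rightarrow> vec)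
    \<Rightarrow> real \<Rightarrow> real \<Rightarrow> real \<Rightarrow> bool" where
  "cond_C4 M D W a b T N fl p cb qb \<longleftrightarrow>
     (\<forall>s\<in>{0..T}. \<forall>x\<in>vspace D. sde_sol M D W a b s x T (\<lambda>t \<omega>. fl x s t \<omega>))
   \<and> (\<forall>\<omega>\<in>space M. \<forall>i. (\<lambda>(x, s, t). fl x s t \<omega> i) \<in> borel_measurable borel)
   \<and> (\<forall>n<N. \<forall>s t. tgrid T N n \<le> s \<and> s < t \<and> t \<le> tgrid T N (Suc n) \<longrightarrow>
        (\<integral>\<^sup>+\<omega>. ennpow (growth D D (\<lambda>x. fl x s t \<omega>)) p \<partial>M) \<le> ennreal ((cb * real D powr qb) powr p)
      \<and> (\<exists>(I::nat) (w :: 'w \<Rightarrow> nat \<Rightarrow> nat \<Rightarrow> vec).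
            real I \<le> cb * real D powr qb
          \<and> (\<forall>l m j. (\<lambda>\<omega>. w \<omega> l m j) \<in> borel_measurable M)
          \<and> (\<forall>\<omega>\<in>space M. ran_valid D I (w \<omega>))
          \<and> (AE \<omega> in M. \<forall>x\<in>vspace D. fl x s t \<omega> = ran_eval (w \<omega>) I x)
          \<and> (\<integral>\<^sup>+\<omega>. ran_size I (w \<omega>) \<partial>M) \<le> ennreal (cb * real D powr qb)))"

definition cond_C5 :: "nat \<Rightarrow> real \<Rightarrow> nat \<Rightarrow> (real \<Rightarrow> vec \<Rightarrow> real) \<Rightarrow> real \<Rightarrow> real \<Rightarrow> real \<Rightarrow> bool" where
  "cond_C5 D T N g c q r \<longleftrightarrow>
     (\<forall>\<epsilon>>0. \<forall>n\<le>N. \<exists>\<Phi>. valid_net D 1 \<Phi>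
        \<and> (\<forall>x\<in>vspace D. \<bar>realize \<Phi> x 0 - g (tgrid T N n) x\<bar> \<le> \<epsilon> * c * real D powr q * (1 + vnorm D x))
        \<and> real (net_size \<Phi>) \<le> c * real D powr q * \<epsilon> powr (- r)
        \<and> (\<forall>x\<in>vspace D. \<forall>y\<in>vspace D. \<bar>realize \<Phi> x 0 - realize \<Phi> y 0\<bar> \<le> c * real D powr q * vnorm D (x - y))
        \<and> \<bar>g (tgrid T N n) (\<lambda>_. 0)\<bar> \<le> c * real D powr q)"

text \<open>Vrec ... j = V_{N-j}; V_N = g(t_N,.), V_n(x) = max(g(t_n,x), E[V_{n+1}(X^{t_n,x}_{t_{n+1}})])\<close>
fun Vrec :: "'w measure \<Rightarrow> (real \<Rightarrow> vec \<Rightarrow> real) \<Rightarrow> (vec \<Rightarrow> real \<Rightarrow> real \<Rightarrow> 'w \<Rightarrow> vec)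
    \<Rightarrow> real \<Rightarrow> nat \<Rightarrow> nat \<Rightarrow> vec \<Rightarrow> real" where
  "Vrec M g fl T N 0 x = g (tgrid T N N) x"
| "Vrec M g fl T N (Suc j) x =
     max (g (tgrid T N (N - Suc j)) x)
         (\<integral>\<omega>. Vrec M g fl T N j (fl x (tgrid T N (N - Suc j)) (tgrid T N (N - j)) \<omega>) \<partial>M)"

definition Vfun :: "'w measure \<Rightarrow> (real \<Rightarrow> vec \<Rightarrow> real) \<Rightarrow> (vec \<Rightarrow> real \<Rightarrow> real \<Rightarrow> 'w \<Rightarrow> vec)
    \<Rightarrow> real \<Rightarrow> nat \<Rightarrow> nat \<Rightarrow> vec \<Rightarrow> real" where
  "Vfun M g fl T N n = Vrec M g fl T N (N - n)"

definition rho_meas :: "'w measure \<Rightarrow> nat \<Rightarrow> (real \<Rightarrow> 'w \<Rightarrow> vec) \<Rightarrow> (real \<Rightarrow> 'w \<Rightarrow> vec)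
    \<Rightarrow> real \<Rightarrow> nat \<Rightarrow> nat \<Rightarrow> nat \<Rightarrow> vec measure" where
  "rho_meas M D W X T N N0 n = measure_of UNIV (sets borel)
     (\<lambda>A. \<integral>\<^sup>+\<omega>. ennreal (\<Sum>k<N0. (vnorm D (W (tsub T N N0 n (Suc k)) \<omega> - W (tsub T N N0 n k) \<omega>))^2)
                  * indicator A (X (tgrid T N (Suc n)) \<omega>) \<partial>M)"

definition mu_meas :: "'w measure \<Rightarrow> (real \<Rightarrow> 'w \<Rightarrow> vec) \<Rightarrow> real \<Rightarrow> nat \<Rightarrow> nat \<Rightarrow> nat \<Rightarrow> (real \<times> vec) measure" where
  "mu_meas M X T N N0 n = measure_of UNIV (sets borel)
     (\<lambda>A. \<integral>\<^sup>+\<omega>. (\<Sum>k<N0. indicator A (tsub T N N0 n k, X (tsub T N N0 n k) \<omega>) * ennreal (dt T N N0)) \<partial>M)"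

text \<open>Z is a Borel version of Z*_n: hat Z_{t^n_k} = Z(t^n_k, X_{t^n_k}) a.s. for all k, where
  hat Z_{t^n_k} = (1/Delta t) E[Y*_{n+1} Delta W_{t^n_k} | F_{t^n_k}] and Y*_{n+1} = V(X_{t_{n+1}}).\<close>
definition is_Zstar :: "'w measure \<Rightarrow> nat \<Rightarrow> (real \<Rightarrow> 'w \<Rightarrow> vec) \<Rightarrow> (real \<Rightarrow> 'w \<Rightarrow> vec)
    \<Rightarrow> (vec \<Rightarrow> real) \<Rightarrow> real \<Rightarrow> nat \<Rightarrow> nat \<Rightarrow> nat \<Rightarrow> (real \<Rightarrow> vec \<Rightarrow> vec) \<Rightarrow> bool" where
  "is_Zstar M D W X V T N N0 n Z \<longleftrightarrow>
     (\<lambda>(t, x). Z t x) \<in> borel_measurable (borel :: (real \<times> vec) measure)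
   \<and> (\<forall>t x. Z t x \<in> vspace D)
   \<and> (\<forall>k<N0. \<forall>i<D. AE \<omega> in M.
        Z (tsub T N N0 n k) (X (tsub T N N0 n k) \<omega>) i
          = real_cond_exp M (Fm M D W (tsub T N N0 n k))
              (\<lambda>\<omega>. V (X (tgrid T N (Suc n)) \<omega>)
                    * (W (tsub T N N0 n (Suc k)) \<omega> i - W (tsub T N N0 n k) \<omega> i)) \<omega>
            / dt T N N0)"

end

theory Submission
  imports Defs
begin

text \<open>
  Euler's scheme started at \<open>X s\<close> converges to \<open>X\<close> and, started at a fixed \<open>x\<close>, to the flow \<open>X\<^sup>s\<^sup>,\<^sup>x\<close>, while
  the increments driving it are independent of the past. Hence, for a network \<open>\<Phi>\<close> close to \<open>V\<^sub>n\<^sub>+\<^sub>1\<close>, the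
  conditional expectation of \<open>\<Phi>(X\<^sub>t) \<Delta>W / \<Delta>t\<close> given the past at \<open>s = t\<^sup>n\<^sub>k\<close> is \<open>h\<^sub>k(X\<^sub>s)\<close> with
  \<open>h\<^sub>k(x) = E[\<Phi>(X\<^sup>s\<^sup>,\<^sup>x\<^sub>t) \<Delta>W] / \<Delta>t\<close>, where \<open>t = t\<^sub>n\<^sub>+\<^sub>1\<close>. By the conditional Cauchy-Schwarz inequality
  the \<open>L\<^sup>2\<close> distance from \<open>Z\<^sup>*\<close> to \<open>h\<^sub>k\<close> is controlled by the distance from \<open>V\<^sub>n\<^sub>+\<^sub>1\<close> to \<open>\<Phi>\<close> with respect
  to \<open>\<rho>\<close>. The flow is a random network, so an empirical mean of \<open>r\<close> samples of the integrand of \<open>h\<^sub>k\<close> is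
  an ordinary network. Since every sample has finite mean size and growth, and (by
  the moment of order \<open>p > 2\<close> of the growth) finite variance, some choice of samples realises an error
  of order \<open>1 / r\<close> together with the size and growth bounds. If \<open>\<Phi>\<close> has size 0, it vanishes, and the zero
  network serves; otherwise the bound on the size of \<open>\<Phi>\<close> is at least 1, and all quantities
  are dominated by a power of it.
\<close>

section \<open>Rectifier networks\<close>

text \<open>A solution is known only through left Riemann sums that converge in probability along
  uniform partitions; neither its moments nor the independence of the flow from the past come with
  it. Euler's scheme supplies what is missing: as an explicit function of the starting point and of
  finitely many increments it has independence and joint measurability, and both pass to the limit.
  Lacking moments, the convergence is localised to paths that stay in a ball; uniform partitions
  force all times to be multiples of one mesh. Moments of \<open>X\<close> are recovered later from
  the growth of the flow. Powers of \<open>N0\<close> come from the time step: division by it costs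
  a factor \<open>1 / dt\<close> in the squared error, hence the tolerance
  \<open>\<epsilon> * sqrt dt / 2\<close> for the approximation of \<open>V\<close>. A moment of
  order above two is consumed by the product of the growth of the flow with the increment of the
  same sample, as the two need not be independent. Estimates at fixed \<open>D\<close> stay
  explicit, so that a single power of \<open>D\<close> can bound them afterwards.\<close>

definition lsize :: "nat \<Rightarrow> nat \<Rightarrow> (nat \<Rightarrow> nat \<Rightarrow> real) \<times> (nat \<Rightarrow> real) \<Rightarrow> nat" where
  "lsize d e L = card {(j, i). j < e \<and> i < d \<and> fst L j i \<noteq> 0} + card {j. j < e \<and> snd L j \<noteq> 0}"

text \<open>Speaks of realised functions instead of networks, so that composition and addition
  become inductions on layers. Depth is an index because functions are added layer by layer and need
  equal depth; the size is exact, and losses are absorbed by an existential bound in each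
  construction.\<close>

inductive relu_fun :: "nat \<Rightarrow> nat \<Rightarrow> nat \<Rightarrow> nat \<Rightarrow> (vec \<Rightarrow> vec) \<Rightarrow> bool" where
  affine: "relu_fun 1 d e (lsize d e L) (affine d e L)"
| layer: "relu_fun n e f S F \<Longrightarrow>
    relu_fun (Suc n) d f (lsize d e L + S) (\<lambda>x. F (\<lambda>j. relu (affine d e L x j)))"

lemma finite_weights [simp]: "finite {(j, i). j < (e::nat) \<and> i < (d::nat) \<and> P j i}"
  by (rule finite_subset[of _ "{..<e} \<times> {..<d}"]) auto

lemma relu_fun_pos: "relu_fun n d e S F \<Longrightarrow> n > 0"
  by (induction rule: relu_fun.induct) auto

lemma net_size_Cons:
  "net_size (d # e # ds, L # Ls) = lsize d e L + net_size (e # ds, Ls)"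
  unfolding net_size_def lsize_def by (simp add: sum.lessThan_Suc_shift del: sum.lessThan_Suc)

lemma relu_fun_imp_net:
  assumes "relu_fun n d e S F"
  shows "\<exists>\<Phi>. valid_net d e \<Phi> \<and> length (snd \<Phi>) = n \<and> net_size \<Phi> = S \<and> realize \<Phi> = F"
  using assms
proof (induction rule: relu_fun.induct)
  case (affine d e L)
  show ?case
    by (rule exI[of _ "([d, e], [L])"])
       (auto simp: valid_net_def realize_def net_size_def lsize_def)
next
  case (layer n e f S F d L)
  then obtain ds Ls where *: "valid_net e f (ds, Ls)" "length Ls = n" "net_size (ds, Ls) = S"
    "eval_net ds Ls = F" by (auto simp: realize_def)
  obtain L' Ls' where Ls: "Ls = L' # Ls'" using *(1) by (cases Ls) (auto simp: valid_net_def)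
  obtain ds' where ds: "ds = e # ds'" using *(1) by (cases ds) (auto simp: valid_net_def)
  show ?case
    by (rule exI[of _ "(d # ds, L # Ls)"])
       (use * in \<open>auto simp: valid_net_def realize_def net_size_Cons ds Ls\<close>)
qed

lemma net_imp_relu_fun_aux:
  assumes "Ls \<noteq> []" "length ds = length Ls + 1"
  shows "relu_fun (length Ls) (hd ds) (last ds) (net_size (ds, Ls)) (eval_net ds Ls)"
  using assms
proof (induction Ls arbitrary: ds)
  case Nil
  then show ?case by simp
next
  case (Cons L Ls)
  then obtain d ds1 where ds1: "ds = d # ds1" by (cases ds) auto
  with Cons obtain e ds2 where ds: "ds = d # e # ds2" by (cases ds1) auto
  show ?case
  proof (cases Ls)
    case Nil
    then have "ds2 = []" using Cons ds by simp
    then have "eval_net ds (L # Ls) = affine d e L" "net_size (ds, L # Ls) = lsize d e L"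
      using ds Nil by (auto simp: net_size_Cons) (simp add: net_size_def)
    then show ?thesis using relu_fun.affine[of d e L] ds Nil \<open>ds2 = []\<close> by simp
  next
    case (Cons L' Ls')
    have "relu_fun (length Ls) (hd (e # ds2)) (last (e # ds2)) (net_size (e # ds2, Ls)) (eval_net (e # ds2) Ls)"
      by (rule Cons.IH) (use Cons Cons.prems ds in auto)
    from relu_fun.layer[OF this, of d L]
    have "relu_fun (Suc (length Ls)) d (last ds) (net_size (ds, L # Ls))
      (\<lambda>x. eval_net (e # ds2) Ls (\<lambda>j. relu (affine d e L x j)))"
      by (simp add: ds net_size_Cons)
    moreover have "eval_net ds (L # Ls) = (\<lambda>x. eval_net (e # ds2) Ls (\<lambda>j. relu (affine d e L x j)))"
      by (simp add: ds Cons fun_eq_iff)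
    ultimately show ?thesis by (simp add: ds)
  qed
qed

lemma net_imp_relu_fun:
  "valid_net d e \<Phi> \<Longrightarrow> relu_fun (length (snd \<Phi>)) d e (net_size \<Phi>) (realize \<Phi>)"
  using net_imp_relu_fun_aux[of "snd \<Phi>" "fst \<Phi>"] by (auto simp: valid_net_def realize_def)

text \<open>A final layer without nonzero weights and biases outputs zero whatever the hidden layers
  produce. This settles the case in which a size bound carries no information about the
  tolerance.\<close>

lemma relu_fun_size_0: "relu_fun n d e S F \<Longrightarrow> S = 0 \<Longrightarrow> F x = (\<lambda>_. 0)"
proof (induction arbitrary: x rule: relu_fun.induct)
  case (affine d e L)
  have "{(j, i). j < e \<and> i < d \<and> fst L j i \<noteq> 0} = {}" "{j. j < e \<and> snd L j \<noteq> 0} = {}"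
    using affine by (auto simp: lsize_def card_eq_0_iff)
  then show ?case by (auto simp: affine_def fun_eq_iff intro!: sum.neutral)
qed auto

lemma relu_fun_zero: "relu_fun 1 d e 0 (\<lambda>_ _. 0)"
proof -
  have "affine d e (\<lambda>_ _. 0, \<lambda>_. 0) = (\<lambda>_ _. 0)" "lsize d e (\<lambda>_ _. 0, \<lambda>_. 0) = 0"
    by (auto simp: affine_def lsize_def fun_eq_iff)
  then show ?thesis using relu_fun.affine[of d e "(\<lambda>_ _. 0, \<lambda>_. 0)"] by simp
qed

text \<open>The size bound counts paths: a nonzero entry of the product matrix needs some
  \<open>m\<close> with two nonzero factors, so these entries are covered by pairs of nonzero
  weights; a nonzero bias needs a weight paired with an inner bias, or a bias of the outer
  map.\<close>

lemma affine_affine: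
  assumes "L = (\<lambda>j i. \<Sum>m<e. fst L2 j m * fst L1 m i, \<lambda>j. (\<Sum>m<e. fst L2 j m * snd L1 m) + snd L2 j)"
  shows "affine e f L2 (affine d e L1 x) = affine d f L x"
    and "lsize d f L \<le> lsize e f L2 * lsize d e L1 + lsize e f L2"
proof -
  show "affine e f L2 (affine d e L1 x) = affine d f L x"
  proof (rule ext)
    fix j
    have "(\<Sum>m<e. fst L2 j m * ((\<Sum>i<d. fst L1 m i * x i) + snd L1 m))
      = (\<Sum>m<e. \<Sum>i<d. fst L2 j m * fst L1 m i * x i) + (\<Sum>m<e. fst L2 j m * snd L1 m)"
      by (simp add: distrib_left sum.distrib sum_distrib_left mult.assoc)
    also have "(\<Sum>m<e. \<Sum>i<d. fst L2 j m * fst L1 m i * x i) = (\<Sum>i<d. (\<Sum>m<e. fst L2 j m * fst L1 m i) * x i)"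
      by (subst sum.swap) (simp add: sum_distrib_right)
    finally show "affine e f L2 (affine d e L1 x) j = affine d f L x j"
      by (simp add: affine_def assms)
  qed
  define W1 W2 b1 b2 where defs: "W1 = {(j, i). j < e \<and> i < d \<and> fst L1 j i \<noteq> 0}"
    "W2 = {(j, i). j < f \<and> i < e \<and> fst L2 j i \<noteq> 0}"
    "b1 = {j. j < e \<and> snd L1 j \<noteq> 0}" "b2 = {j. j < f \<and> snd L2 j \<noteq> 0}"
  have fin: "finite W1" "finite W2" "finite b1" "finite b2" by (auto simp: defs)
  have "{(j, i). j < f \<and> i < d \<and> fst L j i \<noteq> 0} \<subseteq> (\<lambda>(u, v). (fst u, snd v)) ` (W2 \<times> W1)"
  proof safe
    fix j i assume *: "j < f" "i < d" "fst L j i \<noteq> 0"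
    then have "(\<Sum>m<e. fst L2 j m * fst L1 m i) \<noteq> 0" by (simp add: assms)
    then obtain m where "m < e" "fst L2 j m * fst L1 m i \<noteq> 0" by (auto elim: sum.not_neutral_contains_not_neutral)
    then show "(j, i) \<in> (\<lambda>(u, v). (fst u, snd v)) ` (W2 \<times> W1)"
      using * by (intro image_eqI[of _ _ "((j, m), (m, i))"]) (auto simp: defs)
  qed
  from card_mono[OF _ this] have 1: "card {(j, i). j < f \<and> i < d \<and> fst L j i \<noteq> 0} \<le> card W2 * card W1"
    using card_image_le[of "W2 \<times> W1" "\<lambda>(u, v). (fst u, snd v)"] fin by (auto simp: card_cartesian_product)
  have "{j. j < f \<and> snd L j \<noteq> 0} \<subseteq> (\<lambda>(u, v). fst u) ` (W2 \<times> b1) \<union> b2"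
  proof safe
    fix j assume *: "j < f" "snd L j \<noteq> 0" "j \<notin> b2"
    then have "(\<Sum>m<e. fst L2 j m * snd L1 m) \<noteq> 0" by (simp add: assms defs)
    then obtain m where "m < e" "fst L2 j m * snd L1 m \<noteq> 0" by (auto elim: sum.not_neutral_contains_not_neutral)
    then show "j \<in> (\<lambda>(u, v). fst u) ` (W2 \<times> b1)"
      using * by (intro image_eqI[of _ _ "((j, m), m)"]) (auto simp: defs)
  qed
  from card_mono[OF _ this] have "card {j. j < f \<and> snd L j \<noteq> 0} \<le> card ((\<lambda>(u, v). fst u) ` (W2 \<times> b1) \<union> b2)"
    using fin by auto
  also have "\<dots> \<le> card W2 * card b1 + card b2"
    using card_Un_le[of "(\<lambda>(u, v). fst u) ` (W2 \<times> b1)" b2]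
      card_image_le[of "W2 \<times> b1" "\<lambda>(u, v). fst u"] fin by (auto simp: card_cartesian_product)
  finally have 2: "card {j. j < f \<and> snd L j \<noteq> 0} \<le> card W2 * card b1 + card b2" .
  have "lsize d f L \<le> card W2 * card W1 + card W2 * card b1 + card b2"
    using 1 2 by (simp add: lsize_def)
  also have "\<dots> \<le> (card W2 + card b2) * (card W1 + card b1) + (card W2 + card b2)"
    by (simp add: algebra_simps)
  finally show "lsize d f L \<le> lsize e f L2 * lsize d e L1 + lsize e f L2"
    by (simp add: lsize_def[of e f L2] lsize_def[of d e L1] defs)
qed

text \<open>The affine map is absorbed into the first layer of \<open>F\<close>, which leaves the
  depth unchanged.\<close>

lemma relu_fun_affine_comp:
  assumes "relu_fun n e f S F"
  shows "\<exists>S'\<le>S * lsize d e L1 + S. relu_fun n d f S' (\<lambda>x. F (affine d e L1 x))"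
  using assms
proof (cases rule: relu_fun.cases)
  case (affine L)
  define L' where "L' = (\<lambda>j i. \<Sum>m<e. fst L j m * fst L1 m i, \<lambda>j. (\<Sum>m<e. fst L j m * snd L1 m) + snd L j)"
  show ?thesis
    using affine_affine(1)[OF L'_def, of f d] affine_affine(2)[OF L'_def, of d f] relu_fun.affine[of d f L'] affine
    by auto
next
  case (layer n' e' S' F' L)
  define L' where "L' = (\<lambda>j i. \<Sum>m<e. fst L j m * fst L1 m i, \<lambda>j. (\<Sum>m<e. fst L j m * snd L1 m) + snd L j)"
  have "relu_fun (Suc n') d f (lsize d e' L' + S') (\<lambda>x. F' (\<lambda>j. relu (affine d e' L' x j)))"
    by (rule relu_fun.layer) (use layer in simp)
  moreover have "lsize d e' L' + S' \<le> S * lsize d e L1 + S"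
    using affine_affine(2)[OF L'_def, of d e'] layer by (simp add: algebra_simps)
  ultimately show ?thesis
    using layer affine_affine(1)[OF L'_def, of e' d]
    by (intro exI[of _ "lsize d e' L' + S'"]) simp
qed

text \<open>No ReLU separates the output layer of \<open>F\<close> from the input layer of
  \<open>G\<close>, so these two are multiplied into one; hence depth \<open>n + m - 1\<close> and a
  product term in the size. The induction peels layers of \<open>F\<close> off at the input.\<close>

lemma relu_fun_comp:
  assumes "relu_fun n d e S1 F" "relu_fun m e f S2 G"
  shows "\<exists>S\<le>S2 * S1 + S2 + S1. relu_fun (n + m - 1) d f S (\<lambda>x. G (F x))"
  using assms
proof (induction rule: relu_fun.induct)
  case (affine d e L)
  obtain S' where "S' \<le> S2 * lsize d e L + S2" "relu_fun m d f S' (\<lambda>x. G (affine d e L x))"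
    using relu_fun_affine_comp[OF affine, of d L] by auto
  then show ?case by (intro exI[of _ S']) auto
next
  case (layer n e f' S F d L)
  then obtain S' where S': "S' \<le> S2 * S + S2 + S" "relu_fun (n + m - 1) e f S' (\<lambda>x. G (F x))" by auto
  have "relu_fun (Suc (n + m - 1)) d f (lsize d e L + S') (\<lambda>x. G (F (\<lambda>j. relu (affine d e L x j))))"
    by (rule relu_fun.layer[OF S'(2)])
  moreover have "Suc (n + m - 1) = Suc n + m - 1" using relu_fun_pos[OF layer(1)] by simp
  ultimately show ?case using S'(1)
    by (intro exI[of _ "lsize d e L + S'"]) (auto simp: algebra_simps)
qed

text \<open>Selecting coordinates merely relocates the columns of the first weight matrix, so no
  extra layer arises. It lets two networks read their own blocks of a common hidden vector.\<close>

lemma relu_fun_reindex_input: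
  assumes "relu_fun n d e S F" "inj_on \<iota> {..<d}" "\<iota> ` {..<d} \<subseteq> {..<d'}"
  shows "\<exists>S'\<le>S. relu_fun n d' e S' (\<lambda>x. F (\<lambda>i. if i < d then x (\<iota> i) else 0))"
proof -
  let ?r = "\<lambda>x i. if i < d then x (\<iota> i) else (0::real)"
  have main: "\<exists>L'. lsize d' e L' \<le> lsize d e L \<and> (\<forall>x. affine d e L (?r x) = affine d' e L' x)" for e L
  proof -
    define \<kappa> where "\<kappa> = inv_into {..<d} \<iota>"
    define L' where "L' = (\<lambda>j i. if i \<in> \<iota> ` {..<d} then fst L j (\<kappa> i) else 0, snd L)"
    have k: "\<kappa> (\<iota> i) = i" if "i < d" for i using that assms(2) by (simp add: \<kappa>_def)
    have "affine d e L (?r x) = affine d' e L' x" for x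
    proof (rule ext)
      fix j
      have "(\<Sum>i<d'. fst L' j i * x i) = (\<Sum>i\<in>\<iota> ` {..<d}. fst L' j i * x i)"
        using assms(3) by (intro sum.mono_neutral_right) (auto simp: L'_def)
      also have "\<dots> = (\<Sum>i<d. fst L' j (\<iota> i) * x (\<iota> i))"
        by (subst sum.reindex[OF assms(2)]) simp
      also have "\<dots> = (\<Sum>i<d. fst L j i * ?r x i)" by (intro sum.cong) (auto simp: L'_def k)
      finally show "affine d e L (?r x) j = affine d' e L' x j" by (simp add: affine_def L'_def)
    qed
    moreover have "card {(j, i). j < e \<and> i < d' \<and> fst L' j i \<noteq> 0} \<le> card {(j, i). j < e \<and> i < d \<and> fst L j i \<noteq> 0}"
    proof -
      have "{(j, i). j < e \<and> i < d' \<and> fst L' j i \<noteq> 0} \<subseteq> (\<lambda>(j, i). (j, \<iota> i)) ` {(j, i). j < e \<and> i < d \<and> fst L j i \<noteq> 0}"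
        by (auto simp: L'_def k split: if_splits intro!: image_eqI)
      then show ?thesis by (rule surj_card_le[rotated]) simp
    qed
    ultimately show ?thesis by (intro exI[of _ L']) (auto simp: lsize_def L'_def)
  qed
  from assms(1) show ?thesis
  proof (cases rule: relu_fun.cases)
    case (affine L)
    obtain L' where "lsize d' e L' \<le> lsize d e L" "\<And>x. affine d e L (?r x) = affine d' e L' x"
      using main by metis
    then show ?thesis using affine relu_fun.affine[of d' e L'] by auto
  next
    case (layer n' e' S' F' L)
    obtain L' where L': "lsize d' e' L' \<le> lsize d e' L" "\<And>x. affine d e' L (?r x) = affine d' e' L' x"
      using main by metis
    show ?thesis
      using relu_fun.layer[OF layer(4), of d' L'] L' layer
      by (intro exI[of _ "lsize d' e' L' + S'"]) auto
  qed
qed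

lemma lsize_stack:
  "lsize d (e1 + e2) (\<lambda>j. if j < e1 then fst L1 j else fst L2 (j - e1), \<lambda>j. if j < e1 then snd L1 j else snd L2 (j - e1))
    \<le> lsize d e1 L1 + lsize d e2 L2" (is "lsize _ _ ?L \<le> _")
proof -
  let ?A = "{(j, i). j < e1 \<and> i < d \<and> fst L1 j i \<noteq> 0}" and ?B = "{(j, i). j < e2 \<and> i < d \<and> fst L2 j i \<noteq> 0}"
  have "{(j, i). j < e1 + e2 \<and> i < d \<and> fst ?L j i \<noteq> 0} \<subseteq> ?A \<union> (\<lambda>(j, i). (j + e1, i)) ` ?B"
  proof safe
    fix j i assume "j < e1 + e2" "i < d" "fst ?L j i \<noteq> 0" "(j, i) \<notin> (\<lambda>(j, i). (j + e1, i)) ` ?B"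
    then have "j < e1 \<and> fst L1 j i \<noteq> 0"
      by (cases "j < e1") (force intro: image_eqI[of _ _ "(j - e1, i)"])+
    then show "j < e1" "fst L1 j i = 0 \<Longrightarrow> False" by auto
  qed
  from card_mono[OF _ this] have 1: "card {(j, i). j < e1 + e2 \<and> i < d \<and> fst ?L j i \<noteq> 0} \<le>
    card {(j, i). j < e1 \<and> i < d \<and> fst L1 j i \<noteq> 0} + card {(j, i). j < e2 \<and> i < d \<and> fst L2 j i \<noteq> 0}"
    using card_Un_le[of ?A "(\<lambda>(j, i). (j + e1, i)) ` ?B"] card_image_le[of ?B "\<lambda>(j, i). (j + e1, i)"] by simp
  have "{j. j < e1 + e2 \<and> snd ?L j \<noteq> 0} \<subseteq>
     {j. j < e1 \<and> snd L1 j \<noteq> 0} \<union> (\<lambda>j. j + e1) ` {j. j < e2 \<and> snd L2 j \<noteq> 0}"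
  proof
    fix j assume "j \<in> {j. j < e1 + e2 \<and> snd ?L j \<noteq> 0}"
    then show "j \<in> {j. j < e1 \<and> snd L1 j \<noteq> 0} \<union> (\<lambda>j. j + e1) ` {j. j < e2 \<and> snd L2 j \<noteq> 0}"
      by (cases "j < e1") (auto intro: image_eqI[of _ _ "j - e1"])
  qed
  from card_mono[OF _ this] have 2: "card {j. j < e1 + e2 \<and> snd ?L j \<noteq> 0} \<le>
    card {j. j < e1 \<and> snd L1 j \<noteq> 0} + card {j. j < e2 \<and> snd L2 j \<noteq> 0}"
    using card_Un_le[of "{j. j < e1 \<and> snd L1 j \<noteq> 0}" "(\<lambda>j. j + e1) ` {j. j < e2 \<and> snd L2 j \<noteq> 0}"]
      card_image_le[of "{j. j < e2 \<and> snd L2 j \<noteq> 0}" "\<lambda>j. j + e1"] by simp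
  show ?thesis using 1 2 unfolding lsize_def by linarith
qed

text \<open>Two networks of equal depth run in parallel: hidden vectors are concatenated, each tail
  reads its own block, and only the output layers are added. Sizes add because there are no weights
  between the blocks.\<close>

lemma relu_fun_add:
  assumes "relu_fun n d f S1 F" "relu_fun n d f S2 G"
  shows "\<exists>S\<le>S1 + S2. relu_fun n d f S (\<lambda>x j. F x j + G x j)"
  using assms
proof (induction n arbitrary: d S1 S2 F G)
  case 0
  then show ?case using relu_fun_pos by blast
next
  case (Suc n)
  show ?case
  proof (cases "n = 0")
    case True
    obtain L1 where L1: "F = affine d f L1" "S1 = lsize d f L1"
      using Suc.prems(1) True by (cases rule: relu_fun.cases) (auto dest: relu_fun_pos)
    obtain L2 where L2: "G = affine d f L2" "S2 = lsize d f L2"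
      using Suc.prems(2) True by (cases rule: relu_fun.cases) (auto dest: relu_fun_pos)
    define L where "L = (\<lambda>j i. fst L1 j i + fst L2 j i, \<lambda>j. snd L1 j + snd L2 j)"
    have eq: "(\<lambda>x j. F x j + G x j) = affine d f L"
      by (auto simp: fun_eq_iff L1 L2 L_def affine_def distrib_right sum.distrib)
    have 1: "card {(j, i). j < f \<and> i < d \<and> fst L j i \<noteq> 0} \<le>
      card ({(j, i). j < f \<and> i < d \<and> fst L1 j i \<noteq> 0} \<union> {(j, i). j < f \<and> i < d \<and> fst L2 j i \<noteq> 0})"
      by (rule card_mono) (auto simp: L_def)
    have 2: "card {j. j < f \<and> snd L j \<noteq> 0} \<le> card ({j. j < f \<and> snd L1 j \<noteq> 0} \<union> {j. j < f \<and> snd L2 j \<noteq> 0})"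
      by (rule card_mono) (auto simp: L_def)
    have "lsize d f L \<le> lsize d f L1 + lsize d f L2"
      using le_trans[OF 1 card_Un_le] le_trans[OF 2 card_Un_le] unfolding lsize_def by linarith
    then show ?thesis using eq relu_fun.affine[of d f L] L1 L2 True by auto
  next
    case False
    obtain e1 S1' F' L1 where F: "F = (\<lambda>x. F' (\<lambda>j. relu (affine d e1 L1 x j)))" "S1 = lsize d e1 L1 + S1'"
      "relu_fun n e1 f S1' F'"
      using Suc.prems(1) False by (cases rule: relu_fun.cases) auto
    obtain e2 S2' G' L2 where G: "G = (\<lambda>x. G' (\<lambda>j. relu (affine d e2 L2 x j)))" "S2 = lsize d e2 L2 + S2'"
      "relu_fun n e2 f S2' G'"
      using Suc.prems(2) False by (cases rule: relu_fun.cases) auto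
    define L where "L = (\<lambda>j. if j < e1 then fst L1 j else fst L2 (j - e1), \<lambda>j. if j < e1 then snd L1 j else snd L2 (j - e1))"
    \<comment> \<open>The tails see a vector of width \<open>e1 + e2\<close>: its first block
      belongs to \<open>F'\<close>, the block shifted by \<open>e1\<close> to
      \<open>G'\<close>.\<close>
    obtain S1'' where 1: "S1'' \<le> S1'" "relu_fun n (e1 + e2) f S1'' (\<lambda>x. F' (\<lambda>i. if i < e1 then x i else 0))"
      using relu_fun_reindex_input[OF F(3), of "\<lambda>i. i" "e1 + e2"] by auto
    obtain S2'' where 2: "S2'' \<le> S2'" "relu_fun n (e1 + e2) f S2'' (\<lambda>x. G' (\<lambda>i. if i < e2 then x (i + e1) else 0))"
    proof -
      have "inj_on (\<lambda>i. i + e1) {..<e2}" "(\<lambda>i. i + e1) ` {..<e2} \<subseteq> {..<e1 + e2}" by auto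
      from relu_fun_reindex_input[OF G(3) this] show ?thesis using that by auto
    qed
    obtain S where S: "S \<le> S1'' + S2''" "relu_fun n (e1 + e2) f S
        (\<lambda>x j. F' (\<lambda>i. if i < e1 then x i else 0) j + G' (\<lambda>i. if i < e2 then x (i + e1) else 0) j)"
      using Suc.IH[OF 1(2) 2(2)] by auto
    have r0: "relu 0 = 0" by (simp add: relu_def)
    have e1: "(\<lambda>i. if i < e1 then relu (affine d (e1 + e2) L x i) else 0) = (\<lambda>j. relu (affine d e1 L1 x j))" for x
      by (auto simp: fun_eq_iff affine_def L_def r0)
    have e2: "(\<lambda>i. if i < e2 then relu (affine d (e1 + e2) L x (i + e1)) else 0) = (\<lambda>j. relu (affine d e2 L2 x j))" for x
      by (auto simp: fun_eq_iff affine_def L_def r0)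
    have "relu_fun (Suc n) d f (lsize d (e1 + e2) L + S) (\<lambda>x j. F x j + G x j)"
      using relu_fun.layer[OF S(2), of d L] by (simp add: e1 e2 F G)
    moreover have "lsize d (e1 + e2) L + S \<le> S1 + S2"
      using lsize_stack[of d e1 e2 L1 L2] 1 2 S F G by (simp add: L_def)
    ultimately show ?thesis by blast
  qed
qed

section \<open>Random networks with finitely many parameters\<close>

lemma ran_layer_eq_affine:
  assumes "\<And>j. j \<ge> e \<Longrightarrow> w 0 j = 0" "\<And>m j. j \<ge> e \<Longrightarrow> w (Suc m) j = 0"
    and "\<And>m j. m \<ge> d \<Longrightarrow> w (Suc m) j * y m = 0"
  shows "ran_layer w y = affine d e (\<lambda>j i. w (Suc i) j, w 0) y"
proof (rule ext)
  fix j
  have "(\<Sum>m. w (Suc m) j * y m) = (\<Sum>m<d. w (Suc m) j * y m)"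
    by (rule suminf_finite) (use assms(3) in auto)
  then show "ran_layer w y j = affine d e (\<lambda>j i. w (Suc i) j, w 0) y j"
    by (auto simp: ran_layer_def affine_def assms(1,2) not_less)
qed

lemma lsize_ran:
  assumes "finite {(m, j). v m j \<noteq> (0::real)}"
  shows "lsize d e (\<lambda>j i. v (Suc i) j, v 0) \<le> card {(m, j). v m j \<noteq> 0}"
proof -
  let ?A = "{(j, i). j < e \<and> i < d \<and> v (Suc i) j \<noteq> 0}" and ?B = "{j. j < e \<and> v 0 j \<noteq> 0}"
  have 1: "card ((\<lambda>(j, i). (Suc i, j)) ` ?A) = card ?A" "card (Pair (0::nat) ` ?B) = card ?B"
    by (auto intro!: card_image simp: inj_on_def)
  have 2: "card ((\<lambda>(j, i). (Suc i, j)) ` ?A \<union> Pair 0 ` ?B) = card ((\<lambda>(j, i). (Suc i, j)) ` ?A) + card (Pair (0::nat) ` ?B)"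
    by (rule card_Un_disjoint) auto
  have "card ((\<lambda>(j, i). (Suc i, j)) ` ?A \<union> Pair 0 ` ?B) \<le> card {(m, j). v m j \<noteq> 0}"
    by (rule card_mono[OF assms]) auto
  then show ?thesis using 1 2 by (simp add: lsize_def)
qed

text \<open>A random network with finitely many nonzero parameters is an ordinary one: beyond some width
  all hidden coordinates vanish.\<close>
lemma ran_eval_relu_fun:
  assumes fin: "finite {(l, m, j). l \<le> I \<and> w l m j \<noteq> 0}"
    and out: "\<forall>m. w I m \<in> vspace D"
  shows "\<exists>S F. S \<le> card {(l, m, j). l \<le> I \<and> w l m j \<noteq> 0} \<and> relu_fun (Suc I) D D S F \<and> (\<forall>x\<in>vspace D. F x = ran_eval w I x)"
proof -
  define T where "T = {(l, m, j). l \<le> I \<and> w l m j \<noteq> 0}"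
  \<comment> \<open>\<open>K\<close> exceeds all indices \<open>m\<close> and \<open>j\<close> of
    nonzero parameters and serves as common width of the hidden layers; inserting
    \<open>(0, 0, 0)\<close> keeps the set nonempty.\<close>
  define K where "K = Suc (Max ((\<lambda>(l, m, j). m + j) ` insert (0, 0, 0) T))"
  have K: "w l m j = 0" if "l \<le> I" "m \<ge> K \<or> j \<ge> K" for l m j
  proof (rule ccontr)
    assume "w l m j \<noteq> 0"
    then have "(l, m, j) \<in> T" using that by (simp add: T_def)
    then have "m + j \<le> Max ((\<lambda>(l, m, j). m + j) ` insert (0, 0, 0) T)"
      using fin by (intro Max_ge) (auto simp: T_def intro!: image_eqI[of _ _ "(l, m, j)"])
    then show False using that by (auto simp: K_def)
  qed
  have r0: "relu 0 = 0" by (simp add: relu_def)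
  define dm where "dm l = (if l = Suc I \<or> l = 0 then D else K)" for l
  define Lay where "Lay l = (\<lambda>j i. w l (Suc i) j, w l 0)" for l
  have out': "w I m j = 0" if "j \<ge> D" for m j using out that by (auto simp: vspace_def)
  define cl where "cl l = card {(m, j). w l m j \<noteq> 0}" for l
  have finl: "finite {(m, j). w l m j \<noteq> 0}" if "l \<le> I" for l
    by (rule finite_subset[of _ "snd ` T"]) (use that fin in \<open>auto simp: T_def intro!: image_eqI[of _ _ "(l, _, _)"]\<close>)
  have lay: "ran_layer (w l) y = affine (dm l) (dm (Suc l)) (Lay l) y"
    if "l \<le> I" "\<And>m. l = 0 \<Longrightarrow> m \<ge> D \<Longrightarrow> y m = 0" for l y
    unfolding Lay_def
    by (rule ran_layer_eq_affine) (use that K out' in \<open>auto simp: dm_def split: if_splits\<close>)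
  \<comment> \<open>Induction from the output backwards: \<open>F\<close> is the tail formed by the
    layers \<open>l\<close> to \<open>I\<close>, fed with the rectified output of layer
    \<open>l - 1\<close>, or with the input itself when \<open>l = 0\<close>.\<close>
  have "\<exists>S F. S \<le> (\<Sum>l = l..I. cl l) \<and> relu_fun (Suc (I - l)) (dm l) D S F
      \<and> (\<forall>x\<in>vspace D. F (if l = 0 then x else (\<lambda>m. relu (ran_eval w (l - 1) x m))) = ran_eval w I x)"
    if "l \<le> I" for l
    using that
  proof (induction "I - l" arbitrary: l)
    case 0
    then have l: "l = I" by simp
    have "ran_eval w I x = affine (dm I) D (Lay I) (if I = 0 then x else (\<lambda>m. relu (ran_eval w (I - 1) x m)))" if "x \<in> vspace D" for x
      using lay[of I] that by (cases I) (auto simp: dm_def vspace_def)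
    moreover have "lsize (dm I) D (Lay I) \<le> cl I" unfolding Lay_def cl_def by (rule lsize_ran) (rule finl, simp)
    ultimately show ?case using relu_fun.affine[of "dm I" D "Lay I"] l by auto
  next
    case (Suc k)
    then have l: "l < I" by simp
    obtain S F where IH: "S \<le> (\<Sum>l = Suc l..I. cl l)" "relu_fun (Suc (I - Suc l)) (dm (Suc l)) D S F"
      "\<And>x. x \<in> vspace D \<Longrightarrow> F (\<lambda>m. relu (ran_eval w l x m)) = ran_eval w I x"
      using Suc.hyps(1)[of "Suc l"] Suc.hyps(2) l by (auto; force)
    have ev: "ran_eval w l x = affine (dm l) (dm (Suc l)) (Lay l) (if l = 0 then x else (\<lambda>m. relu (ran_eval w (l - 1) x m)))" if "x \<in> vspace D" for x
      using lay[of l] that l by (cases l) (auto simp: vspace_def)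
    have "lsize (dm l) (dm (Suc l)) (Lay l) \<le> cl l" unfolding Lay_def cl_def by (rule lsize_ran) (rule finl, use l in simp)
    then have "lsize (dm l) (dm (Suc l)) (Lay l) + S \<le> (\<Sum>l = l..I. cl l)"
      using IH(1) l by (simp add: sum.atLeast_Suc_atMost)
    moreover have "relu_fun (Suc (I - l)) (dm l) D (lsize (dm l) (dm (Suc l)) (Lay l) + S) (\<lambda>x. F (\<lambda>j. relu (affine (dm l) (dm (Suc l)) (Lay l) x j)))"
      using relu_fun.layer[OF IH(2)] l by (simp add: Suc_diff_Suc)
    ultimately show ?case using IH(3) ev by (intro exI conjI) auto
  qed
  from this[of 0] obtain S F where SF: "S \<le> (\<Sum>l = 0..I. cl l)" "relu_fun (Suc I) (dm 0) D S F" "\<forall>x\<in>vspace D. F x = ran_eval w I x"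
    by auto
  have "(\<Sum>l = 0..I. cl l) = card (Sigma {0..I} (\<lambda>l. {(m, j). w l m j \<noteq> 0}))"
    unfolding cl_def by (rule card_SigmaI[symmetric]) (auto intro: finl)
  also have "Sigma {0..I} (\<lambda>l. {(m, j). w l m j \<noteq> 0}) = T" by (auto simp: T_def)
  finally show ?thesis using SF by (auto simp: T_def dm_def)
qed

lemma relu_lipschitz: "\<bar>relu x - relu y\<bar> \<le> \<bar>x - y\<bar>"
  by (auto simp: relu_def)

text \<open>Affine layers are Lipschitz and ReLU is a contraction. The constant may be arbitrarily
  large: it enters qualitative arguments only (continuity, convergence of Euler's scheme) and none
  of the final bounds.\<close>

lemma relu_fun_lipschitz:
  assumes "relu_fun n d e S F"
  shows "\<exists>\<Lambda>\<ge>0. \<forall>x y j. \<bar>F x j - F y j\<bar> \<le> \<Lambda> * (\<Sum>i<d. \<bar>x i - y i\<bar>)"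
proof -
  have aff: "\<exists>\<Lambda>\<ge>0. \<forall>x y j. \<bar>affine d e L x j - affine d e L y j\<bar> \<le> \<Lambda> * (\<Sum>i<d. \<bar>x i - y i\<bar>)" for d e L
  proof (intro exI[of _ "\<Sum>j<e. \<Sum>i<d. \<bar>fst L j i\<bar>"] conjI allI)
    fix x y :: vec and j
    let ?\<Lambda> = "\<Sum>j<e. \<Sum>i<d. \<bar>fst L j i\<bar>"
    show "\<bar>affine d e L x j - affine d e L y j\<bar> \<le> ?\<Lambda> * (\<Sum>i<d. \<bar>x i - y i\<bar>)"
    proof (cases "j < e")
      case True
      have "affine d e L x j - affine d e L y j = (\<Sum>i<d. fst L j i * (x i - y i))"
        using True by (simp add: affine_def algebra_simps sum_subtractf)
      also have "\<bar>\<dots>\<bar> \<le> (\<Sum>i<d. \<bar>fst L j i\<bar> * \<bar>x i - y i\<bar>)"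
        by (rule order_trans[OF sum_abs]) (simp add: abs_mult)
      also have "\<dots> \<le> (\<Sum>i<d. ?\<Lambda> * \<bar>x i - y i\<bar>)"
      proof (intro sum_mono mult_right_mono)
        fix i assume "i \<in> {..<d}"
        then have "\<bar>fst L j i\<bar> \<le> (\<Sum>i<d. \<bar>fst L j i\<bar>)" by (intro member_le_sum) auto
        also have "\<dots> \<le> ?\<Lambda>" using True by (intro member_le_sum[of j "{..<e}" "\<lambda>j. \<Sum>i<d. \<bar>fst L j i\<bar>"]) (auto intro: sum_nonneg)
        finally show "\<bar>fst L j i\<bar> \<le> ?\<Lambda>" .
      qed auto
      finally show ?thesis by (simp add: sum_distrib_left)
    qed (auto simp: affine_def intro!: mult_nonneg_nonneg sum_nonneg)
  qed (auto intro!: sum_nonneg)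
  show ?thesis using assms
  proof (induction rule: relu_fun.induct)
    case (affine d e L)
    show ?case by (rule aff)
  next
    case (layer n e f S F d L)
    obtain \<Lambda>1 where 1: "\<Lambda>1 \<ge> 0" "\<And>x y j. \<bar>affine d e L x j - affine d e L y j\<bar> \<le> \<Lambda>1 * (\<Sum>i<d. \<bar>x i - y i\<bar>)" using aff by metis
    obtain \<Lambda>2 where 2: "\<Lambda>2 \<ge> 0" "\<And>x y j. \<bar>F x j - F y j\<bar> \<le> \<Lambda>2 * (\<Sum>i<e. \<bar>x i - y i\<bar>)" using layer.IH by metis
    show ?case
    proof (intro exI[of _ "\<Lambda>2 * (real e * \<Lambda>1)"] conjI allI)
      fix x y :: vec and j
      have "\<bar>F (\<lambda>j. relu (affine d e L x j)) j - F (\<lambda>j. relu (affine d e L y j)) j\<bar>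
        \<le> \<Lambda>2 * (\<Sum>i<e. \<bar>relu (affine d e L x i) - relu (affine d e L y i)\<bar>)" by (rule 2)
      also have "\<dots> \<le> \<Lambda>2 * (\<Sum>i<e. \<Lambda>1 * (\<Sum>i<d. \<bar>x i - y i\<bar>))"
        by (intro mult_left_mono sum_mono order_trans[OF relu_lipschitz] 1 2)
      finally show "\<bar>F (\<lambda>j. relu (affine d e L x j)) j - F (\<lambda>j. relu (affine d e L y j)) j\<bar>
        \<le> \<Lambda>2 * (real e * \<Lambda>1) * (\<Sum>i<d. \<bar>x i - y i\<bar>)" by (simp add: mult_ac)
    qed (use 1 2 in auto)
  qed
qed

section \<open>Brownian increments\<close>

locale brownian = prob_space M for M :: "'w measure" +
  fixes D :: nat and T :: real and W :: "real \<Rightarrow> 'w \<Rightarrow> vec"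
  assumes BM: "is_BM M D T W"
begin

abbreviation F :: "real \<Rightarrow> 'w measure" where "F \<equiv> Fm M D W"

abbreviation \<Delta> :: "real \<Rightarrow> real \<Rightarrow> nat \<Rightarrow> 'w \<Rightarrow> real" where
  "\<Delta> s t i \<equiv> (\<lambda>\<omega>. W t \<omega> i - W s \<omega> i)"

lemma W_vspace: "i \<ge> D \<Longrightarrow> W t \<omega> i = 0"
  using BM by (auto simp: is_BM_def vspace_def)

lemma W_meas [measurable]: "0 \<le> t \<Longrightarrow> t \<le> T \<Longrightarrow> (\<lambda>\<omega>. W t \<omega> i) \<in> borel_measurable M"
  using BM by (auto simp: is_BM_def)

lemma hist_subset: "hist M D W t \<union> null_sets M \<subseteq> Pow (space M)"
  by (auto simp: hist_def dest: sets.sets_into_space)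

lemma space_F [simp]: "space (F t) = space M"
  using hist_subset by (simp add: Fm_def space_measure_of_conv)

lemma sets_F: "sets (F t) = sigma_sets (space M) (hist M D W t \<union> null_sets M)"
  unfolding Fm_def using hist_subset by (rule sets_measure_of)

lemma F_mono: "s \<le> t \<Longrightarrow> sets (F s) \<subseteq> sets (F t)"
  unfolding sets_F by (rule sigma_sets_mono', unfold hist_def) fastforce

lemma hist_events: "t \<le> T \<Longrightarrow> hist M D W t \<union> null_sets M \<subseteq> events"
  by (auto simp: hist_def intro!: measurable_sets[OF W_meas])

lemma subalgebra_F: "t \<le> T \<Longrightarrow> subalgebra M (F t)"
  unfolding subalgebra_def using hist_events sets.sigma_sets_subset[of "hist M D W t \<union> null_sets M" M]
  by (simp add: sets_F)

lemma F_meas_mono: "f \<in> measurable (F s) N \<Longrightarrow> s \<le> t \<Longrightarrow> f \<in> measurable (F t) N"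
  by (rule measurable_from_subalg[of "F t" "F s"]) (auto simp: subalgebra_def dest: F_mono)

lemma F_meas: "f \<in> measurable (F t) N \<Longrightarrow> t \<le> T \<Longrightarrow> f \<in> measurable M N"
  by (rule measurable_from_subalg[OF subalgebra_F])

lemma W_F_meas: "0 \<le> u \<Longrightarrow> u \<le> t \<Longrightarrow> (\<lambda>\<omega>. W u \<omega> i) \<in> borel_measurable (F t)"
proof (cases "i < D")
  case True
  assume u: "0 \<le> u" "u \<le> t"
  show ?thesis
  proof (rule measurableI)
    fix A :: "real set" assume A: "A \<in> sets borel"
    then have "(\<lambda>\<omega>. W u \<omega> i) -` A \<inter> space M \<in> hist M D W t"
      using u True by (auto simp: hist_def intro!: bexI[of _ u] bexI[of _ i])
    then show "(\<lambda>\<omega>. W u \<omega> i) -` A \<inter> space (F t) \<in> sets (F t)"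
      by (auto simp: sets_F)
  qed simp
qed (simp add: W_vspace)

text \<open>Brownian motion is specified with the raw history, whereas the filtration is augmented
  by null sets. An augmented event agrees almost surely with a raw one, and probabilities of finite
  intersections do not see the difference.\<close>

lemma W_increment_indep_aux:
  assumes "0 \<le> s" "s < t" "t \<le> T"
  shows "indep_sets (\<lambda>j. case j of None \<Rightarrow> sets (F s)
     | Some i \<Rightarrow> {\<Delta> s t i -` B \<inter> space M | B. B \<in> sets borel}) (insert None (Some ` {..<D}))"
proof -
  let ?E = "\<lambda>j. case j of None \<Rightarrow> sigma_sets (space M) (hist M D W s)
     | Some i \<Rightarrow> {\<Delta> s t i -` B \<inter> space M | B. B \<in> sets borel}"
  let ?E' = "\<lambda>j. case j of None \<Rightarrow> sets (F s)
     | Some i \<Rightarrow> {\<Delta> s t i -` B \<inter> space M | B. B \<in> sets borel}"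
  have ind: "indep_sets ?E (insert None (Some ` {..<D}))"
    using BM assms unfolding is_BM_def by blast
  have sub: "sets (F s) \<subseteq> events"
    using subalgebra_F[of s] assms by (auto simp: subalgebra_def)
  \<comment> \<open>Induction over the generated sigma-algebra: null sets are replaced by the empty
    set, and countable unions stay almost surely equal because countably many exceptional sets are
    null together.\<close>
  have aug: "\<exists>A'\<in>sigma_sets (space M) (hist M D W s). AE \<omega> in M. \<omega> \<in> A \<longleftrightarrow> \<omega> \<in> A'"
    if "A \<in> sets (F s)" for A
    using that unfolding sets_F
  proof (induction rule: sigma_sets.induct)
    case (Basic A)
    show ?case
    proof (cases "A \<in> null_sets M")
      case True
      then show ?thesis by (intro bexI[of _ "{}"]) (auto intro: sigma_sets.Empty dest: AE_not_in)
    next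
      case False
      then show ?thesis using Basic by (intro bexI[of _ A]) auto
    qed
  next
    case Empty
    then show ?case by (intro bexI[of _ "{}"]) (auto intro: sigma_sets.Empty)
  next
    case (Compl A)
    then obtain A' where "A' \<in> sigma_sets (space M) (hist M D W s)" "AE \<omega> in M. \<omega> \<in> A \<longleftrightarrow> \<omega> \<in> A'" by auto
    then show ?case by (intro bexI[of _ "space M - A'"]) (auto intro: sigma_sets.Compl)
  next
    case (Union A)
    then obtain A' where A': "\<And>i. A' i \<in> sigma_sets (space M) (hist M D W s)"
      "\<And>i. AE \<omega> in M. \<omega> \<in> A i \<longleftrightarrow> \<omega> \<in> A' i" by metis
    have "AE \<omega> in M. \<forall>i::nat. \<omega> \<in> A i \<longleftrightarrow> \<omega> \<in> A' i" using A'(2) by (simp add: AE_all_countable)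
    then show ?case using A'(1) by (intro bexI[of _ "\<Union>i. A' i"]) (auto intro: sigma_sets.Union)
  qed
  show ?thesis
  proof (rule indep_setsI)
    fix i :: "nat option" assume i: "i \<in> insert None (Some ` {..<D})"
    show "?E' i \<subseteq> events"
    proof (cases i)
      case None
      then show ?thesis using sub by simp
    next
      case (Some i')
      have "?E i \<subseteq> events" using ind i unfolding indep_sets_def by blast
      then show ?thesis using Some by simp
    qed
  next
    fix A J assume J: "J \<noteq> {}" "J \<subseteq> insert None (Some ` {..<D})" "finite J" "\<forall>j\<in>J. A j \<in> ?E' j"
    \<comment> \<open>Only the component \<open>None\<close>, the past, is exchanged for a raw
      event; the components of the increment are raw already.\<close>
    define A' where "A' j = (if j = None \<and> None \<in> J then
       (SOME A'. A' \<in> sigma_sets (space M) (hist M D W s) \<and> (AE \<omega> in M. \<omega> \<in> A None \<longleftrightarrow> \<omega> \<in> A')) else A j)" for j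
    have N: "A' None \<in> sigma_sets (space M) (hist M D W s) \<and> (AE \<omega> in M. \<omega> \<in> A None \<longleftrightarrow> \<omega> \<in> A' None)" if "None \<in> J"
    proof -
      have "A None \<in> sets (F s)" using J(4) that by force
      from aug[OF this] show ?thesis
        unfolding A'_def using that by (simp add: Bex_def) (rule someI_ex)
    qed
    have A'E: "A' j \<in> ?E j" if "j \<in> J" for j
      using N J(4) that by (cases j) (auto simp: A'_def split: option.splits)
    have AE': "AE \<omega> in M. \<omega> \<in> A j \<longleftrightarrow> \<omega> \<in> A' j" if "j \<in> J" for j
      using N that by (cases "j = None") (auto simp: A'_def)
    have ev: "A' j \<in> events" if "j \<in> J" for j
      using ind A'E[OF that] that J(2) unfolding indep_sets_def by blast
    have ev0: "A j \<in> events" if "j \<in> J" for j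
    proof (cases j)
      case None
      then show ?thesis using J(4) that sub by force
    next
      case (Some i)
      then show ?thesis using ev[OF that] by (simp add: A'_def)
    qed
    have "AE \<omega> in M. \<forall>j\<in>J. \<omega> \<in> A j \<longleftrightarrow> \<omega> \<in> A' j"
      using AE' J(3) by (simp add: AE_ball_countable countable_finite)
    then have "prob (\<Inter>j\<in>J. A j) = prob (\<Inter>j\<in>J. A' j)"
      using ev ev0 J by (intro finite_measure_eq_AE) auto
    also have "\<dots> = (\<Prod>j\<in>J. prob (A' j))"
      by (rule indep_setsD[OF ind]) (use J A'E in auto)
    also have "\<dots> = (\<Prod>j\<in>J. prob (A j))"
      using AE' ev ev0 by (intro prod.cong refl finite_measure_eq_AE) (auto simp: eq_commute)
    finally show "prob (\<Inter>j\<in>J. A j) = (\<Prod>j\<in>J. prob (A j))" .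
  qed
qed

section \<open>Sigma-algebras generated by increments\<close>

definition incr_gen :: "real \<Rightarrow> real \<Rightarrow> 'w set set" where
  "incr_gen s t = (\<Union>i<D. {\<Delta> s t i -` B \<inter> space M | B. B \<in> sets borel})"

text \<open>All that a scheme on the grid \<open>v 0, ..., v m\<close> sees of the driving noise. It
  is a measurable space of its own so that integrands can be measurable on the product with the
  past.\<close>

definition incr_alg :: "(nat \<Rightarrow> real) \<Rightarrow> nat \<Rightarrow> 'w measure" where
  "incr_alg v m = sigma (space M) (\<Union>l<m. incr_gen (v l) (v (Suc l)))"

lemma incr_gen_events: "0 \<le> s \<Longrightarrow> s \<le> t \<Longrightarrow> t \<le> T \<Longrightarrow> incr_gen s t \<subseteq> sets (F t)"
proof -
  assume "0 \<le> s" "s \<le> t" "t \<le> T"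
  then have [measurable]: "(\<lambda>\<omega>. W s \<omega> i) \<in> borel_measurable (F t)" "(\<lambda>\<omega>. W t \<omega> i) \<in> borel_measurable (F t)" for i
    by (auto intro!: W_F_meas)
  have "\<Delta> s t i -` B \<inter> space M \<in> sets (F t)" if "B \<in> sets borel" for i B
    using measurable_sets[of "\<Delta> s t i" "F t" borel B] that by simp
  then show ?thesis by (auto simp: incr_gen_def)
qed

lemma space_incr_alg [simp]: "space (incr_alg v m) = space M"
  by (simp add: incr_alg_def space_measure_of_conv)

lemma sets_incr_alg: "sets (incr_alg v m) = sigma_sets (space M) (\<Union>l<m. incr_gen (v l) (v (Suc l)))"
  unfolding incr_alg_def by (rule sets_measure_of) (auto simp: incr_gen_def)

text \<open>Merges the component sigma-algebras into the one generated by the whole increment: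
  grouping independent families preserves independence, since every generator is closed under
  intersection.\<close>

lemma one_step_indep:
  assumes "0 \<le> s" "s < t" "t \<le> T"
  shows "indep_set (sets (F s)) (sigma_sets (space M) (incr_gen s t))"
proof -
  let ?E = "\<lambda>j. case j of None \<Rightarrow> sets (F s)
     | Some i \<Rightarrow> {\<Delta> s t i -` B \<inter> space M | B. B \<in> sets borel}"
  let ?I = "\<lambda>b. if b then {None} else Some ` {..<D}"
  have "indep_sets (\<lambda>j. sigma_sets (space M) (\<Union>i\<in>?I j. ?E i)) (UNIV :: bool set)"
  proof (rule indep_sets_collect_sigma)
    show "indep_sets ?E (\<Union>j\<in>UNIV. ?I j)"
      using W_increment_indep_aux[OF assms] by (simp add: UNIV_bool Un_commute)
    show "disjoint_family_on ?I UNIV" by (auto simp: disjoint_family_on_def)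
    fix i j assume "i \<in> ?I j"
    show "Int_stable (?E i)"
    proof (cases i)
      case None
      then show ?thesis by (auto simp: Int_stable_def)
    next
      case (Some k)
      show ?thesis unfolding Some option.case
      proof (safe intro!: Int_stableI)
        fix A B :: "real set" assume "A \<in> sets borel" "B \<in> sets borel"
        then show "\<exists>C. \<Delta> s t k -` A \<inter> space M \<inter> (\<Delta> s t k -` B \<inter> space M) = \<Delta> s t k -` C \<inter> space M \<and> C \<in> sets borel"
          by (intro exI[of _ "A \<inter> B"]) auto
      qed
    qed
  qed
  then have "indep_sets (case_bool (sets (F s)) (sigma_sets (space M) (incr_gen s t))) UNIV"
  proof (rule indep_sets_mono_sets)
    fix b :: bool
    have "sets (F s) \<subseteq> sigma_sets (space M) (sets (F s))" by blast
    then show "case_bool (sets (F s)) (sigma_sets (space M) (incr_gen s t)) b \<subseteq> sigma_sets (space M) (\<Union>i\<in>?I b. ?E i)"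
      by (cases b) (auto simp: incr_gen_def)
  qed
  then show ?thesis by (simp add: indep_set_def)
qed

lemma incr_alg_subset_F:
  assumes "\<And>l. l < m \<Longrightarrow> v l < v (Suc l)" "0 \<le> v 0" "v m \<le> T"
  shows "sets (incr_alg v m) \<subseteq> sets (F (v m))"
proof -
  have mono: "v l \<le> v l'" if "l \<le> l'" "l' \<le> m" for l l'
    using that
  proof (induction l' rule: dec_induct)
    case (step n)
    then show ?case using assms(1)[of n] by simp
  qed simp
  have "incr_gen (v l) (v (Suc l)) \<subseteq> sets (F (v m))" if "l < m" for l
  proof -
    have "incr_gen (v l) (v (Suc l)) \<subseteq> sets (F (v (Suc l)))"
      using that mono[of 0 l] mono[of "Suc l" m] assms by (intro incr_gen_events) (auto simp: less_imp_le)
    also have "\<dots> \<subseteq> sets (F (v m))" using that by (intro F_mono mono) auto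
    finally show ?thesis .
  qed
  then show ?thesis unfolding sets_incr_alg
    by (metis (no_types, lifting) UN_least lessThan_iff sets.sigma_sets_subset space_F)
qed

text \<open>Induction over the steps: the last increment is independent of \<open>F (v m)\<close>,
  which contains both the past and the earlier increments. Independence is shown for intersections
  of an earlier event with an event of the last increment and extended from this pi-system.\<close>

lemma past_indep_increments:
  assumes "\<And>l. l < m \<Longrightarrow> v l < v (Suc l)" "0 \<le> v 0" "v m \<le> T"
  shows "indep_set (sets (F (v 0))) (sets (incr_alg v m))"
  using assms
proof (induction m)
  case 0
  have "sets (incr_alg v 0) = {{}, space M}"
    by (simp add: sets_incr_alg sigma_sets_empty_eq)
  moreover have "sets (F (v 0)) \<subseteq> events" using subalgebra_F[of "v 0"] 0 by (simp add: subalgebra_def)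
  moreover have "prob (a \<inter> space M) = prob a" if "a \<in> sets (F (v 0))" for a
    using sets.sets_into_space[OF that] by (simp add: Int_absorb2)
  ultimately show ?case using prob_space by (auto simp: indep_sets2_eq)
next
  case (Suc m)
  have vm: "v m < v (Suc m)" using Suc.prems by simp
  have ge0: "0 \<le> v m"
  proof -
    have "v 0 \<le> v l" if "l \<le> m" for l using that
    proof (induction l)
      case (Suc l)
      then show ?case using Suc.prems \<open>\<And>l. l < Suc m \<Longrightarrow> v l < v (Suc l)\<close>[of l] by simp
    qed simp
    then show ?thesis using Suc.prems(2) by (meson order_refl order_trans)
  qed
  have IH: "indep_set (sets (F (v 0))) (sets (incr_alg v m))"
    using vm Suc.prems(3) by (intro Suc.IH Suc.prems) linarith+
  have sub: "sets (incr_alg v m) \<subseteq> sets (F (v m))"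
    using vm Suc.prems(3) by (intro incr_alg_subset_F Suc.prems) linarith+
  have F0m: "sets (F (v 0)) \<subseteq> sets (F (v m))"
  proof (rule F_mono)
    have "v 0 \<le> v l" if "l \<le> m" for l using that
    proof (induction l)
      case (Suc l)
      then show ?case using Suc.prems(1) \<open>\<And>l. l < Suc m \<Longrightarrow> v l < v (Suc l)\<close>[of l] by simp
    qed simp
    then show "v 0 \<le> v m" by simp
  qed
  have step: "indep_set (sets (F (v m))) (sigma_sets (space M) (incr_gen (v m) (v (Suc m))))"
    using ge0 vm Suc.prems by (intro one_step_indep) auto
  let ?S = "sigma_sets (space M) (incr_gen (v m) (v (Suc m)))"
  define P where "P = {B \<inter> C | B C. B \<in> sets (incr_alg v m) \<and> C \<in> ?S}"
  have Sev: "?S \<subseteq> events" and Fev: "sets (F (v m)) \<subseteq> events" using indep_setD_ev1[OF step] indep_setD_ev2[OF step] by auto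
  have Sp: "incr_gen (v m) (v (Suc m)) \<subseteq> Pow (space M)" by (auto simp: incr_gen_def)
  have "indep_set (sets (F (v 0))) P"
    unfolding indep_sets2_eq
  proof (intro conjI ballI)
    show "sets (F (v 0)) \<subseteq> events" using indep_setD_ev1[OF IH] .
    show "P \<subseteq> events" using Sev Fev sub by (auto simp: P_def)
    fix A X assume A: "A \<in> sets (F (v 0))" and "X \<in> P"
    then obtain B C where X: "X = B \<inter> C" "B \<in> sets (incr_alg v m)" "C \<in> ?S" by (auto simp: P_def)
    have AB: "A \<inter> B \<in> sets (F (v m))" using A X(2) sub F0m by auto
    have "prob (A \<inter> X) = prob ((A \<inter> B) \<inter> C)" by (simp add: X Int_assoc)
    also have "\<dots> = prob (A \<inter> B) * prob C" by (rule indep_setD[OF step AB X(3)])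
    also have "\<dots> = prob A * (prob B * prob C)" using indep_setD[OF IH A X(2)] by simp
    also have "prob B * prob C = prob X"
      using indep_setD[OF step _ X(3), of B] X sub by auto
    finally show "prob (A \<inter> X) = prob A * prob X" .
  qed
  moreover have "Int_stable (sets (F (v 0)))" by (auto simp: Int_stable_def)
  moreover have "Int_stable P"
  proof (rule Int_stableI)
    fix a b assume "a \<in> P" "b \<in> P"
    then obtain B C B' C' where *: "a = B \<inter> C" "B \<in> sets (incr_alg v m)" "C \<in> ?S"
      "b = B' \<inter> C'" "B' \<in> sets (incr_alg v m)" "C' \<in> ?S" by (auto simp: P_def)
    have "?S = sets (sigma (space M) (incr_gen (v m) (v (Suc m))))" using Sp by simp
    then have "C \<inter> C' \<in> ?S" using *(3,6) by auto
    then show "a \<inter> b \<in> P" using * unfolding P_def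
      by (intro CollectI exI[of _ "B \<inter> B'"] exI[of _ "C \<inter> C'"]) auto
  qed
  ultimately have ind: "indep_set (sigma_sets (space M) (sets (F (v 0)))) (sigma_sets (space M) P)"
    by (rule indep_set_sigma_sets)
  have "sets (incr_alg v (Suc m)) \<subseteq> sigma_sets (space M) P"
    unfolding sets_incr_alg
  proof (rule sigma_sets_mono, safe)
    fix X l assume X: "l < Suc m" "X \<in> incr_gen (v l) (v (Suc l))"
    \<comment> \<open>The whole space as one of the two factors places every generator in
      \<open>P\<close>.\<close>
    have top: "space M \<in> ?S" "space M \<in> sets (incr_alg v m)"
      by (auto simp: sigma_sets_top) (metis sets.top space_incr_alg)
    have X0: "X \<subseteq> space M" using X(2) by (auto simp: incr_gen_def)
    have "X \<in> P"
    proof (cases "l = m")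
      case True
      then have "X \<in> ?S" using X by auto
      then show ?thesis using top X0 unfolding P_def by (intro CollectI exI[of _ "space M"] exI[of _ X]) auto
    next
      case False
      then have "X \<in> sets (incr_alg v m)" using X unfolding sets_incr_alg by (intro sigma_sets.Basic) auto
      then show ?thesis using top X0 unfolding P_def by (intro CollectI exI[of _ X] exI[of _ "space M"]) auto
    qed
    then show "X \<in> sigma_sets (space M) P" by auto
  qed
  moreover have "sets (F (v 0)) \<subseteq> sigma_sets (space M) (sets (F (v 0)))" by auto
  ultimately show ?case using ind unfolding indep_sets2_eq by blast
qed

end

section \<open>Moments of increments and the discrete Ito isometry\<close>

lemma integrable_mult_of_squares:
  fixes f g :: "'a \<Rightarrow> real"
  assumes [measurable]: "f \<in> borel_measurable M" "g \<in> borel_measurable M"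
    and "integrable M (\<lambda>x. (f x)\<^sup>2)" "integrable M (\<lambda>x. (g x)\<^sup>2)"
  shows "integrable M (\<lambda>x. f x * g x)"
proof (rule Bochner_Integration.integrable_bound)
  show "integrable M (\<lambda>x. (f x)\<^sup>2 + (g x)\<^sup>2)" using assms by auto
  have "\<bar>a * b\<bar> \<le> a\<^sup>2 + b\<^sup>2" for a b :: real
    using sum_squares_bound[of "\<bar>a\<bar>" "\<bar>b\<bar>"] zero_le_power2[of a] zero_le_power2[of b]
    by (simp only: abs_mult power2_abs)
  then show "AE x in M. norm (f x * g x) \<le> norm ((f x)\<^sup>2 + (g x)\<^sup>2)" by (auto simp: abs_mult)
qed measurable

lemma (in prob_space) indep_var_subalgebras:
  assumes ind: "indep_set (sets A) (sets B)" and sp: "space A = space M" "space B = space M"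
    and X: "X \<in> measurable A S" and Y: "Y \<in> measurable B N"
  shows "indep_var S X N Y"
proof -
  have sub: "subalgebra M A" "subalgebra M B"
    using indep_setD_ev1[OF ind] indep_setD_ev2[OF ind] sp by (auto simp: subalgebra_def)
  have 1: "{X -` C \<inter> space M | C. C \<in> sets S} \<subseteq> sets A" using measurable_sets[OF X] sp by auto
  have 2: "{Y -` C \<inter> space M | C. C \<in> sets N} \<subseteq> sets B" using measurable_sets[OF Y] sp by auto
  have "sigma_sets (space M) {X -` C \<inter> space M | C. C \<in> sets S} \<subseteq> sets A"
    "sigma_sets (space M) {Y -` C \<inter> space M | C. C \<in> sets N} \<subseteq> sets B"
    using sets.sigma_sets_subset[OF 1] sets.sigma_sets_subset[OF 2] sp by auto
  then have "indep_set (sigma_sets (space M) {X -` C \<inter> space M | C. C \<in> sets S})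
     (sigma_sets (space M) {Y -` C \<inter> space M | C. C \<in> sets N})"
    using ind unfolding indep_sets2_eq by blast
  then show ?thesis
    unfolding indep_var_eq using measurable_from_subalg[OF sub(1) X] measurable_from_subalg[OF sub(2) Y] by simp
qed

context brownian
begin

lemma incr_distributed:
  assumes "i < D" "0 \<le> s" "s < t" "t \<le> T"
  shows "distributed M lborel (\<Delta> s t i) (\<lambda>x. ennreal (normal_density 0 (sqrt (t - s)) x))"
  using BM assms unfolding is_BM_def by blast

lemma incr_moments:
  assumes "i < D" "0 \<le> s" "s < t" "t \<le> T"
  shows incr_power_integrable: "integrable M (\<lambda>\<omega>. (\<Delta> s t i \<omega>) ^ k)"
    and incr_mean: "(\<integral>\<omega>. \<Delta> s t i \<omega> \<partial>M) = 0"
    and incr_even_moment: "(\<integral>\<omega>. (\<Delta> s t i \<omega>) ^ (2 * k) \<partial>M) = fact (2 * k) / (2 ^ k * fact k) * (t - s) ^ k"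
proof -
  note d = incr_distributed[OF assms]
  have s: "0 < sqrt (t - s)" using assms by simp
  show "integrable M (\<lambda>\<omega>. (\<Delta> s t i \<omega>) ^ k)"
    using distributed_integrable[OF d, of "\<lambda>x. x ^ k"] integrable_normal_moment[OF s, of 0 k] by simp
  show "(\<integral>\<omega>. \<Delta> s t i \<omega> \<partial>M) = 0"
    using distributed_integral[OF d, of "\<lambda>x. x"] integral_normal_moment_nz_1[OF s, of 0] by simp
  show "(\<integral>\<omega>. (\<Delta> s t i \<omega>) ^ (2 * k) \<partial>M) = fact (2 * k) / (2 ^ k * fact k) * (t - s) ^ k"
    using distributed_integral[OF d, of "\<lambda>x. x ^ (2 * k)"] integral_normal_moment_even[OF s, of 0 k] assms
    by (simp add: field_simps power_divide)
qed

lemma incr_variance: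
  assumes "i < D" "0 \<le> s" "s < t" "t \<le> T"
  shows "(\<integral>\<omega>. (\<Delta> s t i \<omega>)\<^sup>2 \<partial>M) = t - s"
  using incr_even_moment[OF assms, of 1] by simp

lemma incr_meas_gen: "i < D \<Longrightarrow> \<Delta> s t i \<in> borel_measurable (sigma (space M) (incr_gen s t))"
proof (rule measurableI)
  fix A :: "real set" assume "i < D" "A \<in> sets borel"
  then have "\<Delta> s t i -` A \<inter> space M \<in> incr_gen s t" by (auto simp: incr_gen_def)
  moreover have "incr_gen s t \<subseteq> Pow (space M)" by (auto simp: incr_gen_def)
  ultimately show "\<Delta> s t i -` A \<inter> space (sigma (space M) (incr_gen s t)) \<in> sets (sigma (space M) (incr_gen s t))"
    by (auto simp: space_measure_of_conv)
qed simp

lemma incr_components_uncorrelated: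
  assumes "i < D" "j < D" "i \<noteq> j" "0 \<le> s" "s < t" "t \<le> T"
  shows "(\<integral>\<omega>. \<Delta> s t i \<omega> * \<Delta> s t j \<omega> \<partial>M) = 0"
proof -
  have [measurable]: "(\<lambda>\<omega>. W s \<omega> i) \<in> borel_measurable M" "(\<lambda>\<omega>. W t \<omega> i) \<in> borel_measurable M" for i
    using assms by auto
  let ?G = "\<lambda>i. {\<Delta> s t i -` B \<inter> space M | B. B \<in> sets borel}"
  have st: "Int_stable (?G k)" for k
  proof (safe intro!: Int_stableI)
    fix A B :: "real set" assume "A \<in> sets borel" "B \<in> sets borel"
    then show "\<exists>C. \<Delta> s t k -` A \<inter> space M \<inter> (\<Delta> s t k -` B \<inter> space M) = \<Delta> s t k -` C \<inter> space M \<and> C \<in> sets borel"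
      by (intro exI[of _ "A \<inter> B"]) auto
  qed
  have "indep_set (?G i) (?G j)"
    unfolding indep_sets2_eq
  proof (intro conjI ballI)
    fix a b assume ab: "a \<in> ?G i" "b \<in> ?G j"
    have "prob (\<Inter>k\<in>{Some i, Some j}. if k = Some i then a else b) = (\<Prod>k\<in>{Some i, Some j}. prob (if k = Some i then a else b))"
      by (rule indep_setsD[OF W_increment_indep_aux[OF assms(4-6)]]) (use assms ab in auto)
    then show "prob (a \<inter> b) = prob a * prob b" using assms(3) by (auto simp: Int_commute)
  qed auto
  then have "indep_var borel (\<Delta> s t i) borel (\<Delta> s t j)"
    unfolding indep_var_eq by (intro conjI indep_set_sigma_sets st) auto
  from indep_var_lebesgue_integral[OF this] incr_power_integrable[of i s t 1] incr_power_integrable[of j s t 1] incr_mean[of i s t] assms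
  show ?thesis by simp
qed

lemma one_step_product:
  assumes st: "0 \<le> s" "s < t" "t \<le> T" and H: "H \<in> borel_measurable (F s)" "integrable M H"
    and K: "K \<in> borel_measurable (sigma (space M) (incr_gen s t))" "integrable M K"
  shows "integrable M (\<lambda>\<omega>. H \<omega> * K \<omega> :: real)" "(\<integral>\<omega>. H \<omega> * K \<omega> \<partial>M) = (\<integral>\<omega>. H \<omega> \<partial>M) * (\<integral>\<omega>. K \<omega> \<partial>M)"
proof -
  have "incr_gen s t \<subseteq> Pow (space M)" by (auto simp: incr_gen_def)
  then have "indep_set (sets (F s)) (sets (sigma (space M) (incr_gen s t)))"
    using one_step_indep[OF st] by simp
  then have "indep_var borel H borel K"
    by (rule indep_var_subalgebras) (use H K in \<open>auto simp: space_measure_of_conv\<close>)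
  from indep_var_integrable[OF this] indep_var_lebesgue_integral[OF this] H K
  show "integrable M (\<lambda>\<omega>. H \<omega> * K \<omega> :: real)" "(\<integral>\<omega>. H \<omega> * K \<omega> \<partial>M) = (\<integral>\<omega>. H \<omega> \<partial>M) * (\<integral>\<omega>. K \<omega> \<partial>M)" by auto
qed

text \<open>In the expanded square the terms linear in the increment vanish, since it is centred and
  independent of \<open>F s\<close>, and mixed products of distinct components vanish, since these
  are uncorrelated; the diagonal with variance \<open>t - s\<close> remains. \<open>S\<close> is the
  sum accumulated so far, which makes the step iterable.\<close>

lemma ito_step:
  assumes st: "0 \<le> s" "s < t" "t \<le> T"
    and H: "\<And>j. j < D \<Longrightarrow> H j \<in> borel_measurable (F s)" "\<And>j. j < D \<Longrightarrow> integrable M (\<lambda>\<omega>. (H j \<omega>)\<^sup>2)"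
    and S: "S \<in> borel_measurable (F s)" "integrable M (\<lambda>\<omega>. (S \<omega>)\<^sup>2)"
  shows "integrable M (\<lambda>\<omega>. (S \<omega> + (\<Sum>j<D. H j \<omega> * \<Delta> s t j \<omega>))\<^sup>2)" (is ?int)
    and "(\<integral>\<omega>. (S \<omega> + (\<Sum>j<D. H j \<omega> * \<Delta> s t j \<omega>))\<^sup>2 \<partial>M) = (\<integral>\<omega>. (S \<omega>)\<^sup>2 \<partial>M) + (t - s) * (\<Sum>j<D. \<integral>\<omega>. (H j \<omega>)\<^sup>2 \<partial>M)" (is ?eq)
proof -
  have [measurable]: "(\<lambda>\<omega>. W s \<omega> i) \<in> borel_measurable M" "(\<lambda>\<omega>. W t \<omega> i) \<in> borel_measurable M" for i
    using st by auto
  have Hm [measurable]: "H j \<in> borel_measurable M" if "j < D" for j using F_meas[OF H(1)[OF that]] st by simp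
  have Sm [measurable]: "S \<in> borel_measurable M" using F_meas[OF S(1)] st by simp
  note gm = incr_meas_gen[where s=s and t=t]
  have HH: "integrable M (\<lambda>\<omega>. H i \<omega> * H j \<omega>)" if "i < D" "j < D" for i j
    using that by (intro integrable_mult_of_squares Hm H)
  have ii: "integrable M (\<lambda>\<omega>. \<Delta> s t i \<omega> * \<Delta> s t j \<omega>)" if "i < D" "j < D" for i j
    using incr_power_integrable[OF that(1) st, of 2] incr_power_integrable[OF that(2) st, of 2]
    by (intro integrable_mult_of_squares) auto
  have 1: "integrable M (\<lambda>\<omega>. (H i \<omega> * H j \<omega>) * (\<Delta> s t i \<omega> * \<Delta> s t j \<omega>))"
      "(\<integral>\<omega>. (H i \<omega> * H j \<omega>) * (\<Delta> s t i \<omega> * \<Delta> s t j \<omega>) \<partial>M) = (\<integral>\<omega>. H i \<omega> * H j \<omega> \<partial>M) * (\<integral>\<omega>. \<Delta> s t i \<omega> * \<Delta> s t j \<omega> \<partial>M)"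
    if "i < D" "j < D" for i j
  proof -
    have m1: "(\<lambda>\<omega>. H i \<omega> * H j \<omega>) \<in> borel_measurable (F s)" using H(1)[OF that(1)] H(1)[OF that(2)] by (rule borel_measurable_times)
    have m2: "(\<lambda>\<omega>. \<Delta> s t i \<omega> * \<Delta> s t j \<omega>) \<in> borel_measurable (sigma (space M) (incr_gen s t))"
      using gm[OF that(1)] gm[OF that(2)] by (rule borel_measurable_times)
    show "integrable M (\<lambda>\<omega>. (H i \<omega> * H j \<omega>) * (\<Delta> s t i \<omega> * \<Delta> s t j \<omega>))"
      "(\<integral>\<omega>. (H i \<omega> * H j \<omega>) * (\<Delta> s t i \<omega> * \<Delta> s t j \<omega>) \<partial>M) = (\<integral>\<omega>. H i \<omega> * H j \<omega> \<partial>M) * (\<integral>\<omega>. \<Delta> s t i \<omega> * \<Delta> s t j \<omega> \<partial>M)"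
      by (intro one_step_product[OF st m1 HH[OF that] m2 ii[OF that]])+
  qed
  have 2: "integrable M (\<lambda>\<omega>. (S \<omega> * H j \<omega>) * \<Delta> s t j \<omega>)" "(\<integral>\<omega>. (S \<omega> * H j \<omega>) * \<Delta> s t j \<omega> \<partial>M) = 0" if "j < D" for j
  proof -
    have m1: "(\<lambda>\<omega>. S \<omega> * H j \<omega>) \<in> borel_measurable (F s)" using S(1) H(1)[OF that] by (rule borel_measurable_times)
    have i1: "integrable M (\<lambda>\<omega>. S \<omega> * H j \<omega>)" using that by (intro integrable_mult_of_squares Hm Sm S H)
    have i2: "integrable M (\<Delta> s t j)" using incr_power_integrable[OF that st, of 1] by simp
    show "integrable M (\<lambda>\<omega>. (S \<omega> * H j \<omega>) * \<Delta> s t j \<omega>)" "(\<integral>\<omega>. (S \<omega> * H j \<omega>) * \<Delta> s t j \<omega> \<partial>M) = 0"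
      using one_step_product[OF st m1 i1 gm[OF that] i2] incr_mean[OF that st] by auto
  qed
  have ex: "(S \<omega> + (\<Sum>j<D. H j \<omega> * \<Delta> s t j \<omega>))\<^sup>2 = (S \<omega>)\<^sup>2 + 2 * (\<Sum>j<D. (S \<omega> * H j \<omega>) * \<Delta> s t j \<omega>)
     + (\<Sum>i<D. \<Sum>j<D. (H i \<omega> * H j \<omega>) * (\<Delta> s t i \<omega> * \<Delta> s t j \<omega>))" for \<omega>
  proof -
    have "(\<Sum>j<D. H j \<omega> * \<Delta> s t j \<omega>)\<^sup>2 = (\<Sum>i<D. \<Sum>j<D. (H i \<omega> * H j \<omega>) * (\<Delta> s t i \<omega> * \<Delta> s t j \<omega>))"
      unfolding power2_eq_square sum_product by (intro sum.cong refl) (simp only: mult_ac)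
    moreover have "S \<omega> * (\<Sum>j<D. H j \<omega> * \<Delta> s t j \<omega>) = (\<Sum>j<D. (S \<omega> * H j \<omega>) * \<Delta> s t j \<omega>)"
      unfolding sum_distrib_left by (intro sum.cong refl) (simp only: mult_ac)
    ultimately show ?thesis unfolding power2_sum by (simp only: mult.assoc)
  qed
  have I2: "integrable M (\<lambda>\<omega>. \<Sum>j<D. (S \<omega> * H j \<omega>) * \<Delta> s t j \<omega>)"
    by (intro Bochner_Integration.integrable_sum 2) simp
  have I3: "integrable M (\<lambda>\<omega>. \<Sum>i<D. \<Sum>j<D. (H i \<omega> * H j \<omega>) * (\<Delta> s t i \<omega> * \<Delta> s t j \<omega>))"
    by (intro Bochner_Integration.integrable_sum 1) simp_all
  show ?int unfolding ex using I2 I3 S(2) by auto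
  have "(\<integral>\<omega>. (S \<omega> + (\<Sum>j<D. H j \<omega> * \<Delta> s t j \<omega>))\<^sup>2 \<partial>M) = (\<integral>\<omega>. (S \<omega>)\<^sup>2 \<partial>M)
     + 2 * (\<integral>\<omega>. (\<Sum>j<D. (S \<omega> * H j \<omega>) * \<Delta> s t j \<omega>) \<partial>M)
     + (\<integral>\<omega>. (\<Sum>i<D. \<Sum>j<D. (H i \<omega> * H j \<omega>) * (\<Delta> s t i \<omega> * \<Delta> s t j \<omega>)) \<partial>M)"
    unfolding ex using I2 I3 S(2) by simp
  also have "(\<integral>\<omega>. (\<Sum>j<D. (S \<omega> * H j \<omega>) * \<Delta> s t j \<omega>) \<partial>M) = 0"
    by (subst Bochner_Integration.integral_sum) (auto intro!: 2 sum.neutral)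
  also have "(\<integral>\<omega>. (\<Sum>i<D. \<Sum>j<D. (H i \<omega> * H j \<omega>) * (\<Delta> s t i \<omega> * \<Delta> s t j \<omega>)) \<partial>M)
     = (\<Sum>i<D. \<Sum>j<D. (\<integral>\<omega>. H i \<omega> * H j \<omega> \<partial>M) * (\<integral>\<omega>. \<Delta> s t i \<omega> * \<Delta> s t j \<omega> \<partial>M))"
    by (subst Bochner_Integration.integral_sum, (intro Bochner_Integration.integrable_sum 1; simp),
        intro sum.cong refl, subst Bochner_Integration.integral_sum, (intro 1; simp), intro sum.cong refl 1) auto
  also have "\<dots> = (\<Sum>i<D. \<Sum>j<D. if j = i then (t - s) * (\<integral>\<omega>. (H i \<omega>)\<^sup>2 \<partial>M) else 0)"
    using incr_components_uncorrelated incr_variance st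
    by (intro sum.cong refl) (auto simp: power2_eq_square)
  also have "\<dots> = (t - s) * (\<Sum>i<D. \<integral>\<omega>. (H i \<omega>)\<^sup>2 \<partial>M)"
    by (simp add: sum_distrib_left)
  finally show ?eq by simp
qed

lemma stoch_sum_meas:
  assumes v: "\<And>l. l < m \<Longrightarrow> v l < v (Suc l)" "0 \<le> v 0"
    and H: "\<And>l j. l < m \<Longrightarrow> j < D \<Longrightarrow> H l j \<in> borel_measurable (F (v l))"
  shows "(\<lambda>\<omega>. \<Sum>l<m. \<Sum>j<D. H l j \<omega> * \<Delta> (v l) (v (Suc l)) j \<omega>) \<in> borel_measurable (F (v m))"
proof -
  have mono: "v l \<le> v l'" if "l \<le> l'" "l' \<le> m" for l l'
    using that
  proof (induction l' rule: dec_induct)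
    case (step n)
    then show ?case using v(1)[of n] by simp
  qed simp
  show ?thesis
  proof (intro borel_measurable_sum borel_measurable_times borel_measurable_diff)
    fix l j assume lj: "l \<in> {..<m}" "j \<in> {..<D}"
    show "H l j \<in> borel_measurable (F (v m))"
      using lj mono[of l m] by (intro F_meas_mono[OF H]) auto
    show "(\<lambda>\<omega>. W (v (Suc l)) \<omega> j) \<in> borel_measurable (F (v m))" "(\<lambda>\<omega>. W (v l) \<omega> j) \<in> borel_measurable (F (v m))"
      using lj mono[of 0 l] mono[of "Suc l" m] mono[of l m] mono[of l "Suc l"] v(2) by (auto intro!: W_F_meas)
  qed
qed

lemma ito_isometry_sum:
  assumes v: "\<And>l. l < m \<Longrightarrow> v l < v (Suc l)" "0 \<le> v 0" "v m \<le> T"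
    and H: "\<And>l j. l < m \<Longrightarrow> j < D \<Longrightarrow> H l j \<in> borel_measurable (F (v l))"
     "\<And>l j. l < m \<Longrightarrow> j < D \<Longrightarrow> integrable M (\<lambda>\<omega>. (H l j \<omega>)\<^sup>2)"
  shows "integrable M (\<lambda>\<omega>. (\<Sum>l<m. \<Sum>j<D. H l j \<omega> * \<Delta> (v l) (v (Suc l)) j \<omega>)\<^sup>2) \<and>
    (\<integral>\<omega>. (\<Sum>l<m. \<Sum>j<D. H l j \<omega> * \<Delta> (v l) (v (Suc l)) j \<omega>)\<^sup>2 \<partial>M) = (\<Sum>l<m. (v (Suc l) - v l) * (\<Sum>j<D. \<integral>\<omega>. (H l j \<omega>)\<^sup>2 \<partial>M))"
  using assms
proof (induction m)
  case (Suc m)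
  have vm: "v m < v (Suc m)" "v m \<le> T" using Suc.prems(1)[of m] Suc.prems(3) by auto
  have "v 0 \<le> v l" if "l \<le> m" for l using that
  proof (induction l)
    case (Suc l)
    then show ?case using \<open>\<And>l. l < Suc m \<Longrightarrow> v l < v (Suc l)\<close>[of l] by simp
  qed simp
  then have ge0: "0 \<le> v m" using Suc.prems(2) by (meson order_refl order_trans)
  note IH = Suc.IH[OF Suc.prems(1) Suc.prems(2) vm(2) Suc.prems(4) Suc.prems(5)]
  have sm: "(\<lambda>\<omega>. \<Sum>l<m. \<Sum>j<D. H l j \<omega> * \<Delta> (v l) (v (Suc l)) j \<omega>) \<in> borel_measurable (F (v m))"
    by (rule stoch_sum_meas) (use Suc.prems in auto)
  have "integrable M (\<lambda>\<omega>. (\<Sum>l<m. \<Sum>j<D. H l j \<omega> * \<Delta> (v l) (v (Suc l)) j \<omega>)\<^sup>2)"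
    using IH by auto
  from ito_step[OF ge0 vm(1) Suc.prems(3) Suc.prems(4) Suc.prems(5) sm this] IH
  show ?case by auto
qed simp

text \<open>No integrability is needed: if the right-hand side is finite, the integrands are square integrable.\<close>
lemma ito_isometry_nn:
  assumes v: "\<And>l. l < m \<Longrightarrow> v l < v (Suc l)" "0 \<le> v 0" "v m \<le> T"
    and H: "\<And>l j. l < m \<Longrightarrow> j < D \<Longrightarrow> H l j \<in> borel_measurable (F (v l))"
  shows "(\<integral>\<^sup>+\<omega>. ennreal ((\<Sum>l<m. \<Sum>j<D. H l j \<omega> * \<Delta> (v l) (v (Suc l)) j \<omega>)\<^sup>2) \<partial>M)
    \<le> (\<Sum>l<m. ennreal (v (Suc l) - v l) * (\<Sum>j<D. \<integral>\<^sup>+\<omega>. ennreal ((H l j \<omega>)\<^sup>2) \<partial>M))" (is "_ \<le> ?R")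
proof (cases "?R = \<infinity>")
  case False
  have mono: "v l \<le> v l'" if "l \<le> l'" "l' \<le> m" for l l'
    using that
  proof (induction l' rule: dec_induct)
    case (step n)
    then show ?case using v(1)[of n] by simp
  qed simp
  have Hm: "H l j \<in> borel_measurable M" if "l < m" "j < D" for l j
    using F_meas[OF H[OF that]] mono[of l m] that v(3) by simp
  \<comment> \<open>The weights \<open>v (Suc l) - v l\<close> are strictly positive, so one
    infinite second moment would make the whole right-hand side infinite.\<close>
  have fin: "(\<integral>\<^sup>+\<omega>. ennreal ((H l j \<omega>)\<^sup>2) \<partial>M) < \<infinity>" if "l < m" "j < D" for l j
  proof (rule ccontr)
    assume "\<not> ?thesis"
    then have "(\<Sum>j<D. \<integral>\<^sup>+\<omega>. ennreal ((H l j \<omega>)\<^sup>2) \<partial>M) = \<infinity>"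
      using that by (auto simp: less_top[symmetric] intro!: bexI[of _ j])
    then have "ennreal (v (Suc l) - v l) * (\<Sum>j<D. \<integral>\<^sup>+\<omega>. ennreal ((H l j \<omega>)\<^sup>2) \<partial>M) = \<infinity>"
      using v(1)[OF that(1)] by (simp add: ennreal_mult_eq_top_iff)
    then have "?R = \<infinity>" using that by (auto)
    then show False using False by simp
  qed
  have int: "integrable M (\<lambda>\<omega>. (H l j \<omega>)\<^sup>2)" if "l < m" "j < D" for l j
    using fin[OF that] Hm[OF that] by (intro integrableI_nonneg) auto
  have "(\<integral>\<^sup>+\<omega>. ennreal ((\<Sum>l<m. \<Sum>j<D. H l j \<omega> * \<Delta> (v l) (v (Suc l)) j \<omega>)\<^sup>2) \<partial>M)
    = ennreal (\<Sum>l<m. (v (Suc l) - v l) * (\<Sum>j<D. \<integral>\<omega>. (H l j \<omega>)\<^sup>2 \<partial>M))"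
    using ito_isometry_sum[OF v H int] by (subst nn_integral_eq_integral) auto
  also have "\<dots> = (\<Sum>l<m. ennreal (v (Suc l) - v l) * (\<Sum>j<D. ennreal (\<integral>\<omega>. (H l j \<omega>)\<^sup>2 \<partial>M)))"
    using v(1) by (subst sum_ennreal[symmetric]) (auto simp: less_imp_le ennreal_mult sum_nonneg sum_ennreal intro!: sum.cong mult_nonneg_nonneg)
  also have "\<dots> = ?R"
    using int by (intro sum.cong arg_cong2[where f="(*)"] refl nn_integral_eq_integral[symmetric]) auto
  finally show ?thesis by simp
next
  case True
  show ?thesis unfolding True by simp
qed

end

section \<open>Convergence in probability\<close>

definition null_in_prob :: "'w measure \<Rightarrow> (nat \<Rightarrow> 'w \<Rightarrow> real) \<Rightarrow> bool" where
  "null_in_prob M X \<longleftrightarrow> (\<forall>\<epsilon>>0. (\<lambda>r. measure M {\<omega>\<in>space M. \<bar>X r \<omega>\<bar> > \<epsilon>}) \<longlonglongrightarrow> 0)"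

context prob_space
begin

lemma null_in_prob_add:
  assumes [measurable]: "\<And>r. X r \<in> borel_measurable M" "\<And>r. Y r \<in> borel_measurable M"
    and "null_in_prob M X" "null_in_prob M Y"
  shows "null_in_prob M (\<lambda>r \<omega>. X r \<omega> + Y r \<omega>)"
  unfolding null_in_prob_def
proof (intro allI impI)
  fix e :: real assume e: "e > 0"
  have "(\<lambda>r. prob {\<omega>\<in>space M. \<bar>X r \<omega>\<bar> > e/2} + prob {\<omega>\<in>space M. \<bar>Y r \<omega>\<bar> > e/2}) \<longlonglongrightarrow> 0 + 0"
    using assms(3,4)[unfolded null_in_prob_def, rule_format, of "e/2"] e by (intro tendsto_add) simp_all
  moreover have "prob {\<omega>\<in>space M. \<bar>X r \<omega> + Y r \<omega>\<bar> > e} \<le> prob {\<omega>\<in>space M. \<bar>X r \<omega>\<bar> > e/2} + prob {\<omega>\<in>space M. \<bar>Y r \<omega>\<bar> > e/2}" for r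
  proof -
    have "prob {\<omega>\<in>space M. \<bar>X r \<omega> + Y r \<omega>\<bar> > e} \<le> prob ({\<omega>\<in>space M. \<bar>X r \<omega>\<bar> > e/2} \<union> {\<omega>\<in>space M. \<bar>Y r \<omega>\<bar> > e/2})"
      by (intro finite_measure_mono) auto
    also have "\<dots> \<le> prob {\<omega>\<in>space M. \<bar>X r \<omega>\<bar> > e/2} + prob {\<omega>\<in>space M. \<bar>Y r \<omega>\<bar> > e/2}"
      by (intro measure_Un_le) measurable
    finally show ?thesis .
  qed
  ultimately show "(\<lambda>r. prob {\<omega>\<in>space M. \<bar>X r \<omega> + Y r \<omega>\<bar> > e}) \<longlonglongrightarrow> 0"
    by (rule_tac Lim_null_comparison[where g="\<lambda>r. prob {\<omega>\<in>space M. \<bar>X r \<omega>\<bar> > e/2} + prob {\<omega>\<in>space M. \<bar>Y r \<omega>\<bar> > e/2}"])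
      (simp_all only: real_norm_def abs_of_nonneg measure_nonneg add_0 eventually_True)
qed

lemma null_in_prob_minus: "null_in_prob M X \<Longrightarrow> null_in_prob M (\<lambda>r \<omega>. - X r \<omega>)"
  by (simp add: null_in_prob_def)

lemma null_in_prob_subseq: "null_in_prob M X \<Longrightarrow> filterlim g at_top sequentially \<Longrightarrow> null_in_prob M (\<lambda>r. X (g r))"
  unfolding null_in_prob_def by (auto intro: filterlim_compose)

text \<open>For truncated variables convergence in probability is convergence in mean: the integral
  is at most \<open>e / 2\<close> plus the probability of exceeding \<open>e / 2\<close>. The
  integral form is what yields an almost surely convergent subsequence.\<close>

lemma null_in_prob_L1:
  assumes [measurable]: "\<And>r. X r \<in> borel_measurable M" and X: "null_in_prob M X"
  shows "(\<lambda>r. \<integral>\<omega>. min 1 \<bar>X r \<omega>\<bar> \<partial>M) \<longlonglongrightarrow> 0"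
proof (rule LIMSEQ_I)
  fix e :: real assume e: "e > 0"
  have "(\<lambda>r. prob {\<omega>\<in>space M. \<bar>X r \<omega>\<bar> > e/2}) \<longlonglongrightarrow> 0" using X[unfolded null_in_prob_def, rule_format, of "e/2"] e by simp
  from LIMSEQ_D[OF this, of "e/2"] e
  obtain r0 where r0: "\<And>r. r \<ge> r0 \<Longrightarrow> prob {\<omega>\<in>space M. \<bar>X r \<omega>\<bar> > e/2} < e/2" by auto
  have int: "integrable M (\<lambda>\<omega>. min 1 \<bar>X r \<omega>\<bar>)" for r
    by (rule integrable_const_bound[of _ 1]) auto
  show "\<exists>r0. \<forall>r\<ge>r0. norm ((\<integral>\<omega>. min 1 \<bar>X r \<omega>\<bar> \<partial>M) - 0) < e"
  proof (intro exI[of _ r0] allI impI)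
    fix r assume "r \<ge> r0"
    have ind: "integrable M (indicat_real {\<omega>\<in>space M. \<bar>X r \<omega>\<bar> > e/2})"
      by (rule integrable_const_bound[of _ 1]) (auto simp del: less_divide_eq_numeral1 divide_less_eq_numeral1)
    have "(\<integral>\<omega>. min 1 \<bar>X r \<omega>\<bar> \<partial>M) \<le> (\<integral>\<omega>. e/2 + indicator {\<omega>\<in>space M. \<bar>X r \<omega>\<bar> > e/2} \<omega> \<partial>M)"
      using e by (intro integral_mono int Bochner_Integration.integrable_add ind) (auto split: split_indicator)
    also have "\<dots> = e/2 + prob {\<omega>\<in>space M. \<bar>X r \<omega>\<bar> > e/2}"
      by (subst Bochner_Integration.integral_add[OF _ ind]) (auto simp: prob_space)
    also have "\<dots> < e" using r0[OF \<open>r \<ge> r0\<close>] by simp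
    finally have "(\<integral>\<omega>. min 1 \<bar>X r \<omega>\<bar> \<partial>M) < e" .
    moreover have "(\<integral>\<omega>. min 1 \<bar>X r \<omega>\<bar> \<partial>M) \<ge> 0" by (intro Bochner_Integration.integral_nonneg) auto
    ultimately show "norm ((\<integral>\<omega>. min 1 \<bar>X r \<omega>\<bar> \<partial>M) - 0) < e" by simp
  qed
qed

lemma null_in_prob_pointwise:
  assumes [measurable]: "\<And>r. X r \<in> borel_measurable M" and "\<And>\<omega>. \<omega> \<in> space M \<Longrightarrow> (\<lambda>r. X r \<omega>) \<longlonglongrightarrow> 0"
  shows "null_in_prob M X"
  unfolding null_in_prob_def
proof (intro allI impI)
  fix e :: real assume e: "e > 0"
  have "(\<lambda>r. \<integral>\<omega>. indicator {\<omega>\<in>space M. \<bar>X r \<omega>\<bar> > e} \<omega> \<partial>M) \<longlonglongrightarrow> (\<integral>\<omega>. 0 \<partial>M :: real)"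
  proof (rule integral_dominated_convergence[where w="\<lambda>_. 1"])
    show "AE \<omega> in M. (\<lambda>r. indicat_real {\<omega>\<in>space M. \<bar>X r \<omega>\<bar> > e} \<omega>) \<longlonglongrightarrow> 0"
    proof (rule AE_I2)
      fix \<omega> assume w: "\<omega> \<in> space M"
      have "\<forall>\<^sub>F r in sequentially. \<bar>X r \<omega>\<bar> < e"
        using assms(2)[OF w] e by (auto simp: tendsto_iff dist_real_def)
      then have "\<forall>\<^sub>F r in sequentially. indicat_real {\<omega>\<in>space M. \<bar>X r \<omega>\<bar> > e} \<omega> = 0"
        by eventually_elim auto
      then show "(\<lambda>r. indicat_real {\<omega>\<in>space M. \<bar>X r \<omega>\<bar> > e} \<omega>) \<longlonglongrightarrow> 0" by (rule tendsto_eventually)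
    qed
  qed (auto simp: indicator_def)
  then show "(\<lambda>r. prob {\<omega>\<in>space M. \<bar>X r \<omega>\<bar> > e}) \<longlonglongrightarrow> 0" by simp
qed

text \<open>Fatou's lemma along an almost surely convergent subsequence. It carries second-moment
  bounds from Riemann sums to a limit that is known in probability only.\<close>

lemma nn_integral_square_Fatou_in_prob:
  assumes [measurable]: "\<And>r. X r \<in> borel_measurable M" "Y \<in> borel_measurable M" "A \<in> sets M"
    and X: "null_in_prob M (\<lambda>r \<omega>. Y \<omega> - X r \<omega>)"
    and bd: "\<And>r. (\<integral>\<^sup>+\<omega>. indicator A \<omega> * ennreal ((X r \<omega>)\<^sup>2) \<partial>M) \<le> B"
  shows "(\<integral>\<^sup>+\<omega>. indicator A \<omega> * ennreal ((Y \<omega>)\<^sup>2) \<partial>M) \<le> B"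
proof -
  have "(\<lambda>r. \<integral>\<omega>. norm (min 1 \<bar>Y \<omega> - X r \<omega>\<bar>) \<partial>M) \<longlonglongrightarrow> 0"
    using null_in_prob_L1[OF _ X] by simp
  moreover have "integrable M (\<lambda>\<omega>. min 1 \<bar>Y \<omega> - X r \<omega>\<bar>)" for r
    by (rule integrable_const_bound[of _ 1]) auto
  ultimately obtain r where r: "strict_mono r" "AE \<omega> in M. (\<lambda>n. min 1 \<bar>Y \<omega> - X (r n) \<omega>\<bar>) \<longlonglongrightarrow> 0"
    using tendsto_L1_AE_subseq[of M "\<lambda>r \<omega>. min 1 \<bar>Y \<omega> - X r \<omega>\<bar>"] by auto
  have "AE \<omega> in M. (\<lambda>n. X (r n) \<omega>) \<longlonglongrightarrow> Y \<omega>"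
    using r(2)
  proof eventually_elim
    case (elim \<omega>)
    have "\<forall>\<^sub>F n in sequentially. min 1 \<bar>Y \<omega> - X (r n) \<omega>\<bar> < 1"
      using elim by (rule order_tendstoD) simp
    then have "\<forall>\<^sub>F n in sequentially. min 1 \<bar>Y \<omega> - X (r n) \<omega>\<bar> = \<bar>Y \<omega> - X (r n) \<omega>\<bar>"
      by eventually_elim auto
    then have "(\<lambda>n. \<bar>Y \<omega> - X (r n) \<omega>\<bar>) \<longlonglongrightarrow> 0" using elim by (simp add: tendsto_cong)
    then have "(\<lambda>n. Y \<omega> - X (r n) \<omega>) \<longlonglongrightarrow> 0" by (simp only: tendsto_rabs_zero_iff)
    from tendsto_diff[OF tendsto_const[of "Y \<omega>"] this] show ?case by simp
  qed
  then have "AE \<omega> in M. indicator A \<omega> * ennreal ((Y \<omega>)\<^sup>2) \<le> liminf (\<lambda>n. indicator A \<omega> * ennreal ((X (r n) \<omega>)\<^sup>2))"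
  proof eventually_elim
    case (elim \<omega>)
    have "(\<lambda>n. indicator A \<omega> * ennreal ((X (r n) \<omega>)\<^sup>2)) \<longlonglongrightarrow> indicator A \<omega> * ennreal ((Y \<omega>)\<^sup>2)"
      by (intro ennreal_tendsto_cmult tendsto_ennrealI tendsto_power elim) (simp split: split_indicator)
    then show ?case by (simp add: lim_imp_Liminf)
  qed
  then have "(\<integral>\<^sup>+\<omega>. indicator A \<omega> * ennreal ((Y \<omega>)\<^sup>2) \<partial>M) \<le> (\<integral>\<^sup>+\<omega>. liminf (\<lambda>n. indicator A \<omega> * ennreal ((X (r n) \<omega>)\<^sup>2)) \<partial>M)"
    by (rule nn_integral_mono_AE)
  also have "\<dots> \<le> liminf (\<lambda>n. \<integral>\<^sup>+\<omega>. indicator A \<omega> * ennreal ((X (r n) \<omega>)\<^sup>2) \<partial>M)"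
    by (rule nn_integral_liminf) measurable
  also have "\<dots> \<le> B"
    by (rule Liminf_le) (use bd in auto)
  finally show ?thesis .
qed

end

section \<open>Lipschitz coefficients\<close>

lemma vnorm_L2_set: "vnorm D x = L2_set x {..<D}"
  by (simp add: vnorm_def L2_set_def)

lemma vnorm_nonneg [simp]: "vnorm D x \<ge> 0"
  by (simp add: vnorm_L2_set)

lemma vnorm_square: "(vnorm D x)\<^sup>2 = (\<Sum>i<D. (x i)\<^sup>2)"
  by (simp add: vnorm_def sum_nonneg)

lemma vnorm_triangle: "vnorm D (\<lambda>i. x i + y i) \<le> vnorm D x + vnorm D y"
  unfolding vnorm_L2_set by (rule L2_set_triangle_ineq)

lemma vnorm_triangle_diff: "vnorm D x \<le> vnorm D y + vnorm D (x - y)"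
  using vnorm_triangle[of D y "x - y"] by simp

lemma vnorm_component: "i < D \<Longrightarrow> \<bar>x i\<bar> \<le> vnorm D x"
  unfolding vnorm_L2_set using member_le_L2_set[of "{..<D}" i "\<lambda>i. \<bar>x i\<bar>"] by (simp add: L2_set_def)

lemma coord_measurable [measurable]: "(\<lambda>x::vec. x i) \<in> borel_measurable borel"
  by (intro borel_measurable_continuous_onI) simp

lemma vnorm_measurable [measurable]: "vnorm D \<in> borel_measurable borel"
  unfolding vnorm_def by measurable

lemma continuous_vnorm: "continuous_on UNIV (vnorm D)"
  unfolding vnorm_def by (intro continuous_intros) simp

lemma vec_measurableI: "(\<And>i. (\<lambda>\<omega>. X \<omega> i) \<in> borel_measurable N) \<Longrightarrow> (X :: 'a \<Rightarrow> vec) \<in> measurable N borel"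
  by (rule measurable_coordinatewise_then_product)

text \<open>Coefficients are controlled on \<open>vspace D\<close> only. Composed with this
  projection they become Borel functions of an arbitrary sequence, with unchanged values on
  \<open>vspace D\<close>.\<close>

definition vproj :: "nat \<Rightarrow> vec \<Rightarrow> vec" where
  "vproj D x = (\<lambda>i. if i < D then x i else 0)"

lemma vproj_vspace [simp]: "vproj D x \<in> vspace D"
  by (simp add: vproj_def vspace_def)

lemma vproj_id: "x \<in> vspace D \<Longrightarrow> vproj D x = x"
  by (auto simp: vproj_def vspace_def)

text \<open>One scalar entry of drift or diffusion. Of the Hoelder condition, continuity in time at
  fixed \<open>x\<close> is kept: the Hoelder constant may depend on \<open>x\<close>, and the
  convergence proof asks for no rate.\<close>

definition lip_coeff :: "real \<Rightarrow> nat \<Rightarrow> real \<Rightarrow> (real \<Rightarrow> vec \<Rightarrow> real) \<Rightarrow> bool" where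
  "lip_coeff T D L c \<longleftrightarrow> (\<forall>t\<in>{0..T}. \<forall>x\<in>vspace D. \<forall>y\<in>vspace D. \<bar>c t x - c t y\<bar> \<le> L * vnorm D (x - y))
     \<and> (\<forall>x\<in>vspace D. continuous_on {0..T} (\<lambda>t. c t x))"

lemma holder_half_continuous:
  assumes "\<And>s t. s \<in> {0..T} \<Longrightarrow> t \<in> {0..T} \<Longrightarrow> \<bar>f t - f s\<bar> \<le> C * \<bar>t - s\<bar> powr (1/2)"
  shows "continuous_on {0..T} (f :: real \<Rightarrow> real)"
  unfolding continuous_on_def
proof
  fix s assume s: "s \<in> {0..T}"
  have "((\<lambda>t. f t - f s) \<longlongrightarrow> 0) (at s within {0..T})"
  proof (rule Lim_null_comparison)
    show "\<forall>\<^sub>F t in at s within {0..T}. norm (f t - f s) \<le> C * sqrt \<bar>t - s\<bar>"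
      using assms[OF s] by (auto simp: eventually_at_filter powr_half_sqrt intro!: always_eventually)
    have "((\<lambda>t. C * sqrt \<bar>t - s\<bar>) \<longlongrightarrow> C * sqrt \<bar>s - s\<bar>) (at s within {0..T})"
      by (intro tendsto_intros)
    then show "((\<lambda>t. C * sqrt \<bar>t - s\<bar>) \<longlongrightarrow> 0) (at s within {0..T})" by simp
  qed
  then show "(f \<longlongrightarrow> f s) (at s within {0..T})" by (simp add: LIM_zero_iff)
qed

lemma sde_coeffs_lip:
  assumes "sde_coeffs D T a b"
  obtains L where "L \<ge> 0" "\<And>i. lip_coeff T D L (\<lambda>t x. a t x i)" "\<And>i j. lip_coeff T D L (\<lambda>t x. b t x i j)"
proof -
  have av: "a t x i = 0" if "i \<ge> D" for t x i using assms that by (auto simp: sde_coeffs_def vspace_def)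
  have bv: "b t x i j = 0" if "i \<ge> D \<or> j \<ge> D" for t x i j using assms that by (auto simp: sde_coeffs_def)
  obtain L0 where L0: "\<And>t x y. t\<in>{0..T} \<Longrightarrow> x\<in>vspace D \<Longrightarrow> y\<in>vspace D \<Longrightarrow>
         vnorm D (a t x - a t y) \<le> L0 * vnorm D (x - y)"
       "\<And>t x y. t\<in>{0..T} \<Longrightarrow> x\<in>vspace D \<Longrightarrow> y\<in>vspace D \<Longrightarrow> sqrt (\<Sum>i<D. \<Sum>j<D. (b t x i j - b t y i j)^2) \<le> L0 * vnorm D (x - y)"
    using assms[unfolded sde_coeffs_def, THEN conjunct2, THEN conjunct2, THEN conjunct1] by blast
  have ac: "\<bar>u i\<bar> \<le> vnorm D u" if "\<And>i. i \<ge> D \<Longrightarrow> u i = 0" for u i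
    using that vnorm_component[of i D u] by (cases "i < D") auto
  have bc: "\<bar>u i j\<bar> \<le> sqrt (\<Sum>i<D. \<Sum>j<D. (u i j)\<^sup>2)" if "\<And>i j. i \<ge> D \<or> j \<ge> D \<Longrightarrow> u i j = 0" for u :: "nat \<Rightarrow> nat \<Rightarrow> real" and i j
  proof (cases "i < D \<and> j < D")
    case True
    have "(u i j)\<^sup>2 \<le> (\<Sum>j<D. (u i j)\<^sup>2)" using True by (intro member_le_sum) auto
    also have "\<dots> \<le> (\<Sum>i<D. \<Sum>j<D. (u i j)\<^sup>2)"
      using True by (intro member_le_sum[of i "{..<D}" "\<lambda>i. \<Sum>j<D. (u i j)\<^sup>2"]) (auto intro: sum_nonneg)
    finally have "sqrt ((u i j)\<^sup>2) \<le> sqrt (\<Sum>i<D. \<Sum>j<D. (u i j)\<^sup>2)" by (rule real_sqrt_le_mono)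
    then show ?thesis by simp
  next
    case False
    then show ?thesis using that by (auto simp: not_less intro!: sum_nonneg)
  qed
  show ?thesis
  proof
    show "max 0 L0 \<ge> 0" by simp
    have le: "L0 * vnorm D z \<le> max 0 L0 * vnorm D z" for z by (intro mult_right_mono) auto
    fix i
    show "lip_coeff T D (max 0 L0) (\<lambda>t x. a t x i)"
      unfolding lip_coeff_def
    proof (intro conjI ballI)
      fix t x y assume *: "t \<in> {0..T}" "x \<in> vspace D" "y \<in> vspace D"
      show "\<bar>a t x i - a t y i\<bar> \<le> max 0 L0 * vnorm D (x - y)"
        using ac[of "a t x - a t y" i] av L0(1)[OF *] le[of "x - y"] by simp
    next
      fix x assume "x \<in> vspace D"
      then obtain C where C: "\<And>s t. s \<in> {0..T} \<Longrightarrow> t \<in> {0..T} \<Longrightarrow> vnorm D (a t x - a s x) \<le> C * \<bar>t - s\<bar> powr (1/2)"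
        using assms[unfolded sde_coeffs_def, THEN conjunct2, THEN conjunct2, THEN conjunct2] by blast
      show "continuous_on {0..T} (\<lambda>t. a t x i)"
      proof (rule holder_half_continuous)
        fix s t assume "s \<in> {0..T}" "t \<in> {0..T}"
        then show "\<bar>a t x i - a s x i\<bar> \<le> C * \<bar>t - s\<bar> powr (1/2)"
          using ac[of "a t x - a s x" i] av C[of s t] by simp
      qed
    qed
    fix j
    show "lip_coeff T D (max 0 L0) (\<lambda>t x. b t x i j)"
      unfolding lip_coeff_def
    proof (intro conjI ballI)
      fix t x y assume *: "t \<in> {0..T}" "x \<in> vspace D" "y \<in> vspace D"
      show "\<bar>b t x i j - b t y i j\<bar> \<le> max 0 L0 * vnorm D (x - y)"
        using bc[of "\<lambda>i j. b t x i j - b t y i j" i j] bv L0(2)[OF *] le[of "x - y"] by simp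
    next
      fix x assume "x \<in> vspace D"
      then obtain C where C: "\<And>s t. s \<in> {0..T} \<Longrightarrow> t \<in> {0..T} \<Longrightarrow> sqrt (\<Sum>i<D. \<Sum>j<D. (b t x i j - b s x i j)^2) \<le> C * \<bar>t - s\<bar> powr (1/2)"
        using assms[unfolded sde_coeffs_def, THEN conjunct2, THEN conjunct2, THEN conjunct2] by blast
      show "continuous_on {0..T} (\<lambda>t. b t x i j)"
      proof (rule holder_half_continuous)
        fix s t assume "s \<in> {0..T}" "t \<in> {0..T}"
        then show "\<bar>b t x i j - b s x i j\<bar> \<le> C * \<bar>t - s\<bar> powr (1/2)"
          using bc[of "\<lambda>i j. b t x i j - b s x i j" i j] bv C[of s t] by simp
      qed
    qed
  qed
qed

text \<open>The change of the coefficient along the path is split into a change of the space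
  argument, handled by the Lipschitz bound at time \<open>v\<close>, and a change of time at the
  fixed point \<open>y u\<close>.\<close>

lemma lip_coeff_path_continuous:
  assumes c: "lip_coeff T D L c" and s: "0 \<le> s"
    and y: "continuous_on {s..T} y" "\<And>u. u \<in> {s..T} \<Longrightarrow> y u \<in> vspace D"
  shows "continuous_on {s..T} (\<lambda>u. c u (y u))"
  unfolding continuous_on_def
proof
  fix u assume u: "u \<in> {s..T}"
  let ?F = "at u within {s..T}"
  have "((\<lambda>v. c v (y v) - c u (y u)) \<longlongrightarrow> 0) ?F"
  proof (rule Lim_null_comparison)
    show "\<forall>\<^sub>F v in ?F. norm (c v (y v) - c u (y u)) \<le> L * vnorm D (y v - y u) + \<bar>c v (y u) - c u (y u)\<bar>"
    proof (rule eventually_at_filter[THEN iffD2, OF always_eventually], intro allI impI)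
      fix v assume v: "v \<in> {s..T}"
      have "\<bar>c v (y v) - c v (y u)\<bar> \<le> L * vnorm D (y v - y u)"
        using c v u s y unfolding lip_coeff_def by auto
      then show "norm (c v (y v) - c u (y u)) \<le> L * vnorm D (y v - y u) + \<bar>c v (y u) - c u (y u)\<bar>" by simp
    qed
    have yi: "((\<lambda>v. y v i) \<longlongrightarrow> y u i) ?F" for i
      using continuous_on_product_then_coordinatewise[OF y(1), of i] u unfolding continuous_on_def by auto
    have "((\<lambda>v. vnorm D (y v - y u)) \<longlongrightarrow> sqrt (\<Sum>i<D. (y u i - y u i)\<^sup>2)) ?F"
      unfolding vnorm_def fun_diff_def by (intro tendsto_intros yi)
    moreover have "((\<lambda>v. c v (y u)) \<longlongrightarrow> c u (y u)) ?F"
      using c u s y(2)[OF u] unfolding lip_coeff_def continuous_on_def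
      by (meson atLeastAtMost_iff atLeastatMost_subset_iff order_refl order_trans tendsto_within_subset)
    ultimately have "((\<lambda>v. L * vnorm D (y v - y u) + \<bar>c v (y u) - c u (y u)\<bar>) \<longlongrightarrow> L * sqrt (\<Sum>i<D. (y u i - y u i)\<^sup>2) + \<bar>c u (y u) - c u (y u)\<bar>) ?F"
      by (intro tendsto_intros)
    then show "((\<lambda>v. L * vnorm D (y v - y u) + \<bar>c v (y u) - c u (y u)\<bar>) \<longlongrightarrow> 0) ?F" by simp
  qed
  then show "((\<lambda>v. c v (y v)) \<longlongrightarrow> c u (y u)) ?F" by (simp add: LIM_zero_iff)
qed

lemma lip_coeff_bounded:
  assumes c: "lip_coeff T D L c" and L: "L \<ge> 0"
  obtains B where "B \<ge> 0" "\<And>t x. t \<in> {0..T} \<Longrightarrow> x \<in> vspace D \<Longrightarrow> vnorm D x \<le> R \<Longrightarrow> \<bar>c t x\<bar> \<le> B"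
proof -
  have z: "(\<lambda>_. 0) \<in> vspace D" by (simp add: vspace_def)
  have "compact ((\<lambda>t. c t (\<lambda>_. 0)) ` {0..T})"
    using c z by (intro compact_continuous_image) (auto simp: lip_coeff_def)
  then obtain B0 where B0: "\<And>t. t \<in> {0..T} \<Longrightarrow> \<bar>c t (\<lambda>_. 0)\<bar> \<le> B0"
    using compact_imp_bounded bounded_iff by (metis imageI real_norm_def)
  show ?thesis
  proof (rule that[of "max 0 (B0 + L * R)"])
    fix t x assume *: "t \<in> {0..T}" "x \<in> vspace D" "vnorm D x \<le> R"
    have "\<bar>c t x - c t (\<lambda>_. 0)\<bar> \<le> L * vnorm D (x - (\<lambda>_. 0))" using c * z unfolding lip_coeff_def by blast
    also have "x - (\<lambda>_. 0) = x" by auto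
    also have "L * vnorm D x \<le> L * R" using * L by (intro mult_left_mono)
    finally show "\<bar>c t x\<bar> \<le> max 0 (B0 + L * R)" using B0[OF *(1)] by linarith
  qed simp
qed

lemma lip_coeff_measurable:
  assumes c: "lip_coeff T D L c" and t: "t \<in> {0..T}"
  shows "(\<lambda>x. c t (vproj D x)) \<in> borel_measurable borel"
proof (rule borel_measurable_continuous_onI)
  show "continuous_on UNIV (\<lambda>x. c t (vproj D x))"
    unfolding continuous_on_def
  proof
    fix x :: vec
    have xi: "((\<lambda>y. y i) \<longlongrightarrow> x i) (at x)" for i
      using continuous_on_product_coordinates[of i] unfolding continuous_on_def by auto
    have "((\<lambda>y. c t (vproj D y) - c t (vproj D x)) \<longlongrightarrow> 0) (at x)"
    proof (rule Lim_null_comparison)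
      show "\<forall>\<^sub>F y in at x. norm (c t (vproj D y) - c t (vproj D x)) \<le> L * sqrt (\<Sum>i<D. (y i - x i)\<^sup>2)"
      proof (rule always_eventually, intro allI)
        fix y
        have "\<bar>c t (vproj D y) - c t (vproj D x)\<bar> \<le> L * vnorm D (vproj D y - vproj D x)"
          using c t unfolding lip_coeff_def by simp
        then show "norm (c t (vproj D y) - c t (vproj D x)) \<le> L * sqrt (\<Sum>i<D. (y i - x i)\<^sup>2)"
          by (simp add: vnorm_def vproj_def)
      qed
      have "((\<lambda>y. L * sqrt (\<Sum>i<D. (y i - x i)\<^sup>2)) \<longlongrightarrow> L * sqrt (\<Sum>i<D. (x i - x i)\<^sup>2)) (at x)"
        by (intro tendsto_intros xi)
      then show "((\<lambda>y. L * sqrt (\<Sum>i<D. (y i - x i)\<^sup>2)) \<longlongrightarrow> 0) (at x)" by simp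
    qed
    then show "((\<lambda>y. c t (vproj D y)) \<longlongrightarrow> c t (vproj D x)) (at x within UNIV)" by (simp add: LIM_zero_iff)
  qed
qed

section \<open>Riemann sums of continuous functions\<close>

lemma riemann_sum_error:
  fixes f :: "real \<Rightarrow> real"
  assumes "h \<ge> 0" and cont: "continuous_on {s..s + real n * h} f"
    and osc: "\<And>u v. s \<le> u \<Longrightarrow> u \<le> v \<Longrightarrow> v \<le> s + real n * h \<Longrightarrow> v - u \<le> h \<Longrightarrow> \<bar>f v - f u\<bar> \<le> e"
  shows "\<bar>integral {s..s + real n * h} f - (\<Sum>l<n. f (s + real l * h) * h)\<bar> \<le> real n * h * e"
  using cont osc
proof (induction n)
  case (Suc n)
  let ?u = "s + real n * h" and ?v = "s + real (Suc n) * h"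
  have uv: "s \<le> ?u" "?u \<le> ?v" "?v - ?u = h" using assms(1) by (auto simp: algebra_simps)
  have int: "f integrable_on {s..?v}" by (rule integrable_continuous_real[OF Suc.prems(1)])
  have intu: "f integrable_on {?u..?v}" by (rule integrable_on_subinterval[OF int]) (use uv in auto)
  have IH: "\<bar>integral {s..?u} f - (\<Sum>l<n. f (s + real l * h) * h)\<bar> \<le> real n * h * e"
    using uv Suc.prems by (intro Suc.IH) (auto intro: continuous_on_subset)
  have c: "integral {?u..?v} (\<lambda>x. f x - f ?u) = integral {?u..?v} f - f ?u * h"
    using intu uv by (subst Henstock_Kurzweil_Integration.integral_diff) auto
  have "norm (integral {?u..?v} (\<lambda>x. f x - f ?u)) \<le> e * (?v - ?u)"
  proof (rule integral_bound[OF uv(2)])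
    show "continuous_on {?u..?v} (\<lambda>x. f x - f ?u)"
      by (intro continuous_intros continuous_on_subset[OF Suc.prems(1)]) (use uv in auto)
    fix t assume "t \<in> {?u..?v}"
    then show "norm (f t - f ?u) \<le> e" using Suc.prems(2)[of ?u t] uv by simp
  qed
  then have "\<bar>integral {?u..?v} f - f ?u * h\<bar> \<le> e * h" using c uv by simp
  moreover have "integral {s..?v} f = integral {s..?u} f + integral {?u..?v} f"
    using Henstock_Kurzweil_Integration.integral_combine[OF uv(1,2) int] by simp
  ultimately show ?case using IH by (simp add: algebra_simps)
qed simp

lemma riemann_sum_tendsto:
  fixes f :: "real \<Rightarrow> real"
  assumes st: "s \<le> t" and cont: "continuous_on {s..t} f"
    and n: "filterlim n at_top sequentially" "\<And>r. n r > 0"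
  shows "(\<lambda>r. (\<Sum>l<n r. f (s + real l * ((t - s) / real (n r))) * ((t - s) / real (n r)))) \<longlonglongrightarrow> integral {s..t} f"
proof (rule LIMSEQ_I)
  fix e :: real assume e: "e > 0"
  define e' where "e' = e / (t - s + 1)"
  have e': "e' > 0" "(t - s) * e' < e" using e st by (auto simp: e'_def field_simps)
  have "uniformly_continuous_on {s..t} f" using cont by (intro compact_uniformly_continuous) auto
  then obtain d where d: "d > 0" "\<And>x x'. x \<in> {s..t} \<Longrightarrow> x' \<in> {s..t} \<Longrightarrow> dist x' x < d \<Longrightarrow> dist (f x') (f x) < e'"
    using e' unfolding uniformly_continuous_on_def by meson
  obtain r0 where r0: "\<And>r. r \<ge> r0 \<Longrightarrow> real (n r) > (t - s) / d"
  proof -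
    obtain m where m: "real m > (t - s) / d" using reals_Archimedean2 by blast
    have "\<forall>\<^sub>F r in sequentially. n r \<ge> m" using n(1) by (simp add: filterlim_at_top)
    then obtain r0 where "\<And>r. r \<ge> r0 \<Longrightarrow> n r \<ge> m" by (auto simp: eventually_sequentially)
    then show ?thesis using m that[of r0] by (meson of_nat_le_iff order_less_le_trans)
  qed
  show "\<exists>r0. \<forall>r\<ge>r0. norm ((\<Sum>l<n r. f (s + real l * ((t - s) / real (n r))) * ((t - s) / real (n r))) - integral {s..t} f) < e"
  proof (intro exI[of _ r0] allI impI)
    fix r assume "r0 \<le> r"
    let ?h = "(t - s) / real (n r)"
    have nr: "real (n r) > 0" using n(2) by simp
    have hd: "?h < d" using r0[OF \<open>r0 \<le> r\<close>] d(1) nr by (simp add: field_simps)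
    have t: "s + real (n r) * ?h = t" using nr by simp
    have "\<bar>integral {s..s + real (n r) * ?h} f - (\<Sum>l<n r. f (s + real l * ?h) * ?h)\<bar> \<le> real (n r) * ?h * e'"
    proof (rule riemann_sum_error)
      show "0 \<le> ?h" using st nr by simp
      show "continuous_on {s..s + real (n r) * ?h} f" using cont t by simp
      fix u v assume uv: "s \<le> u" "u \<le> v" "v \<le> s + real (n r) * ?h" "v - u \<le> ?h"
      then have "dist v u < d" using hd by (simp add: dist_real_def)
      then have "dist (f v) (f u) < e'" using uv t by (intro d) auto
      then show "\<bar>f v - f u\<bar> \<le> e'" by (simp add: dist_real_def)
    qed
    also have "real (n r) * ?h * e' = (t - s) * e'" using nr by simp
    finally show "norm ((\<Sum>l<n r. f (s + real l * ?h) * ?h) - integral {s..t} f) < e"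
      using e' t by (simp add: abs_minus_commute)
  qed
qed

section \<open>Convergence of Euler's scheme\<close>

lemma sum_lessThan_blocks:
  fixes f :: "nat \<Rightarrow> 'a::comm_monoid_add"
  shows "(\<Sum>k<l * m. f k) = (\<Sum>i<l. \<Sum>k<m. f (i * m + k))"
proof (induction l)
  case (Suc l)
  have "(\<Sum>k<Suc l * m. f k) = (\<Sum>k<l * m + m. f k)" by (simp add: add.commute)
  also have "\<dots> = (\<Sum>k<l * m. f k) + (\<Sum>k<m. f (l * m + k))"
  proof -
    have "(\<Sum>k<n + m. f k) = (\<Sum>k<n. f k) + (\<Sum>k<m. f (n + k))" for n
      by (induction m) (simp_all add: add.assoc)
    then show ?thesis .
  qed
  finally show ?case using Suc.IH by simp
qed simp

text \<open>Bounding \<open>\<rho> + \<Lambda> * e l\<close> instead of \<open>e l\<close> makes the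
  recursion close exactly through the geometric sum. In extended nonnegative reals nothing has to be
  known finite beforehand.\<close>

lemma discrete_gronwall:
  fixes e :: "nat \<Rightarrow> ennreal"
  assumes "\<And>l. l \<le> n \<Longrightarrow> e l \<le> C * h * (\<Sum>k<l. \<rho> + \<Lambda> * e k)" "l \<le> n"
  shows "\<rho> + \<Lambda> * e l \<le> \<rho> * (1 + \<Lambda> * C * h) ^ l"
  using assms(2)
proof (induction l rule: less_induct)
  case (less l)
  have geo: "1 + x * (\<Sum>k<l. (1 + x) ^ k) = (1 + x) ^ l" for x :: ennreal
  proof (induction l)
    case (Suc l)
    have "1 + x * (\<Sum>k<Suc l. (1 + x) ^ k) = (1 + x * (\<Sum>k<l. (1 + x) ^ k)) + x * (1 + x) ^ l"
      by (simp only: sum.lessThan_Suc distrib_left add.assoc)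
    also have "\<dots> = (1 + x) ^ Suc l" by (simp add: Suc.IH distrib_right)
    finally show ?case .
  qed simp
  have "\<rho> + \<Lambda> * e l \<le> \<rho> + \<Lambda> * (C * h * (\<Sum>k<l. \<rho> + \<Lambda> * e k))"
    using less.prems by (intro add_left_mono mult_left_mono assms) auto
  also have "\<dots> \<le> \<rho> + \<Lambda> * (C * h * (\<Sum>k<l. \<rho> * (1 + \<Lambda> * C * h) ^ k))"
    using less.prems by (intro add_left_mono mult_left_mono sum_mono less.IH) auto
  also have "\<dots> = \<rho> * (1 + (\<Lambda> * C * h) * (\<Sum>k<l. (1 + \<Lambda> * C * h) ^ k))"
    by (simp add: distrib_left mult_ac flip: sum_distrib_left)
  also have "\<dots> = \<rho> * (1 + \<Lambda> * C * h) ^ l" by (simp only: geo)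
  finally show ?case .
qed

locale sde = brownian M D T W for M :: "'w measure" and D T W +
  fixes a :: "real \<Rightarrow> vec \<Rightarrow> vec" and b :: "real \<Rightarrow> vec \<Rightarrow> nat \<Rightarrow> nat \<Rightarrow> real" and L :: real
  assumes L: "L \<ge> 0"
    and a_lip: "\<And>i. lip_coeff T D L (\<lambda>t x. a t x i)"
    and b_lip: "\<And>i j. lip_coeff T D L (\<lambda>t x. b t x i j)"
    and a_vspace: "\<And>t x. a t x \<in> vspace D"
    and b_vspace: "\<And>t x i j. i \<ge> D \<Longrightarrow> b t x i j = 0"
begin

text \<open>The sample \<open>\<omega>\<close> enters through increments of \<open>W\<close> alone
  and \<open>x\<close> is a free argument, so starting point and noise can be taken from different
  samples. The projection is the identity along a scheme started in \<open>vspace D\<close> and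
  serves measurability elsewhere.\<close>

primrec eul :: "real \<Rightarrow> real \<Rightarrow> nat \<Rightarrow> vec \<Rightarrow> 'w \<Rightarrow> vec" where
  "eul s h 0 x \<omega> = x"
| "eul s h (Suc l) x \<omega> = (\<lambda>i. eul s h l x \<omega> i + a (s + real l * h) (vproj D (eul s h l x \<omega>)) i * h
     + (\<Sum>j<D. b (s + real l * h) (vproj D (eul s h l x \<omega>)) i j * \<Delta> (s + real l * h) (s + real (Suc l) * h) j \<omega>))"

lemma eul_vspace: "x \<in> vspace D \<Longrightarrow> eul s h l x \<omega> \<in> vspace D"
proof (induction l)
  case (Suc l)
  then show ?case using a_vspace b_vspace by (auto simp: vspace_def)
qed simp

text \<open>Starting point \<open>\<xi>\<close> and noise \<open>p\<close> are kept apart over an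
  arbitrary space \<open>N\<close>, which covers the adapted scheme, the scheme from a fixed point,
  and the scheme on a product with separate samples for past and future.\<close>

lemma eul_measurable:
  assumes s: "0 \<le> s" "0 \<le> h" "s + real l * h \<le> T"
    and \<xi>: "\<xi> \<in> measurable N borel"
    and p: "\<And>k j. k < l \<Longrightarrow> j < D \<Longrightarrow> (\<lambda>z. \<Delta> (s + real k * h) (s + real (Suc k) * h) j (p z)) \<in> borel_measurable N"
  shows "(\<lambda>z. eul s h l (\<xi> z) (p z)) \<in> measurable N borel"
  using assms(3) p
proof (induction l)
  case 0
  then show ?case using \<xi> by simp
next
  case (Suc l)
  have le: "s + real l * h \<le> T" using Suc.prems(1) s(2) by (simp add: algebra_simps)
  then have IH [measurable]: "(\<lambda>z. eul s h l (\<xi> z) (p z)) \<in> measurable N borel"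
    using Suc by auto
  have t: "s + real l * h \<in> {0..T}" using s le by simp
  have am: "(\<lambda>z. a (s + real l * h) (vproj D (eul s h l (\<xi> z) (p z))) i) \<in> borel_measurable N" for i
    by (rule measurable_compose[OF IH lip_coeff_measurable[OF a_lip t]])
  have bm: "(\<lambda>z. b (s + real l * h) (vproj D (eul s h l (\<xi> z) (p z))) i j) \<in> borel_measurable N" for i j
    by (rule measurable_compose[OF IH lip_coeff_measurable[OF b_lip t]])
  show ?case
    unfolding eul.simps
  proof (intro vec_measurableI borel_measurable_add borel_measurable_sum borel_measurable_times am bm)
    show "(\<lambda>z. eul s h l (\<xi> z) (p z) i) \<in> borel_measurable N" for i by measurable
  qed (use Suc.prems(2) in auto)
qed

text \<open>The coefficients of the coarse scheme are constant on blocks of \<open>m\<close> fine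
  steps, and the increments telescope inside a block. On the fine grid the scheme can be subtracted
  termwise from a Riemann sum of the solution.\<close>

lemma eul_refined:
  assumes x: "x \<in> vspace D" and m: "m > 0"
  shows "eul s h l x \<omega> i = x i + (\<Sum>k<l * m.
      a (s + real (k div m) * h) (eul s h (k div m) x \<omega>) i * (h / real m)
    + (\<Sum>j<D. b (s + real (k div m) * h) (eul s h (k div m) x \<omega>) i j
        * \<Delta> (s + real k * (h / real m)) (s + real (Suc k) * (h / real m)) j \<omega>))"
proof (induction l arbitrary: i)
  case (Suc l)
  let ?E = "eul s h l x \<omega>" and ?u = "s + real l * h"
  have E: "vproj D ?E = ?E" using eul_vspace[OF x] by (rule vproj_id)
  have dv: "(l * m + k) div m = l" if "k < m" for k using that m by simp
  have pt: "s + real (l * m + k) * (h / real m) = ?u + real k * (h / real m)" for k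
    using m by (simp add: field_simps)
  have tel: "(\<Sum>k<m. \<Delta> (?u + real k * (h / real m)) (?u + real (Suc k) * (h / real m)) j \<omega>) = \<Delta> ?u (s + real (Suc l) * h) j \<omega>" for j
  proof -
    have "(\<Sum>k<m. \<Delta> (?u + real k * (h / real m)) (?u + real (Suc k) * (h / real m)) j \<omega>)
      = W (?u + real m * (h / real m)) \<omega> j - W (?u + real 0 * (h / real m)) \<omega> j"
      by (rule sum_lessThan_telescope)
    then show ?thesis using m by (simp add: algebra_simps)
  qed
  have "(\<Sum>k<m. a (s + real ((l * m + k) div m) * h) (eul s h ((l * m + k) div m) x \<omega>) i * (h / real m)
    + (\<Sum>j<D. b (s + real ((l * m + k) div m) * h) (eul s h ((l * m + k) div m) x \<omega>) i j
        * \<Delta> (s + real (l * m + k) * (h / real m)) (s + real (Suc (l * m + k)) * (h / real m)) j \<omega>))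
    = (\<Sum>k<m. a ?u ?E i * (h / real m) + (\<Sum>j<D. b ?u ?E i j * \<Delta> (?u + real k * (h / real m)) (?u + real (Suc k) * (h / real m)) j \<omega>))"
    using pt[of "Suc _"] by (intro sum.cong refl) (simp only: lessThan_iff dv pt flip: add_Suc_right)
  also have "\<dots> = a ?u ?E i * h + (\<Sum>j<D. b ?u ?E i j * \<Delta> ?u (s + real (Suc l) * h) j \<omega>)"
  proof -
    have "(\<Sum>k<m. \<Sum>j<D. b ?u ?E i j * \<Delta> (?u + real k * (h / real m)) (?u + real (Suc k) * (h / real m)) j \<omega>)
      = (\<Sum>j<D. b ?u ?E i j * (\<Sum>k<m. \<Delta> (?u + real k * (h / real m)) (?u + real (Suc k) * (h / real m)) j \<omega>))"
      by (subst sum.swap) (simp only: sum_distrib_left)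
    then show ?thesis unfolding tel sum.distrib using m by simp
  qed
  finally show ?case
    unfolding sum_lessThan_blocks[of _ "Suc l"] eul.simps E Suc.IH[unfolded sum_lessThan_blocks] by simp
qed simp

text \<open>The form in which the equation is used: on the grid of mesh \<open>\<eta> / q\<close>
  the increment of \<open>Y\<close> from \<open>s\<close> is a limit in probability of left Riemann
  sums over refinements of that grid by \<open>Suc r\<close>. Nested grids allow a fine sum to be
  compared with Euler's scheme on the coarse grid. The drift is a sum as well, so both parts are
  compared termwise.\<close>

definition riemann_sol :: "real \<Rightarrow> real \<Rightarrow> nat \<Rightarrow> (real \<Rightarrow> 'w \<Rightarrow> vec) \<Rightarrow> bool" where
  "riemann_sol s \<eta> d Y \<longleftrightarrow> (\<forall>q>0. \<forall>p\<le>d * q. \<forall>i<D. null_in_prob M (\<lambda>r \<omega>. Y (s + real p * (\<eta> / real q)) \<omega> i - Y s \<omega> i -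
     (\<Sum>k<p * Suc r. a (s + real k * (\<eta> / real q / real (Suc r))) (Y (s + real k * (\<eta> / real q / real (Suc r))) \<omega>) i * (\<eta> / real q / real (Suc r))
    + (\<Sum>j<D. b (s + real k * (\<eta> / real q / real (Suc r))) (Y (s + real k * (\<eta> / real q / real (Suc r))) \<omega>) i j
        * \<Delta> (s + real k * (\<eta> / real q / real (Suc r))) (s + real (Suc k) * (\<eta> / real q / real (Suc r))) j \<omega>))))"

end

section \<open>Localised error of Euler's scheme\<close>

locale sde_process = sde M D T W a b L for M :: "'w measure" and D T W a b L +
  fixes s :: real and Y :: "real \<Rightarrow> 'w \<Rightarrow> vec"
  assumes s: "0 \<le> s"
    and Y_vspace: "\<And>u \<omega>. s \<le> u \<Longrightarrow> u \<le> T \<Longrightarrow> \<omega> \<in> space M \<Longrightarrow> Y u \<omega> \<in> vspace D"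
    and Y_cont: "\<And>\<omega>. \<omega> \<in> space M \<Longrightarrow> continuous_on {s..T} (\<lambda>u. Y u \<omega>)"
    and Y_adapted: "\<And>u i. s \<le> u \<Longrightarrow> u \<le> T \<Longrightarrow> (\<lambda>\<omega>. Y u \<omega> i) \<in> borel_measurable (F u)"
begin

text \<open>Substitute for a stopping time while no moments of \<open>Y\<close> are known. The event
  belongs to \<open>F v\<close> and decreases in \<open>v\<close>, so an integrand may carry the
  indicator of its own time and stay adapted, without loss on the final event.\<close>

definition G :: "real \<Rightarrow> real \<Rightarrow> 'w set" where
  "G R v = {\<omega>\<in>space M. \<forall>u\<in>{s..v}. vnorm D (Y u \<omega>) \<le> R}"

lemma Y_meas_F: "s \<le> u \<Longrightarrow> u \<le> T \<Longrightarrow> Y u \<in> measurable (F u) borel"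
  by (intro vec_measurableI Y_adapted)

lemma Y_meas: "s \<le> u \<Longrightarrow> u \<le> T \<Longrightarrow> Y u \<in> measurable M borel"
  using F_meas[OF Y_meas_F] by simp

lemma G_sets: assumes v: "s \<le> v" "v \<le> T" shows "G R v \<in> sets (F v)"
proof -
  have cn: "continuous_on {s..v} (\<lambda>u. vnorm D (Y u \<omega>))" if "\<omega> \<in> space M" for \<omega>
    using continuous_on_compose2[OF continuous_vnorm continuous_on_subset[OF Y_cont[OF that]], of "{s..v}"] v by auto
  let ?Q = "\<rat> \<inter> {0..1::real}"
  have in_seg: "s \<le> s + q * (v - s)" "s + q * (v - s) \<le> v" if "q \<in> {0..1}" for q
    using that v mult_right_mono[of q 1 "v - s"] by auto
  \<comment> \<open>Rational proportions of \<open>[s, v]\<close> replace rational times, because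
    \<open>s\<close> and \<open>v\<close> are arbitrary reals; proportions in \<open>[0, 1]\<close>
    also reach the end points.\<close>
  have "G R v = (\<Inter>q\<in>?Q. {\<omega>\<in>space M. vnorm D (Y (s + q * (v - s)) \<omega>) \<le> R})"
  proof (intro equalityI subsetI)
    fix \<omega> assume "\<omega> \<in> G R v"
    then show "\<omega> \<in> (\<Inter>q\<in>?Q. {\<omega>\<in>space M. vnorm D (Y (s + q * (v - s)) \<omega>) \<le> R})"
      using in_seg by (auto simp: G_def)
  next
    fix \<omega> assume *: "\<omega> \<in> (\<Inter>q\<in>?Q. {\<omega>\<in>space M. vnorm D (Y (s + q * (v - s)) \<omega>) \<le> R})"
    have "0 \<in> ?Q" by simp
    then have w: "\<omega> \<in> space M" using * by blast
    have "vnorm D (Y u \<omega>) \<le> R" if u: "u \<in> {s..v}" for u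
    proof (cases "s = v")
      case True
      then show ?thesis using u INT_D[OF * \<open>0 \<in> ?Q\<close>] by simp
    next
      case False
      define q where "q = (u - s) / (v - s)"
      have q: "q \<in> {0..1}" "u = s + q * (v - s)" using u False v by (auto simp: q_def field_simps)
      have c1: "continuous_on {0..1} (\<lambda>q. vnorm D (Y (s + q * (v - s)) \<omega>))"
        by (rule continuous_on_compose2[OF cn[OF w]]) (use in_seg in \<open>force intro!: continuous_intros\<close>)+
      have c2: "q \<in> closure ?Q"
      proof -
        have "closure (\<rat> \<inter> {0<..<1::real}) = {0..1}"
          using closure_open_Int_superset[of "{0<..<1::real}" "\<rat>"] Rats_closure_real by (simp add: Int_commute)
        moreover have "closure (\<rat> \<inter> {0<..<1::real}) \<subseteq> closure ?Q" by (intro closure_mono) auto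
        ultimately show ?thesis using q by auto
      qed
      have c3: "closure ?Q \<subseteq> {0..1}" by (rule closure_minimal) auto
      have "vnorm D (Y (s + q * (v - s)) \<omega>) \<le> R" if "q \<in> ?Q" for q
        using INT_D[OF * that] by simp
      from continuous_le_on_closure[OF continuous_on_subset[OF c1 c3] c2 this]
      have "vnorm D (Y (s + q * (v - s)) \<omega>) \<le> R" .
      then show ?thesis using q by simp
    qed
    then show "\<omega> \<in> G R v" using w by (auto simp: G_def)
  qed
  also have "\<dots> \<in> sets (F v)"
  proof (rule sets.countable_INT', goal_cases)
    case 1
    show ?case by (rule countable_subset[OF Int_lower1 countable_rat])
  next
    case 2
    have "0 \<in> ?Q" by simp
    then show ?case by blast
  next
    case 3
    have "{\<omega>\<in>space M. vnorm D (Y (s + q * (v - s)) \<omega>) \<le> R} \<in> sets (F v)" if "q \<in> ?Q" for q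
    proof -
    from that have "Y (s + q * (v - s)) \<in> measurable (F v) borel"
      using in_seg[of q] v by (intro F_meas_mono[OF Y_meas_F]) auto
    then have [measurable]: "(\<lambda>\<omega>. vnorm D (Y (s + q * (v - s)) \<omega>)) \<in> borel_measurable (F v)"
      by (rule measurable_compose) measurable
    have "{\<omega> \<in> space (F v). vnorm D (Y (s + q * (v - s)) \<omega>) \<le> R} \<in> sets (F v)" by measurable
    then show ?thesis by simp
    qed
    then show ?case by blast
  qed
  finally show ?thesis .
qed

lemma G_events: "s \<le> v \<Longrightarrow> v \<le> T \<Longrightarrow> G R v \<in> events"
  using G_sets[of v R] subalgebra_F[of v] by (auto simp: subalgebra_def)

lemma G_antimono: "u \<le> v \<Longrightarrow> G R v \<subseteq> G R u"
  by (auto simp: G_def)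

lemma prob_G_tendsto:
  assumes v: "s \<le> v" "v \<le> T"
  shows "(\<lambda>R. prob (space M - G (real R) v)) \<longlonglongrightarrow> 0"
proof -
  have "incseq (\<lambda>R. G (real R) v)" by (force simp: incseq_def G_def)
  then have "(\<lambda>R. prob (G (real R) v)) \<longlonglongrightarrow> prob (\<Union>R. G (real R) v)"
    using G_events[OF v] by (intro finite_Lim_measure_incseq) auto
  moreover have "(\<Union>R. G (real R) v) = space M"
  proof safe
    fix \<omega> assume w: "\<omega> \<in> space M"
    have "continuous_on {s..v} (\<lambda>u. vnorm D (Y u \<omega>))"
      using continuous_on_compose2[OF continuous_vnorm continuous_on_subset[OF Y_cont[OF w]], of "{s..v}"] v by auto
    then have "bounded ((\<lambda>u. vnorm D (Y u \<omega>)) ` {s..v})"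
      by (intro compact_imp_bounded compact_continuous_image) auto
    then obtain B where "\<And>u. u \<in> {s..v} \<Longrightarrow> vnorm D (Y u \<omega>) \<le> B"
      unfolding bounded_iff by (metis abs_le_D1 imageI real_norm_def)
    moreover obtain n :: nat where "B \<le> real n" using real_arch_simple by blast
    ultimately have "\<omega> \<in> G (real n) v" using w unfolding G_def by (blast intro: order_trans)
    then show "\<omega> \<in> (\<Union>R. G (real R) v)" by blast
  qed (auto simp: G_def)
  ultimately have "(\<lambda>R. 1 - prob (G (real R) v)) \<longlonglongrightarrow> 1 - 1"
    by (intro tendsto_diff tendsto_const) (simp add: prob_space)
  then show ?thesis using G_events[OF v] by (simp add: prob_compl)
qed

text \<open>No rate is available, hence the argument by contradiction: along bad pairs
  \<open>u n\<close>, \<open>v n\<close> with vanishing distance the integrand tends to zero by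
  uniform continuity of each path, and on \<open>G R\<close> it is bounded, so dominated convergence
  contradicts the lower bound \<open>e\<close>.\<close>

lemma coeff_oscillation:
  assumes c: "lip_coeff T D L c" and e: "e > 0"
  shows "\<exists>h0>0. \<forall>u v. s \<le> u \<longrightarrow> u \<le> v \<longrightarrow> v \<le> T \<longrightarrow> v - u \<le> h0 \<longrightarrow>
    (\<integral>\<^sup>+\<omega>. indicator (G R v) \<omega> * ennreal ((c v (Y v \<omega>) - c u (Y u \<omega>))\<^sup>2) \<partial>M) \<le> ennreal e"
proof (rule ccontr)
  assume "\<not> ?thesis"
  then have *: "\<exists>u v. s \<le> u \<and> u \<le> v \<and> v \<le> T \<and> v - u \<le> h0 \<and>
    (\<integral>\<^sup>+\<omega>. indicator (G R v) \<omega> * ennreal ((c v (Y v \<omega>) - c u (Y u \<omega>))\<^sup>2) \<partial>M) > ennreal e" if "h0 > 0" for h0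
    using that by (auto simp: not_le)
  have "\<forall>n. \<exists>u v. s \<le> u \<and> u \<le> v \<and> v \<le> T \<and> v - u \<le> inverse (real (Suc n)) \<and>
    (\<integral>\<^sup>+\<omega>. indicator (G R v) \<omega> * ennreal ((c v (Y v \<omega>) - c u (Y u \<omega>))\<^sup>2) \<partial>M) > ennreal e"
    by (intro allI *) simp
  then obtain u v where all: "\<forall>n. s \<le> u n \<and> u n \<le> v n \<and> v n \<le> T \<and> v n - u n \<le> inverse (real (Suc n)) \<and>
    (\<integral>\<^sup>+\<omega>. indicator (G R (v n)) \<omega> * ennreal ((c (v n) (Y (v n) \<omega>) - c (u n) (Y (u n) \<omega>))\<^sup>2) \<partial>M) > ennreal e"
    unfolding choice_iff by blast
  then have uv: "\<And>n. s \<le> u n" "\<And>n. u n \<le> v n" "\<And>n. v n \<le> T" "\<And>n. v n - u n \<le> inverse (real (Suc n))"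
    and big: "\<And>n. (\<integral>\<^sup>+\<omega>. indicator (G R (v n)) \<omega> * ennreal ((c (v n) (Y (v n) \<omega>) - c (u n) (Y (u n) \<omega>))\<^sup>2) \<partial>M) > ennreal e"
    by blast+
  have sv: "s \<le> v n" "u n \<le> T" for n using uv(1-3)[of n] by auto
  obtain B where B: "B \<ge> 0" "\<And>t x. t \<in> {0..T} \<Longrightarrow> x \<in> vspace D \<Longrightarrow> vnorm D x \<le> R \<Longrightarrow> \<bar>c t x\<bar> \<le> B"
    using lip_coeff_bounded[OF c L] by metis
  let ?f = "\<lambda>n \<omega>. indicator (G R (v n)) \<omega> * (c (v n) (Y (v n) \<omega>) - c (u n) (Y (u n) \<omega>))\<^sup>2"
  have cm: "(\<lambda>\<omega>. c t (Y t \<omega>)) \<in> borel_measurable M" if "s \<le> t" "t \<le> T" for t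
  proof -
    have "(\<lambda>\<omega>. c t (vproj D (Y t \<omega>))) \<in> borel_measurable M"
      by (rule measurable_compose[OF Y_meas[OF that] lip_coeff_measurable[OF c]]) (use s that in auto)
    then show ?thesis
      by (rule measurable_cong[THEN iffD1, rotated]) (use Y_vspace that in \<open>auto simp: vproj_id\<close>)
  qed
  have [measurable]: "?f n \<in> borel_measurable M" for n
    using cm[OF uv(1) sv(2)] cm[OF sv(1) uv(3)] G_events[OF sv(1) uv(3)]
    by (intro borel_measurable_times borel_measurable_indicator borel_measurable_power borel_measurable_diff)
  have "(\<lambda>n. \<integral>\<omega>. ?f n \<omega> \<partial>M) \<longlonglongrightarrow> (\<integral>\<omega>. 0 \<partial>M)"
  proof (rule integral_dominated_convergence[where w="\<lambda>_. (2 * B)\<^sup>2"])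
    show "AE \<omega> in M. norm (?f n \<omega>) \<le> (2 * B)\<^sup>2" for n
    proof (rule AE_I2)
      fix \<omega> assume w: "\<omega> \<in> space M"
      show "norm (?f n \<omega>) \<le> (2 * B)\<^sup>2"
      proof (cases "\<omega> \<in> G R (v n)")
        case True
        then have n: "vnorm D (Y (v n) \<omega>) \<le> R" "vnorm D (Y (u n) \<omega>) \<le> R" using uv sv by (auto simp: G_def)
        have "\<bar>c (v n) (Y (v n) \<omega>)\<bar> \<le> B" "\<bar>c (u n) (Y (u n) \<omega>)\<bar> \<le> B"
          using uv[of n] sv[of n] s n Y_vspace w by (auto intro!: B)
        then have "\<bar>c (v n) (Y (v n) \<omega>) - c (u n) (Y (u n) \<omega>)\<bar> \<le> \<bar>2 * B\<bar>" by linarith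
        then have "(c (v n) (Y (v n) \<omega>) - c (u n) (Y (u n) \<omega>))\<^sup>2 \<le> (2 * B)\<^sup>2" by (simp only: abs_le_square_iff)
        then show ?thesis using True by simp
      qed simp
    qed
    show "AE \<omega> in M. (\<lambda>n. ?f n \<omega>) \<longlonglongrightarrow> 0"
    proof (rule AE_I2)
      fix \<omega> assume w: "\<omega> \<in> space M"
      have "continuous_on {s..T} (\<lambda>t. c t (Y t \<omega>))"
        using lip_coeff_path_continuous[OF c s Y_cont[OF w]] Y_vspace w by auto
      then have uc: "uniformly_continuous_on {s..T} (\<lambda>t. c t (Y t \<omega>))" by (intro compact_uniformly_continuous) auto
      have "(\<lambda>n. v n - u n) \<longlonglongrightarrow> 0"
        by (rule Lim_null_comparison[OF _ LIMSEQ_inverse_real_of_nat]) (use uv in \<open>auto intro!: always_eventually\<close>)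
      then have "(\<lambda>n. dist (v n) (u n)) \<longlonglongrightarrow> 0" by (simp add: dist_real_def tendsto_rabs_zero_iff)
      then have "(\<lambda>n. dist (c (v n) (Y (v n) \<omega>)) (c (u n) (Y (u n) \<omega>))) \<longlonglongrightarrow> 0"
        using uc unfolding uniformly_continuous_on_sequentially using uv sv by simp
      then have "(\<lambda>n. (dist (c (v n) (Y (v n) \<omega>)) (c (u n) (Y (u n) \<omega>)))\<^sup>2) \<longlonglongrightarrow> 0\<^sup>2" by (rule tendsto_power)
      then have "(\<lambda>n. (c (v n) (Y (v n) \<omega>) - c (u n) (Y (u n) \<omega>))\<^sup>2) \<longlonglongrightarrow> 0" by (simp add: dist_real_def)
      then show "(\<lambda>n. ?f n \<omega>) \<longlonglongrightarrow> 0"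
        by (rule Lim_null_comparison[rotated]) (auto simp: indicator_def intro!: always_eventually)
    qed
  qed auto
  moreover have "(\<integral>\<omega>. ?f n \<omega> \<partial>M) > e" for n
  proof -
    have int: "integrable M (?f n)"
    proof (rule integrable_const_bound[of _ "(2 * B)\<^sup>2"])
      show "AE \<omega> in M. norm (?f n \<omega>) \<le> (2 * B)\<^sup>2"
      proof (rule AE_I2)
        fix \<omega> assume w: "\<omega> \<in> space M"
        show "norm (?f n \<omega>) \<le> (2 * B)\<^sup>2"
        proof (cases "\<omega> \<in> G R (v n)")
          case True
          then have n: "vnorm D (Y (v n) \<omega>) \<le> R" "vnorm D (Y (u n) \<omega>) \<le> R" using uv sv by (auto simp: G_def)
          have "\<bar>c (v n) (Y (v n) \<omega>)\<bar> \<le> B" "\<bar>c (u n) (Y (u n) \<omega>)\<bar> \<le> B"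
            using uv[of n] sv[of n] s n Y_vspace w by (auto intro!: B)
          then have "\<bar>c (v n) (Y (v n) \<omega>) - c (u n) (Y (u n) \<omega>)\<bar> \<le> \<bar>2 * B\<bar>" by linarith
          then have "(c (v n) (Y (v n) \<omega>) - c (u n) (Y (u n) \<omega>))\<^sup>2 \<le> (2 * B)\<^sup>2" by (simp only: abs_le_square_iff)
          then show ?thesis using True by simp
        qed simp
      qed
    qed measurable
    have "(\<integral>\<^sup>+\<omega>. indicator (G R (v n)) \<omega> * ennreal ((c (v n) (Y (v n) \<omega>) - c (u n) (Y (u n) \<omega>))\<^sup>2) \<partial>M) = (\<integral>\<^sup>+\<omega>. ennreal (?f n \<omega>) \<partial>M)"
      by (intro nn_integral_cong) (auto split: split_indicator)
    also have "\<dots> = ennreal (\<integral>\<omega>. ?f n \<omega> \<partial>M)" by (rule nn_integral_eq_integral[OF int]) auto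
    finally show ?thesis using big[of n] e by (simp add: ennreal_less_iff)
  qed
  ultimately have "e \<le> 0" by (intro LIMSEQ_le_const[of _ 0]) (auto simp: less_imp_le)
  then show False using e by simp
qed

end

lemma affine_diff:
  fixes p q \<delta> :: real
  shows "(p - q) * \<delta> + (\<Sum>j<n. (u j - v j) * w j) = (p * \<delta> + (\<Sum>j<n. u j * w j)) - (q * \<delta> + (\<Sum>j<n. v j * w j))"
  by (simp add: left_diff_distrib sum_subtractf)

lemma square_add_le: "(x + y)\<^sup>2 \<le> 2 * (x\<^sup>2 + y\<^sup>2)" for x y :: real
  using zero_le_power2[of "x - y"] by (simp add: power2_sum power2_diff)

lemma (in sde) lip_coeff_comp_measurable:
  assumes c: "lip_coeff T D L c" and t: "0 \<le> t" "t \<le> T"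
    and Z: "Z \<in> measurable N borel" "\<And>\<omega>. \<omega> \<in> space N \<Longrightarrow> Z \<omega> \<in> vspace D"
  shows "(\<lambda>\<omega>. c t (Z \<omega>)) \<in> borel_measurable N"
proof -
  have "(\<lambda>\<omega>. c t (vproj D (Z \<omega>))) \<in> borel_measurable N"
    by (rule measurable_compose[OF Z(1) lip_coeff_measurable[OF c]]) (use t in auto)
  then show ?thesis
    by (rule measurable_cong[THEN iffD1, rotated]) (use Z(2) in \<open>auto simp: vproj_id\<close>)
qed

context sde_process
begin

text \<open>The scheme starts at the random value of \<open>Y\<close> at \<open>s\<close>. The error
  is an extended real because its finiteness is an outcome of the Gronwall argument.\<close>

definition eul_err :: "real \<Rightarrow> real \<Rightarrow> nat \<Rightarrow> ennreal" where
  "eul_err R h l = (\<integral>\<^sup>+\<omega>. indicator (G R (s + real l * h)) \<omega> *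
     ennreal (\<Sum>i<D. (Y (s + real l * h) \<omega> i - eul s h l (Y s \<omega>) \<omega> i)\<^sup>2) \<partial>M)"

lemma eul_adapted:
  assumes h: "0 \<le> h" "s + real l * h \<le> T"
  shows "(\<lambda>\<omega>. eul s h l (Y s \<omega>) \<omega>) \<in> measurable (F (s + real l * h)) borel"
proof (rule eul_measurable[OF s h])
  have sl: "s \<le> s + real l * h" using h by simp
  show "Y s \<in> measurable (F (s + real l * h)) borel"
    by (rule F_meas_mono[OF Y_meas_F sl]) (use order_trans[OF sl h(2)] in auto)
  fix k j assume k: "k < l"
  have "real (Suc k) * h \<le> real l * h" "real k * h \<le> real (Suc k) * h" using k h(1) by (auto intro!: mult_right_mono)
  moreover have "0 \<le> real k * h" using h(1) by simp
  ultimately show "(\<lambda>z. \<Delta> (s + real k * h) (s + real (Suc k) * h) j z) \<in> borel_measurable (F (s + real l * h))"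
    using s by (intro borel_measurable_diff W_F_meas) auto
qed

text \<open>The value \<open>c u (Y u \<omega>)\<close> is inserted: the first difference is the
  oscillation of the coefficient along the solution, the second is the Lipschitz error of the scheme
  at the coarse time \<open>u\<close>, where \<open>G R v\<close> may be enlarged to
  \<open>G R u\<close>.\<close>

lemma coeff_error:
  assumes c: "lip_coeff T D L c" and h: "0 \<le> h"
    and u: "u = s + real n * h" "u \<le> v" "v \<le> T"
    and osc: "(\<integral>\<^sup>+\<omega>. indicator (G R v) \<omega> * ennreal ((c v (Y v \<omega>) - c u (Y u \<omega>))\<^sup>2) \<partial>M) \<le> ennreal \<rho>"
    and \<rho>: "\<rho> \<ge> 0"
  shows "(\<integral>\<^sup>+\<omega>. indicator (G R v) \<omega> * ennreal ((c v (Y v \<omega>) - c u (eul s h n (Y s \<omega>) \<omega>))\<^sup>2) \<partial>M)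
    \<le> 2 * (ennreal \<rho> + ennreal (L\<^sup>2) * eul_err R h n)"
proof -
  have "s \<le> u" using u(1) h by simp
  then have su: "s \<le> u" "s \<le> v" "u \<le> T" using u(2,3) by auto
  have [measurable]: "(\<lambda>\<omega>. c v (Y v \<omega>)) \<in> borel_measurable M" "(\<lambda>\<omega>. c u (Y u \<omega>)) \<in> borel_measurable M"
    using s su u Y_meas Y_vspace by (auto intro!: lip_coeff_comp_measurable[OF c])
  have [measurable]: "(\<lambda>\<omega>. eul s h n (Y s \<omega>) \<omega>) \<in> measurable M borel"
    using F_meas[OF eul_adapted[OF h]] su u(1) by auto
  have [measurable]: "G R v \<in> events" "G R u \<in> events" using G_events su u by auto
  have [measurable]: "Y u \<in> measurable M borel" using Y_meas su by auto
  have "(\<integral>\<^sup>+\<omega>. indicator (G R v) \<omega> * ennreal ((c v (Y v \<omega>) - c u (eul s h n (Y s \<omega>) \<omega>))\<^sup>2) \<partial>M)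
    \<le> (\<integral>\<^sup>+\<omega>. 2 * (indicator (G R v) \<omega> * ennreal ((c v (Y v \<omega>) - c u (Y u \<omega>))\<^sup>2)
        + ennreal (L\<^sup>2) * (indicator (G R u) \<omega> * ennreal (\<Sum>i<D. (Y u \<omega> i - eul s h n (Y s \<omega>) \<omega> i)\<^sup>2))) \<partial>M)"
  proof (rule nn_integral_mono)
    fix \<omega> assume w: "\<omega> \<in> space M"
    show "indicator (G R v) \<omega> * ennreal ((c v (Y v \<omega>) - c u (eul s h n (Y s \<omega>) \<omega>))\<^sup>2)
      \<le> 2 * (indicator (G R v) \<omega> * ennreal ((c v (Y v \<omega>) - c u (Y u \<omega>))\<^sup>2)
        + ennreal (L\<^sup>2) * (indicator (G R u) \<omega> * ennreal (\<Sum>i<D. (Y u \<omega> i - eul s h n (Y s \<omega>) \<omega> i)\<^sup>2)))"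
    proof (cases "\<omega> \<in> G R v")
      case True
      then have Gu: "\<omega> \<in> G R u" using G_antimono[OF u(2)] by auto
      let ?x = "c v (Y v \<omega>) - c u (Y u \<omega>)" and ?y = "c u (Y u \<omega>) - c u (eul s h n (Y s \<omega>) \<omega>)"
      let ?S = "\<Sum>i<D. (Y u \<omega> i - eul s h n (Y s \<omega>) \<omega> i)\<^sup>2"
      have "\<bar>?y\<bar> \<le> L * vnorm D (Y u \<omega> - eul s h n (Y s \<omega>) \<omega>)"
        using c s su w Y_vspace eul_vspace unfolding lip_coeff_def by auto
      then have "\<bar>?y\<bar>\<^sup>2 \<le> (L * vnorm D (Y u \<omega> - eul s h n (Y s \<omega>) \<omega>))\<^sup>2" by (rule power_mono) simp
      then have y: "?y\<^sup>2 \<le> L\<^sup>2 * ?S" by (simp add: power_mult_distrib vnorm_square)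
      have "(c v (Y v \<omega>) - c u (eul s h n (Y s \<omega>) \<omega>))\<^sup>2 = (?x + ?y)\<^sup>2" by simp
      also have "\<dots> \<le> 2 * (?x\<^sup>2 + ?y\<^sup>2)"
        by (rule square_add_le)
      also have "\<dots> \<le> 2 * (?x\<^sup>2 + L\<^sup>2 * ?S)" using y by simp
      finally have "ennreal ((c v (Y v \<omega>) - c u (eul s h n (Y s \<omega>) \<omega>))\<^sup>2) \<le> ennreal (2 * (?x\<^sup>2 + L\<^sup>2 * ?S))"
        by (rule ennreal_leI)
      also have "\<dots> = 2 * (ennreal (?x\<^sup>2) + ennreal (L\<^sup>2) * ennreal ?S)"
        by (simp add: ennreal_mult ennreal_plus sum_nonneg)
      finally show ?thesis using True Gu by simp
    qed simp
  qed
  also have "\<dots> = 2 * ((\<integral>\<^sup>+\<omega>. indicator (G R v) \<omega> * ennreal ((c v (Y v \<omega>) - c u (Y u \<omega>))\<^sup>2) \<partial>M)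
      + ennreal (L\<^sup>2) * eul_err R h n)"
    unfolding eul_err_def u(1)[symmetric]
    by (subst nn_integral_cmult, measurable, subst nn_integral_add, measurable, subst nn_integral_cmult, measurable)
  also have "\<dots> \<le> 2 * (ennreal \<rho> + ennreal (L\<^sup>2) * eul_err R h n)"
    by (intro mult_left_mono add_right_mono osc) auto
  finally show ?thesis .
qed

text \<open>The error of the scheme is the limit in probability of sums of coefficient differences
  over refined grids. For these, Cauchy-Schwarz bounds the drift and the Ito isometry the noise,
  uniformly in the refinement; Fatou then gives the bound for the error itself. The cost is
  \<open>4 * (T + D)\<close> per coordinate, and summing over coordinates gives another
  \<open>D\<close>.\<close>

lemma euler_error_step:
  assumes \<eta>: "\<eta> > 0" and q: "q > 0" and h: "h = \<eta> / real q" and dT: "s + real d * \<eta> \<le> T"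
    and RS: "riemann_sol s \<eta> d Y" and \<rho>: "\<rho> \<ge> 0"
    and osc_a: "\<And>i u v. i < D \<Longrightarrow> s \<le> u \<Longrightarrow> u \<le> v \<Longrightarrow> v \<le> T \<Longrightarrow> v - u \<le> h \<Longrightarrow>
       (\<integral>\<^sup>+\<omega>. indicator (G R v) \<omega> * ennreal ((a v (Y v \<omega>) i - a u (Y u \<omega>) i)\<^sup>2) \<partial>M) \<le> ennreal \<rho>"
    and osc_b: "\<And>i j u v. i < D \<Longrightarrow> j < D \<Longrightarrow> s \<le> u \<Longrightarrow> u \<le> v \<Longrightarrow> v \<le> T \<Longrightarrow> v - u \<le> h \<Longrightarrow>
       (\<integral>\<^sup>+\<omega>. indicator (G R v) \<omega> * ennreal ((b v (Y v \<omega>) i j - b u (Y u \<omega>) i j)\<^sup>2) \<partial>M) \<le> ennreal \<rho>"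
    and l: "l \<le> d * q"
  shows "eul_err R h l \<le> ennreal (real D * (4 * (T + real D))) * ennreal h * (\<Sum>k<l. ennreal \<rho> + ennreal (L\<^sup>2) * eul_err R h k)"
proof -
  have h0: "h > 0" using \<eta> q h by simp
  have "real l * h \<le> real (d * q) * h" using l h0 by (intro mult_right_mono of_nat_mono) auto
  also have "\<dots> = real d * \<eta>" using q h by simp
  finally have lh: "s + real l * h \<le> T" using dT by simp
  have T0: "T \<ge> 0" "real l * h \<le> T" using lh s h0 by (auto intro: order_trans[OF _ lh] add_nonneg_nonneg)
  have sT: "s \<le> T" using lh mult_nonneg_nonneg[of "real l" h] h0 by linarith
  define \<delta> where "\<delta> r = h / real (Suc r)" for r
  define pt where "pt r k = s + real k * \<delta> r" for r k
  \<comment> \<open>The coarse grid time at or below the fine point \<open>pt r k\<close>. The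
    scheme \<open>E r k\<close> is evaluated there, the solution at the fine point.\<close>
  define uh where "uh r k = s + real (k div Suc r) * h" for r k
  define E where "E r k \<omega> = eul s h (k div Suc r) (Y s \<omega>) \<omega>" for r k \<omega>
  define A where "A i r k \<omega> = a (pt r k) (Y (pt r k) \<omega>) i - a (uh r k) (E r k \<omega>) i" for i r k \<omega>
  define Bt where "Bt i r k j \<omega> = b (pt r k) (Y (pt r k) \<omega>) i j - b (uh r k) (E r k \<omega>) i j" for i r k j \<omega>
  define X where "X i r \<omega> = (\<Sum>k<l * Suc r. A i r k \<omega> * \<delta> r + (\<Sum>j<D. Bt i r k j \<omega> * \<Delta> (pt r k) (pt r (Suc k)) j \<omega>))" for i r \<omega>
  have \<delta>0: "\<delta> r > 0" for r using h0 by (simp add: \<delta>_def)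
  have md: "real (Suc r) * \<delta> r = h" for r by (simp add: \<delta>_def)
  have pt_props: "s \<le> pt r k" "uh r k \<le> pt r k" "pt r k - uh r k \<le> h" "s \<le> uh r k" for r k
  proof -
    have e: "real k = real (k div Suc r) * real (Suc r) + real (k mod Suc r)"
      by (metis div_mult_mod_eq of_nat_add of_nat_mult)
    have "real k * \<delta> r = real (k div Suc r) * (real (Suc r) * \<delta> r) + real (k mod Suc r) * \<delta> r"
      by (subst e) (simp add: algebra_simps)
    from this[unfolded md] have "pt r k = uh r k + real (k mod Suc r) * \<delta> r" by (simp add: pt_def uh_def)
    moreover have "real (k mod Suc r) * \<delta> r \<le> real (Suc r) * \<delta> r"
      using \<delta>0[of r] by (intro mult_right_mono of_nat_mono less_imp_le[OF mod_less_divisor]) auto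
    ultimately show "uh r k \<le> pt r k" "pt r k - uh r k \<le> h" using \<delta>0[of r] md[of r] by auto
    show "s \<le> pt r k" "s \<le> uh r k" using \<delta>0[of r] h0 by (auto simp: pt_def uh_def)
  qed
  have pt_top: "pt r (l * Suc r) = s + real l * h" for r
    unfolding pt_def by (simp only: of_nat_mult mult.assoc md)
  have pt_T: "pt r k \<le> s + real l * h" "pt r k \<le> T" if "k \<le> l * Suc r" for r k
  proof -
    have "pt r k \<le> pt r (l * Suc r)" unfolding pt_def using that \<delta>0[of r] by (intro add_left_mono mult_right_mono of_nat_mono) auto
    then show "pt r k \<le> s + real l * h" "pt r k \<le> T" using pt_top lh by auto
  qed
  have pt_mono: "pt r k < pt r (Suc k)" for r k using \<delta>0[of r] by (simp add: pt_def)
  have uhT: "uh r k \<le> T" if "k \<le> l * Suc r" for r k using pt_props(2)[of r k] pt_T(2)[OF that] by linarith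
  have E_F: "E r k \<in> measurable (F (uh r k)) borel" if "k \<le> l * Suc r" for r k
    unfolding E_def uh_def using eul_adapted[of h "k div Suc r"] h0 uhT[OF that] by (simp add: uh_def)
  have E_v: "E r k \<omega> \<in> vspace D" if "\<omega> \<in> space M" for r k \<omega>
    unfolding E_def by (intro eul_vspace Y_vspace that sT) simp
  have dm: "lip_coeff T D L c \<Longrightarrow> k \<le> l * Suc r \<Longrightarrow>
     (\<lambda>\<omega>. c (pt r k) (Y (pt r k) \<omega>) - c (uh r k) (E r k \<omega>)) \<in> borel_measurable (F (pt r k))" for c r k
  proof (rule borel_measurable_diff)
    assume c: "lip_coeff T D L c" and k: "k \<le> l * Suc r"
    show "(\<lambda>\<omega>. c (pt r k) (Y (pt r k) \<omega>)) \<in> borel_measurable (F (pt r k))"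
      using s pt_props[of r k] pt_T[OF k] Y_meas_F Y_vspace by (intro lip_coeff_comp_measurable[OF c]) auto
    have "(\<lambda>\<omega>. c (uh r k) (E r k \<omega>)) \<in> borel_measurable (F (uh r k))"
      using s pt_props[of r k] uhT[OF k] E_F[OF k] E_v by (intro lip_coeff_comp_measurable[OF c]) auto
    then show "(\<lambda>\<omega>. c (uh r k) (E r k \<omega>)) \<in> borel_measurable (F (pt r k))"
      by (rule F_meas_mono) (rule pt_props)
  qed
  have A_F: "A i r k \<in> borel_measurable (F (pt r k))" if "k \<le> l * Suc r" for i r k
    using dm[OF a_lip that] unfolding A_def by simp
  have B_F: "Bt i r k j \<in> borel_measurable (F (pt r k))" if "k \<le> l * Suc r" for i r k j
    using dm[OF b_lip that] unfolding Bt_def by simp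
  have A_M [measurable]: "A i r k \<in> borel_measurable M" if "k \<le> l * Suc r" for i r k
    using F_meas[OF A_F[OF that]] pt_T[OF that] by simp
  have B_M [measurable]: "Bt i r k j \<in> borel_measurable M" if "k \<le> l * Suc r" for i r k j
    using F_meas[OF B_F[OF that]] pt_T[OF that] by simp
  have W_M: "(\<lambda>\<omega>. W (pt r k) \<omega> j) \<in> borel_measurable M" if "k \<le> l * Suc r" for r k j
    using s pt_props(1)[of r k] pt_T[OF that] by (intro W_meas) auto
  have X_M [measurable]: "X i r \<in> borel_measurable M" for i r
    unfolding X_def by (intro borel_measurable_sum borel_measurable_add borel_measurable_times borel_measurable_diff A_M B_M W_M borel_measurable_const) auto
  have errA: "(\<integral>\<^sup>+\<omega>. indicator (G R (pt r k)) \<omega> * ennreal ((A i r k \<omega>)\<^sup>2) \<partial>M) \<le> 2 * (ennreal \<rho> + ennreal (L\<^sup>2) * eul_err R h (k div Suc r))"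
    if "i < D" "k \<le> l * Suc r" for i r k
    unfolding A_def E_def
    by (rule coeff_error[OF a_lip]) (use h0 pt_props pt_T[OF that(2)] osc_a[OF that(1)] \<rho> in \<open>auto simp: uh_def\<close>)
  have errB: "(\<integral>\<^sup>+\<omega>. indicator (G R (pt r k)) \<omega> * ennreal ((Bt i r k j \<omega>)\<^sup>2) \<partial>M) \<le> 2 * (ennreal \<rho> + ennreal (L\<^sup>2) * eul_err R h (k div Suc r))"
    if "i < D" "j < D" "k \<le> l * Suc r" for i r k j
    unfolding Bt_def E_def
    by (rule coeff_error[OF b_lip]) (use h0 pt_props pt_T[OF that(3)] osc_b[OF that(1,2)] \<rho> in \<open>auto simp: uh_def\<close>)
  define Z where "Z i \<omega> = Y (s + real l * h) \<omega> i - eul s h l (Y s \<omega>) \<omega> i" for i \<omega>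
  have Z_M [measurable]: "Z i \<in> borel_measurable M" for i
  proof -
    have [measurable]: "(\<lambda>\<omega>. eul s h l (Y s \<omega>) \<omega>) \<in> measurable M borel"
      using F_meas[OF eul_adapted[of h l]] h0 lh by auto
    have [measurable]: "Y (s + real l * h) \<in> measurable M borel" using Y_meas lh h0 by auto
    show ?thesis unfolding Z_def by measurable
  qed
  have GM [measurable]: "G R (pt r k) \<in> events" if "k \<le> l * Suc r" for r k
    using G_events pt_props pt_T[OF that] by auto
  have GL [measurable]: "G R (s + real l * h) \<in> events" using G_events h0 lh by auto
  let ?K = "ennreal (4 * (T + real D)) * ennreal h * (\<Sum>k<l. ennreal \<rho> + ennreal (L\<^sup>2) * eul_err R h k)"
  have comp: "(\<integral>\<^sup>+\<omega>. indicator (G R (s + real l * h)) \<omega> * ennreal ((Z i \<omega>)\<^sup>2) \<partial>M) \<le> ?K" if i: "i < D" for i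
  proof (rule nn_integral_square_Fatou_in_prob[OF X_M Z_M GL])
    have "Z i \<omega> - X i r \<omega> = Y (s + real l * (\<eta> / real q)) \<omega> i - Y s \<omega> i -
     (\<Sum>k<l * Suc r. a (s + real k * (\<eta> / real q / real (Suc r))) (Y (s + real k * (\<eta> / real q / real (Suc r))) \<omega>) i * (\<eta> / real q / real (Suc r))
    + (\<Sum>j<D. b (s + real k * (\<eta> / real q / real (Suc r))) (Y (s + real k * (\<eta> / real q / real (Suc r))) \<omega>) i j
        * \<Delta> (s + real k * (\<eta> / real q / real (Suc r))) (s + real (Suc k) * (\<eta> / real q / real (Suc r))) j \<omega>))"
      (is "_ = ?rhs r \<omega>") if w: "\<omega> \<in> space M" for \<omega> r
    proof -
      have Ys: "Y s \<omega> \<in> vspace D" by (intro Y_vspace w sT) simp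
      have "eul s h l (Y s \<omega>) \<omega> i = Y s \<omega> i + (\<Sum>k<l * Suc r. a (uh r k) (E r k \<omega>) i * \<delta> r
         + (\<Sum>j<D. b (uh r k) (E r k \<omega>) i j * \<Delta> (pt r k) (pt r (Suc k)) j \<omega>))"
        unfolding eul_refined[OF Ys zero_less_Suc[of r], of s h l \<omega> i] uh_def E_def pt_def \<delta>_def ..
      moreover have "?rhs r \<omega> = Y (s + real l * h) \<omega> i - Y s \<omega> i - (\<Sum>k<l * Suc r. a (pt r k) (Y (pt r k) \<omega>) i * \<delta> r
         + (\<Sum>j<D. b (pt r k) (Y (pt r k) \<omega>) i j * \<Delta> (pt r k) (pt r (Suc k)) j \<omega>))"
        unfolding h \<delta>_def pt_def ..
      moreover have "X i r \<omega> = (\<Sum>k<l * Suc r. a (pt r k) (Y (pt r k) \<omega>) i * \<delta> r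
         + (\<Sum>j<D. b (pt r k) (Y (pt r k) \<omega>) i j * \<Delta> (pt r k) (pt r (Suc k)) j \<omega>))
         - (\<Sum>k<l * Suc r. a (uh r k) (E r k \<omega>) i * \<delta> r + (\<Sum>j<D. b (uh r k) (E r k \<omega>) i j * \<Delta> (pt r k) (pt r (Suc k)) j \<omega>))"
        unfolding X_def A_def Bt_def sum_subtractf[symmetric]
        by (intro sum.cong refl affine_diff)
      ultimately show ?thesis unfolding Z_def by linarith
    qed
    then have "(\<lambda>r. prob {\<omega>\<in>space M. \<bar>Z i \<omega> - X i r \<omega>\<bar> > e}) = (\<lambda>r. prob {\<omega>\<in>space M. \<bar>?rhs r \<omega>\<bar> > e})" for e
      by (intro ext arg_cong[where f=prob] Collect_cong) (auto simp only:)
    moreover have "null_in_prob M ?rhs" using RS q l i unfolding riemann_sol_def by blast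
    ultimately show "null_in_prob M (\<lambda>r \<omega>. Z i \<omega> - X i r \<omega>)"
      unfolding null_in_prob_def by simp
  next
    fix r
    let ?n = "l * Suc r"
    \<comment> \<open>Each term carries the indicator of \<open>G R\<close> at its own time and not
      at the final time, as the Ito isometry requires adapted integrands; on the final event all
      these indicators equal one.\<close>
    let ?J = "\<lambda>k. indicator (G R (pt r k)) :: 'w \<Rightarrow> real"
    let ?H = "\<lambda>k j \<omega>. ?J k \<omega> * Bt i r k j \<omega>"
    let ?I = "\<lambda>k f. \<integral>\<^sup>+\<omega>. indicator (G R (pt r k)) \<omega> * ennreal ((f \<omega>)\<^sup>2) \<partial>M"
    let ?P = "\<lambda>\<omega>. \<Sum>k<?n. ?J k \<omega> * A i r k \<omega> * \<delta> r"
    let ?Q = "\<lambda>\<omega>. \<Sum>k<?n. \<Sum>j<D. ?H k j \<omega> * \<Delta> (pt r k) (pt r (Suc k)) j \<omega>"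
    have H_F: "?H k j \<in> borel_measurable (F (pt r k))" if "k < ?n" for k j
      using B_F[of k r i j] G_sets[OF pt_props(1) pt_T(2), of k r] that
      by (intro borel_measurable_times borel_measurable_indicator) auto
    have H_M: "?H k j \<in> borel_measurable M" if "k < ?n" for k j
      using F_meas[OF H_F[OF that]] pt_T[of k r] that by simp
    have Qm: "(\<lambda>\<omega>. ennreal ((?Q \<omega>)\<^sup>2)) \<in> borel_measurable M"
      by (intro measurable_compose[OF _ measurable_ennreal] borel_measurable_power borel_measurable_sum borel_measurable_times borel_measurable_diff H_M W_M) auto
    have AJ: "(\<lambda>\<omega>. ?J k \<omega> * A i r k \<omega>) \<in> borel_measurable M" if "k < ?n" for k
      using that by (intro borel_measurable_times A_M borel_measurable_indicator GM) auto
    have Pm: "(\<lambda>\<omega>. ennreal ((?P \<omega>)\<^sup>2)) \<in> borel_measurable M"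
      by (intro measurable_compose[OF _ measurable_ennreal] borel_measurable_power borel_measurable_sum borel_measurable_times[OF AJ]) auto
    have "(\<integral>\<^sup>+\<omega>. indicator (G R (s + real l * h)) \<omega> * ennreal ((X i r \<omega>)\<^sup>2) \<partial>M)
       \<le> (\<integral>\<^sup>+\<omega>. 2 * ennreal ((?P \<omega>)\<^sup>2) + 2 * ennreal ((?Q \<omega>)\<^sup>2) \<partial>M)"
    proof (rule nn_integral_mono)
      fix \<omega>
      show "indicator (G R (s + real l * h)) \<omega> * ennreal ((X i r \<omega>)\<^sup>2) \<le> 2 * ennreal ((?P \<omega>)\<^sup>2) + 2 * ennreal ((?Q \<omega>)\<^sup>2)"
      proof (cases "\<omega> \<in> G R (s + real l * h)")
        case True
        have "?J k \<omega> = 1" if "k < ?n" for k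
          using True G_antimono[OF pt_T(1)[of k r]] that by (auto simp: indicator_def)
        then have "X i r \<omega> = ?P \<omega> + ?Q \<omega>" unfolding X_def sum.distrib[symmetric] by (intro sum.cong refl) auto
        then have "(X i r \<omega>)\<^sup>2 \<le> 2 * (?P \<omega>)\<^sup>2 + 2 * (?Q \<omega>)\<^sup>2"
          using square_add_le[of "?P \<omega>" "?Q \<omega>"] by simp
        then have "ennreal ((X i r \<omega>)\<^sup>2) \<le> ennreal (2 * (?P \<omega>)\<^sup>2 + 2 * (?Q \<omega>)\<^sup>2)" by (rule ennreal_leI)
        then show ?thesis using True by (simp add: ennreal_plus ennreal_mult)
      qed simp
    qed
    also have "\<dots> = 2 * (\<integral>\<^sup>+\<omega>. ennreal ((?P \<omega>)\<^sup>2) \<partial>M) + 2 * (\<integral>\<^sup>+\<omega>. ennreal ((?Q \<omega>)\<^sup>2) \<partial>M)"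
      by (simp only: nn_integral_add[OF borel_measurable_times_ennreal[OF borel_measurable_const Pm] borel_measurable_times_ennreal[OF borel_measurable_const Qm]]
          nn_integral_cmult[OF Pm] nn_integral_cmult[OF Qm])
    also have "\<dots> \<le> 2 * (ennreal T * (\<Sum>k<?n. ennreal (\<delta> r) * ?I k (A i r k))) + 2 * (\<Sum>k<?n. ennreal (\<delta> r) * (\<Sum>j<D. ?I k (Bt i r k j)))"
    proof (intro add_mono mult_left_mono)
      have "(\<integral>\<^sup>+\<omega>. ennreal ((?P \<omega>)\<^sup>2) \<partial>M) \<le> (\<integral>\<^sup>+\<omega>. ennreal T * (\<Sum>k<?n. ennreal (\<delta> r) * (indicator (G R (pt r k)) \<omega> * ennreal ((A i r k \<omega>)\<^sup>2))) \<partial>M)"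
      proof (rule nn_integral_mono)
        fix \<omega>
        have "(?P \<omega>)\<^sup>2 \<le> (\<Sum>k<?n. (?J k \<omega> * A i r k \<omega> * \<delta> r)\<^sup>2) * real (card {..<?n})"
          by (rule sum_squared_le_sum_of_squares)
        also have "\<dots> = real ?n * \<delta> r * (\<Sum>k<?n. \<delta> r * (?J k \<omega> * (A i r k \<omega>)\<^sup>2))"
        proof -
          have "(?J k \<omega> * A i r k \<omega> * \<delta> r)\<^sup>2 = \<delta> r * (\<delta> r * (?J k \<omega> * (A i r k \<omega>)\<^sup>2))" for k
            by (auto simp: power2_eq_square indicator_def)
          then show ?thesis by (simp only: sum_distrib_left[symmetric] card_lessThan mult_ac)
        qed
        also have "real ?n * \<delta> r = real l * h" by (simp only: of_nat_mult mult.assoc md)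
        also have "real l * h * (\<Sum>k<?n. \<delta> r * (?J k \<omega> * (A i r k \<omega>)\<^sup>2)) \<le> T * (\<Sum>k<?n. \<delta> r * (?J k \<omega> * (A i r k \<omega>)\<^sup>2))"
          using T0 \<delta>0[of r] by (intro mult_right_mono sum_nonneg) (auto simp: less_imp_le)
        finally have "ennreal ((?P \<omega>)\<^sup>2) \<le> ennreal (T * (\<Sum>k<?n. \<delta> r * (?J k \<omega> * (A i r k \<omega>)\<^sup>2)))" by (rule ennreal_leI)
        also have "\<dots> = ennreal T * (\<Sum>k<?n. ennreal (\<delta> r * (?J k \<omega> * (A i r k \<omega>)\<^sup>2)))"
          using T0 \<delta>0[of r] by (subst sum_ennreal) (auto simp: ennreal_mult sum_nonneg less_imp_le)
        also have "\<dots> = ennreal T * (\<Sum>k<?n. ennreal (\<delta> r) * (indicator (G R (pt r k)) \<omega> * ennreal ((A i r k \<omega>)\<^sup>2)))"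
          using \<delta>0[of r] by (intro arg_cong2[where f="(*)"] sum.cong refl) (auto simp: ennreal_mult indicator_def less_imp_le)
        finally show "ennreal ((?P \<omega>)\<^sup>2) \<le> ennreal T * (\<Sum>k<?n. ennreal (\<delta> r) * (indicator (G R (pt r k)) \<omega> * ennreal ((A i r k \<omega>)\<^sup>2)))" .
      qed
      also have "\<dots> = ennreal T * (\<Sum>k<?n. ennreal (\<delta> r) * ?I k (A i r k))"
      proof -
        have m: "(\<lambda>\<omega>. indicator (G R (pt r k)) \<omega> * ennreal ((A i r k \<omega>)\<^sup>2)) \<in> borel_measurable M" if "k < ?n" for k
          using that by (intro borel_measurable_times_ennreal borel_measurable_indicator GM
              measurable_compose[OF borel_measurable_power[OF A_M] measurable_ennreal]) auto
        show ?thesis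
          by (subst nn_integral_cmult, (intro borel_measurable_sum borel_measurable_times_ennreal m borel_measurable_const; simp),
              subst nn_integral_sum, (intro borel_measurable_times_ennreal m borel_measurable_const; simp))
             (auto intro!: arg_cong2[where f="(*)"] sum.cong nn_integral_cmult m)
      qed
      finally show "(\<integral>\<^sup>+\<omega>. ennreal ((?P \<omega>)\<^sup>2) \<partial>M) \<le> ennreal T * (\<Sum>k<?n. ennreal (\<delta> r) * ?I k (A i r k))" .
      have "(\<integral>\<^sup>+\<omega>. ennreal ((?Q \<omega>)\<^sup>2) \<partial>M) \<le> (\<Sum>k<?n. ennreal (pt r (Suc k) - pt r k) * (\<Sum>j<D. \<integral>\<^sup>+\<omega>. ennreal ((?H k j \<omega>)\<^sup>2) \<partial>M))"
      proof (rule ito_isometry_nn)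
        show "0 \<le> pt r 0" using s by (simp add: pt_def)
        show "pt r ?n \<le> T" using pt_T by simp
      qed (use pt_mono H_F in auto)
      also have "\<dots> = (\<Sum>k<?n. ennreal (\<delta> r) * (\<Sum>j<D. ?I k (Bt i r k j)))"
        by (intro sum.cong arg_cong2[where f="(*)"] refl nn_integral_cong)
           (auto simp: pt_def algebra_simps indicator_def)
      finally show "(\<integral>\<^sup>+\<omega>. ennreal ((?Q \<omega>)\<^sup>2) \<partial>M) \<le> (\<Sum>k<?n. ennreal (\<delta> r) * (\<Sum>j<D. ?I k (Bt i r k j)))" .
    qed auto
    also have "\<dots> \<le> 2 * (ennreal T * (\<Sum>k<?n. ennreal (\<delta> r) * (2 * (ennreal \<rho> + ennreal (L\<^sup>2) * eul_err R h (k div Suc r)))))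
       + 2 * (\<Sum>k<?n. ennreal (\<delta> r) * (\<Sum>j<D. 2 * (ennreal \<rho> + ennreal (L\<^sup>2) * eul_err R h (k div Suc r))))"
      using i by (intro add_mono mult_left_mono sum_mono errA errB) auto
    \<comment> \<open>One factor 2 comes from separating drift and noise, another from
      \<open>coeff_error\<close>; the noise has \<open>D\<close> integrands per coordinate.\<close>
    also have "\<dots> = ennreal (4 * (T + real D)) * (\<Sum>k<?n. ennreal (\<delta> r) * (ennreal \<rho> + ennreal (L\<^sup>2) * eul_err R h (k div Suc r)))"
    proof -
      let ?S = "\<Sum>k<?n. ennreal (\<delta> r) * (ennreal \<rho> + ennreal (L\<^sup>2) * eul_err R h (k div Suc r))"
      have 1: "(\<Sum>k<?n. ennreal (\<delta> r) * (2 * (ennreal \<rho> + ennreal (L\<^sup>2) * eul_err R h (k div Suc r)))) = 2 * ?S"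
        unfolding sum_distrib_left by (intro sum.cong refl mult.left_commute)
      have 2: "(\<Sum>k<?n. ennreal (\<delta> r) * (\<Sum>j<D. 2 * (ennreal \<rho> + ennreal (L\<^sup>2) * eul_err R h (k div Suc r)))) = 2 * ennreal (real D) * ?S"
      proof -
        have "d * (\<Sum>j<D. 2 * x) = 2 * ennreal (real D) * (d * x)" for d x :: ennreal
          by (simp add: ennreal_of_nat_eq_real_of_nat mult_ac)
        then show ?thesis unfolding sum_distrib_left[of "2 * ennreal (real D)"] by (intro sum.cong refl)
      qed
      have "ennreal (4 * (T + real D)) = 2 * ennreal T * 2 + 2 * (2 * ennreal (real D))"
        using T0 by (simp add: ennreal_mult ennreal_plus distrib_left mult_ac)
      then show ?thesis unfolding 1 2 by (simp only: distrib_right mult.assoc)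
    qed
    \<comment> \<open>Grouping fine steps by their coarse step removes the dependence on
      \<open>r\<close>, as a bound along the whole sequence demands.\<close>
    also have "(\<Sum>k<?n. ennreal (\<delta> r) * (ennreal \<rho> + ennreal (L\<^sup>2) * eul_err R h (k div Suc r)))
       = (\<Sum>n<l. \<Sum>k<Suc r. ennreal (\<delta> r) * (ennreal \<rho> + ennreal (L\<^sup>2) * eul_err R h n))"
    proof -
      have "(n * m + k) div m = n" if "k < m" for n m k :: nat using that by simp
      then show ?thesis unfolding sum_lessThan_blocks by (intro sum.cong refl) (simp only: lessThan_iff)
    qed
    also have "\<dots> = ennreal h * (\<Sum>n<l. ennreal \<rho> + ennreal (L\<^sup>2) * eul_err R h n)"
    proof -
      have "of_nat (Suc r) * ennreal (\<delta> r) = ennreal h"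
        unfolding ennreal_of_nat_eq_real_of_nat md[of r, symmetric] using \<delta>0[of r] by (subst ennreal_mult) auto
      then show ?thesis
        unfolding sum_distrib_left sum_constant card_lessThan by (simp only: mult.assoc[symmetric])
    qed
    finally show "(\<integral>\<^sup>+\<omega>. indicator (G R (s + real l * h)) \<omega> * ennreal ((X i r \<omega>)\<^sup>2) \<partial>M) \<le> ?K"
      by (simp only: mult.assoc)
  qed
  have "eul_err R h l = (\<integral>\<^sup>+\<omega>. (\<Sum>i<D. indicator (G R (s + real l * h)) \<omega> * ennreal ((Z i \<omega>)\<^sup>2)) \<partial>M)"
    unfolding eul_err_def Z_def by (intro nn_integral_cong) (simp add: sum_distrib_left flip: sum_ennreal)
  also have "\<dots> = (\<Sum>i<D. \<integral>\<^sup>+\<omega>. indicator (G R (s + real l * h)) \<omega> * ennreal ((Z i \<omega>)\<^sup>2) \<partial>M)"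
    by (rule nn_integral_sum) measurable
  also have "\<dots> \<le> (\<Sum>i<D. ?K)" by (intro sum_mono comp) simp
  also have "\<dots> = ennreal (real D * (4 * (T + real D))) * ennreal h * (\<Sum>k<l. ennreal \<rho> + ennreal (L\<^sup>2) * eul_err R h k)"
    using T0 by (simp only: sum_constant card_lessThan ennreal_of_nat_eq_real_of_nat) (subst ennreal_mult, auto simp: mult.assoc)
  finally show ?thesis .
qed

end

lemma grid_cancel: "m > 0 \<Longrightarrow> real (d * m) * (\<eta> / real m) = real d * \<eta>"
  by simp

lemma finite_uniform_scale:
  fixes P :: "'i \<Rightarrow> real \<Rightarrow> bool"
  assumes "finite S" "\<And>i. i \<in> S \<Longrightarrow> \<exists>h>0. P i h" "\<And>i h h'. P i h \<Longrightarrow> h' \<le> h \<Longrightarrow> P i h'"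
  shows "\<exists>h>0. \<forall>i\<in>S. P i h"
  using assms(1,2)
proof (induction S rule: finite_induct)
  case empty
  then show ?case by (intro exI[of _ 1]) simp
next
  case (insert x S)
  then obtain h1 h2 where "h1 > 0" "\<forall>i\<in>S. P i h1" "h2 > 0" "P x h2" by (metis insertI1 insertI2)
  then show ?case using assms(3) by (intro exI[of _ "min h1 h2"]) (auto intro: min.cobounded1 min.cobounded2)
qed

context sde_process
begin

lemma eul_err_bound:
  assumes \<eta>: "\<eta> > 0" and dT: "s + real d * \<eta> \<le> T" and RS: "riemann_sol s \<eta> d Y" and e: "e > 0"
  shows "\<exists>q0. \<forall>q\<ge>q0. eul_err R (\<eta> / real (Suc q)) (d * Suc q) \<le> ennreal e"
proof -
  define C where "C = real D * (4 * (T + real D))"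
  \<comment> \<open>Chosen so that the Gronwall bound
    \<open>\<rho> * exp (L\<^sup>2 * C * T)\<close>, multiplied by \<open>C * T\<close>, is at most
    \<open>e\<close>; the summand 1 keeps the denominator positive.\<close>
  define \<rho> where "\<rho> = e / ((C * T + 1) * exp (L\<^sup>2 * C * T))"
  have T0: "T \<ge> 0" using dT s \<eta> by (smt (verit) mult_nonneg_nonneg of_nat_0_le_iff)
  have C0: "C \<ge> 0" using T0 by (simp add: C_def)
  then have CT: "C * T \<ge> 0" using T0 by simp
  have \<rho>0: "\<rho> > 0" using e CT by (auto simp: \<rho>_def intro!: divide_pos_pos mult_pos_pos)
  have \<rho>e: "C * T * (\<rho> * exp (L\<^sup>2 * C * T)) \<le> e"
  proof -
    have "C * T * (\<rho> * exp (L\<^sup>2 * C * T)) = e * (C * T / (C * T + 1))" by (simp add: \<rho>_def)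
    also have "\<dots> \<le> e * 1" using e CT by (intro mult_left_mono) auto
    finally show ?thesis by simp
  qed
  let ?P = "\<lambda>c h. \<forall>u v. s \<le> u \<longrightarrow> u \<le> v \<longrightarrow> v \<le> T \<longrightarrow> v - u \<le> h \<longrightarrow>
    (\<integral>\<^sup>+\<omega>. indicator (G R v) \<omega> * ennreal ((c v (Y v \<omega>) - c u (Y u \<omega>))\<^sup>2) \<partial>M) \<le> ennreal \<rho>"
  \<comment> \<open>There are finitely many scalar coefficients, so one mesh \<open>h0\<close>
    controls the oscillation of all of them.\<close>
  define S where "S = ((\<lambda>i t x. a t x i) ` {..<D}) \<union> ((\<lambda>(i, j) t x. b t x i j) ` ({..<D} \<times> {..<D}))"
  have "\<exists>h>0. \<forall>c\<in>S. ?P c h"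
  proof (rule finite_uniform_scale)
    show "finite S" by (simp add: S_def)
    fix c assume "c \<in> S"
    then have "lip_coeff T D L c" using a_lip b_lip by (auto simp: S_def)
    then show "\<exists>h>0. ?P c h" by (rule coeff_oscillation[OF _ \<rho>0])
  qed (meson order_trans)
  then obtain h0 where h0: "h0 > 0" "\<And>c. c \<in> S \<Longrightarrow> ?P c h0" by blast
  obtain q0 :: nat where q0: "real q0 > \<eta> / h0" using reals_Archimedean2 by blast
  show ?thesis
  proof (intro exI[of _ q0] allI impI)
    fix q assume "q0 \<le> q"
    define h where "h = \<eta> / real (Suc q)"
    have hpos: "h > 0" using \<eta> by (simp add: h_def)
    have "real (Suc q) > \<eta> / h0" using q0 \<open>q0 \<le> q\<close> by linarith
    then have hh0: "h \<le> h0" using h0(1) by (simp add: h_def field_simps)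
    let ?n = "d * Suc q"
    let ?g = "\<lambda>k. ennreal \<rho> + ennreal (L\<^sup>2) * eul_err R h k"
    have nh: "real ?n * h = real d * \<eta>" unfolding h_def by (rule grid_cancel) simp
    then have nhT: "real ?n * h \<le> T" using dT s by simp
    have step: "eul_err R h l \<le> ennreal C * ennreal h * (\<Sum>k<l. ?g k)" if "l \<le> ?n" for l
      unfolding C_def
    proof (rule euler_error_step[OF \<eta> zero_less_Suc[of q] h_def dT RS])
      show "0 \<le> \<rho>" using \<rho>0 by simp
      fix i u v assume "i < D" "s \<le> u" "u \<le> v" "v \<le> T" "v - u \<le> h"
      then show "(\<integral>\<^sup>+\<omega>. indicator (G R v) \<omega> * ennreal ((a v (Y v \<omega>) i - a u (Y u \<omega>) i)\<^sup>2) \<partial>M) \<le> ennreal \<rho>"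
        using h0(2)[of "\<lambda>t x. a t x i"] hh0 by (auto simp: S_def)
    next
      fix i j u v assume "i < D" "j < D" "s \<le> u" "u \<le> v" "v \<le> T" "v - u \<le> h"
      then show "(\<integral>\<^sup>+\<omega>. indicator (G R v) \<omega> * ennreal ((b v (Y v \<omega>) i j - b u (Y u \<omega>) i j)\<^sup>2) \<partial>M) \<le> ennreal \<rho>"
        using h0(2)[of "\<lambda>t x. b t x i j"] hh0 by (force simp: S_def)
    qed (use that in auto)
    have g: "?g k \<le> ennreal (\<rho> * exp (L\<^sup>2 * C * T))" if k: "k \<le> ?n" for k
    proof -
      have "?g k \<le> ennreal \<rho> * (1 + ennreal (L\<^sup>2) * ennreal C * ennreal h) ^ k"
        by (rule discrete_gronwall[where n="?n"]) (use step k in auto)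
      also have "\<dots> = ennreal (\<rho> * (1 + L\<^sup>2 * C * h) ^ k)"
      proof -
        have eq: "1 + ennreal (L\<^sup>2) * ennreal C * ennreal h = ennreal (1 + L\<^sup>2 * C * h)"
          using C0 hpos by (simp add: ennreal_mult ennreal_plus)
        have nn: "0 \<le> 1 + L\<^sup>2 * C * h" using C0 hpos by simp
        show ?thesis
          unfolding eq ennreal_power[OF nn] using \<rho>0 nn by (intro ennreal_mult[symmetric]) auto
      qed
      also have "\<dots> \<le> ennreal (\<rho> * exp (L\<^sup>2 * C * T))"
      proof (intro ennreal_leI mult_left_mono)
        have "(1 + L\<^sup>2 * C * h) ^ k \<le> exp (L\<^sup>2 * C * h) ^ k"
          using C0 hpos by (intro power_mono exp_ge_add_one_self) auto
        also have "\<dots> = exp (L\<^sup>2 * C * (real k * h))" by (simp add: exp_of_nat_mult mult_ac flip: exp_of_nat_mult)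
        also have "\<dots> \<le> exp (L\<^sup>2 * C * T)"
        proof -
          have "real k * h \<le> real ?n * h" using k hpos by (intro mult_right_mono of_nat_mono) auto
          then show ?thesis using nhT C0 by (simp add: mult_left_mono)
        qed
        finally show "(1 + L\<^sup>2 * C * h) ^ k \<le> exp (L\<^sup>2 * C * T)" .
      qed (use \<rho>0 in simp)
      finally show ?thesis .
    qed
    have "eul_err R h ?n \<le> ennreal C * ennreal h * (\<Sum>k<?n. ?g k)" by (rule step) simp
    also have "\<dots> \<le> ennreal C * ennreal h * (\<Sum>k<?n. ennreal (\<rho> * exp (L\<^sup>2 * C * T)))"
      by (intro mult_left_mono sum_mono g) auto
    also have "\<dots> = ennreal (C * (real ?n * h) * (\<rho> * exp (L\<^sup>2 * C * T)))"
      using C0 hpos \<rho>0 by (simp add: ennreal_of_nat_eq_real_of_nat ennreal_mult mult_ac)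
    also have "\<dots> \<le> ennreal e"
    proof (rule ennreal_leI)
      have "C * (real ?n * h) * (\<rho> * exp (L\<^sup>2 * C * T)) \<le> C * T * (\<rho> * exp (L\<^sup>2 * C * T))"
        using C0 nhT \<rho>0 by (intro mult_right_mono mult_left_mono) auto
      then show "C * (real ?n * h) * (\<rho> * exp (L\<^sup>2 * C * T)) \<le> e" using \<rho>e by linarith
    qed
    finally show "eul_err R (\<eta> / real (Suc q)) (d * Suc q) \<le> ennreal e" by (simp add: h_def)
  qed
qed

lemma eul_meas_M: "0 \<le> h \<Longrightarrow> s + real l * h \<le> T \<Longrightarrow> (\<lambda>\<omega>. eul s h l (Y s \<omega>) \<omega>) \<in> measurable M borel"
  using F_meas[OF eul_adapted] by auto

text \<open>For bounded \<open>\<psi>\<close> the localisation can be removed: off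
  \<open>G R\<close> boundedness and a small probability suffice, on \<open>G R\<close> the
  Lipschitz bound reduces the claim to \<open>eul_err\<close>. The radius \<open>R\<close> is fixed
  before the step is refined.\<close>

lemma euler_weak_convergence:
  assumes \<eta>: "\<eta> > 0" and dT: "s + real d * \<eta> \<le> T" and RS: "riemann_sol s \<eta> d Y"
    and \<psi>: "\<psi> \<in> borel_measurable borel" "\<And>x. \<bar>\<psi> x\<bar> \<le> B"
    and lip: "\<Lambda> \<ge> 0" "\<And>x y. x \<in> vspace D \<Longrightarrow> y \<in> vspace D \<Longrightarrow> (\<psi> x - \<psi> y)\<^sup>2 \<le> \<Lambda> * (\<Sum>i<D. (x i - y i)\<^sup>2)"
  shows "(\<lambda>q. \<integral>\<omega>. (\<psi> (Y (s + real d * \<eta>) \<omega>) - \<psi> (eul s (\<eta> / real (Suc q)) (d * Suc q) (Y s \<omega>) \<omega>))\<^sup>2 \<partial>M) \<longlonglongrightarrow> 0"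
proof (rule LIMSEQ_I)
  fix e :: real assume e: "e > 0"
  let ?t = "s + real d * \<eta>"
  have st: "s \<le> ?t" using \<eta> by simp
  have B0: "B \<ge> 0" using \<psi>(2)[of undefined] by linarith
  define e1 where "e1 = e / 4 / (4 * B\<^sup>2 + 1)"
  define e2 where "e2 = e / 4 / (\<Lambda> + 1)"
  have e12: "e1 > 0" "e2 > 0" "4 * B\<^sup>2 * e1 \<le> e / 4" "\<Lambda> * e2 \<le> e / 4"
  proof -
    have p: "4 * B\<^sup>2 + 1 > 0" "\<Lambda> + 1 > 0" using lip by (auto intro: add_nonneg_pos)
    show "e1 > 0" "e2 > 0" using e p by (auto simp: e1_def e2_def)
    have "4 * B\<^sup>2 * e1 = e / 4 * (4 * B\<^sup>2 / (4 * B\<^sup>2 + 1))" unfolding e1_def by (simp only: times_divide_eq_right mult.commute)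
    also have "\<dots> \<le> e / 4 * 1" using e p by (intro mult_left_mono) auto
    finally show "4 * B\<^sup>2 * e1 \<le> e / 4" by simp
    have "\<Lambda> * e2 = e / 4 * (\<Lambda> / (\<Lambda> + 1))" by (simp add: e2_def mult.commute)
    also have "\<dots> \<le> e / 4 * 1" using e p lip by (intro mult_left_mono) auto
    finally show "\<Lambda> * e2 \<le> e / 4" by simp
  qed
  obtain R :: nat where R: "prob (space M - G (real R) ?t) < e1"
    using LIMSEQ_D[OF prob_G_tendsto[OF st dT] e12(1)] by (metis diff_zero measure_nonneg order_refl real_norm_def abs_of_nonneg)
  obtain q0 where q0: "\<And>q. q \<ge> q0 \<Longrightarrow> eul_err (real R) (\<eta> / real (Suc q)) (d * Suc q) \<le> ennreal e2"
    using eul_err_bound[OF \<eta> dT RS e12(2)] by blast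
  show "\<exists>q0. \<forall>q\<ge>q0. norm ((\<integral>\<omega>. (\<psi> (Y ?t \<omega>) - \<psi> (eul s (\<eta> / real (Suc q)) (d * Suc q) (Y s \<omega>) \<omega>))\<^sup>2 \<partial>M) - 0) < e"
  proof (intro exI[of _ q0] allI impI)
    fix q assume q: "q \<ge> q0"
    let ?h = "\<eta> / real (Suc q)" and ?n = "d * Suc q"
    have nh: "s + real ?n * ?h = ?t" by (simp only: grid_cancel[OF zero_less_Suc])
    let ?E = "\<lambda>\<omega>. eul s ?h ?n (Y s \<omega>) \<omega>" and ?G = "G (real R) ?t"
    have h0: "0 \<le> ?h" using \<eta> by simp
    have Em [measurable]: "?E \<in> measurable M borel" by (rule eul_meas_M) (use h0 nh dT in auto)
    have Ym [measurable]: "Y ?t \<in> measurable M borel" using Y_meas[OF st dT] .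
    have [measurable]: "?G \<in> events" using G_events[OF st dT] .
    note \<psi>(1)[measurable]
    have "(\<integral>\<^sup>+\<omega>. ennreal ((\<psi> (Y ?t \<omega>) - \<psi> (?E \<omega>))\<^sup>2) \<partial>M) \<le>
       (\<integral>\<^sup>+\<omega>. ennreal \<Lambda> * (indicator ?G \<omega> * ennreal (\<Sum>i<D. (Y ?t \<omega> i - ?E \<omega> i)\<^sup>2)) + ennreal (4 * B\<^sup>2) * indicator (space M - ?G) \<omega> \<partial>M)"
    proof (rule nn_integral_mono)
      fix \<omega> assume w: "\<omega> \<in> space M"
      have v: "Y ?t \<omega> \<in> vspace D" "?E \<omega> \<in> vspace D" using Y_vspace[OF _ _ w] eul_vspace st dT by auto
      show "ennreal ((\<psi> (Y ?t \<omega>) - \<psi> (?E \<omega>))\<^sup>2) \<le> ennreal \<Lambda> * (indicator ?G \<omega> * ennreal (\<Sum>i<D. (Y ?t \<omega> i - ?E \<omega> i)\<^sup>2)) + ennreal (4 * B\<^sup>2) * indicator (space M - ?G) \<omega>"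
      proof (cases "\<omega> \<in> ?G")
        case True
        have "ennreal ((\<psi> (Y ?t \<omega>) - \<psi> (?E \<omega>))\<^sup>2) \<le> ennreal (\<Lambda> * (\<Sum>i<D. (Y ?t \<omega> i - ?E \<omega> i)\<^sup>2))" by (intro ennreal_leI lip v)
        then show ?thesis using True lip by (simp add: ennreal_mult sum_nonneg)
      next
        case False
        have "\<bar>\<psi> (Y ?t \<omega>) - \<psi> (?E \<omega>)\<bar> \<le> \<bar>2 * B\<bar>" using \<psi>(2)[of "Y ?t \<omega>"] \<psi>(2)[of "?E \<omega>"] by linarith
        then have "(\<psi> (Y ?t \<omega>) - \<psi> (?E \<omega>))\<^sup>2 \<le> (2 * B)\<^sup>2" by (simp only: abs_le_square_iff)
        then have "ennreal ((\<psi> (Y ?t \<omega>) - \<psi> (?E \<omega>))\<^sup>2) \<le> ennreal (4 * B\<^sup>2)" by (intro ennreal_leI) (simp add: power_mult_distrib)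
        then show ?thesis using False w by simp
      qed
    qed
    also have "\<dots> = ennreal \<Lambda> * eul_err (real R) ?h ?n + ennreal (4 * B\<^sup>2) * emeasure M (space M - ?G)"
      unfolding eul_err_def nh
    proof -
      have m1: "(\<lambda>\<omega>. indicator ?G \<omega> * ennreal (\<Sum>i<D. (Y ?t \<omega> i - ?E \<omega> i)\<^sup>2)) \<in> borel_measurable M" by measurable
      have m2: "indicator (space M - ?G) \<in> borel_measurable M" by measurable
      show "(\<integral>\<^sup>+\<omega>. ennreal \<Lambda> * (indicator ?G \<omega> * ennreal (\<Sum>i<D. (Y ?t \<omega> i - ?E \<omega> i)\<^sup>2)) + ennreal (4 * B\<^sup>2) * indicator (space M - ?G) \<omega> \<partial>M)
        = ennreal \<Lambda> * (\<integral>\<^sup>+\<omega>. indicator ?G \<omega> * ennreal (\<Sum>i<D. (Y ?t \<omega> i - ?E \<omega> i)\<^sup>2) \<partial>M) + ennreal (4 * B\<^sup>2) * emeasure M (space M - ?G)"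
        unfolding nn_integral_add[OF borel_measurable_times_ennreal[OF borel_measurable_const m1] borel_measurable_times_ennreal[OF borel_measurable_const m2]]
          nn_integral_cmult[OF m1] nn_integral_cmult[OF m2] by simp
    qed
    also have "\<dots> \<le> ennreal \<Lambda> * ennreal e2 + ennreal (4 * B\<^sup>2) * ennreal e1"
    proof (intro add_mono mult_left_mono)
      show "emeasure M (space M - ?G) \<le> ennreal e1"
        using R by (subst emeasure_eq_measure) (auto intro!: ennreal_leI)
    qed (use q0[OF q] in auto)
    also have "\<dots> = ennreal (\<Lambda> * e2 + 4 * B\<^sup>2 * e1)"
      using lip e12 by (subst ennreal_plus) (auto simp: ennreal_mult)
    also have "\<dots> \<le> ennreal (e / 2)" using e12 by (intro ennreal_leI) linarith
    finally have b: "(\<integral>\<^sup>+\<omega>. ennreal ((\<psi> (Y ?t \<omega>) - \<psi> (?E \<omega>))\<^sup>2) \<partial>M) \<le> ennreal (e / 2)" .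
    have "(\<integral>\<omega>. (\<psi> (Y ?t \<omega>) - \<psi> (?E \<omega>))\<^sup>2 \<partial>M) = enn2real (\<integral>\<^sup>+\<omega>. ennreal ((\<psi> (Y ?t \<omega>) - \<psi> (?E \<omega>))\<^sup>2) \<partial>M)"
      by (rule integral_eq_nn_integral)
        (intro borel_measurable_power borel_measurable_diff measurable_compose[OF Ym \<psi>(1)] measurable_compose[OF Em \<psi>(1)], simp)
    also have "\<dots> \<le> enn2real (ennreal (e / 2))" by (rule enn2real_mono[OF b]) simp
    finally have "(\<integral>\<omega>. (\<psi> (Y ?t \<omega>) - \<psi> (?E \<omega>))\<^sup>2 \<partial>M) < e" using e by simp
    moreover have "(\<integral>\<omega>. (\<psi> (Y ?t \<omega>) - \<psi> (?E \<omega>))\<^sup>2 \<partial>M) \<ge> 0" by (intro Bochner_Integration.integral_nonneg) auto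
    ultimately show "norm ((\<integral>\<omega>. (\<psi> (Y ?t \<omega>) - \<psi> (?E \<omega>))\<^sup>2 \<partial>M) - 0) < e" by simp
  qed
qed

end

section \<open>Solutions restarted on a grid\<close>

context sde
begin

lemma sde_sol_process:
  assumes sol: "sde_sol M D W a b s0 x T Y" and s: "0 \<le> s0" "s0 \<le> s"
  shows "sde_process M D T W a b L s Y"
proof unfold_locales
  show "0 \<le> s" using s by simp
  fix u \<omega> assume "s \<le> u" "u \<le> T" "\<omega> \<in> space M"
  then show "Y u \<omega> \<in> vspace D" using sol s unfolding sde_sol_def by auto
next
  fix \<omega> assume "\<omega> \<in> space M"
  then show "continuous_on {s..T} (\<lambda>u. Y u \<omega>)"
    using sol s unfolding sde_sol_def by (auto intro: continuous_on_subset)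
next
  fix u i assume "s \<le> u" "u \<le> T"
  then show "(\<lambda>\<omega>. Y u \<omega> i) \<in> borel_measurable (F u)"
    using sol s unfolding sde_sol_def by auto
qed

text \<open>Besides convergence for every path, the Riemann sums give measurability of the pathwise
  drift integral as their limit.\<close>

lemma drift_integral:
  assumes sol: "sde_sol M D W a b s0 x T Y" and su: "0 \<le> s0" "s0 \<le> u" "u \<le> v" "v \<le> T"
    and n: "filterlim n at_top sequentially" "\<And>r. n r > 0"
  shows "\<And>\<omega>. \<omega> \<in> space M \<Longrightarrow> (\<lambda>r. (\<Sum>l<n r. a (u + real l * ((v - u) / real (n r))) (Y (u + real l * ((v - u) / real (n r))) \<omega>) i * ((v - u) / real (n r))))
     \<longlonglongrightarrow> integral {u..v} (\<lambda>t. a t (Y t \<omega>) i)"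
    and "(\<lambda>\<omega>. integral {u..v} (\<lambda>t. a t (Y t \<omega>) i)) \<in> borel_measurable M"
    and "\<And>r. (\<lambda>\<omega>. (\<Sum>l<n r. a (u + real l * ((v - u) / real (n r))) (Y (u + real l * ((v - u) / real (n r))) \<omega>) i * ((v - u) / real (n r)))) \<in> borel_measurable M"
proof -
  interpret sde_process M D T W a b L s0 Y by (rule sde_sol_process[OF sol]) (use su in auto)
  show 1: "(\<lambda>r. (\<Sum>l<n r. a (u + real l * ((v - u) / real (n r))) (Y (u + real l * ((v - u) / real (n r))) \<omega>) i * ((v - u) / real (n r))))
     \<longlonglongrightarrow> integral {u..v} (\<lambda>t. a t (Y t \<omega>) i)" if "\<omega> \<in> space M" for \<omega>
  proof (rule riemann_sum_tendsto[OF su(3) _ n])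
    have "continuous_on {s0..T} (\<lambda>t. a t (Y t \<omega>) i)"
      using lip_coeff_path_continuous[OF a_lip su(1) Y_cont[OF that]] Y_vspace that by auto
    then show "continuous_on {u..v} (\<lambda>t. a t (Y t \<omega>) i)" by (rule continuous_on_subset) (use su in auto)
  qed
  show 2: "(\<lambda>\<omega>. (\<Sum>l<n r. a (u + real l * ((v - u) / real (n r))) (Y (u + real l * ((v - u) / real (n r))) \<omega>) i * ((v - u) / real (n r)))) \<in> borel_measurable M" for r
  proof (intro borel_measurable_sum borel_measurable_times borel_measurable_const)
    fix l assume l: "l \<in> {..<n r}"
    have "real l * ((v - u) / real (n r)) \<le> real (n r) * ((v - u) / real (n r))" using l su by (intro mult_right_mono) auto
    also have "\<dots> = v - u" using n(2)[of r] by simp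
    finally have le: "u + real l * ((v - u) / real (n r)) \<le> T" "0 \<le> real l * ((v - u) / real (n r))" using su by auto
    have ge: "0 \<le> u + real l * ((v - u) / real (n r))" "s0 \<le> u + real l * ((v - u) / real (n r))" using le su by linarith+
    show "(\<lambda>\<omega>. a (u + real l * ((v - u) / real (n r))) (Y (u + real l * ((v - u) / real (n r))) \<omega>) i) \<in> borel_measurable M"
      by (rule lip_coeff_comp_measurable[OF a_lip ge(1) le(1) Y_meas[OF ge(2) le(1)] Y_vspace[OF ge(2) le(1)]])
  qed
  show "(\<lambda>\<omega>. integral {u..v} (\<lambda>t. a t (Y t \<omega>) i)) \<in> borel_measurable M"
    by (rule borel_measurable_LIMSEQ_real[OF 1 2])
qed

text \<open>The notion of solution uses partitions of \<open>[s0, t]\<close> into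
  \<open>Suc m\<close> equal parts. At the end time \<open>s0 + n * h\<close> the subsequence with
  \<open>Suc m = n * Suc r\<close> has mesh \<open>h / Suc r\<close>, the same for all
  \<open>n\<close>, which makes sums up to different end times nested.\<close>

lemma sde_sol_grid:
  assumes sol: "sde_sol M D W a b s0 x T Y" and s0: "0 \<le> s0" and h: "h > 0" and n: "s0 + real n * h \<le> T" and i: "i < D"
  shows "null_in_prob M (\<lambda>r \<omega>. Y (s0 + real n * h) \<omega> i - x i - integral {s0..s0 + real n * h} (\<lambda>u. a u (Y u \<omega>) i)
     - (\<Sum>l<n * Suc r. \<Sum>j<D. b (s0 + real l * (h / real (Suc r))) (Y (s0 + real l * (h / real (Suc r))) \<omega>) i j
        * \<Delta> (s0 + real l * (h / real (Suc r))) (s0 + real (Suc l) * (h / real (Suc r))) j \<omega>))"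
proof -
  let ?t = "s0 + real n * h"
  have t: "?t \<in> {s0..T}" using h n by simp
  have N: "null_in_prob M (\<lambda>m \<omega>. Y ?t \<omega> i - x i - integral {s0..?t} (\<lambda>u. a u (Y u \<omega>) i)
            - (\<Sum>l<Suc m. \<Sum>j<D.
                 b (s0 + real l * (?t - s0) / real (Suc m)) (Y (s0 + real l * (?t - s0) / real (Suc m)) \<omega>) i j
                 * (W (s0 + real (Suc l) * (?t - s0) / real (Suc m)) \<omega> j
                    - W (s0 + real l * (?t - s0) / real (Suc m)) \<omega> j)))"
    using sol t i unfolding sde_sol_def null_in_prob_def by blast
  show ?thesis
  proof (cases "n = 0")
    case True
    then show ?thesis using N by simp
  next
    case False
    \<comment> \<open>The subtracted 1 is undone by the \<open>Suc\<close> in the number of parts,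
      exactly because \<open>n\<close> is positive here.\<close>
    have "filterlim (\<lambda>r. n * Suc r - 1) at_top sequentially"
    proof (rule filterlim_at_top_mono[OF filterlim_ident])
      have "r \<le> n * Suc r - 1" for r using False by (cases n) auto
      then show "\<forall>\<^sub>F r in sequentially. r \<le> n * Suc r - 1" by simp
    qed
    from null_in_prob_subseq[OF N this]
    show ?thesis
    proof (rule back_subst[of "null_in_prob M"], intro ext)
      fix r \<omega>
      have S: "Suc (n * Suc r - 1) = n * Suc r" using False by simp
      have p: "real l * (?t - s0) / real (n * Suc r) = real l * (h / real (Suc r))" for l
      proof -
        have "x * (N * y) / (N * m) = x * (y / m)" if "N \<noteq> 0" for x y N m :: real using that by simp
        from this[of "real n" "real l" h "real (Suc r)"] show ?thesis using False by (simp only: of_nat_mult add_diff_cancel_left' of_nat_eq_0_iff not_False_eq_True)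
      qed
      show "Y ?t \<omega> i - x i - integral {s0..?t} (\<lambda>u. a u (Y u \<omega>) i)
            - (\<Sum>l<Suc (n * Suc r - 1). \<Sum>j<D.
                 b (s0 + real l * (?t - s0) / real (Suc (n * Suc r - 1))) (Y (s0 + real l * (?t - s0) / real (Suc (n * Suc r - 1))) \<omega>) i j
                 * (W (s0 + real (Suc l) * (?t - s0) / real (Suc (n * Suc r - 1))) \<omega> j
                    - W (s0 + real l * (?t - s0) / real (Suc (n * Suc r - 1))) \<omega> j)) =
       Y (s0 + real n * h) \<omega> i - x i - integral {s0..s0 + real n * h} (\<lambda>u. a u (Y u \<omega>) i)
     - (\<Sum>l<n * Suc r. \<Sum>j<D. b (s0 + real l * (h / real (Suc r))) (Y (s0 + real l * (h / real (Suc r))) \<omega>) i j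
        * \<Delta> (s0 + real l * (h / real (Suc r))) (s0 + real (Suc l) * (h / real (Suc r))) j \<omega>)"
        unfolding S p ..
    qed
  qed
qed

text \<open>The initial value is implicit in the notion of solution: at \<open>t = s0\<close> the
  integral and all sums vanish, so the condition says that the constant sequence with value
  \<open>Y s0 \<omega> i - x i\<close> tends to zero in probability.\<close>

lemma sde_sol_start:
  assumes sol: "sde_sol M D W a b s0 x T Y" and s0: "0 \<le> s0" "s0 \<le> T" and x: "x \<in> vspace D"
  shows "AE \<omega> in M. Y s0 \<omega> = x"
proof -
  interpret sde_process M D T W a b L s0 Y by (rule sde_sol_process[OF sol]) (use s0 in auto)
  note m [measurable] = Y_meas[OF order_refl s0(2)]
  have "AE \<omega> in M. Y s0 \<omega> i - x i = 0" if "i < D" for i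
  proof -
    have "null_in_prob M (\<lambda>r \<omega>. Y s0 \<omega> i - x i)"
      using sde_sol_grid[OF sol s0(1) zero_less_one, of 0] s0 that by simp
    then have z: "prob {\<omega>\<in>space M. \<bar>Y s0 \<omega> i - x i\<bar> > e} = 0" if "e > 0" for e
      using that LIMSEQ_unique[OF tendsto_const] unfolding null_in_prob_def by blast
    have "AE \<omega> in M. \<forall>n::nat. \<not> \<bar>Y s0 \<omega> i - x i\<bar> > inverse (real (Suc n))"
      unfolding AE_all_countable
    proof
      fix n
      have "prob {\<omega>\<in>space M. \<bar>Y s0 \<omega> i - x i\<bar> > inverse (real (Suc n))} = 0" by (rule z) simp
      then show "AE \<omega> in M. \<not> \<bar>Y s0 \<omega> i - x i\<bar> > inverse (real (Suc n))"
        by (subst AE_iff_measurable[OF _ refl]) (auto simp: emeasure_eq_measure)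
    qed
    then show ?thesis
    proof eventually_elim
      case (elim \<omega>)
      show ?case
      proof (rule ccontr)
        assume "\<not> ?thesis"
        then have "0 < \<bar>Y s0 \<omega> i - x i\<bar>" by simp
        from reals_Archimedean[OF this] elim show False by auto
      qed
    qed
  qed
  then have "AE \<omega> in M. \<forall>i\<in>{..<D}. Y s0 \<omega> i - x i = 0" by (subst AE_ball_countable) auto
  then show ?thesis using AE_space
  proof eventually_elim
    case (elim \<omega>)
    have "Y s0 \<omega> \<in> vspace D" using Y_vspace s0 elim by auto
    show ?case
    proof
      fix i
      show "Y s0 \<omega> i = x i"
        using elim \<open>Y s0 \<omega> \<in> vspace D\<close> x by (cases "i < D") (auto simp: vspace_def)
    qed
  qed
qed

text \<open>Subtracting the statements for the two end times removes the part before
  \<open>s\<close>, provided both use the same mesh; this is why \<open>s - s0\<close> has to be a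
  multiple of \<open>\<eta>\<close>. The remaining drift integral is exchanged for its Riemann sum,
  which converges for every path.\<close>

lemma sde_sol_riemann:
  assumes sol: "sde_sol M D W a b s0 x T Y" and s0: "0 \<le> s0" and \<eta>: "\<eta> > 0" and seq: "s = s0 + real j * \<eta>"
    and d: "s + real d * \<eta> \<le> T"
  shows "riemann_sol s \<eta> d Y"
  unfolding riemann_sol_def
proof (intro allI impI)
  fix q p i assume q: "q > (0::nat)" and p: "p \<le> d * q" and i: "i < D"
  have ss0: "s0 \<le> s" using seq \<eta> by simp
  interpret sde_process M D T W a b L s0 Y by (rule sde_sol_process[OF sol s0]) simp
  let ?h = "\<eta> / real q"
  let ?t = "s + real p * ?h"
  \<comment> \<open>The number of steps of mesh \<open>\<eta> / q\<close> that lead from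
    \<open>s0\<close> to \<open>s\<close>.\<close>
  define n where "n = j * q"
  have h: "?h > 0" using \<eta> q by simp
  have sn: "s = s0 + real n * ?h" using q by (simp add: seq n_def)
  have tn: "?t = s0 + real (n + p) * ?h" unfolding sn by (simp only: of_nat_add distrib_right add.assoc)
  have "real p * ?h \<le> real (d * q) * ?h" using p h by (intro mult_right_mono of_nat_mono) auto
  also have "\<dots> = real d * \<eta>" using q by simp
  finally have tT: "?t \<le> T" using d by simp
  have sT: "s \<le> T" using tT h by (smt (verit) mult_nonneg_nonneg of_nat_0_le_iff)
  let ?d = "\<lambda>r. ?h / real (Suc r)"
  let ?f = "\<lambda>r \<omega> l. \<Sum>j<D. b (s0 + real l * ?d r) (Y (s0 + real l * ?d r) \<omega>) i j * \<Delta> (s0 + real l * ?d r) (s0 + real (Suc l) * ?d r) j \<omega>"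
  let ?I = "\<lambda>u v \<omega>. integral {u..v} (\<lambda>t. a t (Y t \<omega>) i)"
  let ?E1 = "\<lambda>r \<omega>. Y ?t \<omega> i - x i - ?I s0 ?t \<omega> - (\<Sum>l<(n + p) * Suc r. ?f r \<omega> l)"
  let ?E2 = "\<lambda>r \<omega>. Y s \<omega> i - x i - ?I s0 s \<omega> - (\<Sum>l<n * Suc r. ?f r \<omega> l)"
  let ?A = "\<lambda>r \<omega>. \<Sum>k<p * Suc r. a (s + real k * ?d r) (Y (s + real k * ?d r) \<omega>) i * ?d r"
  have E1: "null_in_prob M ?E1" using sde_sol_grid[OF sol s0 h, of "n + p"] tT i unfolding tn by blast
  have E2: "null_in_prob M ?E2" using sde_sol_grid[OF sol s0 h, of n] sT i unfolding sn[symmetric] by blast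
  show "null_in_prob M (\<lambda>r \<omega>. Y ?t \<omega> i - Y s \<omega> i -
     (\<Sum>k<p * Suc r. a (s + real k * ?d r) (Y (s + real k * ?d r) \<omega>) i * ?d r
    + (\<Sum>j<D. b (s + real k * ?d r) (Y (s + real k * ?d r) \<omega>) i j * \<Delta> (s + real k * ?d r) (s + real (Suc k) * ?d r) j \<omega>)))"
  proof (cases "p = 0")
    case True
    then show ?thesis by (simp add: null_in_prob_def)
  next
    case False
    have pn: "filterlim (\<lambda>r. p * Suc r) at_top sequentially"
    proof (rule filterlim_at_top_mono[OF filterlim_ident])
      have "r \<le> p * Suc r" for r using False by (cases p) auto
      then show "\<forall>\<^sub>F r in sequentially. r \<le> p * Suc r" by simp
    qed
    have ppos: "p * Suc r > 0" for r using False by simp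
    have st: "s \<le> ?t" using mult_nonneg_nonneg[of "real p" ?h] h by linarith
    have dd: "(?t - s) / real (p * Suc r) = ?d r" for r
    proof -
      have "(N * y) / (N * m) = y / m" if "N \<noteq> 0" for y N m :: real using that by simp
      from this[of "real p" ?h "real (Suc r)"] show ?thesis
        using False by (simp only: of_nat_mult add_diff_cancel_left' of_nat_eq_0_iff not_False_eq_True)
    qed
    note dr = drift_integral[where i=i, OF sol s0 ss0 st tT pn ppos, unfolded dd]
    note dr1 = drift_integral(2)[OF sol s0 order_refl ss0 sT pn ppos]
    note dr2 = drift_integral(2)[OF sol s0 order_refl order_trans[OF ss0 st] tT pn ppos]
    have Ym: "(\<lambda>\<omega>. Y u \<omega> i) \<in> borel_measurable M" if "s0 \<le> u" "u \<le> T" for u i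
      using measurable_compose[OF Y_meas[OF that] coord_measurable] .
    have d0: "0 < ?d r" for r using h by (rule divide_pos_pos) simp
    have fm: "(\<lambda>\<omega>. ?f r \<omega> l) \<in> borel_measurable M" if "l < (n + p) * Suc r" for r l
    proof (intro borel_measurable_sum borel_measurable_times borel_measurable_diff)
      have "real (Suc l) * ?d r \<le> real ((n + p) * Suc r) * ?d r" using that d0[of r] by (intro mult_right_mono of_nat_mono) auto
      also have "\<dots> = real (n + p) * ?h" by (rule grid_cancel) simp
      finally have le: "s0 + real (Suc l) * ?d r \<le> T" using tT tn by simp
      have ge: "0 \<le> real l * ?d r" "real l * ?d r \<le> real (Suc l) * ?d r"
        using d0[of r] by (intro mult_right_mono mult_nonneg_nonneg of_nat_mono; simp add: less_imp_le)+
      fix j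
      show "(\<lambda>\<omega>. b (s0 + real l * ?d r) (Y (s0 + real l * ?d r) \<omega>) i j) \<in> borel_measurable M"
        using s0 ge le Y_meas Y_vspace by (intro lip_coeff_comp_measurable[OF b_lip]) auto
      show "(\<lambda>\<omega>. W (s0 + real (Suc l) * ?d r) \<omega> j) \<in> borel_measurable M" "(\<lambda>\<omega>. W (s0 + real l * ?d r) \<omega> j) \<in> borel_measurable M"
        using s0 ge le by (auto intro!: W_meas simp del: of_nat_Suc)
    qed
    have mono: "n * Suc r \<le> (n + p) * Suc r" for r by (intro mult_le_mono1) simp
    have sm: "(\<lambda>\<omega>. \<Sum>l<k. ?f r \<omega> l) \<in> borel_measurable M" if "k \<le> (n + p) * Suc r" for k r
      by (rule borel_measurable_sum, rule fm) (use that in auto)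
    have mE1: "?E1 r \<in> borel_measurable M" for r
      by (rule borel_measurable_diff[OF borel_measurable_diff[OF borel_measurable_diff[OF Ym borel_measurable_const] dr2] sm])
         (use st tT ss0 in auto)
    have mE2: "?E2 r \<in> borel_measurable M" for r
      by (rule borel_measurable_diff[OF borel_measurable_diff[OF borel_measurable_diff[OF Ym borel_measurable_const] dr1] sm])
         (use sT ss0 mono in auto)
    have mA: "(\<lambda>\<omega>. ?I s ?t \<omega> - ?A r \<omega>) \<in> borel_measurable M" for r using dr(2,3) by auto
    have "null_in_prob M (\<lambda>r \<omega>. ?I s ?t \<omega> - ?A r \<omega>)"
    proof (rule null_in_prob_pointwise[OF mA])
      fix \<omega> assume w: "\<omega> \<in> space M"
      from tendsto_diff[OF tendsto_const dr(1)[OF w], of "?I s ?t \<omega>"]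
      show "(\<lambda>r. ?I s ?t \<omega> - ?A r \<omega>) \<longlonglongrightarrow> 0" by (simp only: diff_self)
    qed
    from null_in_prob_add[OF borel_measurable_add[OF mE1 borel_measurable_uminus[OF mE2]] mA
         null_in_prob_add[OF mE1 borel_measurable_uminus[OF mE2] E1 null_in_prob_minus[OF E2]] this]
    have N: "null_in_prob M (\<lambda>r \<omega>. ?E1 r \<omega> + - ?E2 r \<omega> + (?I s ?t \<omega> - ?A r \<omega>))" .
    have eq: "?E1 r \<omega> + - ?E2 r \<omega> + (?I s ?t \<omega> - ?A r \<omega>) = Y ?t \<omega> i - Y s \<omega> i -
     (\<Sum>k<p * Suc r. a (s + real k * ?d r) (Y (s + real k * ?d r) \<omega>) i * ?d r
    + (\<Sum>j<D. b (s + real k * ?d r) (Y (s + real k * ?d r) \<omega>) i j * \<Delta> (s + real k * ?d r) (s + real (Suc k) * ?d r) j \<omega>))"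
      if w: "\<omega> \<in> space M" for r \<omega>
    proof -
      have "(\<lambda>t. a t (Y t \<omega>) i) integrable_on {s0..?t}"
      proof (rule integrable_continuous_real)
        have "continuous_on {s0..T} (\<lambda>t. a t (Y t \<omega>) i)"
          using lip_coeff_path_continuous[OF a_lip s0 Y_cont[OF w]] Y_vspace w by auto
        then show "continuous_on {s0..?t} (\<lambda>t. a t (Y t \<omega>) i)" by (rule continuous_on_subset) (use tT in auto)
      qed
      from Henstock_Kurzweil_Integration.integral_combine[OF ss0 st this]
      have I: "?I s0 s \<omega> + ?I s ?t \<omega> = ?I s0 ?t \<omega>" .
      have pt: "s0 + real (n * Suc r + k) * ?d r = s + real k * ?d r" for k
      proof -
        have "real (n * Suc r) * ?d r = real n * ?h" by (rule grid_cancel) simp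
        then show ?thesis unfolding sn by (simp only: of_nat_add distrib_right add.assoc)
      qed
      have "(\<Sum>l<(n + p) * Suc r. ?f r \<omega> l) = (\<Sum>l<n * Suc r. ?f r \<omega> l) + (\<Sum>k<p * Suc r. ?f r \<omega> (n * Suc r + k))"
      proof -
        have "(\<Sum>k<u + v. g k) = (\<Sum>k<u. g k) + (\<Sum>k<v. g (u + k))" for u v and g :: "nat \<Rightarrow> real"
          by (induction v) (simp_all add: add.assoc)
        from this[of "?f r \<omega>" "n * Suc r" "p * Suc r"] show ?thesis by (simp only: distrib_right)
      qed
      also have "(\<Sum>k<p * Suc r. ?f r \<omega> (n * Suc r + k)) = (\<Sum>k<p * Suc r. \<Sum>j<D. b (s + real k * ?d r) (Y (s + real k * ?d r) \<omega>) i j * \<Delta> (s + real k * ?d r) (s + real (Suc k) * ?d r) j \<omega>)"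
        by (simp only: add_Suc_right[symmetric] pt)
      finally show ?thesis using I by (simp only: sum.distrib)
    qed
    have "prob {\<omega>\<in>space M. e < \<bar>?E1 r \<omega> + - ?E2 r \<omega> + (?I s ?t \<omega> - ?A r \<omega>)\<bar>} = prob {\<omega>\<in>space M. e < \<bar>Y ?t \<omega> i - Y s \<omega> i -
     (\<Sum>k<p * Suc r. a (s + real k * ?d r) (Y (s + real k * ?d r) \<omega>) i * ?d r
    + (\<Sum>j<D. b (s + real k * ?d r) (Y (s + real k * ?d r) \<omega>) i j * \<Delta> (s + real k * ?d r) (s + real (Suc k) * ?d r) j \<omega>))\<bar>}" for e r
      by (intro arg_cong[where f=prob] Collect_cong conj_cong refl) (simp only: eq)
    then show ?thesis using N unfolding null_in_prob_def by simp
  qed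
qed

end

section \<open>Freezing the starting point\<close>

text \<open>By independence the identity map, taken into \<open>A\<close> and into \<open>B\<close>
  jointly, has a product law, and Fubini applies. With both sigma-algebras on one space,
  \<open>k\<close> may depend on its first sample through the past and on its second through the
  increments.\<close>

lemma (in prob_space) freezing:
  fixes k :: "'a \<times> 'a \<Rightarrow> real"
  assumes ind: "indep_set (sets A) (sets B)" and sp: "space A = space M" "space B = space M"
    and k: "k \<in> borel_measurable (A \<Otimes>\<^sub>M B)" and int: "integrable M (\<lambda>\<omega>. k (\<omega>, \<omega>))"
  shows "(\<integral>\<omega>. k (\<omega>, \<omega>) \<partial>M) = (\<integral>\<omega>. (\<integral>\<omega>'. k (\<omega>, \<omega>') \<partial>M) \<partial>M)"
proof -
  let ?P = "distr M A (\<lambda>\<omega>. \<omega>)" and ?Q = "distr M B (\<lambda>\<omega>. \<omega>)"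
  have "indep_var A (\<lambda>\<omega>. \<omega>) B (\<lambda>\<omega>. \<omega>)"
    by (rule indep_var_subalgebras[OF ind sp]) auto
  then have rv: "(\<lambda>\<omega>. \<omega>) \<in> measurable M A" "(\<lambda>\<omega>. \<omega>) \<in> measurable M B"
    and eq: "?P \<Otimes>\<^sub>M ?Q = distr M (A \<Otimes>\<^sub>M B) (\<lambda>\<omega>. (\<omega>, \<omega>))"
    by (auto simp: indep_var_distribution_eq)
  interpret P: prob_space ?P by (rule prob_space_distr[OF rv(1)])
  interpret Q: prob_space ?Q by (rule prob_space_distr[OF rv(2)])
  interpret PQ: pair_prob_space ?P ?Q ..
  have diag: "(\<lambda>\<omega>. (\<omega>, \<omega>)) \<in> measurable M (A \<Otimes>\<^sub>M B)" using rv by (rule measurable_Pair)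
  have kQ: "(\<lambda>y. k (x, y)) \<in> borel_measurable B" if "x \<in> space A" for x
    using measurable_Pair2[OF k that] .
  have inner: "(\<integral>y. k (x, y) \<partial>?Q) = (\<integral>\<omega>'. k (x, \<omega>') \<partial>M)" if "x \<in> space A" for x
    by (rule integral_distr[OF rv(2) kQ[OF that]])
  have k': "case_prod (\<lambda>x y. k (x, y)) \<in> borel_measurable (A \<Otimes>\<^sub>M ?Q)"
    using k by (simp add: split_def cong: measurable_cong_sets sets_pair_measure_cong)
  have outer: "(\<lambda>x. \<integral>y. k (x, y) \<partial>?Q) \<in> borel_measurable A"
    by (rule Q.borel_measurable_lebesgue_integral[OF k'])
  have "(\<integral>\<omega>. k (\<omega>, \<omega>) \<partial>M) = (\<integral>z. k z \<partial>(?P \<Otimes>\<^sub>M ?Q))"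
    unfolding eq by (rule integral_distr[OF diag k, symmetric])
  also have "\<dots> = (\<integral>x. (\<integral>y. k (x, y) \<partial>?Q) \<partial>?P)"
  proof (rule PQ.integral_fst'[symmetric])
    show "integrable (?P \<Otimes>\<^sub>M ?Q) k" unfolding eq by (subst integrable_distr_eq[OF diag k]) (rule int)
  qed
  also have "\<dots> = (\<integral>x. (\<integral>y. k (x, y) \<partial>?Q) \<partial>M)"
    by (rule integral_distr[OF rv(1) outer])
  also have "\<dots> = (\<integral>\<omega>. (\<integral>\<omega>'. k (\<omega>, \<omega>') \<partial>M) \<partial>M)"
    by (rule Bochner_Integration.integral_cong[OF refl]) (simp add: inner sp)
  finally show ?thesis .
qed

text \<open>A weighted Cauchy-Schwarz bound: \<open>c\<close> balances the two squares and is so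
  large that the fixed second moment of \<open>U\<close> contributes less than
  \<open>e / 2\<close>.\<close>

lemma L2_null_product:
  fixes f :: "nat \<Rightarrow> 'a \<Rightarrow> real"
  assumes f: "\<And>q. f q \<in> borel_measurable M" "\<And>q. integrable M (\<lambda>x. (f q x)\<^sup>2)" "(\<lambda>q. \<integral>x. (f q x)\<^sup>2 \<partial>M) \<longlonglongrightarrow> 0"
    and U: "U \<in> borel_measurable M" "integrable M (\<lambda>x. (U x)\<^sup>2)"
  shows "(\<lambda>q. \<integral>x. f q x * U x \<partial>M) \<longlonglongrightarrow> 0"
proof (rule LIMSEQ_I)
  fix e :: real assume e: "e > 0"
  define K where "K = (\<integral>x. (U x)\<^sup>2 \<partial>M)"
  have K: "K \<ge> 0" unfolding K_def by (intro Bochner_Integration.integral_nonneg) auto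
  define c where "c = 2 * (K + 1) / e"
  have c: "c > 0" using K e by (simp add: c_def)
  have Kc: "K / c < e / 2" using K e by (simp add: c_def field_simps)
  have "e / 2 / c > 0" using e c by simp
  from LIMSEQ_D[OF f(3) this] obtain q0 where q0: "\<And>q. q \<ge> q0 \<Longrightarrow> \<bar>\<integral>x. (f q x)\<^sup>2 \<partial>M\<bar> < e / 2 / c" by auto
  show "\<exists>q0. \<forall>q\<ge>q0. norm ((\<integral>x. f q x * U x \<partial>M) - 0) < e"
  proof (intro exI[of _ q0] allI impI)
    fix q assume q: "q \<ge> q0"
    have ab: "\<bar>a * b\<bar> \<le> c * a\<^sup>2 + b\<^sup>2 / c" for a b :: real
    proof -
      have "\<bar>a * b\<bar> = \<bar>sqrt c * a\<bar> * \<bar>b / sqrt c\<bar>" using c by (simp add: abs_mult)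
      also have "\<dots> \<le> \<bar>sqrt c * a\<bar>\<^sup>2 + \<bar>b / sqrt c\<bar>\<^sup>2"
      proof -
        have "p * r \<le> p\<^sup>2 + r\<^sup>2" if "p \<ge> 0" "r \<ge> 0" for p r :: real
          using sum_squares_bound[of p r] mult_nonneg_nonneg[OF that] by (simp only: mult.assoc)
        from this[OF abs_ge_zero abs_ge_zero] show ?thesis .
      qed
      also have "\<dots> = c * a\<^sup>2 + b\<^sup>2 / c" using c by (simp add: power_mult_distrib power_divide)
      finally show ?thesis .
    qed
    have "\<bar>\<integral>x. f q x * U x \<partial>M\<bar> \<le> (\<integral>x. \<bar>f q x * U x\<bar> \<partial>M)"
      by (rule integral_abs_bound)
    also have "\<dots> \<le> (\<integral>x. c * (f q x)\<^sup>2 + (U x)\<^sup>2 / c \<partial>M)"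
      using f U by (intro integral_mono ab integrable_abs integrable_mult_of_squares Bochner_Integration.integrable_add integrable_mult_right integrable_divide_zero)
    also have "\<dots> = c * (\<integral>x. (f q x)\<^sup>2 \<partial>M) + K / c"
      using f U by (subst Bochner_Integration.integral_add) (auto simp: K_def)
    also have "\<dots> < c * (e / 2 / c) + e / 2"
      using q0[OF q] Kc c by (intro add_strict_mono mult_strict_left_mono) auto
    also have "\<dots> = e" using c by simp
    finally show "norm ((\<integral>x. f q x * U x \<partial>M) - 0) < e" by simp
  qed
qed

context sde
begin

lemma incr_meas_alg:
  assumes "k < m" "j < D"
  shows "\<Delta> (v k) (v (Suc k)) j \<in> borel_measurable (incr_alg v m)"
proof (rule measurableI)
  fix A :: "real set" assume "A \<in> sets borel"
  then have "\<Delta> (v k) (v (Suc k)) j -` A \<inter> space M \<in> incr_gen (v k) (v (Suc k))" using assms by (auto simp: incr_gen_def)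
  then show "\<Delta> (v k) (v (Suc k)) j -` A \<inter> space (incr_alg v m) \<in> sets (incr_alg v m)"
    using assms unfolding sets_incr_alg by (intro sigma_sets.Basic) auto
qed simp

text \<open>Euler's scheme started at \<open>X s\<close> converges to \<open>X\<close>, and started at a deterministic \<open>x\<close> it converges
  to the flow; the increments driving it are independent of the past, so the conditional expectation
  can be computed by freezing the starting point.\<close>
theorem flow_expectation:
  assumes solX: "sde_sol M D W a b s0 x0 T X" and s0: "0 \<le> s0" and \<eta>: "\<eta> > 0" and seq: "s = s0 + real j * \<eta>"
    and d: "d \<ge> 1" and dT: "s + real d * \<eta> \<le> T"
    and fl: "\<And>x. x \<in> vspace D \<Longrightarrow> sde_sol M D W a b s x T (fl x)"
    and \<psi>: "\<psi> \<in> borel_measurable borel" "\<And>x. \<bar>\<psi> x\<bar> \<le> B"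
    and lip: "\<Lambda> \<ge> 0" "\<And>x y. x \<in> vspace D \<Longrightarrow> y \<in> vspace D \<Longrightarrow> (\<psi> x - \<psi> y)\<^sup>2 \<le> \<Lambda> * (\<Sum>i<D. (x i - y i)\<^sup>2)"
    and U: "U = (\<lambda>_. 1) \<or> (\<exists>i<D. U = \<Delta> s (s + \<eta>) i)"
    and A: "A \<in> sets (F s)"
  shows "(\<integral>\<omega>. indicator A \<omega> * (\<psi> (X (s + real d * \<eta>) \<omega>) * U \<omega>) \<partial>M)
    = (\<integral>\<omega>. indicator A \<omega> * (\<integral>\<omega>'. \<psi> (fl (X s \<omega>) (s + real d * \<eta>) \<omega>') * U \<omega>' \<partial>M) \<partial>M)"
proof -
  let ?t = "s + real d * \<eta>"
  have ss0: "s0 \<le> s" "0 \<le> s" using seq \<eta> s0 by auto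
  have st: "s \<le> ?t" using \<eta> by simp
  have sT: "s \<le> T" using st dT by simp
  have s\<eta>: "s + \<eta> \<le> ?t"
  proof -
    have "1 * \<eta> \<le> real d * \<eta>" using d \<eta> by (intro mult_right_mono) auto
    then show ?thesis by simp
  qed
  have s\<eta>T: "s + \<eta> \<le> T" "0 \<le> s + \<eta>" using s\<eta> dT ss0 \<eta> by linarith+
  have B0: "B \<ge> 0" using \<psi>(2)[of undefined] by linarith
  interpret X: sde_process M D T W a b L s X by (rule sde_sol_process[OF solX s0 ss0(1)])
  have RSX: "riemann_sol s \<eta> d X" by (rule sde_sol_riemann[OF solX s0 \<eta> seq dT])
  define h where "h q = \<eta> / real (Suc q)" for q
  define n where "n q = d * Suc q" for q
  define v where "v q k = s + real k * h q" for q k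
  define E where "E q x \<omega> = eul s (h q) (n q) x \<omega>" for q x \<omega>
  have h0: "h q > 0" for q using \<eta> by (simp add: h_def)
  have vn: "v q (n q) = ?t" for q unfolding v_def n_def h_def by (simp only: grid_cancel[OF zero_less_Suc])
  have nT: "s + real (n q) * h q \<le> T" for q using vn[of q] dT by (simp add: v_def)
  have ind: "indep_set (sets (F s)) (sets (incr_alg (v q) (n q)))" for q
  proof -
    have "indep_set (sets (F (v q 0))) (sets (incr_alg (v q) (n q)))"
    proof (rule past_indep_increments)
      show "v q l < v q (Suc l)" for l using h0[of q] by (simp add: v_def)
      show "0 \<le> v q 0" using ss0 by (simp add: v_def)
      show "v q (n q) \<le> T" using vn dT by simp
    qed
    then show ?thesis by (simp add: v_def)
  qed
  have incm: "(\<lambda>\<omega>. \<Delta> (s + real k * h q) (s + real (Suc k) * h q) j \<omega>) \<in> borel_measurable (incr_alg (v q) (n q))"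
    if "k < n q" "j < D" for k j q
    using incr_meas_alg[OF that, of "v q"] by (simp only: v_def)
  \<comment> \<open>The increment over \<open>[s, s + \<eta>]\<close> is the sum of the first
    \<open>Suc q\<close> increments of mesh \<open>h q\<close>, hence a function of the noise that
    drives the scheme; \<open>d \<ge> 1\<close> ensures that these are among its \<open>n q\<close>
    steps.\<close>
  have UG: "U \<in> borel_measurable (incr_alg (v q) (n q))" for q
    using U
  proof
    assume "\<exists>i<D. U = \<Delta> s (s + \<eta>) i"
    then obtain i where i: "i < D" "U = \<Delta> s (s + \<eta>) i" by auto
    have "real (Suc q) * h q = \<eta>" unfolding h_def using grid_cancel[of "Suc q" 1 \<eta>] by simp
    then have "U = (\<lambda>\<omega>. \<Sum>k<Suc q. \<Delta> (s + real k * h q) (s + real (Suc k) * h q) i \<omega>)"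
      unfolding i(2) by (intro ext) (simp add: sum_lessThan_telescope[where f="\<lambda>k. W (s + real k * h q) _ i"] del: sum.lessThan_Suc of_nat_Suc)
    moreover have "(\<lambda>\<omega>. \<Sum>k<Suc q. \<Delta> (s + real k * h q) (s + real (Suc k) * h q) i \<omega>) \<in> borel_measurable (incr_alg (v q) (n q))"
    proof (rule borel_measurable_sum, rule incm)
      fix k assume "k \<in> {..<Suc q}"
      moreover have "1 * Suc q \<le> n q" unfolding n_def using d by (intro mult_le_mono1)
      ultimately show "k < n q" by simp
    qed (rule i)
    ultimately show ?thesis by (simp only:)
  qed simp
  have Um [measurable]: "U \<in> borel_measurable M"
    using U
  proof
    assume "\<exists>i<D. U = \<Delta> s (s + \<eta>) i"
    then obtain i where i: "U = \<Delta> s (s + \<eta>) i" by auto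
    show ?thesis unfolding i
      by (intro borel_measurable_diff W_meas) (use ss0 sT s\<eta>T in auto)
  qed simp
  have U2: "integrable M (\<lambda>\<omega>. (U \<omega>)\<^sup>2)"
    using U
  proof
    assume "\<exists>i<D. U = \<Delta> s (s + \<eta>) i"
    then obtain i where i: "i < D" "U = \<Delta> s (s + \<eta>) i" by auto
    then show ?thesis using incr_power_integrable[OF i(1) ss0(2), of "s + \<eta>" 2] \<eta> s\<eta>T by simp
  qed simp
  have Uint: "integrable M U"
    using integrable_mult_of_squares[OF Um _ U2, of "\<lambda>_. 1"] by simp
  note \<psi>(1)[measurable]
  have Xt [measurable]: "X ?t \<in> measurable M borel" using X.Y_meas[OF st dT] .
  have EM [measurable]: "(\<lambda>\<omega>. E q (X s \<omega>) \<omega>) \<in> measurable M borel" for q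
    unfolding E_def using h0[of q] by (intro X.eul_meas_M nT) simp
  have Ex [measurable]: "(\<lambda>\<omega>. E q x \<omega>) \<in> measurable M borel" for q x
    unfolding E_def
  proof (rule eul_measurable[OF ss0(2) _ nT])
    show "0 \<le> h q" using h0[of q] by simp
    fix k j assume "k < n q" "j < D"
    from incm[OF this] show "(\<lambda>z. \<Delta> (s + real k * h q) (s + real (Suc k) * h q) j z) \<in> borel_measurable M"
      by (rule measurable_from_subalg[rotated])
         (use indep_setD_ev2[OF ind[of q]] in \<open>auto simp: subalgebra_def\<close>)
  qed simp
  have Aev [measurable]: "A \<in> events" using A subalgebra_F[OF sT] by (auto simp: subalgebra_def)
  have bU: "\<bar>indicator A \<omega> * (\<psi> x * U \<omega>)\<bar> \<le> B * \<bar>U \<omega>\<bar>" "\<bar>\<psi> x * U \<omega>\<bar> \<le> B * \<bar>U \<omega>\<bar>" for \<omega> x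
    using mult_right_mono[OF \<psi>(2)[of x], of "\<bar>U \<omega>\<bar>"] B0 by (auto simp: abs_mult indicator_def)
  have BUint: "integrable M (\<lambda>\<omega>. B * \<bar>U \<omega>\<bar>)" using Uint by auto
  \<comment> \<open>Freezing is applied to the scheme, which is jointly measurable in the past and
    the increments, and not to the flow.\<close>
  have F1: "(\<integral>\<omega>. indicator A \<omega> * (\<psi> (E q (X s \<omega>) \<omega>) * U \<omega>) \<partial>M)
     = (\<integral>\<omega>. indicator A \<omega> * (\<integral>\<omega>'. \<psi> (E q (X s \<omega>) \<omega>') * U \<omega>' \<partial>M) \<partial>M)" for q
  proof -
    let ?k = "\<lambda>z. indicator A (fst z) * (\<psi> (E q (X s (fst z)) (snd z)) * U (snd z))"
    have "?k \<in> borel_measurable (F s \<Otimes>\<^sub>M incr_alg (v q) (n q))"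
    proof (intro borel_measurable_times)
      show "(\<lambda>z. indicator A (fst z)) \<in> borel_measurable (F s \<Otimes>\<^sub>M incr_alg (v q) (n q))"
        using A by (intro measurable_compose[OF measurable_fst borel_measurable_indicator])
      show "(\<lambda>z. U (snd z)) \<in> borel_measurable (F s \<Otimes>\<^sub>M incr_alg (v q) (n q))"
        by (rule measurable_compose[OF measurable_snd UG])
      have "(\<lambda>z. E q (X s (fst z)) (snd z)) \<in> measurable (F s \<Otimes>\<^sub>M incr_alg (v q) (n q)) borel"
        unfolding E_def
      proof (rule eul_measurable[OF ss0(2) _ nT])
        show "0 \<le> h q" using h0[of q] by simp
        show "(\<lambda>z. X s (fst z)) \<in> measurable (F s \<Otimes>\<^sub>M incr_alg (v q) (n q)) borel"
          by (rule measurable_compose[OF measurable_fst X.Y_meas_F]) (use sT in auto)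
        show "(\<lambda>z. \<Delta> (s + real k * h q) (s + real (Suc k) * h q) j (snd z)) \<in> borel_measurable (F s \<Otimes>\<^sub>M incr_alg (v q) (n q))"
          if "k < n q" "j < D" for k j
          by (rule measurable_compose[OF measurable_snd incm[OF that]])
      qed
      then show "(\<lambda>z. \<psi> (E q (X s (fst z)) (snd z))) \<in> borel_measurable (F s \<Otimes>\<^sub>M incr_alg (v q) (n q))"
        by (rule measurable_compose) (rule \<psi>(1))
    qed
    moreover have "integrable M (\<lambda>\<omega>. ?k (\<omega>, \<omega>))"
    proof (rule Bochner_Integration.integrable_bound[OF BUint])
      show "AE \<omega> in M. norm (?k (\<omega>, \<omega>)) \<le> norm (B * \<bar>U \<omega>\<bar>)" using bU B0 by (auto simp: abs_mult)
    qed simp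
    ultimately have "(\<integral>\<omega>. ?k (\<omega>, \<omega>) \<partial>M) = (\<integral>\<omega>. (\<integral>\<omega>'. ?k (\<omega>, \<omega>') \<partial>M) \<partial>M)"
      by (intro freezing[OF ind[of q]]) auto
    then show ?thesis by simp
  qed
  let ?I = "\<integral>\<omega>. indicator A \<omega> * (\<psi> (X ?t \<omega>) * U \<omega>) \<partial>M"
  let ?J = "\<lambda>\<omega>. \<integral>\<omega>'. \<psi> (fl (X s \<omega>) ?t \<omega>') * U \<omega>' \<partial>M"
  have sq: "integrable M (\<lambda>\<omega>. (c \<omega> * (\<psi> (f \<omega>) - \<psi> (g \<omega>)))\<^sup>2)"
    if [measurable]: "f \<in> measurable M borel" "g \<in> measurable M borel" "c \<in> borel_measurable M" and c: "\<And>\<omega>. \<bar>c \<omega>\<bar> \<le> 1" for f g c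
  proof (rule integrable_const_bound[of _ "(2 * B)\<^sup>2"])
    have "\<bar>c \<omega> * (\<psi> (f \<omega>) - \<psi> (g \<omega>))\<bar> \<le> \<bar>2 * B\<bar>" for \<omega>
    proof -
      have "\<bar>c \<omega> * (\<psi> (f \<omega>) - \<psi> (g \<omega>))\<bar> \<le> 1 * \<bar>\<psi> (f \<omega>) - \<psi> (g \<omega>)\<bar>"
        unfolding abs_mult using c by (intro mult_right_mono) auto
      also have "\<dots> \<le> \<bar>2 * B\<bar>"
        using abs_triangle_ineq4[of "\<psi> (f \<omega>)" "\<psi> (g \<omega>)"] \<psi>(2)[of "f \<omega>"] \<psi>(2)[of "g \<omega>"] B0 by simp
      finally show ?thesis .
    qed
    then show "AE \<omega> in M. norm ((c \<omega> * (\<psi> (f \<omega>) - \<psi> (g \<omega>)))\<^sup>2) \<le> (2 * B)\<^sup>2"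
      by (simp add: abs_le_square_iff del: abs_mult)
  qed measurable
  have int\<psi>: "integrable M (\<lambda>\<omega>. c \<omega> * (\<psi> (f \<omega>) * U \<omega>))"
    if [measurable]: "f \<in> measurable M borel" "c \<in> borel_measurable M" and c: "\<And>\<omega>. \<bar>c \<omega>\<bar> \<le> 1" for f c
  proof (rule Bochner_Integration.integrable_bound[OF BUint])
    have "\<bar>c \<omega> * (\<psi> (f \<omega>) * U \<omega>)\<bar> \<le> B * \<bar>U \<omega>\<bar>" for \<omega>
      using mult_mono[OF c bU(2)[of "f \<omega>" \<omega>]] by (simp add: abs_mult)
    then show "AE \<omega> in M. norm (c \<omega> * (\<psi> (f \<omega>) * U \<omega>)) \<le> norm (B * \<bar>U \<omega>\<bar>)" using B0 by (simp add: abs_mult)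
  qed measurable
  have limL: "(\<lambda>q. \<integral>\<omega>. indicator A \<omega> * (\<psi> (E q (X s \<omega>) \<omega>) * U \<omega>) \<partial>M) \<longlonglongrightarrow> ?I"
  proof -
    have w: "(\<lambda>q. \<integral>\<omega>. (\<psi> (X ?t \<omega>) - \<psi> (E q (X s \<omega>) \<omega>))\<^sup>2 \<partial>M) \<longlonglongrightarrow> 0"
      unfolding E_def h_def n_def by (rule X.euler_weak_convergence[OF \<eta> dT RSX \<psi> lip])
    let ?f = "\<lambda>q \<omega>. indicator A \<omega> * (\<psi> (X ?t \<omega>) - \<psi> (E q (X s \<omega>) \<omega>)) :: real"
    have "(\<lambda>q. \<integral>\<omega>. (?f q \<omega>)\<^sup>2 \<partial>M) \<longlonglongrightarrow> 0"
    proof (rule Lim_null_comparison[OF always_eventually w], intro allI)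
      fix q
      have "(\<integral>\<omega>. (?f q \<omega>)\<^sup>2 \<partial>M) \<le> (\<integral>\<omega>. (\<psi> (X ?t \<omega>) - \<psi> (E q (X s \<omega>) \<omega>))\<^sup>2 \<partial>M)"
        using sq[OF Xt EM, of "\<lambda>_. 1" q] by (intro integral_mono sq Xt EM) (auto simp: indicator_def)
      then show "norm (\<integral>\<omega>. (?f q \<omega>)\<^sup>2 \<partial>M) \<le> (\<integral>\<omega>. (\<psi> (X ?t \<omega>) - \<psi> (E q (X s \<omega>) \<omega>))\<^sup>2 \<partial>M)" by simp
    qed
    then have "(\<lambda>q. \<integral>\<omega>. ?f q \<omega> * U \<omega> \<partial>M) \<longlonglongrightarrow> 0"
      by (intro L2_null_product sq Xt EM U2) (auto simp: indicator_def)
    moreover have "(\<integral>\<omega>. ?f q \<omega> * U \<omega> \<partial>M) = ?I - (\<integral>\<omega>. indicator A \<omega> * (\<psi> (E q (X s \<omega>) \<omega>) * U \<omega>) \<partial>M)" for q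
    proof -
      have i1: "integrable M (\<lambda>\<omega>. indicator A \<omega> * (\<psi> (X ?t \<omega>) * U \<omega>))"
        by (rule int\<psi>[OF Xt]) (auto simp: indicator_def)
      have i2: "integrable M (\<lambda>\<omega>. indicator A \<omega> * (\<psi> (E q (X s \<omega>) \<omega>) * U \<omega>))"
        by (rule int\<psi>[OF EM]) (auto simp: indicator_def)
      show ?thesis unfolding Bochner_Integration.integral_diff[OF i1 i2, symmetric]
        by (rule Bochner_Integration.integral_cong[OF refl]) (simp add: algebra_simps)
    qed
    ultimately have "(\<lambda>q. ?I - (\<integral>\<omega>. indicator A \<omega> * (\<psi> (E q (X s \<omega>) \<omega>) * U \<omega>) \<partial>M)) \<longlonglongrightarrow> 0" by simp
    from tendsto_diff[OF tendsto_const[of ?I] this] show ?thesis by simp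
  qed
  \<comment> \<open>The second use of convergence, pointwise in the starting point: the flow from
    \<open>x\<close> is itself a solution from \<open>s\<close>, and equals \<open>x\<close> at time
    \<open>s\<close> almost surely.\<close>
  have inner: "(\<lambda>q. \<integral>\<omega>'. \<psi> (E q x \<omega>') * U \<omega>' \<partial>M) \<longlonglongrightarrow> (\<integral>\<omega>'. \<psi> (fl x ?t \<omega>') * U \<omega>' \<partial>M)" if x: "x \<in> vspace D" for x
  proof -
    interpret Y: sde_process M D T W a b L s "fl x" by (rule sde_sol_process[OF fl[OF x] ss0(2) order_refl])
    have RS: "riemann_sol s \<eta> d (fl x)" by (rule sde_sol_riemann[OF fl[OF x] ss0(2) \<eta> _ dT, of 0]) simp
    note st0 = sde_sol_start[OF fl[OF x] ss0(2) sT x]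
    have Yt: "fl x ?t \<in> measurable M borel" using Y.Y_meas[OF st dT] .
    have "(\<lambda>q. \<integral>\<omega>. (\<psi> (fl x ?t \<omega>) - \<psi> (E q (fl x s \<omega>) \<omega>))\<^sup>2 \<partial>M) \<longlonglongrightarrow> 0"
      unfolding E_def h_def n_def by (rule Y.euler_weak_convergence[OF \<eta> dT RS \<psi> lip])
    moreover have "(\<integral>\<omega>. (\<psi> (fl x ?t \<omega>) - \<psi> (E q (fl x s \<omega>) \<omega>))\<^sup>2 \<partial>M) = (\<integral>\<omega>. (1 * (\<psi> (fl x ?t \<omega>) - \<psi> (E q x \<omega>)))\<^sup>2 \<partial>M)" for q
    proof (rule Bochner_Integration.integral_cong_AE)
      have [measurable]: "(\<lambda>\<omega>. E q (fl x s \<omega>) \<omega>) \<in> measurable M borel"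
        unfolding E_def using h0[of q] by (intro Y.eul_meas_M nT) simp
      show "(\<lambda>\<omega>. (\<psi> (fl x ?t \<omega>) - \<psi> (E q (fl x s \<omega>) \<omega>))\<^sup>2) \<in> borel_measurable M" using Yt by measurable
      show "(\<lambda>\<omega>. (1 * (\<psi> (fl x ?t \<omega>) - \<psi> (E q x \<omega>)))\<^sup>2) \<in> borel_measurable M" using Yt by measurable
      show "AE \<omega> in M. (\<psi> (fl x ?t \<omega>) - \<psi> (E q (fl x s \<omega>) \<omega>))\<^sup>2 = (1 * (\<psi> (fl x ?t \<omega>) - \<psi> (E q x \<omega>)))\<^sup>2"
        using st0 by eventually_elim simp
    qed
    ultimately have "(\<lambda>q. \<integral>\<omega>. (1 * (\<psi> (fl x ?t \<omega>) - \<psi> (E q x \<omega>)))\<^sup>2 \<partial>M) \<longlonglongrightarrow> 0" by simp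
    then have "(\<lambda>q. \<integral>\<omega>. 1 * (\<psi> (fl x ?t \<omega>) - \<psi> (E q x \<omega>)) * U \<omega> \<partial>M) \<longlonglongrightarrow> 0"
      using Yt by (intro L2_null_product sq Ex U2) auto
    moreover have "(\<integral>\<omega>. 1 * (\<psi> (fl x ?t \<omega>) - \<psi> (E q x \<omega>)) * U \<omega> \<partial>M) = (\<integral>\<omega>'. \<psi> (fl x ?t \<omega>') * U \<omega>' \<partial>M) - (\<integral>\<omega>'. \<psi> (E q x \<omega>') * U \<omega>' \<partial>M)" for q
    proof -
      have i1: "integrable M (\<lambda>\<omega>. \<psi> (fl x ?t \<omega>) * U \<omega>)" using int\<psi>[OF Yt, of "\<lambda>_. 1"] by simp
      have i2: "integrable M (\<lambda>\<omega>. \<psi> (E q x \<omega>) * U \<omega>)" using int\<psi>[OF Ex, of "\<lambda>_. 1" q x] by simp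
      show ?thesis unfolding Bochner_Integration.integral_diff[OF i1 i2, symmetric]
        by (rule Bochner_Integration.integral_cong[OF refl]) (simp add: algebra_simps)
    qed
    ultimately have "(\<lambda>q. (\<integral>\<omega>'. \<psi> (fl x ?t \<omega>') * U \<omega>' \<partial>M) - (\<integral>\<omega>'. \<psi> (E q x \<omega>') * U \<omega>' \<partial>M)) \<longlonglongrightarrow> 0" by simp
    from tendsto_diff[OF tendsto_const[of "\<integral>\<omega>'. \<psi> (fl x ?t \<omega>') * U \<omega>' \<partial>M"] this] show ?thesis by simp
  qed
  have Xs: "X s \<omega> \<in> vspace D" if "\<omega> \<in> space M" for \<omega> using X.Y_vspace that sT by auto
  have Jq_m: "(\<lambda>\<omega>. indicator A \<omega> * (\<integral>\<omega>'. \<psi> (E q (X s \<omega>) \<omega>') * U \<omega>' \<partial>M)) \<in> borel_measurable M" for q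
  proof (intro borel_measurable_times borel_measurable_indicator Aev)
    have "(\<lambda>z. E q (X s (fst z)) (snd z)) \<in> measurable (M \<Otimes>\<^sub>M M) borel"
      unfolding E_def
    proof (rule eul_measurable[OF ss0(2) _ nT])
      show "0 \<le> h q" using h0[of q] by simp
      show "(\<lambda>z. X s (fst z)) \<in> measurable (M \<Otimes>\<^sub>M M) borel"
        by (rule measurable_compose[OF measurable_fst X.Y_meas]) (use sT in auto)
      fix k j assume kj: "k < n q" "j < D"
      have "(\<lambda>z. \<Delta> (s + real k * h q) (s + real (Suc k) * h q) j z) \<in> borel_measurable M"
        by (rule measurable_from_subalg[OF _ incm[OF kj]])
           (use indep_setD_ev2[OF ind[of q]] in \<open>auto simp: subalgebra_def\<close>)
      then show "(\<lambda>z. \<Delta> (s + real k * h q) (s + real (Suc k) * h q) j (snd z)) \<in> borel_measurable (M \<Otimes>\<^sub>M M)"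
        by (rule measurable_compose[OF measurable_snd])
    qed
    then have [measurable]: "(\<lambda>(\<omega>, \<omega>'). E q (X s \<omega>) \<omega>') \<in> measurable (M \<Otimes>\<^sub>M M) borel" by (simp add: split_def)
    show "(\<lambda>\<omega>. \<integral>\<omega>'. \<psi> (E q (X s \<omega>) \<omega>') * U \<omega>' \<partial>M) \<in> borel_measurable M"
      by (intro borel_measurable_lebesgue_integral) (simp add: split_def, measurable)
  qed
  have lim_pt: "(\<lambda>q. indicator A \<omega> * (\<integral>\<omega>'. \<psi> (E q (X s \<omega>) \<omega>') * U \<omega>' \<partial>M)) \<longlonglongrightarrow> indicator A \<omega> * ?J \<omega>" if "\<omega> \<in> space M" for \<omega>
    by (intro tendsto_mult tendsto_const inner Xs that)
  have limR: "(\<lambda>q. \<integral>\<omega>. indicator A \<omega> * (\<integral>\<omega>'. \<psi> (E q (X s \<omega>) \<omega>') * U \<omega>' \<partial>M) \<partial>M) \<longlonglongrightarrow> (\<integral>\<omega>. indicator A \<omega> * ?J \<omega> \<partial>M)"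
  proof (rule integral_dominated_convergence[where w="\<lambda>_. \<integral>\<omega>'. B * \<bar>U \<omega>'\<bar> \<partial>M"])
    show "(\<lambda>\<omega>. indicator A \<omega> * ?J \<omega>) \<in> borel_measurable M"
      by (rule borel_measurable_LIMSEQ_real[OF lim_pt Jq_m])
    show "AE \<omega> in M. norm (indicator A \<omega> * (\<integral>\<omega>'. \<psi> (E q (X s \<omega>) \<omega>') * U \<omega>' \<partial>M)) \<le> (\<integral>\<omega>'. B * \<bar>U \<omega>'\<bar> \<partial>M)" for q
    proof (rule AE_I2)
      fix \<omega>
      have "\<bar>\<integral>\<omega>'. \<psi> (E q (X s \<omega>) \<omega>') * U \<omega>' \<partial>M\<bar> \<le> (\<integral>\<omega>'. \<bar>\<psi> (E q (X s \<omega>) \<omega>') * U \<omega>'\<bar> \<partial>M)"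
        by (rule integral_abs_bound)
      also have "\<dots> \<le> (\<integral>\<omega>'. B * \<bar>U \<omega>'\<bar> \<partial>M)"
        using int\<psi>[OF Ex, of "\<lambda>_. 1" q "X s \<omega>"] by (intro integral_mono bU BUint integrable_abs) auto
      finally show "norm (indicator A \<omega> * (\<integral>\<omega>'. \<psi> (E q (X s \<omega>) \<omega>') * U \<omega>' \<partial>M)) \<le> (\<integral>\<omega>'. B * \<bar>U \<omega>'\<bar> \<partial>M)"
        by (auto simp: indicator_def)
    qed
    show "AE \<omega> in M. (\<lambda>q. indicator A \<omega> * (\<integral>\<omega>'. \<psi> (E q (X s \<omega>) \<omega>') * U \<omega>' \<partial>M)) \<longlonglongrightarrow> indicator A \<omega> * ?J \<omega>"
      using lim_pt by auto
  qed (use Jq_m in auto)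
  show ?thesis by (rule LIMSEQ_unique[OF limL]) (use limR in \<open>simp add: F1\<close>)
qed

end

section \<open>Random networks representing the flow\<close>

text \<open>If \<open>f\<close> is not integrable, its Bochner integral is 0; this default spares an
  integrability proof wherever an upper bound suffices.\<close>

lemma ennreal_integral_le:
  fixes f :: "'a \<Rightarrow> real"
  assumes "\<And>x. 0 \<le> f x"
  shows "ennreal (\<integral>x. f x \<partial>M) \<le> (\<integral>\<^sup>+x. ennreal (f x) \<partial>M)"
  using assms by (cases "integrable M f") (auto simp: nn_integral_eq_integral not_integrable_integral_eq)

text \<open>The source of joint measurability in starting point and sample: the output is built from
  iterated series of measurable parameters and inputs.\<close>

lemma ran_eval_measurable:
  assumes w: "\<And>l m j. (\<lambda>z. w z l m j) \<in> borel_measurable N" and x: "x \<in> measurable N borel"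
  shows "(\<lambda>z. ran_eval (w z) I (x z)) \<in> measurable N borel"
proof (induction I)
  case 0
  have [measurable]: "(\<lambda>z. x z i) \<in> borel_measurable N" for i by (rule measurable_compose[OF x coord_measurable])
  note w[measurable]
  show ?case by (rule vec_measurableI) (simp add: ran_layer_def)
next
  case (Suc I)
  have [measurable]: "(\<lambda>z. ran_eval (w z) I (x z) i) \<in> borel_measurable N" for i
    by (rule measurable_compose[OF Suc coord_measurable])
  note w[measurable]
  show ?case by (rule vec_measurableI) (simp add: ran_layer_def relu_def)
qed

lemma relu_fun_measurable:
  assumes "relu_fun n d e S F"
  shows "F \<in> measurable borel borel"
  using assms
proof (induction rule: relu_fun.induct)
  case (affine d e L)
  show ?case by (rule vec_measurableI) (simp add: affine_def)
next
  case (layer n e f S F d L)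
  have "(\<lambda>x. (\<lambda>j. relu (affine d e L x j))) \<in> measurable borel borel"
    by (rule vec_measurableI) (simp add: affine_def relu_def)
  then show ?case by (rule measurable_compose) (rule layer.IH)
qed

lemma ennpow_mono: "x \<le> y \<Longrightarrow> p \<ge> 0 \<Longrightarrow> ennpow x p \<le> ennpow y p"
  by (auto simp: ennpow_def intro!: ennreal_leI powr_mono2 enn2real_mono simp: top_unique less_top[symmetric])

text \<open>After encoding triples as naturals, the number of nonzero parameters is a countable sum
  of indicators; the infinite case of the definition is divergence of this sum.\<close>

lemma ran_size_measurable:
  assumes [measurable]: "\<And>l m j. (\<lambda>z. w z l m j) \<in> borel_measurable N"
  shows "(\<lambda>z. ran_size I (w z)) \<in> borel_measurable N"
proof -
  have eq: "ran_size I v = (\<integral>\<^sup>+k. (case prod_decode k of (l, k') \<Rightarrow> case prod_decode k' of (m, j) \<Rightarrow>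
      if l \<le> I \<and> v l m j \<noteq> 0 then 1 else 0) \<partial>count_space UNIV)" for v :: "nat \<Rightarrow> nat \<Rightarrow> vec"
  proof -
    let ?S = "{(l, m, j). l \<le> I \<and> v l m j \<noteq> 0}"
    let ?e = "\<lambda>(l, m, j). prod_encode (l, prod_encode (m, j))"
    have inj: "inj_on ?e A" for A by (auto simp: inj_on_def)
    have "(\<integral>\<^sup>+k. (case prod_decode k of (l, k') \<Rightarrow> case prod_decode k' of (m, j) \<Rightarrow>
      if l \<le> I \<and> v l m j \<noteq> 0 then 1 else 0) \<partial>count_space UNIV) = (\<integral>\<^sup>+k. indicator (?e ` ?S) k \<partial>count_space UNIV)"
    proof (rule nn_integral_cong)
      fix k
      obtain l k' where k: "prod_decode k = (l, k')" by (cases "prod_decode k")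
      obtain m j where k': "prod_decode k' = (m, j)" by (cases "prod_decode k'")
      have kk: "k = ?e (l, m, j)" using k k' by (metis (no_types, lifting) case_prod_conv prod_decode_inverse)
      have "k \<in> ?e ` ?S \<longleftrightarrow> (l, m, j) \<in> ?S" unfolding kk by (rule inj_image_mem_iff[OF inj])
      then show "(case prod_decode k of (l, k') \<Rightarrow> case prod_decode k' of (m, j) \<Rightarrow>
        if l \<le> I \<and> v l m j \<noteq> 0 then 1 else 0) = (indicator (?e ` ?S) k :: ennreal)"
        by (simp add: k k' indicator_def)
    qed
    also have "\<dots> = emeasure (count_space UNIV) (?e ` ?S)" by (rule nn_integral_indicator) simp
    also have "\<dots> = ran_size I v"
      by (auto simp: ran_size_def Let_def emeasure_count_space finite_image_iff[OF inj] card_image[OF inj] ennreal_of_nat_eq_real_of_nat)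
    finally show ?thesis by simp
  qed
  show ?thesis unfolding eq nn_integral_count_space_nat
    by (intro borel_measurable_suminf_order) (auto split: prod.splits)
qed

text \<open>The set where the bound fails is open by continuity of \<open>F\<close>, and a nonempty
  open set would meet the dense set. Dense points are projected to \<open>vspace D\<close> because
  density refers to the space of all sequences.\<close>

lemma relu_fun_sup_dense:
  assumes F: "relu_fun n D D S F" and dense: "\<And>X :: vec set. open X \<Longrightarrow> X \<noteq> {} \<Longrightarrow> \<exists>d\<in>Dn. d \<in> X"
    and b: "\<And>y. y \<in> vproj D ` Dn \<Longrightarrow> vnorm D (F y) \<le> c * (1 + vnorm D y)" and x: "x \<in> vspace D"
  shows "vnorm D (F x) \<le> c * (1 + vnorm D x)"
proof -
  obtain \<Lambda> where \<Lambda>: "\<Lambda> \<ge> 0" "\<And>x y j. \<bar>F x j - F y j\<bar> \<le> \<Lambda> * (\<Sum>i<D. \<bar>x i - y i\<bar>)"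
    using relu_fun_lipschitz[OF F] by blast
  have Fc: "continuous_on UNIV (\<lambda>y. F (vproj D y) j)" for j
    unfolding continuous_on_def
  proof
    fix y :: vec
    have yi: "((\<lambda>z. z i) \<longlongrightarrow> y i) (at y)" for i
      using continuous_on_product_coordinates[of i] unfolding continuous_on_def by auto
    have "((\<lambda>z. F (vproj D z) j - F (vproj D y) j) \<longlongrightarrow> 0) (at y)"
    proof (rule Lim_null_comparison)
      show "\<forall>\<^sub>F z in at y. norm (F (vproj D z) j - F (vproj D y) j) \<le> \<Lambda> * (\<Sum>i<D. \<bar>z i - y i\<bar>)"
        using \<Lambda>(2)[of "vproj D _" j "vproj D y"] by (auto simp: vproj_def intro!: always_eventually)
      have "((\<lambda>z. \<Lambda> * (\<Sum>i<D. \<bar>z i - y i\<bar>)) \<longlongrightarrow> \<Lambda> * (\<Sum>i<D. \<bar>y i - y i\<bar>)) (at y)" by (intro tendsto_intros yi)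
      then show "((\<lambda>z. \<Lambda> * (\<Sum>i<D. \<bar>z i - y i\<bar>)) \<longlongrightarrow> 0) (at y)" by simp
    qed
    then show "((\<lambda>z. F (vproj D z) j) \<longlongrightarrow> F (vproj D y) j) (at y within UNIV)" by (simp add: LIM_zero_iff)
  qed
  have pc: "continuous_on UNIV (\<lambda>y::vec. vproj D y i)" for i by (cases "i < D") (auto simp: vproj_def)
  have c1: "continuous_on UNIV (\<lambda>y. vnorm D (F (vproj D y)) - c * (1 + vnorm D (vproj D y)))"
    unfolding vnorm_def by (intro continuous_intros Fc pc)
  have "open {y. 0 < vnorm D (F (vproj D y)) - c * (1 + vnorm D (vproj D y))}" (is "open ?X")
    by (rule open_Collect_less[OF continuous_on_const c1])
  moreover have "?X = {}"
  proof (rule ccontr)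
    assume "?X \<noteq> {}"
    then obtain d where "d \<in> Dn" "d \<in> ?X" using dense[OF \<open>open ?X\<close>] by blast
    then show False using b[of "vproj D d"] by auto
  qed
  ultimately have "x \<notin> ?X" by blast
  then show ?thesis using vproj_id[OF x] by simp
qed

lemma le_growthD:
  assumes "x \<in> vspace d"
  shows "ennreal (vnorm e (f x) / (1 + vnorm d x)) \<le> growth d e f"
  unfolding growth_def using assms by (rule SUP_upper)

lemma vnorm_le_of_growth:
  assumes "growth d e f \<le> ennreal c" "c \<ge> 0" "x \<in> vspace d"
  shows "vnorm e (f x) \<le> c * (1 + vnorm d x)"
proof -
  have "ennreal (vnorm e (f x) / (1 + vnorm d x)) \<le> ennreal c" using le_growthD[OF assms(3)] assms(1) by (rule order_trans)
  then have "vnorm e (f x) / (1 + vnorm d x) \<le> c" using assms(2) by simp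
  moreover have "1 + vnorm d x > 0" using vnorm_nonneg[of d x] by linarith
  ultimately show ?thesis by (simp add: pos_divide_le_eq)
qed

lemma growth_leI:
  assumes "\<And>x. x \<in> vspace d \<Longrightarrow> vnorm e (f x) \<le> c * (1 + vnorm d x)"
  shows "growth d e f \<le> ennreal c"
  unfolding growth_def
proof (intro SUP_least ennreal_leI)
  fix x assume "x \<in> vspace d"
  moreover have "1 + vnorm d x > 0" using vnorm_nonneg[of d x] by linarith
  ultimately show "vnorm e (f x) / (1 + vnorm d x) \<le> c" using assms by (simp add: pos_divide_le_eq)
qed

text \<open>The growth of the flow is a supremum over an uncountable set; over a countable dense set it is
  measurable, and it has the same value since the realised networks are continuous.\<close>
lemma ran_flow_rep:
  assumes "prob_space M" and p: "p > 0" and K: "K > 0"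
    and gr: "(\<integral>\<^sup>+\<omega>. ennpow (growth D D (f \<omega>)) p \<partial>M) \<le> ennreal (K powr p)"
    and w: "\<And>l m j. (\<lambda>\<omega>. w \<omega> l m j) \<in> borel_measurable M" "\<And>\<omega>. \<omega> \<in> space M \<Longrightarrow> ran_valid D I (w \<omega>)"
    and eq: "AE \<omega> in M. \<forall>x\<in>vspace D. f \<omega> x = ran_eval (w \<omega>) I x"
    and sz: "(\<integral>\<^sup>+\<omega>. ran_size I (w \<omega>) \<partial>M) \<le> ennreal K"
  obtains g where "g \<in> borel_measurable M" "\<And>\<omega>. g \<omega> \<ge> (0::real)"
    "(\<integral>\<^sup>+\<omega>. ennreal (g \<omega> powr p) \<partial>M) \<le> ennreal (K powr p)"
    "AE \<omega> in M. finite {(l, m, j). l \<le> I \<and> w \<omega> l m j \<noteq> 0} \<and>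
       (\<forall>x\<in>vspace D. vnorm D (ran_eval (w \<omega>) I x) \<le> g \<omega> * (1 + vnorm D x))"
proof -
  interpret prob_space M by fact
  obtain Dn :: "vec set" where Dn: "countable Dn" "\<And>X. open X \<Longrightarrow> X \<noteq> {} \<Longrightarrow> \<exists>d\<in>Dn. d \<in> X"
    using countable_dense_setE by blast
  define G where "G \<omega> = (SUP x\<in>vproj D ` Dn. ennreal (vnorm D (ran_eval (w \<omega>) I x) / (1 + vnorm D x)))" for \<omega>
  have [measurable]: "(\<lambda>\<omega>. ran_eval (w \<omega>) I x) \<in> measurable M borel" for x
    by (rule ran_eval_measurable[OF w(1)]) simp
  have Gm [measurable]: "G \<in> borel_measurable M"
    unfolding G_def using Dn(1) by (intro borel_measurable_SUP) auto
  have G_le: "AE \<omega> in M. G \<omega> \<le> growth D D (f \<omega>)"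
    using eq
  proof eventually_elim
    case (elim \<omega>)
    have "ennreal (vnorm D (ran_eval (w \<omega>) I x) / (1 + vnorm D x)) \<le> growth D D (f \<omega>)" if "x \<in> vspace D" for x
      using le_growthD[OF that, of D "f \<omega>"] elim that by simp
    then show ?case unfolding G_def by (intro SUP_least) auto
  qed
  have Gp: "(\<integral>\<^sup>+\<omega>. ennpow (G \<omega>) p \<partial>M) \<le> ennreal (K powr p)"
  proof (rule order_trans[OF nn_integral_mono_AE gr])
    show "AE \<omega> in M. ennpow (G \<omega>) p \<le> ennpow (growth D D (f \<omega>)) p"
      using G_le by eventually_elim (rule ennpow_mono, use p in auto)
  qed
  have powm: "(\<lambda>\<omega>. ennpow (G \<omega>) p) \<in> borel_measurable M" unfolding ennpow_def by measurable
  have "AE \<omega> in M. ennpow (G \<omega>) p \<noteq> \<infinity>"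
    by (rule nn_integral_PInf_AE[OF powm]) (use Gp in \<open>auto simp: top_unique\<close>)
  then have Gfin: "AE \<omega> in M. G \<omega> \<noteq> \<infinity>" by eventually_elim (auto simp: ennpow_def)
  have "AE \<omega> in M. ran_size I (w \<omega>) \<noteq> \<infinity>"
    by (rule nn_integral_PInf_AE[OF ran_size_measurable[OF w(1)]]) (use sz in \<open>auto simp: top_unique\<close>)
  then have fin: "AE \<omega> in M. finite {(l, m, j). l \<le> I \<and> w \<omega> l m j \<noteq> 0}"
    by eventually_elim (auto simp: ran_size_def Let_def split: if_splits)
  show ?thesis
  proof (rule that[of "\<lambda>\<omega>. enn2real (G \<omega>)"])
    have "(\<integral>\<^sup>+\<omega>. ennreal (enn2real (G \<omega>) powr p) \<partial>M) = (\<integral>\<^sup>+\<omega>. ennpow (G \<omega>) p \<partial>M)"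
      by (rule nn_integral_cong_AE) (use Gfin in \<open>eventually_elim, auto simp: ennpow_def\<close>)
    then show "(\<integral>\<^sup>+\<omega>. ennreal (enn2real (G \<omega>) powr p) \<partial>M) \<le> ennreal (K powr p)" using Gp by simp
    show "AE \<omega> in M. finite {(l, m, j). l \<le> I \<and> w \<omega> l m j \<noteq> 0} \<and>
       (\<forall>x\<in>vspace D. vnorm D (ran_eval (w \<omega>) I x) \<le> enn2real (G \<omega>) * (1 + vnorm D x))"
      using Gfin fin AE_space
    proof eventually_elim
      case (elim \<omega>)
      obtain S Fn where F: "relu_fun (Suc I) D D S Fn" "\<And>x. x \<in> vspace D \<Longrightarrow> Fn x = ran_eval (w \<omega>) I x"
        using ran_eval_relu_fun[OF elim(2)] w(2)[OF elim(3)] unfolding ran_valid_def by metis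
      have "vnorm D (Fn y) \<le> enn2real (G \<omega>) * (1 + vnorm D y)" if "y \<in> vproj D ` Dn" for y
      proof -
        have "ennreal (vnorm D (ran_eval (w \<omega>) I y) / (1 + vnorm D y)) \<le> G \<omega>"
          unfolding G_def by (rule SUP_upper[OF that])
        then have "enn2real (ennreal (vnorm D (ran_eval (w \<omega>) I y) / (1 + vnorm D y))) \<le> enn2real (G \<omega>)"
          using elim(1) by (intro enn2real_mono) (auto simp: less_top)
        moreover have "1 + vnorm D y > 0" using vnorm_nonneg[of D y] by linarith
        ultimately have "vnorm D (ran_eval (w \<omega>) I y) / (1 + vnorm D y) \<le> enn2real (G \<omega>)" by simp
        moreover have "y \<in> vspace D" using that by auto
        ultimately show ?thesis using F(2) \<open>1 + vnorm D y > 0\<close> by (simp add: pos_divide_le_eq)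
      qed
      then have "\<forall>x\<in>vspace D. vnorm D (Fn x) \<le> enn2real (G \<omega>) * (1 + vnorm D x)"
        using relu_fun_sup_dense[OF F(1) Dn(2)] by blast
      then show ?case using elim F(2) by simp
    qed
  qed (use Gm in auto)
qed

text \<open>One dimension at a time: \<open>K\<close> stands for the bound of (C4) at this
  \<open>D\<close>. Later estimates are explicit in \<open>K\<close> and \<open>D\<close>, so
  uniformity in the dimension becomes a matter of bounding expressions.\<close>

locale flow_model = sde M D T W a b L for M :: "'w measure" and D T W a b L +
  fixes X :: "real \<Rightarrow> 'w \<Rightarrow> vec" and x0 :: vec and fl :: "vec \<Rightarrow> real \<Rightarrow> real \<Rightarrow> 'w \<Rightarrow> vec"
    and N :: nat and p K :: real
  assumes T0: "T > 0" and N_ge: "N \<ge> 1" and D0: "D \<ge> 1" and p2: "p > 2" and K0: "K > 0"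
    and solX: "sde_sol M D W a b 0 x0 T X" and x0: "x0 \<in> vspace D"
    and solfl: "\<And>s x. 0 \<le> s \<Longrightarrow> s \<le> T \<Longrightarrow> x \<in> vspace D \<Longrightarrow> sde_sol M D W a b s x T (fl x s)"
    and flow: "\<And>n s t. n < N \<Longrightarrow> tgrid T N n \<le> s \<Longrightarrow> s < t \<Longrightarrow> t \<le> tgrid T N (Suc n) \<Longrightarrow>
        (\<integral>\<^sup>+\<omega>. ennpow (growth D D (\<lambda>x. fl x s t \<omega>)) p \<partial>M) \<le> ennreal (K powr p)
      \<and> (\<exists>(I::nat) (w :: 'w \<Rightarrow> nat \<Rightarrow> nat \<Rightarrow> vec).
            real I \<le> K
          \<and> (\<forall>l m j. (\<lambda>\<omega>. w \<omega> l m j) \<in> borel_measurable M)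
          \<and> (\<forall>\<omega>\<in>space M. ran_valid D I (w \<omega>))
          \<and> (AE \<omega> in M. \<forall>x\<in>vspace D. fl x s t \<omega> = ran_eval (w \<omega>) I x)
          \<and> (\<integral>\<^sup>+\<omega>. ran_size I (w \<omega>) \<partial>M) \<le> ennreal K)"
begin

sublocale X: sde_process M D T W a b L 0 X
  by (rule sde_sol_process[OF solX]) auto

lemma flow_rep:
  assumes "n < N" "tgrid T N n \<le> s" "s < t" "t \<le> tgrid T N (Suc n)"
  obtains I w g where
    "\<And>l m j. (\<lambda>\<omega>. w \<omega> l m j) \<in> borel_measurable M" "\<And>\<omega>. \<omega> \<in> space M \<Longrightarrow> ran_valid D I (w \<omega>)"
    "AE \<omega> in M. \<forall>x\<in>vspace D. fl x s t \<omega> = ran_eval (w \<omega>) I x"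
    "(\<integral>\<^sup>+\<omega>. ran_size I (w \<omega>) \<partial>M) \<le> ennreal K"
    "g \<in> borel_measurable M" "\<And>\<omega>. g \<omega> \<ge> (0::real)" "(\<integral>\<^sup>+\<omega>. ennreal (g \<omega> powr p) \<partial>M) \<le> ennreal (K powr p)"
    "AE \<omega> in M. finite {(l, m, j). l \<le> I \<and> w \<omega> l m j \<noteq> 0} \<and>
       (\<forall>x\<in>vspace D. vnorm D (ran_eval (w \<omega>) I x) \<le> g \<omega> * (1 + vnorm D x))"
proof -
  obtain I w where w: "\<And>l m j. (\<lambda>\<omega>. w \<omega> l m j) \<in> borel_measurable M" "\<And>\<omega>. \<omega> \<in> space M \<Longrightarrow> ran_valid D I (w \<omega>)"
    "AE \<omega> in M. \<forall>x\<in>vspace D. fl x s t \<omega> = ran_eval (w \<omega>) I x"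
    "(\<integral>\<^sup>+\<omega>. ran_size I (w \<omega>) \<partial>M) \<le> ennreal K"
    using flow[OF assms, THEN conjunct2] by (elim exE conjE) blast
  have p: "p > 0" using p2 by simp
  obtain g where g: "g \<in> borel_measurable M" "\<And>\<omega>. g \<omega> \<ge> (0::real)"
    "(\<integral>\<^sup>+\<omega>. ennreal (g \<omega> powr p) \<partial>M) \<le> ennreal (K powr p)"
    "AE \<omega> in M. finite {(l, m, j). l \<le> I \<and> w \<omega> l m j \<noteq> 0} \<and>
       (\<forall>x\<in>vspace D. vnorm D (ran_eval (w \<omega>) I x) \<le> g \<omega> * (1 + vnorm D x))"
    by (rule ran_flow_rep[OF prob_space_axioms p K0 flow[OF assms, THEN conjunct1] w(1) w(2) w(3) w(4)]) blast+
  show ?thesis by (rule that[OF w(1) w(2) w(3) w(4) g])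
qed

section \<open>Second moments of the flow and of the process\<close>

lemma tgrid_le: "n \<le> N \<Longrightarrow> tgrid T N n \<le> T" "0 \<le> tgrid T N n"
  using T0 N_ge mult_right_mono[of "real n" "real N" T] by (auto simp: tgrid_def field_simps)

text \<open>The growth \<open>g\<close> contributes the factor
  \<open>(1 + g)\<^sup>2 \<le> 2 * (1 + g\<^sup>2)\<close>, and
  \<open>g\<^sup>2 \<le> 1 + g powr p\<close> turns its mean into
  \<open>4 + 2 * K powr p\<close>.\<close>

lemma flow_second_moment:
  assumes nst: "n < N" "tgrid T N n \<le> s" "s < t" "t \<le> tgrid T N (Suc n)" and x: "x \<in> vspace D"
  shows "(\<integral>\<^sup>+\<omega>. ennreal ((1 + vnorm D (fl x s t \<omega>))\<^sup>2) \<partial>M) \<le> ennreal ((4 + 2 * K powr p) * (1 + vnorm D x)\<^sup>2)"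
proof -
  obtain I w g where r: "AE \<omega> in M. \<forall>x\<in>vspace D. fl x s t \<omega> = ran_eval (w \<omega>) I x"
    and g: "g \<in> borel_measurable M" "\<And>\<omega>. g \<omega> \<ge> (0::real)" "(\<integral>\<^sup>+\<omega>. ennreal (g \<omega> powr p) \<partial>M) \<le> ennreal (K powr p)"
    and b: "AE \<omega> in M. finite {(l, m, j). l \<le> I \<and> w \<omega> l m j \<noteq> 0} \<and>
       (\<forall>x\<in>vspace D. vnorm D (ran_eval (w \<omega>) I x) \<le> g \<omega> * (1 + vnorm D x))"
    by (rule flow_rep[OF nst]) blast
  note g(1)[measurable]
  let ?c = "(1 + vnorm D x)\<^sup>2"
  have "(\<integral>\<^sup>+\<omega>. ennreal ((1 + vnorm D (fl x s t \<omega>))\<^sup>2) \<partial>M) \<le> (\<integral>\<^sup>+\<omega>. ennreal (4 * ?c) + ennreal (2 * ?c) * ennreal (g \<omega> powr p) \<partial>M)"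
  proof (rule nn_integral_mono_AE)
    show "AE \<omega> in M. ennreal ((1 + vnorm D (fl x s t \<omega>))\<^sup>2) \<le> ennreal (4 * ?c) + ennreal (2 * ?c) * ennreal (g \<omega> powr p)"
      using r b
    proof eventually_elim
      case (elim \<omega>)
      have le: "vnorm D (fl x s t \<omega>) \<le> g \<omega> * (1 + vnorm D x)" using elim x by auto
      have gp: "(g \<omega>)\<^sup>2 \<le> 1 + g \<omega> powr p"
      proof (cases "g \<omega> \<le> 1")
        case True
        then have "(g \<omega>)\<^sup>2 \<le> 1" using g(2)[of \<omega>] by (simp add: power_le_one)
        then show ?thesis using powr_ge_zero[of "g \<omega>" p] by linarith
      next
        case False
        then have "(g \<omega>)\<^sup>2 = g \<omega> powr 2" by simp
        also have "\<dots> \<le> g \<omega> powr p" using False p2 by (intro powr_mono) auto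
        finally show ?thesis by simp
      qed
      have "(1 + vnorm D (fl x s t \<omega>))\<^sup>2 \<le> (1 * (1 + vnorm D x) + g \<omega> * (1 + vnorm D x))\<^sup>2"
        using le vnorm_nonneg[of D x] by (intro power_mono add_mono) auto
      also have "\<dots> = (1 + g \<omega>)\<^sup>2 * ?c" by (simp only: power_mult_distrib distrib_right[symmetric])
      also have "\<dots> \<le> (2 * (1\<^sup>2 + (g \<omega>)\<^sup>2)) * ?c" by (intro mult_right_mono square_add_le) auto
      also have "\<dots> \<le> (4 + 2 * g \<omega> powr p) * ?c" using gp by (intro mult_right_mono) auto
      finally have "ennreal ((1 + vnorm D (fl x s t \<omega>))\<^sup>2) \<le> ennreal (4 * ?c + 2 * ?c * g \<omega> powr p)"
        by (intro ennreal_leI) (simp add: algebra_simps)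
      then show ?case by (simp add: ennreal_mult ennreal_plus)
    qed
  qed
  also have "\<dots> = ennreal (4 * ?c) + ennreal (2 * ?c) * (\<integral>\<^sup>+\<omega>. ennreal (g \<omega> powr p) \<partial>M)"
    by (subst nn_integral_add, simp, simp, subst nn_integral_cmult, simp, simp add: emeasure_space_1)
  also have "\<dots> \<le> ennreal (4 * ?c) + ennreal (2 * ?c) * ennreal (K powr p)"
    by (intro add_left_mono mult_left_mono g) auto
  also have "\<dots> = ennreal ((4 + 2 * K powr p) * ?c)"
    by (simp add: ennreal_mult ennreal_plus algebra_simps flip: ennreal_mult ennreal_plus)
  finally show ?thesis .
qed

lemma fl_meas: "0 \<le> s \<Longrightarrow> s \<le> t \<Longrightarrow> t \<le> T \<Longrightarrow> x \<in> vspace D \<Longrightarrow> fl x s t \<in> measurable M borel"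
  using sde_process.Y_meas[OF sde_sol_process[OF solfl, of s x s]] by auto

definition m2 :: "real \<Rightarrow> ennreal" where
  "m2 t = (\<integral>\<^sup>+\<omega>. ennreal ((1 + vnorm D (X t \<omega>))\<^sup>2) \<partial>M)"

text \<open>Moments of \<open>X\<close> follow from those of the flow by conditioning on time
  \<open>s\<close>, that is, from \<open>flow_expectation\<close> with
  \<open>U = (\<lambda>_. 1)\<close>. As this needs bounded Lipschitz functions, the squared norm is
  truncated, and Fatou removes the truncation.\<close>

lemma moment_step:
  assumes nst: "n < N" "tgrid T N n \<le> s" "t \<le> tgrid T N (Suc n)"
    and \<eta>: "\<eta> > 0" and s: "s = real j * \<eta>" and t: "t = s + real d * \<eta>" and d: "d \<ge> 1"
  shows "m2 t \<le> ennreal (10 + 4 * K powr p) * m2 s"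
proof -
  have st: "s < t" using t d \<eta> by simp
  have tT: "t \<le> T" using nst(1,3) tgrid_le(1)[of "Suc n"] by simp
  have s0: "0 \<le> s" using s \<eta> by simp
  \<comment> \<open>Truncating the norm before squaring makes the function bounded and Lipschitz,
    with constant \<open>2 * R\<close>.\<close>
  define \<psi> where "\<psi> R y = (min R (vnorm D y))\<^sup>2" for R y
  have \<psi>m [measurable]: "\<psi> R \<in> borel_measurable borel" for R unfolding \<psi>_def by measurable
  have Xm [measurable]: "X t \<in> measurable M borel" "X s \<in> measurable M borel" using X.Y_meas s0 st tT by auto
  let ?C = "4 + 2 * K powr p"
  have step: "(\<integral>\<^sup>+\<omega>. ennreal (\<psi> (real R) (X t \<omega>)) \<partial>M) \<le> ennreal ?C * m2 s" for R :: nat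
  proof -
    have bnd: "0 \<le> \<psi> (real R) y" "\<bar>\<psi> (real R) y\<bar> \<le> (real R)\<^sup>2" for y
      by (auto simp: \<psi>_def intro!: power_mono)
    have lip: "(\<psi> (real R) x - \<psi> (real R) y)\<^sup>2 \<le> (2 * real R)\<^sup>2 * (\<Sum>i<D. (x i - y i)\<^sup>2)" for x y
    proof -
      let ?u = "min (real R) (vnorm D x)" and ?v = "min (real R) (vnorm D y)"
      have "\<bar>vnorm D x - vnorm D y\<bar> \<le> vnorm D (x - y)"
      proof -
        have "vnorm D (y - x) = vnorm D (x - y)" by (simp add: vnorm_def power2_commute)
        then show ?thesis using vnorm_triangle_diff[of D x y] vnorm_triangle_diff[of D y x] by linarith
      qed
      then have 1: "\<bar>?u - ?v\<bar> \<le> vnorm D (x - y)" by linarith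
      have 2: "\<bar>?u + ?v\<bar> \<le> 2 * real R" using vnorm_nonneg[of D x] vnorm_nonneg[of D y] by linarith
      have "(\<psi> (real R) x - \<psi> (real R) y)\<^sup>2 = (\<bar>?u + ?v\<bar> * \<bar>?u - ?v\<bar>)\<^sup>2"
        unfolding \<psi>_def by (simp add: power2_eq_square algebra_simps abs_mult[symmetric])
      also have "\<dots> \<le> (2 * real R * vnorm D (x - y))\<^sup>2"
        using 1 2 by (intro power_mono mult_mono) auto
      finally show ?thesis by (simp add: power_mult_distrib vnorm_square)
    qed
    have Xs: "X s \<omega> \<in> vspace D" if "\<omega> \<in> space M" for \<omega> using X.Y_vspace that s0 st tT by auto
    have int1: "integrable M (\<lambda>\<omega>. \<psi> (real R) (X t \<omega>))"
      by (rule integrable_const_bound[of _ "(real R)\<^sup>2"]) (use bnd in auto)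
    have fe: "(\<integral>\<omega>. indicator (space M) \<omega> * (\<psi> (real R) (X t \<omega>) * 1) \<partial>M)
       = (\<integral>\<omega>. indicator (space M) \<omega> * (\<integral>\<omega>'. \<psi> (real R) (fl (X s \<omega>) s t \<omega>') * 1 \<partial>M) \<partial>M)"
      unfolding t
      by (rule flow_expectation[OF solX order_refl \<eta> _ d _ _ \<psi>m bnd(2) _ lip])
         (use s t tT solfl s0 st sets.top[of "F s"] in auto)
    have "(\<integral>\<^sup>+\<omega>. ennreal (\<psi> (real R) (X t \<omega>)) \<partial>M) = ennreal (\<integral>\<omega>. \<psi> (real R) (X t \<omega>) \<partial>M)"
      by (rule nn_integral_eq_integral[OF int1]) (use bnd in auto)
    also have "(\<integral>\<omega>. \<psi> (real R) (X t \<omega>) \<partial>M) = (\<integral>\<omega>. indicator (space M) \<omega> * (\<psi> (real R) (X t \<omega>) * 1) \<partial>M)"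
      by (rule Bochner_Integration.integral_cong) auto
    also have "\<dots> = (\<integral>\<omega>. (\<integral>\<omega>'. \<psi> (real R) (fl (X s \<omega>) s t \<omega>') \<partial>M) \<partial>M)"
      unfolding fe by (rule Bochner_Integration.integral_cong) auto
    also have "ennreal \<dots> \<le> (\<integral>\<^sup>+\<omega>. ennreal (\<integral>\<omega>'. \<psi> (real R) (fl (X s \<omega>) s t \<omega>') \<partial>M) \<partial>M)"
      by (rule ennreal_integral_le) (use bnd in \<open>auto intro!: Bochner_Integration.integral_nonneg\<close>)
    also have "\<dots> \<le> (\<integral>\<^sup>+\<omega>. ennreal ?C * ennreal ((1 + vnorm D (X s \<omega>))\<^sup>2) \<partial>M)"
    proof (rule nn_integral_mono)
      fix \<omega> assume w: "\<omega> \<in> space M"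
      have [measurable]: "fl (X s \<omega>) s t \<in> measurable M borel" using fl_meas[OF s0 _ tT Xs[OF w]] st by simp
      have "ennreal (\<integral>\<omega>'. \<psi> (real R) (fl (X s \<omega>) s t \<omega>') \<partial>M) = (\<integral>\<^sup>+\<omega>'. ennreal (\<psi> (real R) (fl (X s \<omega>) s t \<omega>')) \<partial>M)"
        by (rule nn_integral_eq_integral[symmetric])
           (use bnd in \<open>auto intro!: integrable_const_bound[of _ "(real R)\<^sup>2"]\<close>)
      also have "\<dots> \<le> (\<integral>\<^sup>+\<omega>'. ennreal ((1 + vnorm D (fl (X s \<omega>) s t \<omega>'))\<^sup>2) \<partial>M)"
        by (intro nn_integral_mono ennreal_leI) (auto simp: \<psi>_def intro!: power_mono)
      also have "\<dots> \<le> ennreal (?C * (1 + vnorm D (X s \<omega>))\<^sup>2)"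
        by (rule flow_second_moment[OF nst(1,2) st nst(3) Xs[OF w]])
      finally show "ennreal (\<integral>\<omega>'. \<psi> (real R) (fl (X s \<omega>) s t \<omega>') \<partial>M) \<le> ennreal ?C * ennreal ((1 + vnorm D (X s \<omega>))\<^sup>2)"
        by (simp add: ennreal_mult)
    qed
    also have "\<dots> = ennreal ?C * m2 s" unfolding m2_def by (rule nn_integral_cmult) measurable
    finally show ?thesis .
  qed
  have "(\<integral>\<^sup>+\<omega>. ennreal ((vnorm D (X t \<omega>))\<^sup>2) \<partial>M) \<le> ennreal ?C * m2 s"
  proof -
    have "(\<integral>\<^sup>+\<omega>. ennreal ((vnorm D (X t \<omega>))\<^sup>2) \<partial>M) \<le> (\<integral>\<^sup>+\<omega>. liminf (\<lambda>R. ennreal (\<psi> (real R) (X t \<omega>))) \<partial>M)"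
    proof (rule nn_integral_mono)
      fix \<omega>
      obtain R0 :: nat where R0: "vnorm D (X t \<omega>) \<le> real R0" using real_arch_simple by blast
      have "\<forall>\<^sub>F R in sequentially. ennreal ((vnorm D (X t \<omega>))\<^sup>2) \<le> ennreal (\<psi> (real R) (X t \<omega>))"
        unfolding eventually_sequentially \<psi>_def
        by (rule exI[of _ R0]) (use R0 in \<open>auto simp: min_def not_le intro: order_trans\<close>)
      then show "ennreal ((vnorm D (X t \<omega>))\<^sup>2) \<le> liminf (\<lambda>R. ennreal (\<psi> (real R) (X t \<omega>)))" by (rule Liminf_bounded)
    qed
    also have "\<dots> \<le> liminf (\<lambda>R. \<integral>\<^sup>+\<omega>. ennreal (\<psi> (real R) (X t \<omega>)) \<partial>M)" by (rule nn_integral_liminf) measurable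
    also have "\<dots> \<le> ennreal ?C * m2 s" by (rule Liminf_le) (use step in auto)
    finally show ?thesis .
  qed
  moreover have "m2 t \<le> (\<integral>\<^sup>+\<omega>. 2 + 2 * ennreal ((vnorm D (X t \<omega>))\<^sup>2) \<partial>M)"
    unfolding m2_def
  proof (rule nn_integral_mono)
    fix \<omega>
    have "(1 + vnorm D (X t \<omega>))\<^sup>2 \<le> 2 + 2 * (vnorm D (X t \<omega>))\<^sup>2" using square_add_le[of 1 "vnorm D (X t \<omega>)"] by simp
    then have "ennreal ((1 + vnorm D (X t \<omega>))\<^sup>2) \<le> ennreal (2 + 2 * (vnorm D (X t \<omega>))\<^sup>2)" by (rule ennreal_leI)
    then show "ennreal ((1 + vnorm D (X t \<omega>))\<^sup>2) \<le> 2 + 2 * ennreal ((vnorm D (X t \<omega>))\<^sup>2)" by (simp add: ennreal_plus ennreal_mult)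
  qed
  moreover have "(\<integral>\<^sup>+\<omega>. 2 + 2 * ennreal ((vnorm D (X t \<omega>))\<^sup>2) \<partial>M) = 2 + 2 * (\<integral>\<^sup>+\<omega>. ennreal ((vnorm D (X t \<omega>))\<^sup>2) \<partial>M)"
    by (subst nn_integral_add, simp, simp, subst nn_integral_cmult, simp, simp add: emeasure_space_1)
  moreover have one: "1 \<le> m2 s"
  proof -
    have "(1::ennreal) = (\<integral>\<^sup>+\<omega>. 1 \<partial>M)" by (simp add: emeasure_space_1)
    also have "\<dots> \<le> m2 s" unfolding m2_def
      by (intro nn_integral_mono) (auto simp: one_ennreal_def[symmetric] simp flip: ennreal_1 intro!: ennreal_leI)
    finally show ?thesis .
  qed
  ultimately have "m2 t \<le> 2 + 2 * (ennreal ?C * m2 s)"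
    by (smt (verit, best) add_left_mono mult_left_mono order_trans zero_le)
  also have "\<dots> \<le> 2 * m2 s + 2 * (ennreal ?C * m2 s)" using mult_left_mono[OF one, of 2] by (intro add_right_mono) simp
  \<comment> \<open>\<open>10 = 2 + 2 * 4\<close>: the additive 2 was absorbed through
    \<open>m2 s \<ge> 1\<close>, which turns the recursion into a purely multiplicative one.\<close>
  also have "\<dots> = ennreal (10 + 4 * K powr p) * m2 s"
  proof -
    have "ennreal (10 + 4 * K powr p) = 2 + 2 * ennreal ?C" by (simp add: ennreal_plus ennreal_mult distrib_left flip: add.assoc)
    then show ?thesis by (simp only: distrib_right mult.assoc)
  qed
  finally show ?thesis .
qed

end

text \<open>Compare \<open>v\<^sup>2\<close> with \<open>u powr (p - 2)\<close>: below it the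
  product is at most \<open>u powr p\<close>; above it \<open>u \<le> v powr (2 / (p - 2))\<close>,
  and the product is at most \<open>v powr (2 + 4 / (p - 2))\<close> when \<open>v > 1\<close>. This
  is where \<open>p > 2\<close> enters. An even exponent is taken because even Gaussian moments are
  explicit.\<close>

lemma young_power:
  fixes u v p :: real
  assumes "u \<ge> 0" "v \<ge> 0" "p > 2" and j: "2 + 4 / (p - 2) \<le> real (2 * j)"
  shows "u\<^sup>2 * v\<^sup>2 \<le> 1 + u powr p + v ^ (2 * j)"
proof -
  have up: "u powr p \<ge> 0" "v ^ (2 * j) \<ge> 0" using assms by auto
  show ?thesis
  proof (cases "v \<le> 1")
    case True
    then have v: "v\<^sup>2 \<le> 1" using assms by (simp add: power_le_one)
    have "u\<^sup>2 * v\<^sup>2 \<le> u\<^sup>2 * 1" using v by (intro mult_left_mono) auto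
    also have "\<dots> \<le> 1 + u powr p"
    proof (cases "u \<le> 1")
      case True
      then have "u\<^sup>2 \<le> 1" using assms by (simp add: power_le_one)
      then show ?thesis using up by linarith
    next
      case False
      then have "u\<^sup>2 = u powr 2" by simp
      also have "\<dots> \<le> u powr p" using False assms by (intro powr_mono) auto
      finally show ?thesis by simp
    qed
    finally show ?thesis using up by linarith
  next
    case False
    then have v: "v > 1" by simp
    show ?thesis
    proof (cases "v\<^sup>2 \<le> u powr (p - 2)")
      case True
      have u: "u > 0"
      proof (rule ccontr)
        assume "\<not> u > 0"
        then have "v\<^sup>2 \<le> 0" using assms True by simp
        then show False using v by simp
      qed
      have "u\<^sup>2 * v\<^sup>2 \<le> u\<^sup>2 * u powr (p - 2)" using True by (intro mult_left_mono) auto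
      also have "\<dots> = u powr p" using u by (simp add: powr_diff)
      finally show ?thesis using up by linarith
    next
      case False
      have "u \<le> v powr (2 / (p - 2))"
      proof (rule ccontr)
        assume "\<not> ?thesis"
        then have "(v powr (2 / (p - 2))) powr (p - 2) \<le> u powr (p - 2)" using assms by (intro powr_mono2) auto
        moreover have "2 / (p - 2) * (p - 2) = 2"
          using assms(3) by (simp only: times_divide_eq_left) (rule nonzero_mult_div_cancel_right, simp)
        ultimately have "v powr 2 \<le> u powr (p - 2)" by (simp only: powr_powr)
        then show False using False v by simp
      qed
      then have "u\<^sup>2 \<le> (v powr (2 / (p - 2)))\<^sup>2" using assms by (intro power_mono) auto
      also have "\<dots> = v powr (4 / (p - 2))"
        using v by (simp add: power2_eq_square flip: powr_add)
      finally have "u\<^sup>2 * v\<^sup>2 \<le> v powr (4 / (p - 2)) * v powr 2" using v by (intro mult_mono) auto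
      also have "\<dots> = v powr (2 + 4 / (p - 2))" by (simp add: powr_add mult.commute)
      also have "\<dots> \<le> v powr (real (2 * j))" using v j by (intro powr_mono) auto
      also have "\<dots> = v ^ (2 * j)" using v by (subst powr_realpow) auto
      finally show ?thesis using up by linarith
    qed
  qed
qed

lemma sum_power_le:
  fixes f :: "nat \<Rightarrow> real"
  assumes "D \<ge> 1" "\<And>i. f i \<ge> 0"
  shows "(\<Sum>i<D. f i) ^ j \<le> real D ^ j * (\<Sum>i<D. f i ^ j)"
proof -
  define m where "m = Max (f ` {..<D})"
  have ne: "f ` {..<D} \<noteq> {}" using assms(1) by (auto simp: lessThan_empty_iff)
  have "m \<in> f ` {..<D}" unfolding m_def using ne by (intro Max_in) auto
  then obtain i0 where i0: "i0 < D" "m = f i0" by auto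
  have "(\<Sum>i<D. f i) \<le> (\<Sum>i<D. m)" by (intro sum_mono) (auto simp: m_def)
  then have "(\<Sum>i<D. f i) ^ j \<le> (real D * m) ^ j" using assms by (intro power_mono sum_nonneg) auto
  also have "\<dots> = real D ^ j * f i0 ^ j" by (simp add: power_mult_distrib i0)
  also have "\<dots> \<le> real D ^ j * (\<Sum>i<D. f i ^ j)"
    using assms i0 by (intro mult_left_mono member_le_sum[of i0 _ "\<lambda>i. f i ^ j"]) auto
  finally show ?thesis .
qed

lemma powr_one_plus_le: "(1 + x) powr p \<le> 2 powr p * (1 + x powr p)" if "x \<ge> 0" "p > 0" for x p :: real
proof -
  have "(1 + x) powr p \<le> (2 * max 1 x) powr p" using that by (intro powr_mono2) auto
  also have "\<dots> = 2 powr p * (max 1 x) powr p" by (simp add: powr_mult)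
  also have "\<dots> \<le> 2 powr p * (1 + x powr p)" by (intro mult_left_mono) (auto simp: max_def)
  finally show ?thesis .
qed

text \<open>The quotient of factorials is the standard Gaussian moment of order
  \<open>2 * j\<close>; \<open>j\<close> powers of \<open>D\<close> come from the power of a sum and
  one more from summing coordinates, so the bound is polynomial in \<open>D\<close> once
  \<open>j\<close> is fixed.\<close>

lemma (in brownian) incr_norm_moment:
  assumes D: "D \<ge> 1" and st: "0 \<le> s" "s < t" "t \<le> T"
  shows "(\<integral>\<^sup>+\<omega>. ennreal (vnorm D (\<lambda>i. \<Delta> s t i \<omega>) ^ (2 * j)) \<partial>M) \<le> ennreal (real D ^ Suc j * (fact (2 * j) / (2 ^ j * fact j) * T ^ j))"
proof -
  let ?c = "fact (2 * j) / (2 ^ j * fact j) :: real"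
  have [measurable]: "\<Delta> s t i \<in> borel_measurable M" for i using st by (intro borel_measurable_diff W_meas) auto
  have "(\<integral>\<^sup>+\<omega>. ennreal (vnorm D (\<lambda>i. \<Delta> s t i \<omega>) ^ (2 * j)) \<partial>M) \<le> (\<integral>\<^sup>+\<omega>. ennreal (real D ^ j) * (\<Sum>i<D. ennreal ((\<Delta> s t i \<omega>) ^ (2 * j))) \<partial>M)"
  proof (rule nn_integral_mono)
    fix \<omega>
    have "vnorm D (\<lambda>i. \<Delta> s t i \<omega>) ^ (2 * j) = (\<Sum>i<D. (\<Delta> s t i \<omega>)\<^sup>2) ^ j"
      unfolding power_mult vnorm_square ..
    also have "\<dots> \<le> real D ^ j * (\<Sum>i<D. ((\<Delta> s t i \<omega>)\<^sup>2) ^ j)" by (rule sum_power_le[OF D]) simp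
    finally have "ennreal (vnorm D (\<lambda>i. \<Delta> s t i \<omega>) ^ (2 * j)) \<le> ennreal (real D ^ j * (\<Sum>i<D. (\<Delta> s t i \<omega>) ^ (2 * j)))"
      by (intro ennreal_leI) (simp add: power_mult)
    also have "\<dots> = ennreal (real D ^ j) * (\<Sum>i<D. ennreal ((\<Delta> s t i \<omega>) ^ (2 * j)))"
      by (subst sum_ennreal) (auto simp: ennreal_mult sum_nonneg)
    finally show "ennreal (vnorm D (\<lambda>i. \<Delta> s t i \<omega>) ^ (2 * j)) \<le> ennreal (real D ^ j) * (\<Sum>i<D. ennreal ((\<Delta> s t i \<omega>) ^ (2 * j)))" .
  qed
  also have "\<dots> = ennreal (real D ^ j) * (\<Sum>i<D. \<integral>\<^sup>+\<omega>. ennreal ((\<Delta> s t i \<omega>) ^ (2 * j)) \<partial>M)"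
    by (subst nn_integral_cmult, measurable, subst nn_integral_sum, measurable)
  also have "(\<Sum>i<D. \<integral>\<^sup>+\<omega>. ennreal ((\<Delta> s t i \<omega>) ^ (2 * j)) \<partial>M) = (\<Sum>i<D. ennreal (?c * (t - s) ^ j))"
  proof (rule sum.cong[OF refl])
    fix i assume "i \<in> {..<D}"
    then have i: "i < D" by simp
    have "(\<integral>\<^sup>+\<omega>. ennreal ((\<Delta> s t i \<omega>) ^ (2 * j)) \<partial>M) = ennreal (\<integral>\<omega>. (\<Delta> s t i \<omega>) ^ (2 * j) \<partial>M)"
      by (rule nn_integral_eq_integral[OF incr_power_integrable[OF i st]]) auto
    then show "(\<integral>\<^sup>+\<omega>. ennreal ((\<Delta> s t i \<omega>) ^ (2 * j)) \<partial>M) = ennreal (?c * (t - s) ^ j)"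
      using incr_even_moment[OF i st, of j] by simp
  qed
  also have "ennreal (real D ^ j) * (\<Sum>i<D. ennreal (?c * (t - s) ^ j)) = ennreal (real D ^ Suc j * (?c * (t - s) ^ j))"
    using st by (subst sum_ennreal) (auto simp flip: ennreal_mult simp: mult_ac)
  also have "\<dots> \<le> ennreal (real D ^ Suc j * (?c * T ^ j))"
    using st by (intro ennreal_leI mult_left_mono power_mono) auto
  finally show ?thesis .
qed

context flow_model
begin

text \<open>Half of an even exponent that is large enough for \<open>young_power\<close>; a function
  of \<open>p\<close> alone, hence the same in every dimension.\<close>

definition jexp :: nat where "jexp = nat \<lceil>2 + 4 / (p - 2)\<rceil>"

text \<open>Bounds the mean of the product of \<open>(1 + g)\<^sup>2\<close> with the squared norm
  of an increment. The summands are those of \<open>young_power\<close>: a constant, the moment of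
  order \<open>p\<close> of \<open>1 + g\<close>, and the moment of order \<open>2 * jexp\<close> of
  the increment. Both factors belong to the same sample, so the mean need not factorise.\<close>

definition Q1 :: real where
  "Q1 = 1 + 2 powr p * (1 + K powr p) + real D ^ Suc jexp * (fact (2 * jexp) / (2 ^ jexp * fact jexp) * T ^ jexp)"

lemma Q1_ge: "Q1 \<ge> 1"
  unfolding Q1_def using T0 by (auto intro!: add_nonneg_nonneg mult_nonneg_nonneg)

lemma growth_noise_moment:
  assumes st: "0 \<le> s" "s < t" "t \<le> T"
    and g: "g \<in> borel_measurable M" "\<And>\<omega>. g \<omega> \<ge> (0::real)" "(\<integral>\<^sup>+\<omega>. ennreal (g \<omega> powr p) \<partial>M) \<le> ennreal (K powr p)"
  shows "(\<integral>\<^sup>+\<omega>. ennreal ((1 + g \<omega>)\<^sup>2 * (vnorm D (\<lambda>i. \<Delta> s t i \<omega>))\<^sup>2) \<partial>M) \<le> ennreal Q1"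
proof -
  let ?w = "\<lambda>\<omega>. vnorm D (\<lambda>i. \<Delta> s t i \<omega>)"
  let ?c = "2 powr p"
  note g(1)[measurable]
  have dm: "\<Delta> s t i \<in> borel_measurable M" for i using st by (intro borel_measurable_diff W_meas) auto
  have [measurable]: "?w \<in> borel_measurable M"
    unfolding vnorm_def by (intro measurable_compose[OF _ borel_measurable_sqrt] borel_measurable_sum borel_measurable_power dm)
  have j: "2 + 4 / (p - 2) \<le> real (2 * jexp)"
  proof -
    have "2 + 4 / (p - 2) \<le> real jexp" unfolding jexp_def by (rule real_nat_ceiling_ge)
    also have "\<dots> \<le> real (2 * jexp)" by simp
    finally show ?thesis .
  qed
  have "(\<integral>\<^sup>+\<omega>. ennreal ((1 + g \<omega>)\<^sup>2 * (?w \<omega>)\<^sup>2) \<partial>M) \<le> (\<integral>\<^sup>+\<omega>. (ennreal (1 + ?c) + ennreal ?c * ennreal (g \<omega> powr p)) + ennreal (?w \<omega> ^ (2 * jexp)) \<partial>M)"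
  proof (rule nn_integral_mono)
    fix \<omega>
    have "(1 + g \<omega>)\<^sup>2 * (?w \<omega>)\<^sup>2 \<le> 1 + (1 + g \<omega>) powr p + ?w \<omega> ^ (2 * jexp)"
      by (rule young_power) (use g(2)[of \<omega>] p2 j in auto)
    also have "\<dots> \<le> ((1 + ?c) + ?c * g \<omega> powr p) + ?w \<omega> ^ (2 * jexp)"
      using powr_one_plus_le[OF g(2)[of \<omega>], of p] p2 by (simp add: distrib_left)
    finally have "ennreal ((1 + g \<omega>)\<^sup>2 * (?w \<omega>)\<^sup>2) \<le> ennreal (((1 + ?c) + ?c * g \<omega> powr p) + ?w \<omega> ^ (2 * jexp))" by (rule ennreal_leI)
    also have "\<dots> = (ennreal (1 + ?c) + ennreal ?c * ennreal (g \<omega> powr p)) + ennreal (?w \<omega> ^ (2 * jexp))"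
      by (subst ennreal_plus, simp, simp, subst ennreal_plus, auto simp: ennreal_mult)
    finally show "ennreal ((1 + g \<omega>)\<^sup>2 * (?w \<omega>)\<^sup>2) \<le> (ennreal (1 + ?c) + ennreal ?c * ennreal (g \<omega> powr p)) + ennreal (?w \<omega> ^ (2 * jexp))" .
  qed
  also have "\<dots> = (ennreal (1 + ?c) + ennreal ?c * (\<integral>\<^sup>+\<omega>. ennreal (g \<omega> powr p) \<partial>M)) + (\<integral>\<^sup>+\<omega>. ennreal (?w \<omega> ^ (2 * jexp)) \<partial>M)"
    by (subst nn_integral_add, measurable, subst nn_integral_add, measurable, subst nn_integral_cmult, measurable, simp add: emeasure_space_1)
  also have "\<dots> \<le> (ennreal (1 + ?c) + ennreal ?c * ennreal (K powr p)) + ennreal (real D ^ Suc jexp * (fact (2 * jexp) / (2 ^ jexp * fact jexp) * T ^ jexp))"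
    by (intro add_mono order_refl mult_left_mono g incr_norm_moment[OF D0 st]) auto
  also have "\<dots> = ennreal (((1 + ?c) + ?c * K powr p) + real D ^ Suc jexp * (fact (2 * jexp) / (2 ^ jexp * fact jexp) * T ^ jexp))"
    using T0 by (subst ennreal_plus, simp, simp, subst ennreal_plus, auto simp: ennreal_mult)
  also have "((1 + ?c) + ?c * K powr p) + real D ^ Suc jexp * (fact (2 * jexp) / (2 ^ jexp * fact jexp) * T ^ jexp) = Q1"
    by (simp add: Q1_def distrib_left)
  finally show ?thesis .
qed

text \<open>Every time of the coarse and the fine grid is an integer multiple of
  \<open>dt T N m\<close>, the form in which \<open>flow_expectation\<close> accepts times.\<close>

lemma tgrid_dt: "m \<ge> 1 \<Longrightarrow> tgrid T N n = real (n * m) * dt T N m"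
  using N_ge by (simp add: tgrid_def dt_def)

lemma tsub_dt: "m \<ge> 1 \<Longrightarrow> tsub T N m n k = real (n * m + k) * dt T N m"
  using tgrid_dt[of m n] by (simp add: tsub_def distrib_right)

lemma tsub_end: "m \<ge> 1 \<Longrightarrow> tsub T N m n m = tgrid T N (Suc n)"
  using tgrid_dt[of m "Suc n"] tsub_dt[of m n m] by (simp add: add.commute)

lemma dt_pos: "m \<ge> 1 \<Longrightarrow> dt T N m > 0"
  using T0 N_ge by (simp add: dt_def)

lemma m2_0: "m2 0 = ennreal ((1 + vnorm D x0)\<^sup>2)"
proof -
  have "AE \<omega> in M. X 0 \<omega> = x0" using sde_sol_start[OF solX _ _ x0] T0 by simp
  then have "m2 0 = (\<integral>\<^sup>+\<omega>. ennreal ((1 + vnorm D x0)\<^sup>2) \<partial>M)"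
    unfolding m2_def by (intro nn_integral_cong_AE) (auto elim: eventually_mono)
  then show ?thesis by (simp add: emeasure_space_1)
qed

lemma m2_grid: "n \<le> N \<Longrightarrow> m2 (tgrid T N n) \<le> ennreal ((10 + 4 * K powr p) ^ n * (1 + vnorm D x0)\<^sup>2)"
proof (induction n)
  case 0
  then show ?case using m2_0 by (simp add: tgrid_def)
next
  case (Suc n)
  have "m2 (tgrid T N (Suc n)) \<le> ennreal (10 + 4 * K powr p) * m2 (tgrid T N n)"
    by (rule moment_step[of n _ _ "dt T N 1" n 1])
       (use Suc.prems dt_pos[of 1] tgrid_dt[of 1 n] tgrid_dt[of 1 "Suc n"] in \<open>auto simp: distrib_right\<close>)
  also have "\<dots> \<le> ennreal (10 + 4 * K powr p) * ennreal ((10 + 4 * K powr p) ^ n * (1 + vnorm D x0)\<^sup>2)"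
    using Suc by (intro mult_left_mono) auto
  also have "\<dots> = ennreal ((10 + 4 * K powr p) ^ Suc n * (1 + vnorm D x0)\<^sup>2)"
    by (subst ennreal_mult[symmetric]) (auto simp: mult.assoc)
  finally show ?case .
qed

text \<open>The exponent \<open>Suc n\<close> stands for \<open>n\<close> steps along the coarse
  grid to \<open>tgrid T N n\<close> and one further step to a fine time of the next
  interval.\<close>

definition m2max :: "nat \<Rightarrow> real" where
  "m2max n = (10 + 4 * K powr p) ^ Suc n * (1 + vnorm D x0)\<^sup>2"

lemma m2max_pos: "m2max n > 0"
  unfolding m2max_def using vnorm_nonneg[of D x0] by (intro mult_pos_pos zero_less_power) (auto intro: add_pos_nonneg)

lemma m2_tsub:
  assumes "n < N" "m \<ge> 1" "k \<le> m"
  shows "m2 (tsub T N m n k) \<le> ennreal (m2max n)"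
proof (cases "k = 0")
  case True
  \<comment> \<open>At \<open>k = 0\<close> there is no further step to take, and
    \<open>moment_step\<close> demands a positive number of them.\<close>
  have "m2 (tgrid T N n) \<le> ennreal ((10 + 4 * K powr p) ^ n * (1 + vnorm D x0)\<^sup>2)" using assms by (intro m2_grid) simp
  also have "\<dots> \<le> ennreal (m2max n)"
  proof (intro ennreal_leI)
    have "1 \<le> 10 + 4 * K powr p" by (simp add: add_increasing2)
    then have "(10 + 4 * K powr p) ^ n \<le> (10 + 4 * K powr p) ^ Suc n" by (intro power_increasing) auto
    then show "(10 + 4 * K powr p) ^ n * (1 + vnorm D x0)\<^sup>2 \<le> m2max n" unfolding m2max_def by (intro mult_right_mono) auto
  qed
  finally show ?thesis using True by (simp add: tsub_def)
next
  case False
  have le: "tsub T N m n k \<le> tgrid T N (Suc n)" unfolding tsub_end[OF assms(2), symmetric] tsub_def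
    using assms dt_pos[of m] by (intro add_left_mono mult_right_mono) auto
  have "m2 (tsub T N m n k) \<le> ennreal (10 + 4 * K powr p) * m2 (tgrid T N n)"
    by (intro moment_step[of n _ _ "dt T N m" "n * m" k])
       (use assms False dt_pos[of m] tgrid_dt[of m n] le in \<open>auto simp: tsub_def\<close>)
  also have "\<dots> \<le> ennreal (10 + 4 * K powr p) * ennreal ((10 + 4 * K powr p) ^ n * (1 + vnorm D x0)\<^sup>2)"
    using assms by (intro mult_left_mono m2_grid) auto
  also have "\<dots> = ennreal (m2max n)"
    unfolding m2max_def by (subst ennreal_mult[symmetric]) (auto simp: mult.assoc)
  finally show ?thesis .
qed

text \<open>Extends \<open>flow_expectation\<close> from bounded functions to linear growth and
  reads it as a conditional expectation. The representing network replaces the flow in the result,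
  which makes the candidate a Borel function of \<open>X s\<close>; domination comes from second
  moments of flow, process and increment.\<close>

lemma cond_exp_flow:
  assumes n: "n < N" and m: "m \<ge> 1" and k: "k < m" and i: "i < D"
    and s: "s = tsub T N m n k" and t: "t = tgrid T N (Suc n)"
    and \<phi>: "\<phi> \<in> borel_measurable borel" "C \<ge> 0" "\<And>y. y \<in> vspace D \<Longrightarrow> \<bar>\<phi> y\<bar> \<le> C * (1 + vnorm D y)"
    and lip: "\<Lambda> \<ge> 0" "\<And>x y. x \<in> vspace D \<Longrightarrow> y \<in> vspace D \<Longrightarrow> (\<phi> x - \<phi> y)\<^sup>2 \<le> \<Lambda> * (\<Sum>i<D. (x i - y i)\<^sup>2)"
    and w: "\<And>l m j. (\<lambda>\<omega>. w \<omega> l m j) \<in> borel_measurable M"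
    and eq: "AE \<omega> in M. \<forall>x\<in>vspace D. fl x s t \<omega> = ran_eval (w \<omega>) I x"
  defines "U \<equiv> \<Delta> s (s + dt T N m) i"
  shows "integrable M (\<lambda>\<omega>. \<phi> (X t \<omega>) * U \<omega>)"
    and "AE \<omega> in M. real_cond_exp M (F s) (\<lambda>\<omega>. \<phi> (X t \<omega>) * U \<omega>) \<omega> = (\<integral>\<omega>'. \<phi> (ran_eval (w \<omega>') I (X s \<omega>)) * U \<omega>' \<partial>M)"
proof -
  let ?\<eta> = "dt T N m"
  have \<eta>: "?\<eta> > 0" using dt_pos[OF m] .
  have sj: "s = 0 + real (n * m + k) * ?\<eta>" using s tsub_dt[OF m] by simp
  have td: "t = s + real (m - k) * ?\<eta>"
    unfolding t s tsub_dt[OF m] tgrid_dt[OF m] using k by (simp add: of_nat_diff algebra_simps)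
  have s0: "0 \<le> s" using sj \<eta> by simp
  have st: "s < t" using td k \<eta> by simp
  have tT: "t \<le> T" using t tgrid_le(1)[of "Suc n"] n by simp
  have s\<eta>: "s < s + ?\<eta>" "s + ?\<eta> \<le> T"
  proof -
    have "1 * ?\<eta> \<le> real (m - k) * ?\<eta>" using k \<eta> by (intro mult_right_mono) auto
    then show "s + ?\<eta> \<le> T" using td tT by simp
  qed (use \<eta> in simp)
  have gs: "tgrid T N n \<le> s" using s \<eta> by (simp add: tsub_def)
  have gt: "t \<le> tgrid T N (Suc n)" using t by simp
  have sT: "s \<le> T" using st tT by simp
  note [measurable] = \<phi>(1)
  have Xt [measurable]: "X t \<in> measurable M borel" and Xs [measurable]: "X s \<in> measurable M borel" using X.Y_meas s0 st tT by auto
  have Xv: "X s \<omega> \<in> vspace D" "X t \<omega> \<in> vspace D" if "\<omega> \<in> space M" for \<omega> using X.Y_vspace that s0 st tT by auto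
  have Um [measurable]: "U \<in> borel_measurable M" unfolding U_def using s0 sT s\<eta> \<eta> by (intro borel_measurable_diff W_meas) auto
  have U2: "integrable M (\<lambda>\<omega>. (U \<omega>)\<^sup>2)" unfolding U_def using incr_power_integrable[OF i s0 s\<eta>, of 2] .
  have m2t: "m2 t \<le> ennreal (m2max n)" using m2_tsub[OF n m order_refl] tsub_end[OF m] t by simp
  have m2s: "m2 s \<le> ennreal (m2max n)" using m2_tsub[OF n m, of k] k s by simp
  have int2: "integrable M (\<lambda>\<omega>. (1 + vnorm D (f \<omega>))\<^sup>2)" if "f \<in> measurable M borel" "(\<integral>\<^sup>+\<omega>. ennreal ((1 + vnorm D (f \<omega>))\<^sup>2) \<partial>M) \<le> ennreal c" for f c
  proof (rule integrableI_nonneg)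
    show "(\<lambda>\<omega>. (1 + vnorm D (f \<omega>))\<^sup>2) \<in> borel_measurable M" using that(1) by measurable
    show "(\<integral>\<^sup>+\<omega>. ennreal ((1 + vnorm D (f \<omega>))\<^sup>2) \<partial>M) < \<infinity>" using that(2) by (simp add: le_less_trans)
  qed simp
  have iX: "integrable M (\<lambda>\<omega>. (1 + vnorm D (X t \<omega>))\<^sup>2)" "integrable M (\<lambda>\<omega>. (1 + vnorm D (X s \<omega>))\<^sup>2)"
    using int2[OF Xt] int2[OF Xs] m2t m2s unfolding m2_def by auto
  have \<phi>2: "(\<phi> y)\<^sup>2 \<le> C\<^sup>2 * (1 + vnorm D y)\<^sup>2" if "y \<in> vspace D" for y
    using power_mono[OF \<phi>(3)[OF that], of 2] by (simp add: power_mult_distrib)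
  have i\<phi>: "integrable M (\<lambda>\<omega>. (\<phi> (f \<omega>))\<^sup>2)" if [measurable]: "f \<in> measurable M borel"
    and "integrable M (\<lambda>\<omega>. (1 + vnorm D (f \<omega>))\<^sup>2)" "\<And>\<omega>. \<omega> \<in> space M \<Longrightarrow> f \<omega> \<in> vspace D" for f
    by (rule Bochner_Integration.integrable_bound[OF integrable_mult_right[OF that(2), of "C\<^sup>2"]])
       (use \<phi>2 that(3) in auto)
  show int: "integrable M (\<lambda>\<omega>. \<phi> (X t \<omega>) * U \<omega>)"
    by (intro integrable_mult_of_squares i\<phi> iX U2) (use Xv in auto)
  \<comment> \<open>Clamping to \<open>[-R, R]\<close> keeps the Lipschitz bound with the same
    \<open>\<Lambda>\<close>, is dominated by \<open>\<phi>\<close>, and at each point equals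
    \<open>\<phi>\<close> for large \<open>R\<close>.\<close>
  define \<psi> where "\<psi> R y = max (- real R) (min (real R) (\<phi> y))" for R :: nat and y
  have \<psi>m [measurable]: "\<psi> R \<in> borel_measurable borel" for R unfolding \<psi>_def by measurable
  have \<psi>B: "\<bar>\<psi> R y\<bar> \<le> real R" "\<bar>\<psi> R y\<bar> \<le> \<bar>\<phi> y\<bar>" for R y unfolding \<psi>_def by auto
  have \<psi>L: "(\<psi> R x - \<psi> R y)\<^sup>2 \<le> \<Lambda> * (\<Sum>i<D. (x i - y i)\<^sup>2)" if "x \<in> vspace D" "y \<in> vspace D" for R x y
  proof -
    have "\<bar>\<psi> R x - \<psi> R y\<bar> \<le> \<bar>\<phi> x - \<phi> y\<bar>" unfolding \<psi>_def by linarith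
    then have "(\<psi> R x - \<psi> R y)\<^sup>2 \<le> (\<phi> x - \<phi> y)\<^sup>2" by (simp only: abs_le_square_iff)
    then show ?thesis using lip(2)[OF that] by linarith
  qed
  have \<psi>lim: "(\<lambda>R. \<psi> R y) \<longlonglongrightarrow> \<phi> y" for y
  proof -
    obtain R0 :: nat where "\<bar>\<phi> y\<bar> \<le> real R0" using real_arch_simple by blast
    then have "\<psi> R y = \<phi> y" if "R \<ge> R0" for R using that unfolding \<psi>_def by auto
    then have "\<forall>\<^sub>F R in sequentially. \<psi> R y = \<phi> y" unfolding eventually_sequentially by blast
    then show ?thesis by (rule tendsto_eventually)
  qed
  define f where "f x \<omega> = ran_eval (w \<omega>) I x" for x \<omega>
  have fj [measurable]: "(\<lambda>z. f (fst z) (snd z)) \<in> measurable (borel \<Otimes>\<^sub>M M) borel"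
    unfolding f_def by (rule ran_eval_measurable) (use w in \<open>auto intro: measurable_compose[OF measurable_snd]\<close>)
  have fm [measurable]: "f x \<in> measurable M borel" for x
    unfolding f_def by (rule ran_eval_measurable[OF w]) simp
  have flf: "AE \<omega> in M. fl x s t \<omega> = f x \<omega>" if "x \<in> vspace D" for x
    using eq by eventually_elim (use that in \<open>auto simp: f_def\<close>)
  have flv: "fl x s t \<omega> \<in> vspace D" if "x \<in> vspace D" "\<omega> \<in> space M" for x \<omega>
    using sde_process.Y_vspace[OF sde_sol_process[OF solfl[OF s0 sT that(1)] s0 order_refl]] st tT that by auto
  let ?C1 = "4 + 2 * K powr p"
  have flow2: "(\<integral>\<^sup>+\<omega>. ennreal ((1 + vnorm D (fl x s t \<omega>))\<^sup>2) \<partial>M) \<le> ennreal (?C1 * (1 + vnorm D x)\<^sup>2)" if "x \<in> vspace D" for x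
    by (rule flow_second_moment[OF n gs st gt that])
  have flm [measurable]: "fl x s t \<in> measurable M borel" if "x \<in> vspace D" for x using fl_meas[OF s0 _ tT that] st by simp
  have ifl: "integrable M (\<lambda>\<omega>. (1 + vnorm D (fl x s t \<omega>))\<^sup>2)" if "x \<in> vspace D" for x
    by (rule int2[OF flm[OF that] flow2[OF that]])
  have i\<phi>fl: "integrable M (\<lambda>\<omega>. (\<phi> (fl x s t \<omega>))\<^sup>2)" if "x \<in> vspace D" for x
    using i\<phi>[OF flm ifl flv] that by blast
  have i\<phi>U: "integrable M (\<lambda>\<omega>. \<phi> (fl x s t \<omega>) * U \<omega>)" if "x \<in> vspace D" for x
    using flm[OF that] by (intro integrable_mult_of_squares i\<phi>fl that U2) auto
  define H where "H x = (\<integral>\<omega>'. \<phi> (f x \<omega>') * U \<omega>' \<partial>M)" for x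
  define HR where "HR R x = (\<integral>\<omega>'. \<psi> R (f x \<omega>') * U \<omega>' \<partial>M)" for R x
  have Hm [measurable]: "H \<in> borel_measurable borel" unfolding H_def
    by (intro borel_measurable_lebesgue_integral) (simp add: split_def, measurable)
  have HRm [measurable]: "HR R \<in> borel_measurable borel" for R unfolding HR_def
    by (intro borel_measurable_lebesgue_integral) (simp add: split_def, measurable)
  have Hfl: "H x = (\<integral>\<omega>'. \<phi> (fl x s t \<omega>') * U \<omega>' \<partial>M)" "HR R x = (\<integral>\<omega>'. \<psi> R (fl x s t \<omega>') * U \<omega>' \<partial>M)" if "x \<in> vspace D" for x R
  proof -
    show "H x = (\<integral>\<omega>'. \<phi> (fl x s t \<omega>') * U \<omega>' \<partial>M)" unfolding H_def
    proof (rule Bochner_Integration.integral_cong_AE)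
      show "AE \<omega> in M. \<phi> (f x \<omega>) * U \<omega> = \<phi> (fl x s t \<omega>) * U \<omega>" using flf[OF that] by eventually_elim simp
    qed (intro borel_measurable_times measurable_compose[OF fm \<phi>(1)] measurable_compose[OF flm[OF that] \<phi>(1)] Um)+
    show "HR R x = (\<integral>\<omega>'. \<psi> R (fl x s t \<omega>') * U \<omega>' \<partial>M)" unfolding HR_def
    proof (rule Bochner_Integration.integral_cong_AE)
      show "AE \<omega> in M. \<psi> R (f x \<omega>) * U \<omega> = \<psi> R (fl x s t \<omega>) * U \<omega>" using flf[OF that] by eventually_elim simp
    qed (intro borel_measurable_times measurable_compose[OF fm \<psi>m] measurable_compose[OF flm[OF that] \<psi>m] Um)+
  qed
  have HRlim: "(\<lambda>R. HR R x) \<longlonglongrightarrow> H x" if "x \<in> vspace D" for x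
    unfolding Hfl[OF that]
  proof (rule integral_dominated_convergence[where w="\<lambda>\<omega>. \<bar>\<phi> (fl x s t \<omega>) * U \<omega>\<bar>"])
    show "AE \<omega> in M. (\<lambda>R. \<psi> R (fl x s t \<omega>) * U \<omega>) \<longlonglongrightarrow> \<phi> (fl x s t \<omega>) * U \<omega>"
      by (intro AE_I2 tendsto_mult \<psi>lim tendsto_const)
    show "AE \<omega> in M. norm (\<psi> R (fl x s t \<omega>) * U \<omega>) \<le> \<bar>\<phi> (fl x s t \<omega>) * U \<omega>\<bar>" for R
      using \<psi>B(2) by (auto simp: abs_mult intro!: mult_right_mono)
  qed (use i\<phi>U[OF that] flm[OF that] in auto)
  define c0 where "c0 = (\<integral>\<omega>. (U \<omega>)\<^sup>2 \<partial>M)"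
  \<comment> \<open>Dominates all frozen expectations at once, since a product is at most the sum of
    the two squares; integrable along \<open>X s\<close> because \<open>m2 s\<close> is
    finite.\<close>
  define dom where "dom x = C\<^sup>2 * (?C1 * (1 + vnorm D x)\<^sup>2) + c0" for x
  have bound: "\<bar>\<integral>\<omega>'. \<zeta> (fl x s t \<omega>') * U \<omega>' \<partial>M\<bar> \<le> dom x" if x: "x \<in> vspace D"
    and z: "\<And>y. \<bar>\<zeta> y\<bar> \<le> \<bar>\<phi> y\<bar>" "\<zeta> \<in> borel_measurable borel" for x \<zeta>
  proof -
    note z(2)[measurable] flm[OF x, measurable]
    have iz: "integrable M (\<lambda>\<omega>. \<zeta> (fl x s t \<omega>) * U \<omega>)"
      by (rule Bochner_Integration.integrable_bound[OF i\<phi>U[OF x]])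
         (use z(1) in \<open>auto simp: abs_mult intro!: mult_right_mono\<close>)
    have "\<bar>\<integral>\<omega>'. \<zeta> (fl x s t \<omega>') * U \<omega>' \<partial>M\<bar> \<le> (\<integral>\<omega>'. \<bar>\<zeta> (fl x s t \<omega>') * U \<omega>'\<bar> \<partial>M)" by (rule integral_abs_bound)
    also have "\<dots> \<le> (\<integral>\<omega>'. C\<^sup>2 * (1 + vnorm D (fl x s t \<omega>'))\<^sup>2 + (U \<omega>')\<^sup>2 \<partial>M)"
    proof (intro integral_mono integrable_abs iz Bochner_Integration.integrable_add integrable_mult_right ifl x U2)
      fix \<omega> assume w: "\<omega> \<in> space M"
      have ab: "\<bar>u * v\<bar> \<le> u\<^sup>2 + v\<^sup>2" for u v :: real
        using sum_squares_bound[of "\<bar>u\<bar>" "\<bar>v\<bar>"] zero_le_power2[of u] zero_le_power2[of v]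
        by (simp only: abs_mult power2_abs)
      have "\<bar>\<zeta> (fl x s t \<omega>) * U \<omega>\<bar> \<le> \<bar>\<phi> (fl x s t \<omega>) * U \<omega>\<bar>" using z(1) by (auto simp: abs_mult intro!: mult_right_mono)
      also have "\<dots> \<le> (\<phi> (fl x s t \<omega>))\<^sup>2 + (U \<omega>)\<^sup>2" by (rule ab)
      also have "\<dots> \<le> C\<^sup>2 * (1 + vnorm D (fl x s t \<omega>))\<^sup>2 + (U \<omega>)\<^sup>2" using \<phi>2[OF flv[OF x w]] by simp
      finally show "\<bar>\<zeta> (fl x s t \<omega>) * U \<omega>\<bar> \<le> C\<^sup>2 * (1 + vnorm D (fl x s t \<omega>))\<^sup>2 + (U \<omega>)\<^sup>2" .
    qed
    also have "\<dots> = C\<^sup>2 * (\<integral>\<omega>'. (1 + vnorm D (fl x s t \<omega>'))\<^sup>2 \<partial>M) + c0"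
      unfolding c0_def using ifl[OF x] U2 by simp
    also have "\<dots> \<le> dom x"
    proof -
      have "ennreal (\<integral>\<omega>'. (1 + vnorm D (fl x s t \<omega>'))\<^sup>2 \<partial>M) \<le> ennreal (?C1 * (1 + vnorm D x)\<^sup>2)"
        using flow2[OF x] by (subst nn_integral_eq_integral[symmetric]) (use ifl[OF x] in auto)
      then have "(\<integral>\<omega>'. (1 + vnorm D (fl x s t \<omega>'))\<^sup>2 \<partial>M) \<le> ?C1 * (1 + vnorm D x)\<^sup>2"
        by (subst (asm) ennreal_le_iff) (auto intro!: mult_nonneg_nonneg add_nonneg_nonneg)
      then show ?thesis unfolding dom_def by (intro add_right_mono mult_left_mono) auto
    qed
    finally show ?thesis .
  qed
  have idom: "integrable M (\<lambda>\<omega>. dom (X s \<omega>))"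
    unfolding dom_def using iX(2) by (intro Bochner_Integration.integrable_add integrable_mult_right) auto
  have Hdom: "\<bar>H (X s \<omega>)\<bar> \<le> dom (X s \<omega>)" "\<bar>HR R (X s \<omega>)\<bar> \<le> dom (X s \<omega>)" if "\<omega> \<in> space M" for \<omega> R
    unfolding Hfl[OF Xv(1)[OF that]] using \<psi>B(2) by (auto intro!: bound Xv that)
  have intH: "integrable M (\<lambda>\<omega>. H (X s \<omega>))"
    by (rule Bochner_Integration.integrable_bound[OF idom]) (use Hdom(1) in \<open>auto intro!: AE_I2 order_trans[OF _ abs_ge_self]\<close>)
  have main: "(\<integral>\<omega>. indicator A \<omega> * (\<phi> (X t \<omega>) * U \<omega>) \<partial>M) = (\<integral>\<omega>. indicator A \<omega> * H (X s \<omega>) \<partial>M)" if A: "A \<in> sets (F s)" for A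
  proof -
    have [measurable]: "A \<in> events" using A subalgebra_F[OF sT] by (auto simp: subalgebra_def)
    have step: "(\<integral>\<omega>. indicator A \<omega> * (\<psi> R (X t \<omega>) * U \<omega>) \<partial>M) = (\<integral>\<omega>. indicator A \<omega> * HR R (X s \<omega>) \<partial>M)" for R
    proof -
      have "(\<integral>\<omega>. indicator A \<omega> * (\<psi> R (X t \<omega>) * U \<omega>) \<partial>M)
         = (\<integral>\<omega>. indicator A \<omega> * (\<integral>\<omega>'. \<psi> R (fl (X s \<omega>) s t \<omega>') * U \<omega>' \<partial>M) \<partial>M)"
        unfolding td
      proof (rule flow_expectation[OF solX order_refl \<eta> sj _ _ solfl \<psi>m \<psi>B(1) lip(1) \<psi>L _ A])
        show "1 \<le> m - k" using k by simp
        show "s + real (m - k) * ?\<eta> \<le> T" using td tT by simp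
        show "U = (\<lambda>_. 1) \<or> (\<exists>i<D. U = \<Delta> s (s + ?\<eta>) i)" using i by (auto simp: U_def)
      qed (use s0 sT in auto)
      also have "\<dots> = (\<integral>\<omega>. indicator A \<omega> * HR R (X s \<omega>) \<partial>M)"
        by (rule Bochner_Integration.integral_cong[OF refl]) (use Hfl(2)[OF Xv(1)] in simp)
      finally show ?thesis .
    qed
    have l1: "(\<lambda>R. \<integral>\<omega>. indicator A \<omega> * (\<psi> R (X t \<omega>) * U \<omega>) \<partial>M) \<longlonglongrightarrow> (\<integral>\<omega>. indicator A \<omega> * (\<phi> (X t \<omega>) * U \<omega>) \<partial>M)"
    proof (rule integral_dominated_convergence[where w="\<lambda>\<omega>. \<bar>\<phi> (X t \<omega>) * U \<omega>\<bar>"])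
      show "AE \<omega> in M. (\<lambda>R. indicator A \<omega> * (\<psi> R (X t \<omega>) * U \<omega>)) \<longlonglongrightarrow> indicator A \<omega> * (\<phi> (X t \<omega>) * U \<omega>)"
        by (intro AE_I2 tendsto_mult \<psi>lim tendsto_const)
      show "AE \<omega> in M. norm (indicator A \<omega> * (\<psi> R (X t \<omega>) * U \<omega>)) \<le> \<bar>\<phi> (X t \<omega>) * U \<omega>\<bar>" for R
        using \<psi>B(2) by (auto simp: abs_mult indicator_def intro!: mult_right_mono)
    qed (use int in auto)
    have l2: "(\<lambda>R. \<integral>\<omega>. indicator A \<omega> * HR R (X s \<omega>) \<partial>M) \<longlonglongrightarrow> (\<integral>\<omega>. indicator A \<omega> * H (X s \<omega>) \<partial>M)"
    proof (rule integral_dominated_convergence[where w="\<lambda>\<omega>. dom (X s \<omega>)"])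
      show "AE \<omega> in M. (\<lambda>R. indicator A \<omega> * HR R (X s \<omega>)) \<longlonglongrightarrow> indicator A \<omega> * H (X s \<omega>)"
        by (intro AE_I2 tendsto_mult HRlim Xv tendsto_const)
      show "AE \<omega> in M. norm (indicator A \<omega> * HR R (X s \<omega>)) \<le> dom (X s \<omega>)" for R
      proof (rule AE_I2)
        fix \<omega> assume "\<omega> \<in> space M"
        from Hdom(2)[OF this, of R] show "norm (indicator A \<omega> * HR R (X s \<omega>)) \<le> dom (X s \<omega>)" by (auto simp: indicator_def)
      qed
    qed (use idom in auto)
    show ?thesis by (rule LIMSEQ_unique[OF l1]) (use l2 in \<open>simp add: step\<close>)
  qed
  interpret sub: finite_measure_subalgebra M "F s"
    by unfold_locales (rule subalgebra_F[OF sT])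
  have "AE \<omega> in M. real_cond_exp M (F s) (\<lambda>\<omega>. \<phi> (X t \<omega>) * U \<omega>) \<omega> = H (X s \<omega>)"
  proof (rule sub.real_cond_exp_charact[OF _ int intH])
    show "(\<lambda>\<omega>. H (X s \<omega>)) \<in> borel_measurable (F s)"
      by (rule measurable_compose[OF X.Y_meas_F Hm]) (use s0 sT in auto)
  qed (use main in \<open>simp add: set_lebesgue_integral_def\<close>)
  then show "AE \<omega> in M. real_cond_exp M (F s) (\<lambda>\<omega>. \<phi> (X t \<omega>) * U \<omega>) \<omega> = (\<integral>\<omega>'. \<phi> (ran_eval (w \<omega>') I (X s \<omega>)) * U \<omega>' \<partial>M)"
    by (simp add: H_def f_def)
qed

end

section \<open>Sampling\<close>

text \<open>Otherwise \<open>f > c\<close> almost surely, whereas the bound on the mean forces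
  \<open>f - c\<close> to have integral zero. The side condition \<open>P\<close> allows null sets
  of bad samples to be avoided, and \<open>f\<close> may take infinite values.\<close>

lemma (in prob_space) exists_le_mean:
  fixes f :: "'a \<Rightarrow> ennreal"
  assumes f [measurable]: "f \<in> borel_measurable M" and P: "AE \<omega> in M. P \<omega>" and c: "(\<integral>\<^sup>+\<omega>. f \<omega> \<partial>M) \<le> c"
  shows "\<exists>\<omega>\<in>space M. P \<omega> \<and> f \<omega> \<le> c"
proof (rule ccontr)
  assume nt: "\<not> ?thesis"
  have "AE \<omega> in M. c < f \<omega>"
    using P AE_space
  proof eventually_elim
    case (elim \<omega>)
    then show ?case using nt by (auto simp: not_le)
  qed
  then have le: "AE \<omega> in M. c \<le> f \<omega>" and lt: "AE \<omega> in M. c < f \<omega>" by (auto elim: eventually_mono)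
  have cfin: "c \<noteq> \<infinity>"
  proof
    assume "c = \<infinity>"
    then have "AE \<omega> in M. False" using lt by (auto elim: eventually_mono)
    then show False by simp
  qed
  have "(\<integral>\<^sup>+\<omega>. f \<omega> - c \<partial>M) = (\<integral>\<^sup>+\<omega>. f \<omega> \<partial>M) - (\<integral>\<^sup>+\<omega>. c \<partial>M)"
    using le cfin by (intro nn_integral_diff) (auto simp: emeasure_space_1)
  also have "\<dots> = 0"
  proof (rule diff_eq_0_ennreal)
    show "(\<integral>\<^sup>+\<omega>. f \<omega> \<partial>M) < top" using c cfin by (simp add: le_less_trans less_top)
    show "(\<integral>\<^sup>+\<omega>. f \<omega> \<partial>M) \<le> (\<integral>\<^sup>+\<omega>. c \<partial>M)" using c by (simp add: emeasure_space_1)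
  qed
  finally have "AE \<omega> in M. f \<omega> - c = 0" by (subst (asm) nn_integral_0_iff_AE) auto
  with lt have "AE \<omega> in M. False"
    by eventually_elim (metis diff_gt_0_iff_gt_ennreal less_irrefl)
  then show False by simp
qed

text \<open>The cross term has mean zero, so a fixed deviation \<open>s\<close> grows in mean square
  by a variance, which the second moment bounds.\<close>

lemma (in prob_space) centred_second_moment:
  fixes \<xi> :: "'a \<Rightarrow> real"
  assumes [measurable]: "\<xi> \<in> borel_measurable M" and \<xi>: "integrable M (\<lambda>\<omega>. (\<xi> \<omega>)\<^sup>2)"
  shows "(\<integral>\<^sup>+\<omega>. ennreal ((s + (\<xi> \<omega> - (\<integral>\<omega>. \<xi> \<omega> \<partial>M)))\<^sup>2) \<partial>M) \<le> ennreal (s\<^sup>2) + (\<integral>\<^sup>+\<omega>. ennreal ((\<xi> \<omega>)\<^sup>2) \<partial>M)"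
proof -
  let ?h = "\<integral>\<omega>. \<xi> \<omega> \<partial>M"
  have i1: "integrable M \<xi>" using integrable_mult_of_squares[of \<xi> M "\<lambda>_. 1"] \<xi> by simp
  have ex: "(s + (\<xi> \<omega> - ?h))\<^sup>2 = (s - ?h)\<^sup>2 + 2 * (s - ?h) * \<xi> \<omega> + (\<xi> \<omega>)\<^sup>2" for \<omega>
    by (simp add: power2_eq_square algebra_simps)
  have int: "integrable M (\<lambda>\<omega>. (s + (\<xi> \<omega> - ?h))\<^sup>2)" unfolding ex using i1 \<xi> by auto
  have "(\<integral>\<omega>. (s + (\<xi> \<omega> - ?h))\<^sup>2 \<partial>M) = (s - ?h)\<^sup>2 + 2 * (s - ?h) * ?h + (\<integral>\<omega>. (\<xi> \<omega>)\<^sup>2 \<partial>M)"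
    unfolding ex using i1 \<xi> by (simp add: prob_space)
  also have "(s - ?h)\<^sup>2 + 2 * (s - ?h) * ?h = s\<^sup>2 - ?h\<^sup>2" by (simp add: power2_eq_square algebra_simps)
  also have "s\<^sup>2 - ?h\<^sup>2 + (\<integral>\<omega>. (\<xi> \<omega>)\<^sup>2 \<partial>M) \<le> s\<^sup>2 + (\<integral>\<omega>. (\<xi> \<omega>)\<^sup>2 \<partial>M)" by simp
  finally have "ennreal (\<integral>\<omega>. (s + (\<xi> \<omega> - ?h))\<^sup>2 \<partial>M) \<le> ennreal (s\<^sup>2 + (\<integral>\<omega>. (\<xi> \<omega>)\<^sup>2 \<partial>M))" by (rule ennreal_leI)
  then show ?thesis
    using \<xi> by (simp add: nn_integral_eq_integral[OF int] nn_integral_eq_integral[OF \<xi>] ennreal_plus)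
qed

text \<open>Sequential sampling: each new sample is chosen so that a weighted sum of the squared error and of
  the two costs grows by at most its mean increment, which is at most 3.\<close>
lemma (in prob_space) greedy_sampling:
  fixes \<mu> :: "'b measure" and \<xi> :: "nat \<Rightarrow> 'b \<Rightarrow> 'a \<Rightarrow> real" and c1 c2 :: "'a \<Rightarrow> ennreal"
  assumes \<mu>: "prob_space \<mu>"
    and \<xi>: "\<And>i. i < D \<Longrightarrow> (\<lambda>z. \<xi> i (fst z) (snd z)) \<in> borel_measurable (\<mu> \<Otimes>\<^sub>M M)"
    and c [measurable]: "c1 \<in> borel_measurable M" "c2 \<in> borel_measurable M"
    and S: "(\<integral>\<^sup>+\<omega>. c1 \<omega> \<partial>M) \<le> ennreal S1" "(\<integral>\<^sup>+\<omega>. c2 \<omega> \<partial>M) \<le> ennreal S2" "S1 > 0" "S2 > 0"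
    and v: "(\<integral>\<^sup>+x. (\<integral>\<^sup>+\<omega>. (\<Sum>i<D. ennreal ((\<xi> i x \<omega>)\<^sup>2)) \<partial>M) \<partial>\<mu>) \<le> ennreal v" "v > 0"
    and P: "AE \<omega> in M. P \<omega>"
  shows "\<exists>\<omega> :: nat \<Rightarrow> 'a. (\<forall>j<m. \<omega> j \<in> space M \<and> P (\<omega> j))
     \<and> (\<integral>\<^sup>+x. (\<Sum>i<D. ennreal ((\<Sum>j<m. \<xi> i x (\<omega> j) - (\<integral>\<omega>. \<xi> i x \<omega> \<partial>M))\<^sup>2)) \<partial>\<mu>) \<le> ennreal (3 * real m * v)
     \<and> (\<Sum>j<m. c1 (\<omega> j)) \<le> ennreal (3 * real m * S1) \<and> (\<Sum>j<m. c2 (\<omega> j)) \<le> ennreal (3 * real m * S2)"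
proof -
  interpret \<mu>: prob_space \<mu> by fact
  interpret P: pair_prob_space \<mu> M ..
  define h where "h i x = (\<integral>\<omega>. \<xi> i x \<omega> \<partial>M)" for i x
  have hm: "h i \<in> borel_measurable \<mu>" if "i < D" for i
    unfolding h_def using \<xi>[OF that] by (intro borel_measurable_lebesgue_integral) (simp add: split_def)
  have \<xi>x: "\<xi> i x \<in> borel_measurable M" if "i < D" "x \<in> space \<mu>" for i x
    using measurable_Pair2[OF \<xi>[OF that(1)] that(2)] by simp
  have \<xi>\<omega>: "(\<lambda>x. \<xi> i x \<omega>) \<in> borel_measurable \<mu>" if "i < D" "\<omega> \<in> space M" for i \<omega>
    using measurable_Pair1[OF \<xi>[OF that(1)] that(2)] by simp
  define A where "A m \<omega> = (\<integral>\<^sup>+x. (\<Sum>i<D. ennreal ((\<Sum>j<m. \<xi> i x (\<omega> j) - h i x)\<^sup>2)) \<partial>\<mu>)" for m :: nat and \<omega> :: "nat \<Rightarrow> 'a"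
  \<comment> \<open>Each of the three quantities is divided by the bound on its mean increment, so
    that each contributes at most 1 per sample.\<close>
  define pot where "pot m \<omega> = ennreal (1 / v) * A m \<omega> + ennreal (1 / S1) * (\<Sum>j<m. c1 (\<omega> j)) + ennreal (1 / S2) * (\<Sum>j<m. c2 (\<omega> j))" for m :: nat and \<omega> :: "nat \<Rightarrow> 'a"
  have secm: "(\<lambda>x. \<integral>\<^sup>+\<omega>. (\<Sum>i<D. ennreal ((\<xi> i x \<omega>)\<^sup>2)) \<partial>M) \<in> borel_measurable \<mu>"
  proof -
    have "(\<lambda>z. \<Sum>i<D. ennreal ((\<xi> i (fst z) (snd z))\<^sup>2)) \<in> borel_measurable (\<mu> \<Otimes>\<^sub>M M)"
      by (intro borel_measurable_sum measurable_compose[OF borel_measurable_power[OF \<xi>] measurable_ennreal]) simp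
    from borel_measurable_nn_integral_fst[OF this] show ?thesis by simp
  qed
  have "AE x in \<mu>. (\<integral>\<^sup>+\<omega>. (\<Sum>i<D. ennreal ((\<xi> i x \<omega>)\<^sup>2)) \<partial>M) \<noteq> \<infinity>"
    by (rule nn_integral_PInf_AE[OF secm]) (use v(1) in \<open>auto simp: top_unique\<close>)
  then have sqi: "AE x in \<mu>. \<forall>i<D. integrable M (\<lambda>\<omega>. (\<xi> i x \<omega>)\<^sup>2)"
    using AE_space
  proof eventually_elim
    case (elim x)
    show ?case
    proof (intro allI impI)
      fix i assume i: "i < D"
      have "(\<integral>\<^sup>+\<omega>. ennreal ((\<xi> i x \<omega>)\<^sup>2) \<partial>M) \<le> (\<integral>\<^sup>+\<omega>. (\<Sum>i<D. ennreal ((\<xi> i x \<omega>)\<^sup>2)) \<partial>M)"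
        using i by (intro nn_integral_mono member_le_sum[of i _ "\<lambda>i. ennreal ((\<xi> i x _)\<^sup>2)"]) auto
      then show "integrable M (\<lambda>\<omega>. (\<xi> i x \<omega>)\<^sup>2)"
        using elim \<xi>x[OF i] by (intro integrableI_nonneg) (auto simp: less_top[symmetric] top_unique)
    qed
  qed
  have step: "\<exists>\<omega>'\<in>space M. P \<omega>' \<and> pot (Suc m) (fun_upd \<omega> m \<omega>') \<le> pot m \<omega> + 3" if \<omega>: "\<And>j. j < m \<Longrightarrow> \<omega> j \<in> space M" for m \<omega>
  proof -
    define Sm where "Sm i x = (\<Sum>j<m. \<xi> i x (\<omega> j) - h i x)" for i x
    have Smm: "Sm i \<in> borel_measurable \<mu>" if "i < D" for i
      unfolding Sm_def using that \<omega> by (intro borel_measurable_sum borel_measurable_diff \<xi>\<omega> hm) auto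
    let ?q = "\<lambda>z. \<Sum>i<D. ennreal ((Sm i (fst z) + (\<xi> i (fst z) (snd z) - h i (fst z)))\<^sup>2)"
    have qm: "?q \<in> borel_measurable (\<mu> \<Otimes>\<^sub>M M)"
      by (intro borel_measurable_sum measurable_compose[OF _ measurable_ennreal] borel_measurable_power borel_measurable_add borel_measurable_diff \<xi>
          measurable_compose[OF measurable_fst Smm] measurable_compose[OF measurable_fst hm]) auto
    define f where "f \<omega>' = (\<integral>\<^sup>+x. ?q (x, \<omega>') \<partial>\<mu>)" for \<omega>'
    have fm: "f \<in> borel_measurable M" unfolding f_def
      using \<mu>.borel_measurable_nn_integral_fst[OF measurable_pair_swap[OF qm]] by simp
    have fint: "(\<integral>\<^sup>+\<omega>'. f \<omega>' \<partial>M) \<le> A m \<omega> + ennreal v"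
    proof -
      \<comment> \<open>Exchanging the integrals reduces the mean over the new sample to a variance
        bound at fixed \<open>x\<close>.\<close>
      have "(\<integral>\<^sup>+\<omega>'. f \<omega>' \<partial>M) = (\<integral>\<^sup>+x. (\<integral>\<^sup>+\<omega>'. ?q (x, \<omega>') \<partial>M) \<partial>\<mu>)"
        unfolding f_def by (rule P.Fubini'[OF]) (use qm in \<open>simp add: split_def\<close>)
      also have "\<dots> \<le> (\<integral>\<^sup>+x. (\<Sum>i<D. ennreal ((Sm i x)\<^sup>2)) + (\<integral>\<^sup>+\<omega>. (\<Sum>i<D. ennreal ((\<xi> i x \<omega>)\<^sup>2)) \<partial>M) \<partial>\<mu>)"
      proof (rule nn_integral_mono_AE)
        show "AE x in \<mu>. (\<integral>\<^sup>+\<omega>'. ?q (x, \<omega>') \<partial>M) \<le> (\<Sum>i<D. ennreal ((Sm i x)\<^sup>2)) + (\<integral>\<^sup>+\<omega>. (\<Sum>i<D. ennreal ((\<xi> i x \<omega>)\<^sup>2)) \<partial>M)"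
          using sqi AE_space
        proof eventually_elim
          case (elim x)
          have m1: "(\<lambda>\<omega>. ennreal ((\<xi> i x \<omega>)\<^sup>2)) \<in> borel_measurable M" if "i < D" for i
            using \<xi>x[OF that elim(2)] by measurable
          have m2: "(\<lambda>\<omega>. ennreal ((Sm i x + (\<xi> i x \<omega> - h i x))\<^sup>2)) \<in> borel_measurable M" if "i < D" for i
            using \<xi>x[OF that elim(2)] by measurable
          have "(\<integral>\<^sup>+\<omega>'. ?q (x, \<omega>') \<partial>M) = (\<Sum>i<D. \<integral>\<^sup>+\<omega>'. ennreal ((Sm i x + (\<xi> i x \<omega>' - h i x))\<^sup>2) \<partial>M)"
            unfolding fst_conv snd_conv by (rule nn_integral_sum) (use m2 in auto)
          also have "\<dots> \<le> (\<Sum>i<D. ennreal ((Sm i x)\<^sup>2) + (\<integral>\<^sup>+\<omega>. ennreal ((\<xi> i x \<omega>)\<^sup>2) \<partial>M))"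
            unfolding h_def using elim \<xi>x by (intro sum_mono centred_second_moment) auto
          also have "\<dots> = (\<Sum>i<D. ennreal ((Sm i x)\<^sup>2)) + (\<integral>\<^sup>+\<omega>. (\<Sum>i<D. ennreal ((\<xi> i x \<omega>)\<^sup>2)) \<partial>M)"
            unfolding sum.distrib by (subst nn_integral_sum) (use m1 in auto)
          finally show ?case .
        qed
      qed
      also have "\<dots> = A m \<omega> + (\<integral>\<^sup>+x. (\<integral>\<^sup>+\<omega>. (\<Sum>i<D. ennreal ((\<xi> i x \<omega>)\<^sup>2)) \<partial>M) \<partial>\<mu>)"
        unfolding A_def Sm_def[symmetric]
        by (rule nn_integral_add[OF _ secm]) (intro borel_measurable_sum measurable_compose[OF borel_measurable_power[OF Smm] measurable_ennreal], simp)
      also have "\<dots> \<le> A m \<omega> + ennreal v" by (intro add_left_mono v)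
      finally show ?thesis .
    qed
    let ?C1 = "\<Sum>j<m. c1 (\<omega> j)" and ?C2 = "\<Sum>j<m. c2 (\<omega> j)"
    let ?\<Psi> = "\<lambda>\<omega>'. ennreal (1 / v) * f \<omega>' + ennreal (1 / S1) * (?C1 + c1 \<omega>') + ennreal (1 / S2) * (?C2 + c2 \<omega>')"
    note fm [measurable]
    have \<Psi>m: "?\<Psi> \<in> borel_measurable M" by measurable
    have one: "ennreal (1 / r) * ennreal r = 1" if "r > 0" for r :: real using that by (simp flip: ennreal_mult)
    have "(\<integral>\<^sup>+\<omega>'. ?\<Psi> \<omega>' \<partial>M) = ennreal (1 / v) * (\<integral>\<^sup>+\<omega>'. f \<omega>' \<partial>M) + ennreal (1 / S1) * (?C1 + (\<integral>\<^sup>+\<omega>'. c1 \<omega>' \<partial>M)) + ennreal (1 / S2) * (?C2 + (\<integral>\<^sup>+\<omega>'. c2 \<omega>' \<partial>M))"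
      by (simp add: nn_integral_add nn_integral_cmult emeasure_space_1)
    also have "\<dots> \<le> ennreal (1 / v) * (A m \<omega> + ennreal v) + ennreal (1 / S1) * (?C1 + ennreal S1) + ennreal (1 / S2) * (?C2 + ennreal S2)"
      by (intro add_mono mult_left_mono fint S order_refl) auto
    also have "\<dots> = pot m \<omega> + 3"
      using one[OF v(2)] one[OF S(3)] one[OF S(4)] by (simp add: pot_def distrib_left ac_simps)
    finally obtain \<omega>' where w: "\<omega>' \<in> space M" "P \<omega>'" "?\<Psi> \<omega>' \<le> pot m \<omega> + 3"
      using exists_le_mean[OF \<Psi>m P] by blast
    have "pot (Suc m) (fun_upd \<omega> m \<omega>') = ?\<Psi> \<omega>'"
      unfolding pot_def A_def f_def Sm_def by simp
    then show ?thesis using w by auto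
  qed
  have "\<exists>\<omega>. (\<forall>j<m. \<omega> j \<in> space M \<and> P (\<omega> j)) \<and> pot m \<omega> \<le> ennreal (3 * real m)" for m
  proof (induction m)
    case 0
    show ?case by (simp add: pot_def A_def)
  next
    case (Suc m)
    then obtain \<omega> where \<omega>: "\<And>j. j < m \<Longrightarrow> \<omega> j \<in> space M \<and> P (\<omega> j)" "pot m \<omega> \<le> ennreal (3 * real m)" by blast
    obtain \<omega>' where w: "\<omega>' \<in> space M" "P \<omega>'" "pot (Suc m) (fun_upd \<omega> m \<omega>') \<le> pot m \<omega> + 3" using step[of m \<omega>] \<omega>(1) by blast
    have "pot m \<omega> + 3 \<le> ennreal (3 * real m) + ennreal 3" using \<omega>(2) by (intro add_mono) auto
    also have "\<dots> = ennreal (3 * real (Suc m))" by (subst ennreal_plus[symmetric]) (auto simp: algebra_simps)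
    finally have le: "pot m \<omega> + 3 \<le> ennreal (3 * real (Suc m))" .
    show ?case
    proof (intro exI conjI)
      show "\<forall>j<Suc m. fun_upd \<omega> m \<omega>' j \<in> space M \<and> P (fun_upd \<omega> m \<omega>' j)" using w(1,2) \<omega>(1) by (auto simp: less_Suc_eq)
      show "pot (Suc m) (fun_upd \<omega> m \<omega>') \<le> ennreal (3 * real (Suc m))" using w(3) le by (rule order_trans)
    qed
  qed
  then obtain \<omega> where \<omega>: "\<forall>j<m. \<omega> j \<in> space M \<and> P (\<omega> j)" "pot m \<omega> \<le> ennreal (3 * real m)" by blast
  \<comment> \<open>Every summand of the potential is below the total, so undoing its normalisation
    gives the factor 3 in all three bounds.\<close>
  have cancel: "x \<le> ennreal (3 * real m * r)" if "ennreal (1 / r) * x \<le> ennreal (3 * real m)" "r > 0" for x r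
  proof -
    have "x = ennreal r * (ennreal (1 / r) * x)" using that(2) by (simp add: mult.assoc[symmetric] flip: ennreal_mult)
    also have "\<dots> \<le> ennreal r * ennreal (3 * real m)" by (intro mult_left_mono that) auto
    also have "\<dots> = ennreal (3 * real m * r)" using that(2) by (subst ennreal_mult[symmetric]) (auto simp: mult.commute)
    finally show ?thesis .
  qed
  have "ennreal (1 / v) * A m \<omega> \<le> pot m \<omega>" unfolding pot_def add.assoc by (rule add_increasing2) auto
  moreover have "ennreal (1 / S1) * (\<Sum>j<m. c1 (\<omega> j)) \<le> pot m \<omega>" unfolding pot_def by (intro add_increasing2 add_increasing) auto
  moreover have "ennreal (1 / S2) * (\<Sum>j<m. c2 (\<omega> j)) \<le> pot m \<omega>" unfolding pot_def by (intro add_increasing) auto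
  ultimately show ?thesis
    using \<omega> v(2) S(3,4) by (intro exI[of _ \<omega>] conjI cancel) (auto simp: A_def h_def intro: order_trans)
qed

section \<open>The measures rho and mu, and the error of the conditional expectations\<close>

lemma (in finite_measure_subalgebra) cond_exp_square_le:
  fixes f :: "'a \<Rightarrow> real"
  assumes "integrable M f" and f2: "integrable M (\<lambda>x. (f x)\<^sup>2)"
  shows "(\<integral>\<^sup>+x. ennreal ((real_cond_exp M F f x)\<^sup>2) \<partial>M) \<le> (\<integral>\<^sup>+x. ennreal ((f x)\<^sup>2) \<partial>M)"
proof -
  have J: "AE x in M. (real_cond_exp M F f x)\<^sup>2 \<le> real_cond_exp M F (\<lambda>x. (f x)\<^sup>2) x"
    by (rule real_cond_exp_jensens_inequality(2)[where X=f and I=UNIV and q="\<lambda>x. x\<^sup>2" and a=0 and b=0])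
       (use assms convex_power2 in auto)
  have i: "integrable M (real_cond_exp M F (\<lambda>x. (f x)\<^sup>2))" by (rule real_cond_exp_int(1)[OF f2])
  have "(\<integral>\<^sup>+x. ennreal ((real_cond_exp M F f x)\<^sup>2) \<partial>M) \<le> (\<integral>\<^sup>+x. ennreal (real_cond_exp M F (\<lambda>x. (f x)\<^sup>2) x) \<partial>M)"
    by (rule nn_integral_mono_AE) (use J in \<open>auto elim!: eventually_mono intro: ennreal_leI\<close>)
  also have "\<dots> = ennreal (\<integral>x. real_cond_exp M F (\<lambda>x. (f x)\<^sup>2) x \<partial>M)"
    by (rule nn_integral_eq_integral[OF i]) (use J in \<open>auto elim!: eventually_mono intro: order_trans[OF zero_le_power2]\<close>)
  also have "\<dots> = ennreal (\<integral>x. (f x)\<^sup>2 \<partial>M)" using real_cond_exp_int(2)[OF f2] by simp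
  also have "\<dots> = (\<integral>\<^sup>+x. ennreal ((f x)\<^sup>2) \<partial>M)" by (rule nn_integral_eq_integral[symmetric, OF f2]) auto
  finally show ?thesis .
qed

text \<open>A set function handed to \<open>measure_of\<close> is returned as the measure only if it
  is countably additive; agreement with an existing measure provides this.\<close>

lemma measure_of_borel_eq:
  assumes "sets \<nu> = sets borel" "\<And>A. A \<in> sets borel \<Longrightarrow> \<mu> A = emeasure \<nu> A"
  shows "measure_of UNIV (sets borel) \<mu> = \<nu>"
proof -
  have "measure_of UNIV (sets borel) \<mu> = measure_of UNIV (sets borel) (emeasure \<nu>)"
    using assms(2) by (intro measure_of_eq) (auto simp: sets.sigma_sets_eq[of borel, simplified])
  also have "\<dots> = \<nu>" using measure_of_of_measure[of \<nu>] assms(1) sets_eq_imp_space_eq[OF assms(1)] by simp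
  finally show ?thesis .
qed

text \<open>Weighting \<open>M\<close> with the sum of squared increments and taking the image under
  \<open>X\<close> turns integrals against \<open>rho_meas\<close> into expectations.\<close>

lemma rho_meas_eq:
  assumes Xt: "X (tgrid T N (Suc n)) \<in> measurable M borel"
    and W: "\<And>k i. k \<le> m \<Longrightarrow> (\<lambda>\<omega>. W (tsub T N m n k) \<omega> i) \<in> borel_measurable M"
  shows "rho_meas M D W X T N m n = distr (density M (\<lambda>\<omega>. ennreal (\<Sum>k<m. (vnorm D (W (tsub T N m n (Suc k)) \<omega> - W (tsub T N m n k) \<omega>))\<^sup>2)))
     borel (X (tgrid T N (Suc n)))"
    and "(\<lambda>\<omega>. ennreal (\<Sum>k<m. (vnorm D (W (tsub T N m n (Suc k)) \<omega> - W (tsub T N m n k) \<omega>))\<^sup>2)) \<in> borel_measurable M"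
proof -
  let ?f = "\<lambda>\<omega>. ennreal (\<Sum>k<m. (vnorm D (W (tsub T N m n (Suc k)) \<omega> - W (tsub T N m n k) \<omega>))\<^sup>2)"
  show fm: "?f \<in> borel_measurable M"
    unfolding vnorm_square fun_diff_def
    by (intro measurable_compose[OF _ measurable_ennreal] borel_measurable_sum borel_measurable_power borel_measurable_diff W) auto
  show "rho_meas M D W X T N m n = distr (density M ?f) borel (X (tgrid T N (Suc n)))"
    unfolding rho_meas_def
  proof (rule measure_of_borel_eq)
    fix A :: "vec set" assume A: "A \<in> sets borel"
    have "emeasure (distr (density M ?f) borel (X (tgrid T N (Suc n)))) A = (\<integral>\<^sup>+x. indicator A x \<partial>distr (density M ?f) borel (X (tgrid T N (Suc n))))"
      using A by simp
    also have "\<dots> = (\<integral>\<^sup>+\<omega>. indicator A (X (tgrid T N (Suc n)) \<omega>) \<partial>density M ?f)"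
      using A Xt by (intro nn_integral_distr) auto
    also have "\<dots> = (\<integral>\<^sup>+\<omega>. ?f \<omega> * indicator A (X (tgrid T N (Suc n)) \<omega>) \<partial>M)"
      using A Xt fm by (intro nn_integral_density measurable_compose[OF Xt]) auto
    finally show "(\<integral>\<^sup>+\<omega>. ?f \<omega> * indicator A (X (tgrid T N (Suc n)) \<omega>) \<partial>M) = emeasure (distr (density M ?f) borel (X (tgrid T N (Suc n)))) A" by simp
  qed simp
qed

text \<open>The measure is the image of counting measure on \<open>{..<m}\<close> times
  \<open>M\<close>, weighted by \<open>dt\<close>, under the map that pairs a grid time with the
  process at that time; the formula is then Fubini.\<close>

lemma nn_integral_mu_meas:
  assumes "prob_space M" and X: "\<And>k. k < m \<Longrightarrow> X (tsub T N m n k) \<in> measurable M borel" and f: "f \<in> borel_measurable borel"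
  shows "(\<integral>\<^sup>+z. f z \<partial>mu_meas M X T N m n) = (\<Sum>k<m. ennreal (dt T N m) * (\<integral>\<^sup>+\<omega>. f (tsub T N m n k, X (tsub T N m n k) \<omega>) \<partial>M))"
proof -
  interpret prob_space M by fact
  let ?g = "\<lambda>z. (tsub T N m n (fst z), X (tsub T N m n (fst z)) (snd z))"
  let ?d = "ennreal (dt T N m)"
  let ?P = "count_space {..<m} \<Otimes>\<^sub>M M"
  let ?\<nu> = "distr (density ?P (\<lambda>_. ?d)) borel ?g"
  have pm: "(\<lambda>\<omega>. (tsub T N m n k, X (tsub T N m n k) \<omega>)) \<in> measurable M borel" if "k < m" for k
    unfolding borel_prod[symmetric] using X[OF that] by (intro measurable_Pair) auto
  have gm: "?g \<in> measurable ?P borel"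
    by (rule measurable_pair_measure_countable1) (use pm in auto)
  have nu: "(\<integral>\<^sup>+z. f z \<partial>?\<nu>) = (\<Sum>k<m. ?d * (\<integral>\<^sup>+\<omega>. f (tsub T N m n k, X (tsub T N m n k) \<omega>) \<partial>M))" if f: "f \<in> borel_measurable borel" for f
  proof -
    have "(\<integral>\<^sup>+z. f z \<partial>?\<nu>) = (\<integral>\<^sup>+z. f (?g z) \<partial>density ?P (\<lambda>_. ?d))"
      using gm f by (intro nn_integral_distr) auto
    also have "\<dots> = (\<integral>\<^sup>+z. ?d * f (?g z) \<partial>?P)"
      by (intro nn_integral_density measurable_compose[OF gm f]) simp
    also have "\<dots> = (\<integral>\<^sup>+k. (\<integral>\<^sup>+\<omega>. ?d * f (?g (k, \<omega>)) \<partial>M) \<partial>count_space {..<m})"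
      by (rule nn_integral_fst[symmetric]) (intro borel_measurable_times_ennreal measurable_compose[OF gm f], simp)
    also have "\<dots> = (\<Sum>k<m. (\<integral>\<^sup>+\<omega>. ?d * f (?g (k, \<omega>)) \<partial>M))" by (simp add: nn_integral_count_space_finite)
    also have "\<dots> = (\<Sum>k<m. ?d * (\<integral>\<^sup>+\<omega>. f (tsub T N m n k, X (tsub T N m n k) \<omega>) \<partial>M))"
      by (intro sum.cong refl) (simp add: nn_integral_cmult measurable_compose[OF pm f])
    finally show ?thesis .
  qed
  have "mu_meas M X T N m n = ?\<nu>"
    unfolding mu_meas_def
  proof (rule measure_of_borel_eq)
    fix A :: "(real \<times> vec) set" assume A: "A \<in> sets borel"
    have "emeasure ?\<nu> A = (\<integral>\<^sup>+z. indicator A z \<partial>?\<nu>)" using A by simp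
    also have "\<dots> = (\<Sum>k<m. ?d * (\<integral>\<^sup>+\<omega>. indicator A (tsub T N m n k, X (tsub T N m n k) \<omega>) \<partial>M))"
      using A by (intro nu) auto
    also have "\<dots> = (\<integral>\<^sup>+\<omega>. (\<Sum>k<m. indicator A (tsub T N m n k, X (tsub T N m n k) \<omega>) * ?d) \<partial>M)"
    proof -
      have im: "(\<lambda>\<omega>. indicator A (tsub T N m n k, X (tsub T N m n k) \<omega>) :: ennreal) \<in> borel_measurable M" if "k < m" for k
        by (rule measurable_compose[OF pm[OF that] borel_measurable_indicator[OF A]])
      have "(\<integral>\<^sup>+\<omega>. (\<Sum>k<m. indicator A (tsub T N m n k, X (tsub T N m n k) \<omega>) * ?d) \<partial>M)
        = (\<Sum>k<m. \<integral>\<^sup>+\<omega>. indicator A (tsub T N m n k, X (tsub T N m n k) \<omega>) * ?d \<partial>M)"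
        by (rule nn_integral_sum) (use im in auto)
      also have "\<dots> = (\<Sum>k<m. ?d * (\<integral>\<^sup>+\<omega>. indicator A (tsub T N m n k, X (tsub T N m n k) \<omega>) \<partial>M))"
        unfolding mult.commute[of _ ?d] by (intro sum.cong refl nn_integral_cmult im) simp
      finally show ?thesis by simp
    qed
    finally show "(\<integral>\<^sup>+\<omega>. (\<Sum>k<m. indicator A (tsub T N m n k, X (tsub T N m n k) \<omega>) * ?d) \<partial>M) = emeasure ?\<nu> A" by simp
  qed simp
  then show ?thesis using nu[OF f] by simp
qed

text \<open>Repeated parallel addition at a common depth. Taking \<open>Suc m\<close> summands
  avoids the empty sum, which would ask for a zero network of depth \<open>n\<close>.\<close>

lemma relu_fun_sum:
  assumes "\<And>j. j < Suc m \<Longrightarrow> relu_fun n d e (S j) (G j)"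
  shows "\<exists>S'\<le>(\<Sum>j<Suc m. S j). relu_fun n d e S' (\<lambda>x i. \<Sum>j<Suc m. G j x i)"
  using assms
proof (induction m)
  case 0
  then show ?case by (intro exI[of _ "S 0"]) simp
next
  case (Suc m)
  then obtain S' where S': "S' \<le> (\<Sum>j<Suc m. S j)" "relu_fun n d e S' (\<lambda>x i. \<Sum>j<Suc m. G j x i)" by fastforce
  obtain S'' where "S'' \<le> S' + S (Suc m)" "relu_fun n d e S'' (\<lambda>x i. (\<Sum>j<Suc m. G j x i) + G (Suc m) x i)"
    using relu_fun_add[OF S'(2) Suc.prems[of "Suc m"]] by auto
  then show ?case using S'(1) by (intro exI[of _ S'']) auto
qed

text \<open>Output layer of a sample: it multiplies the scalar value of the network for
  \<open>V\<close> with the sampled increment, a fixed vector once the sample is chosen.\<close>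

lemma relu_fun_scale_vector:
  "\<exists>S\<le>D. relu_fun 1 1 D S (\<lambda>y i. if i < D then c i * y 0 else 0)"
proof -
  have "affine 1 D (\<lambda>i _. c i, \<lambda>_. 0) = (\<lambda>y i. if i < D then c i * y 0 else 0)"
    by (auto simp: affine_def fun_eq_iff)
  moreover have "lsize 1 D (\<lambda>i _. c i, \<lambda>_. 0) \<le> D"
  proof -
    have "card {(j, i). j < D \<and> i < (1::nat) \<and> c j \<noteq> 0} \<le> card ((\<lambda>j. (j, 0::nat)) ` {..<D})"
      by (rule card_mono) auto
    also have "\<dots> \<le> D" using card_image_le[of "{..<D}" "\<lambda>j. (j, 0::nat)"] by simp
    finally show ?thesis by (simp add: lsize_def)
  qed
  ultimately show ?thesis using relu_fun.affine[of 1 D "(\<lambda>i _. c i, \<lambda>_. 0)"] by auto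
qed

context flow_model
begin

text \<open>The value function integrates over the flow, and joint measurability in point and sample
  is taken from the representing network. Agreement is claimed on \<open>vspace D\<close>, where the
  network represents the flow and where \<open>X\<close> lives.\<close>

lemma Vrec_measurable:
  assumes g: "\<And>n. n \<le> N \<Longrightarrow> g (tgrid T N n) \<in> borel_measurable borel" and "j \<le> N"
  shows "\<exists>V'\<in>borel_measurable borel. \<forall>x\<in>vspace D. Vrec M g fl T N j x = V' x"
  using \<open>j \<le> N\<close>
proof (induction j)
  case 0
  then show ?case using g[of N] by (intro bexI[of _ "g (tgrid T N N)"]) auto
next
  case (Suc j)
  then obtain V' where V': "V' \<in> borel_measurable borel" "\<And>x. x \<in> vspace D \<Longrightarrow> Vrec M g fl T N j x = V' x" by auto
  define n where "n = N - Suc j"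
  have n: "n < N" "N - j = Suc n" using Suc.prems by (auto simp: n_def)
  let ?s = "tgrid T N n" and ?t = "tgrid T N (Suc n)"
  have st: "?s < ?t" using T0 N_ge by (simp add: tgrid_def divide_strict_right_mono)
  have s0: "0 \<le> ?s" "?t \<le> T" "?s \<le> T" using tgrid_le n by auto
  obtain I w where w: "\<And>l m j. (\<lambda>\<omega>. w \<omega> l m j) \<in> borel_measurable M"
    "AE \<omega> in M. \<forall>x\<in>vspace D. fl x ?s ?t \<omega> = ran_eval (w \<omega>) I x"
    by (rule flow_rep[OF n(1) order_refl st order_refl]) blast
  let ?V = "\<lambda>x. max (g ?s x) (\<integral>\<omega>. V' (ran_eval (w \<omega>) I x) \<partial>M)"
  have jm: "(\<lambda>z. ran_eval (w (snd z)) I (fst z)) \<in> measurable (borel \<Otimes>\<^sub>M M) borel"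
    by (rule ran_eval_measurable) (use w in \<open>auto intro: measurable_compose[OF measurable_snd]\<close>)
  have "(\<lambda>x. \<integral>\<omega>. V' (ran_eval (w \<omega>) I x) \<partial>M) \<in> borel_measurable borel"
    using measurable_compose[OF jm V'(1)] by (intro borel_measurable_lebesgue_integral) (simp add: split_def)
  then have Vm: "?V \<in> borel_measurable borel" using g[of n] n by (intro borel_measurable_max) auto
  show ?case
  proof (intro bexI[of _ ?V] ballI Vm)
    fix x assume x: "x \<in> vspace D"
    have flv: "fl x ?s ?t \<omega> \<in> vspace D" if "\<omega> \<in> space M" for \<omega>
      using sde_process.Y_vspace[OF sde_sol_process[OF solfl[OF s0(1,3) x] s0(1) order_refl]] st s0 that by auto
    have flm: "fl x ?s ?t \<in> measurable M borel" using fl_meas[OF s0(1) _ s0(2) x] st by simp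
    have rm: "(\<lambda>\<omega>. ran_eval (w \<omega>) I x) \<in> measurable M borel" by (rule ran_eval_measurable[OF w(1)]) simp
    have "(\<integral>\<omega>. Vrec M g fl T N j (fl x ?s ?t \<omega>) \<partial>M) = (\<integral>\<omega>. V' (fl x ?s ?t \<omega>) \<partial>M)"
      using V'(2) flv by (intro Bochner_Integration.integral_cong) auto
    also have "\<dots> = (\<integral>\<omega>. V' (ran_eval (w \<omega>) I x) \<partial>M)"
    proof (rule Bochner_Integration.integral_cong_AE)
      show "AE \<omega> in M. V' (fl x ?s ?t \<omega>) = V' (ran_eval (w \<omega>) I x)" using w(2) by eventually_elim (use x in auto)
    qed (rule measurable_compose[OF flm V'(1)] measurable_compose[OF rm V'(1)])+
    finally show "Vrec M g fl T N (Suc j) x = ?V x" by (simp add: n_def[symmetric] n(2))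
  qed
qed

lemma Vfun_measurable:
  assumes "\<And>n. n \<le> N \<Longrightarrow> g (tgrid T N n) \<in> borel_measurable borel"
  shows "\<exists>V'\<in>borel_measurable borel. \<forall>x\<in>vspace D. Vfun M g fl T N n x = V' x"
  unfolding Vfun_def using Vrec_measurable[of g "N - n"] assms by auto

lemma tsub_Suc: "tsub T N m n (Suc k) = tsub T N m n k + dt T N m"
  by (simp add: tsub_def distrib_right)

lemma tsub_range: "n < N \<Longrightarrow> m \<ge> 1 \<Longrightarrow> k \<le> m \<Longrightarrow> 0 \<le> tsub T N m n k \<and> tsub T N m n k \<le> T"
proof -
  assume a: "n < N" "m \<ge> 1" "k \<le> m"
  have "tsub T N m n k \<le> tsub T N m n m" unfolding tsub_def using a dt_pos[of m] by (intro add_left_mono mult_right_mono) auto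
  also have "\<dots> \<le> T" using tsub_end[of m n] tgrid_le(1)[of "Suc n"] a by simp
  finally show ?thesis using tsub_dt[of m n k] dt_pos[of m] a by simp
qed

text \<open>Up to division by \<open>dt\<close>, the difference of \<open>Z\<close> and
  \<open>h\<close> is the conditional expectation of \<open>V - \<phi>\<close> at \<open>X\<close>,
  times the increment, and conditioning contracts the mean square. Summed over times and
  coordinates, the squared increments form the density behind \<open>rho_meas\<close>; the weight
  \<open>dt\<close> and the factor \<open>1 / dt\<^sup>2\<close> leave
  \<open>1 / dt\<close>.\<close>

lemma Zstar_error:
  assumes n: "n < N" and m: "m \<ge> 1"
    and V': "V' \<in> borel_measurable borel" "\<And>x. x \<in> vspace D \<Longrightarrow> V x = V' x"
    and \<phi>: "\<phi> \<in> borel_measurable borel" "C \<ge> 0" "\<And>y. y \<in> vspace D \<Longrightarrow> \<bar>\<phi> y\<bar> \<le> C * (1 + vnorm D y)"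
    and lip: "\<Lambda> \<ge> 0" "\<And>x y. x \<in> vspace D \<Longrightarrow> y \<in> vspace D \<Longrightarrow> (\<phi> x - \<phi> y)\<^sup>2 \<le> \<Lambda> * (\<Sum>i<D. (x i - y i)\<^sup>2)"
    and w: "\<And>k l m j. (\<lambda>\<omega>. w k \<omega> l m j) \<in> borel_measurable M"
    and eq: "\<And>k. k < m \<Longrightarrow> AE \<omega> in M. \<forall>x\<in>vspace D. fl x (tsub T N m n k) (tgrid T N (Suc n)) \<omega> = ran_eval (w k \<omega>) (I k) x"
    and \<rho>: "(\<integral>\<^sup>+x. ennreal ((V x - \<phi> x)\<^sup>2) \<partial>rho_meas M D W X T N m n) \<le> ennreal e"
    and Z: "is_Zstar M D W X V T N m n Z"
  defines "h k i x \<equiv> (\<integral>\<omega>'. \<phi> (ran_eval (w k \<omega>') (I k) x) * \<Delta> (tsub T N m n k) (tsub T N m n (Suc k)) i \<omega>' \<partial>M) / dt T N m"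
  shows "(\<Sum>k<m. ennreal (dt T N m) * (\<integral>\<^sup>+\<omega>. (\<Sum>i<D. ennreal ((Z (tsub T N m n k) (X (tsub T N m n k) \<omega>) i - h k i (X (tsub T N m n k) \<omega>))\<^sup>2)) \<partial>M))
    \<le> ennreal (e / dt T N m)"
proof -
  let ?d = "dt T N m" and ?t = "tgrid T N (Suc n)"
  let ?s = "\<lambda>k. tsub T N m n k"
  let ?U = "\<lambda>k i. \<Delta> (?s k) (?s (Suc k)) i"
  have d: "?d > 0" by (rule dt_pos[OF m])
  have tT: "0 \<le> ?t" "?t \<le> T" using tgrid_le n by auto
  have Xt: "X ?t \<in> measurable M borel" using X.Y_meas tT by auto
  have Wm: "(\<lambda>\<omega>. W (?s k) \<omega> i) \<in> borel_measurable M" if "k \<le> m" for k i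
    using tsub_range[OF n m that] by (intro W_meas) auto
  have Um: "?U k i \<in> borel_measurable M" if "k < m" for k i using that by (intro borel_measurable_diff Wm) auto
  have Xv: "X ?t \<omega> \<in> vspace D" if "\<omega> \<in> space M" for \<omega> using X.Y_vspace that tT by auto
  let ?df = "\<lambda>\<omega>. V' (X ?t \<omega>) - \<phi> (X ?t \<omega>)"
  have dfm: "?df \<in> borel_measurable M"
    by (intro borel_measurable_diff measurable_compose[OF Xt V'(1)] measurable_compose[OF Xt \<phi>(1)])
  have rho: "rho_meas M D W X T N m n = distr (density M (\<lambda>\<omega>. ennreal (\<Sum>k<m. (vnorm D (W (?s (Suc k)) \<omega> - W (?s k) \<omega>))\<^sup>2))) borel (X ?t)"
    "(\<lambda>\<omega>. ennreal (\<Sum>k<m. (vnorm D (W (?s (Suc k)) \<omega> - W (?s k) \<omega>))\<^sup>2)) \<in> borel_measurable M"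
    by (rule rho_meas_eq, rule Xt, rule Wm, assumption)+
  have tot: "(\<integral>\<^sup>+\<omega>. (\<Sum>k<m. \<Sum>i<D. ennreal ((?df \<omega> * ?U k i \<omega>)\<^sup>2)) \<partial>M) \<le> ennreal e"
  proof -
    let ?f = "\<lambda>\<omega>. ennreal (\<Sum>k<m. (vnorm D (W (?s (Suc k)) \<omega> - W (?s k) \<omega>))\<^sup>2)"
    have "(\<integral>\<^sup>+\<omega>. (\<Sum>k<m. \<Sum>i<D. ennreal ((?df \<omega> * ?U k i \<omega>)\<^sup>2)) \<partial>M) = (\<integral>\<^sup>+\<omega>. ?f \<omega> * ennreal ((?df \<omega>)\<^sup>2) \<partial>M)"
    proof (rule nn_integral_cong)
      fix \<omega>
      have "(\<Sum>k<m. \<Sum>i<D. ennreal ((?df \<omega> * ?U k i \<omega>)\<^sup>2)) = ennreal (\<Sum>k<m. \<Sum>i<D. (?df \<omega> * ?U k i \<omega>)\<^sup>2)"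
        by (simp add: sum_ennreal sum_nonneg)
      also have "(\<Sum>k<m. \<Sum>i<D. (?df \<omega> * ?U k i \<omega>)\<^sup>2) = (\<Sum>k<m. (vnorm D (W (?s (Suc k)) \<omega> - W (?s k) \<omega>))\<^sup>2) * (?df \<omega>)\<^sup>2"
        unfolding vnorm_square fun_diff_def by (simp add: power_mult_distrib sum_distrib_left sum_distrib_right mult.commute)
      finally show "(\<Sum>k<m. \<Sum>i<D. ennreal ((?df \<omega> * ?U k i \<omega>)\<^sup>2)) = ?f \<omega> * ennreal ((?df \<omega>)\<^sup>2)"
        by (simp add: ennreal_mult sum_nonneg)
    qed
    also have "\<dots> = (\<integral>\<^sup>+\<omega>. ennreal ((?df \<omega>)\<^sup>2) \<partial>density M ?f)"
      using dfm by (intro nn_integral_density[symmetric] rho(2)) auto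
    also have "\<dots> = (\<integral>\<^sup>+x. ennreal ((V' x - \<phi> x)\<^sup>2) \<partial>distr (density M ?f) borel (X ?t))"
      by (rule nn_integral_distr[symmetric]) (use Xt V'(1) \<phi>(1) in auto)
    also have "\<dots> = (\<integral>\<^sup>+x. ennreal ((V x - \<phi> x)\<^sup>2) \<partial>rho_meas M D W X T N m n)"
      unfolding rho(1)
    proof (rule nn_integral_cong_AE)
      have "AE \<omega> in density M ?f. X ?t \<omega> \<in> vspace D" using Xv by (intro AE_I2) (simp add: space_density)
      moreover have "{x \<in> space borel. x \<in> vspace D} \<in> sets borel"
      proof -
        have "{x \<in> space borel. x \<in> vspace D} = {x \<in> space (borel :: vec measure). \<forall>i. i \<ge> D \<longrightarrow> x i = 0}" by (auto simp: vspace_def)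
        also have "\<dots> \<in> sets borel" by measurable
        finally show ?thesis .
      qed
      ultimately have "AE x in distr (density M ?f) borel (X ?t). x \<in> vspace D"
        by (subst AE_distr_iff) (use Xt in auto)
      then show "AE x in distr (density M ?f) borel (X ?t). ennreal ((V' x - \<phi> x)\<^sup>2) = ennreal ((V x - \<phi> x)\<^sup>2)"
        by eventually_elim (simp add: V'(2))
    qed
    finally show ?thesis using \<rho> by simp
  qed
  \<comment> \<open>Square integrability of each product is read off the finite total; combined with
    integrability of the \<open>\<phi>\<close> term it later yields integrability of the
    \<open>V\<close> term.\<close>
  have fin: "integrable M (\<lambda>\<omega>. (?df \<omega> * ?U k i \<omega>)\<^sup>2)" if k: "k < m" and i: "i < D" for k i
  proof (rule integrableI_nonneg)
    have "(\<integral>\<^sup>+\<omega>. ennreal ((?df \<omega> * ?U k i \<omega>)\<^sup>2) \<partial>M) \<le> (\<integral>\<^sup>+\<omega>. (\<Sum>k<m. \<Sum>i<D. ennreal ((?df \<omega> * ?U k i \<omega>)\<^sup>2)) \<partial>M)"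
    proof (rule nn_integral_mono)
      fix \<omega>
      have "ennreal ((?df \<omega> * ?U k i \<omega>)\<^sup>2) \<le> (\<Sum>i<D. ennreal ((?df \<omega> * ?U k i \<omega>)\<^sup>2))"
        using i by (intro member_le_sum[of i _ "\<lambda>i. ennreal ((?df \<omega> * ?U k i \<omega>)\<^sup>2)"]) auto
      also have "\<dots> \<le> (\<Sum>k<m. \<Sum>i<D. ennreal ((?df \<omega> * ?U k i \<omega>)\<^sup>2))"
        using k by (intro member_le_sum[of k _ "\<lambda>k. \<Sum>i<D. ennreal ((?df \<omega> * ?U k i \<omega>)\<^sup>2)"]) auto
      finally show "ennreal ((?df \<omega> * ?U k i \<omega>)\<^sup>2) \<le> (\<Sum>k<m. \<Sum>i<D. ennreal ((?df \<omega> * ?U k i \<omega>)\<^sup>2))" .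
    qed
    then show "(\<integral>\<^sup>+\<omega>. ennreal ((?df \<omega> * ?U k i \<omega>)\<^sup>2) \<partial>M) < \<infinity>" using tot by (simp add: le_less_trans)
    show "(\<lambda>\<omega>. (?df \<omega> * ?U k i \<omega>)\<^sup>2) \<in> borel_measurable M" by (intro borel_measurable_power borel_measurable_times dfm Um k)
  qed simp
  have one: "(\<integral>\<^sup>+\<omega>. ennreal ((Z (?s k) (X (?s k) \<omega>) i - h k i (X (?s k) \<omega>))\<^sup>2) \<partial>M) \<le> ennreal (1 / ?d\<^sup>2) * (\<integral>\<^sup>+\<omega>. ennreal ((?df \<omega> * ?U k i \<omega>)\<^sup>2) \<partial>M)"
    if k: "k < m" and i: "i < D" for k i
  proof -
    have sT: "0 \<le> ?s k" "?s k \<le> T" using tsub_range[OF n m, of k] k by auto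
    interpret sub: finite_measure_subalgebra M "F (?s k)" by unfold_locales (rule subalgebra_F[OF sT(2)])
    let ?f = "\<lambda>\<omega>. ?df \<omega> * ?U k i \<omega>" and ?b = "\<lambda>\<omega>. \<phi> (X ?t \<omega>) * ?U k i \<omega>"
    have ce: "integrable M ?b"
      "AE \<omega> in M. real_cond_exp M (F (?s k)) ?b \<omega> = (\<integral>\<omega>'. \<phi> (ran_eval (w k \<omega>') (I k) (X (?s k) \<omega>)) * ?U k i \<omega>' \<partial>M)"
      unfolding tsub_Suc by (rule cond_exp_flow[OF n m k i refl refl \<phi> lip w eq[OF k]]; assumption)+
    have fi: "integrable M ?f"
    proof -
      have "integrable M (\<lambda>\<omega>. ?f \<omega> * 1)"
        by (rule integrable_mult_of_squares[OF borel_measurable_times[OF dfm Um[OF k]] _ fin[OF k i]]) auto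
      then show ?thesis by simp
    qed
    have vi: "integrable M (\<lambda>\<omega>. V' (X ?t \<omega>) * ?U k i \<omega>)"
      using Bochner_Integration.integrable_add[OF fi ce(1)] by (simp only: distrib_right[symmetric] diff_add_cancel)
    have Vm: "(\<lambda>\<omega>. V (X ?t \<omega>) * ?U k i \<omega>) \<in> borel_measurable M"
      by (rule measurable_cong[THEN iffD1, OF _ borel_measurable_integrable[OF vi]]) (simp only: V'(2)[OF Xv])
    have e1: "AE \<omega> in M. real_cond_exp M (F (?s k)) (\<lambda>\<omega>. V (X ?t \<omega>) * ?U k i \<omega>) \<omega> = real_cond_exp M (F (?s k)) (\<lambda>\<omega>. V' (X ?t \<omega>) * ?U k i \<omega>) \<omega>"
    proof (rule sub.real_cond_exp_cong)
      show "AE \<omega> in M. V (X ?t \<omega>) * ?U k i \<omega> = V' (X ?t \<omega>) * ?U k i \<omega>"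
        by (rule AE_I2) (simp only: V'(2)[OF Xv])
    qed (rule Vm, rule borel_measurable_integrable[OF vi])
    have e2: "AE \<omega> in M. real_cond_exp M (F (?s k)) (\<lambda>\<omega>. V' (X ?t \<omega>) * ?U k i \<omega> - ?b \<omega>) \<omega>
       = real_cond_exp M (F (?s k)) (\<lambda>\<omega>. V' (X ?t \<omega>) * ?U k i \<omega>) \<omega> - real_cond_exp M (F (?s k)) ?b \<omega>"
      by (rule sub.real_cond_exp_diff[OF vi ce(1)])
    have e3: "AE \<omega> in M. Z (?s k) (X (?s k) \<omega>) i = real_cond_exp M (F (?s k)) (\<lambda>\<omega>. V (X ?t \<omega>) * ?U k i \<omega>) \<omega> / ?d"
      using Z k i unfolding is_Zstar_def by blast
    have ff: "(\<lambda>\<omega>. V' (X ?t \<omega>) * ?U k i \<omega> - ?b \<omega>) = ?f" by (rule ext, rule left_diff_distrib[symmetric])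
    have AEq: "AE \<omega> in M. Z (?s k) (X (?s k) \<omega>) i - h k i (X (?s k) \<omega>) = real_cond_exp M (F (?s k)) ?f \<omega> / ?d"
      using e1 e2 e3 ce(2)
    proof eventually_elim
      case (elim \<omega>)
      have "h k i (X (?s k) \<omega>) = real_cond_exp M (F (?s k)) ?b \<omega> / ?d" unfolding h_def using elim(4) by simp
      then show ?case using elim(1-3) unfolding ff by (simp only: diff_divide_distrib[symmetric])
    qed
    have "(\<integral>\<^sup>+\<omega>. ennreal ((Z (?s k) (X (?s k) \<omega>) i - h k i (X (?s k) \<omega>))\<^sup>2) \<partial>M) = (\<integral>\<^sup>+\<omega>. ennreal (1 / ?d\<^sup>2) * ennreal ((real_cond_exp M (F (?s k)) ?f \<omega>)\<^sup>2) \<partial>M)"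
    proof (rule nn_integral_cong_AE)
      show "AE \<omega> in M. ennreal ((Z (?s k) (X (?s k) \<omega>) i - h k i (X (?s k) \<omega>))\<^sup>2) = ennreal (1 / ?d\<^sup>2) * ennreal ((real_cond_exp M (F (?s k)) ?f \<omega>)\<^sup>2)"
        using AEq by eventually_elim (simp only: power_divide, simp add: ennreal_mult[symmetric])
    qed
    also have "\<dots> = ennreal (1 / ?d\<^sup>2) * (\<integral>\<^sup>+\<omega>. ennreal ((real_cond_exp M (F (?s k)) ?f \<omega>)\<^sup>2) \<partial>M)"
      by (rule nn_integral_cmult) measurable
    also have "\<dots> \<le> ennreal (1 / ?d\<^sup>2) * (\<integral>\<^sup>+\<omega>. ennreal ((?f \<omega>)\<^sup>2) \<partial>M)"
      by (intro mult_left_mono sub.cond_exp_square_le fi fin k i) auto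
    finally show ?thesis .
  qed
  have hm: "h k i \<in> borel_measurable borel" if k: "k < m" for k i
  proof -
    have "(\<lambda>z. ran_eval (w k (snd z)) (I k) (fst z)) \<in> measurable (borel \<Otimes>\<^sub>M M) borel"
      by (rule ran_eval_measurable) (use w in \<open>auto intro: measurable_compose[OF measurable_snd]\<close>)
    from borel_measurable_times[OF measurable_compose[OF this \<phi>(1)] measurable_compose[OF measurable_snd Um[OF k, of i]]]
    have "(\<lambda>x. \<integral>\<omega>'. \<phi> (ran_eval (w k \<omega>') (I k) x) * ?U k i \<omega>' \<partial>M) \<in> borel_measurable borel"
      by (intro borel_measurable_lebesgue_integral) (simp add: split_def)
    then show ?thesis unfolding h_def by (rule borel_measurable_divide[OF _ borel_measurable_const])
  qed
  have Zm: "(\<lambda>\<omega>. Z (?s k) (X (?s k) \<omega>) i) \<in> borel_measurable M" if k: "k < m" for k i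
  proof -
    have Zb: "(\<lambda>(t, x). Z t x) \<in> measurable borel borel" using Z unfolding is_Zstar_def by blast
    have "(\<lambda>\<omega>. (?s k, X (?s k) \<omega>)) \<in> measurable M borel"
      unfolding borel_prod[symmetric] using X.Y_meas tsub_range[OF n m, of k] k by (intro measurable_Pair) auto
    from measurable_compose[OF measurable_compose[OF this Zb] coord_measurable[of i]] show ?thesis by simp
  qed
  have Xs: "X (?s k) \<in> measurable M borel" if "k < m" for k using X.Y_meas tsub_range[OF n m, of k] that by auto
  have "(\<Sum>k<m. ennreal ?d * (\<integral>\<^sup>+\<omega>. (\<Sum>i<D. ennreal ((Z (?s k) (X (?s k) \<omega>) i - h k i (X (?s k) \<omega>))\<^sup>2)) \<partial>M))
    \<le> (\<Sum>k<m. ennreal ?d * (\<Sum>i<D. ennreal (1 / ?d\<^sup>2) * (\<integral>\<^sup>+\<omega>. ennreal ((?df \<omega> * ?U k i \<omega>)\<^sup>2) \<partial>M)))"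
  proof (intro sum_mono mult_left_mono)
    fix k assume "k \<in> {..<m}"
    then have k: "k < m" by simp
    have "(\<integral>\<^sup>+\<omega>. (\<Sum>i<D. ennreal ((Z (?s k) (X (?s k) \<omega>) i - h k i (X (?s k) \<omega>))\<^sup>2)) \<partial>M)
      = (\<Sum>i<D. \<integral>\<^sup>+\<omega>. ennreal ((Z (?s k) (X (?s k) \<omega>) i - h k i (X (?s k) \<omega>))\<^sup>2) \<partial>M)"
      by (intro nn_integral_sum measurable_compose[OF _ measurable_ennreal] borel_measurable_power borel_measurable_diff Zm k measurable_compose[OF Xs hm])
    also have "\<dots> \<le> (\<Sum>i<D. ennreal (1 / ?d\<^sup>2) * (\<integral>\<^sup>+\<omega>. ennreal ((?df \<omega> * ?U k i \<omega>)\<^sup>2) \<partial>M))"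
      by (intro sum_mono one k) simp
    finally show "(\<integral>\<^sup>+\<omega>. (\<Sum>i<D. ennreal ((Z (?s k) (X (?s k) \<omega>) i - h k i (X (?s k) \<omega>))\<^sup>2)) \<partial>M)
      \<le> (\<Sum>i<D. ennreal (1 / ?d\<^sup>2) * (\<integral>\<^sup>+\<omega>. ennreal ((?df \<omega> * ?U k i \<omega>)\<^sup>2) \<partial>M))" .
  qed simp
  also have "\<dots> = ennreal (1 / ?d) * (\<Sum>k<m. \<Sum>i<D. \<integral>\<^sup>+\<omega>. ennreal ((?df \<omega> * ?U k i \<omega>)\<^sup>2) \<partial>M)"
  proof -
    have "ennreal ?d * ennreal (1 / ?d\<^sup>2) = ennreal (1 / ?d)" using d by (simp add: ennreal_mult[symmetric] power2_eq_square)
    then show ?thesis by (simp only: sum_distrib_left[symmetric] mult.assoc[symmetric])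
  qed
  also have "(\<Sum>k<m. \<Sum>i<D. \<integral>\<^sup>+\<omega>. ennreal ((?df \<omega> * ?U k i \<omega>)\<^sup>2) \<partial>M) = (\<integral>\<^sup>+\<omega>. (\<Sum>k<m. \<Sum>i<D. ennreal ((?df \<omega> * ?U k i \<omega>)\<^sup>2)) \<partial>M)"
  proof -
    have mm: "(\<lambda>\<omega>. ennreal ((?df \<omega> * ?U k i \<omega>)\<^sup>2)) \<in> borel_measurable M" if "k < m" for k i
      by (intro measurable_compose[OF _ measurable_ennreal] borel_measurable_power borel_measurable_times dfm Um that)
    show ?thesis
      by (subst nn_integral_sum, (intro borel_measurable_sum mm; simp), intro sum.cong refl, subst nn_integral_sum, (intro mm; simp), simp)
  qed
  also have "ennreal (1 / ?d) * \<dots> \<le> ennreal (1 / ?d) * ennreal e" by (intro mult_left_mono tot) simp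
  also have "\<dots> = ennreal (e / ?d)"
    using d by (cases "e \<ge> 0") (auto simp: ennreal_mult[symmetric] ennreal_neg divide_nonpos_pos)
  finally show ?thesis .
qed

end

section \<open>Networks from sampled flows\<close>

lemma ran_eval_vspace:
  assumes "\<forall>m. w I m \<in> vspace D"
  shows "ran_eval w I x \<in> vspace D"
proof -
  have "ran_layer (w I) y \<in> vspace D" for y using assms by (auto simp: vspace_def ran_layer_def)
  then show ?thesis by (cases I) auto
qed

lemma vnorm_scale: "vnorm D (\<lambda>i. c * u i) = \<bar>c\<bar> * vnorm D u"
  by (simp add: vnorm_def power_mult_distrib real_sqrt_mult flip: sum_distrib_left)

lemma vnorm_sum_le: "vnorm D (\<lambda>i. \<Sum>j<m. f j i) \<le> (\<Sum>j<m. vnorm D (f j))" for m :: nat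
proof (induction m)
  case 0
  then show ?case by (simp add: vnorm_def)
next
  case (Suc m)
  then show ?case using vnorm_triangle[of D "\<lambda>i. \<Sum>j<m. f j i" "f m"] by simp
qed

lemma vnorm_cong: "(\<And>i. i < D \<Longrightarrow> u i = v i) \<Longrightarrow> vnorm D u = vnorm D v"
  by (simp add: vnorm_def)

context flow_model
begin

text \<open>The network is the mean over \<open>Suc r\<close> samples of \<open>Vh\<close> after the
  sampled flow, times the sampled increment over \<open>dt\<close>. Flow parameters and increment
  are read off the same sample, because \<open>h\<close> integrates their product. The outputs of
  \<open>greedy_sampling\<close> become error, size and growth, and its factor 3 appears in each
  bound.\<close>

lemma mc_network:
  assumes n: "n < N" and m: "m \<ge> 1" and k: "k < m"
    and Vh: "relu_fun LV D 1 SV Vh" and C: "C > 0" "\<And>y. y \<in> vspace D \<Longrightarrow> \<bar>Vh y 0\<bar> \<le> C * (1 + vnorm D y)"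
    and w: "\<And>l m j. (\<lambda>\<omega>. w \<omega> l m j) \<in> borel_measurable M" "\<And>\<omega>. \<omega> \<in> space M \<Longrightarrow> ran_valid D I (w \<omega>)"
      "(\<integral>\<^sup>+\<omega>. ran_size I (w \<omega>) \<partial>M) \<le> ennreal K"
    and g: "g \<in> borel_measurable M" "\<And>\<omega>. g \<omega> \<ge> (0::real)" "(\<integral>\<^sup>+\<omega>. ennreal (g \<omega> powr p) \<partial>M) \<le> ennreal (K powr p)"
    and b: "AE \<omega> in M. finite {(l, m, j). l \<le> I \<and> w \<omega> l m j \<noteq> 0} \<and>
       (\<forall>x\<in>vspace D. vnorm D (ran_eval (w \<omega>) I x) \<le> g \<omega> * (1 + vnorm D x))"
  defines "s \<equiv> tsub T N m n k" and "h i x \<equiv> (\<integral>\<omega>'. Vh (ran_eval (w \<omega>') I x) 0 * \<Delta> (tsub T N m n k) (tsub T N m n (Suc k)) i \<omega>' \<partial>M) / dt T N m"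
  shows "\<exists>nl S G. relu_fun nl D D S G
    \<and> real S \<le> (real D + 1) * (real SV + 1) * (real (Suc r) * (1 + 3 * K))
    \<and> (\<forall>x\<in>vspace D. vnorm D (G x) \<le> 3 * C * (1 + Q1) / dt T N m * (1 + vnorm D x))
    \<and> (\<integral>\<^sup>+\<omega>. (\<Sum>i<D. ennreal ((h i (X s \<omega>) - G (X s \<omega>) i)\<^sup>2)) \<partial>M) \<le> ennreal (3 * ((C / dt T N m)\<^sup>2 * Q1 * m2max n) / real (Suc r))"
proof -
  let ?d = "dt T N m" and ?R = "real (Suc r)"
  define U where "U i \<omega> = \<Delta> s (tsub T N m n (Suc k)) i \<omega>" for i \<omega>
  define nU where "nU \<omega> = vnorm D (\<lambda>i. U i \<omega>)" for \<omega>
  define f where "f x \<omega> = ran_eval (w \<omega>) I x" for x \<omega>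
  define \<xi> where "\<xi> i x \<omega> = Vh (f x \<omega>) 0 * U i \<omega> / ?d" for i x \<omega>
  define \<mu> where "\<mu> = distr M borel (X s)"
  have d: "?d > 0" by (rule dt_pos[OF m])
  have sr: "0 \<le> s" "s \<le> T" "s < tsub T N m n (Suc k)" "tsub T N m n (Suc k) \<le> T"
    using tsub_range[OF n m, of k] tsub_range[OF n m, of "Suc k"] k d by (auto simp: s_def tsub_Suc)
  have Um: "U i \<in> borel_measurable M" for i unfolding U_def using sr by (intro borel_measurable_diff W_meas) auto
  have nUm [measurable]: "nU \<in> borel_measurable M"
    unfolding nU_def vnorm_def by (intro measurable_compose[OF _ borel_measurable_sqrt] borel_measurable_sum borel_measurable_power Um)
  note g(1)[measurable]
  have Q: "(\<integral>\<^sup>+\<omega>. ennreal ((1 + g \<omega>)\<^sup>2 * (nU \<omega>)\<^sup>2) \<partial>M) \<le> ennreal Q1"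
    unfolding nU_def U_def by (rule growth_noise_moment[OF sr(1,3,4) g])
  have Xm: "X s \<in> measurable M borel" using X.Y_meas sr by auto
  have Xv: "X s \<omega> \<in> vspace D" if "\<omega> \<in> space M" for \<omega> using X.Y_vspace that sr by auto
  have V0: "(\<lambda>y. Vh y 0) \<in> borel_measurable borel"
    by (rule measurable_compose[OF relu_fun_measurable[OF Vh] coord_measurable])
  have fj: "(\<lambda>z. f (fst z) (snd z)) \<in> measurable (borel \<Otimes>\<^sub>M M) borel"
    unfolding f_def by (rule ran_eval_measurable) (use w in \<open>auto intro: measurable_compose[OF measurable_snd]\<close>)
  have \<xi>j: "(\<lambda>z. \<xi> i (fst z) (snd z)) \<in> borel_measurable (borel \<Otimes>\<^sub>M M)" for i
    unfolding \<xi>_def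
    by (intro borel_measurable_divide borel_measurable_times measurable_compose[OF fj V0] measurable_compose[OF measurable_snd Um] borel_measurable_const)
  have \<xi>\<mu>: "(\<lambda>z. \<xi> i (fst z) (snd z)) \<in> borel_measurable (\<mu> \<Otimes>\<^sub>M M)" for i
    using \<xi>j[of i] unfolding \<mu>_def by (simp cong: measurable_cong_sets sets_pair_measure_cong)
  have fv: "f x \<omega> \<in> vspace D" if "\<omega> \<in> space M" for x \<omega>
    unfolding f_def using w(2)[OF that] by (intro ran_eval_vspace) (auto simp: ran_valid_def)
  define P where "P \<omega> \<longleftrightarrow> finite {(l, m, j). l \<le> I \<and> w \<omega> l m j \<noteq> 0} \<and> (\<forall>x\<in>vspace D. vnorm D (f x \<omega>) \<le> g \<omega> * (1 + vnorm D x))" for \<omega>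
  have PAE: "AE \<omega> in M. P \<omega>" using b unfolding P_def f_def .
  have Vb: "\<bar>Vh (f x \<omega>) 0\<bar> \<le> C * ((1 + g \<omega>) * (1 + vnorm D x))" if "P \<omega>" "\<omega> \<in> space M" "x \<in> vspace D" for x \<omega>
  proof -
    have "\<bar>Vh (f x \<omega>) 0\<bar> \<le> C * (1 + vnorm D (f x \<omega>))" by (rule C(2)[OF fv[OF that(2)]])
    also have "\<dots> \<le> C * ((1 + g \<omega>) * (1 + vnorm D x))"
    proof (rule mult_left_mono)
      have "vnorm D (f x \<omega>) \<le> g \<omega> * (1 + vnorm D x)" using that unfolding P_def by auto
      then have "1 + vnorm D (f x \<omega>) \<le> (1 + vnorm D x) + g \<omega> * (1 + vnorm D x)" by (intro add_mono) auto
      then show "1 + vnorm D (f x \<omega>) \<le> (1 + g \<omega>) * (1 + vnorm D x)" by (simp only: distrib_right mult_1_left)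
    qed (use C in simp)
    finally show ?thesis .
  qed
  \<comment> \<open>Second moment of the integrand at a fixed starting point; the growth of the flow
    and the increment are bounded jointly, through \<open>Q1\<close>.\<close>
  have sec: "(\<integral>\<^sup>+\<omega>. (\<Sum>i<D. ennreal ((\<xi> i x \<omega>)\<^sup>2)) \<partial>M) \<le> ennreal ((C / ?d)\<^sup>2 * Q1) * ennreal ((1 + vnorm D x)\<^sup>2)" if x: "x \<in> vspace D" for x
  proof -
    let ?c = "(C / ?d)\<^sup>2 * (1 + vnorm D x)\<^sup>2"
    have "(\<integral>\<^sup>+\<omega>. (\<Sum>i<D. ennreal ((\<xi> i x \<omega>)\<^sup>2)) \<partial>M) \<le> (\<integral>\<^sup>+\<omega>. ennreal ?c * ennreal ((1 + g \<omega>)\<^sup>2 * (nU \<omega>)\<^sup>2) \<partial>M)"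
    proof (rule nn_integral_mono_AE)
      show "AE \<omega> in M. (\<Sum>i<D. ennreal ((\<xi> i x \<omega>)\<^sup>2)) \<le> ennreal ?c * ennreal ((1 + g \<omega>)\<^sup>2 * (nU \<omega>)\<^sup>2)"
        using PAE AE_space
      proof eventually_elim
        case (elim \<omega>)
        have "(\<Sum>i<D. (\<xi> i x \<omega>)\<^sup>2) = (Vh (f x \<omega>) 0)\<^sup>2 / ?d\<^sup>2 * (nU \<omega>)\<^sup>2"
          unfolding nU_def vnorm_square \<xi>_def by (simp add: power_divide power_mult_distrib sum_distrib_left sum_divide_distrib)
        also have "\<dots> \<le> (C * ((1 + g \<omega>) * (1 + vnorm D x)))\<^sup>2 / ?d\<^sup>2 * (nU \<omega>)\<^sup>2"
        proof -
          have "\<bar>Vh (f x \<omega>) 0\<bar>\<^sup>2 \<le> (C * ((1 + g \<omega>) * (1 + vnorm D x)))\<^sup>2" by (rule power_mono[OF Vb[OF elim x]]) simp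
          then show ?thesis by (intro mult_right_mono divide_right_mono) auto
        qed
        also have "\<dots> = ?c * ((1 + g \<omega>)\<^sup>2 * (nU \<omega>)\<^sup>2)" by (simp add: power_mult_distrib power_divide)
        finally have "ennreal (\<Sum>i<D. (\<xi> i x \<omega>)\<^sup>2) \<le> ennreal (?c * ((1 + g \<omega>)\<^sup>2 * (nU \<omega>)\<^sup>2))" by (rule ennreal_leI)
        then show ?case by (subst sum_ennreal) (auto simp: ennreal_mult)
      qed
    qed
    also have "\<dots> = ennreal ?c * (\<integral>\<^sup>+\<omega>. ennreal ((1 + g \<omega>)\<^sup>2 * (nU \<omega>)\<^sup>2) \<partial>M)" by (rule nn_integral_cmult) measurable
    also have "\<dots> \<le> ennreal ?c * ennreal Q1" by (intro mult_left_mono Q) auto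
    also have "\<dots> = ennreal ((C / ?d)\<^sup>2 * Q1) * ennreal ((1 + vnorm D x)\<^sup>2)"
      using Q1_ge by (simp add: ennreal_mult[symmetric] mult_ac)
    finally show ?thesis .
  qed
  let ?v = "(C / ?d)\<^sup>2 * Q1 * m2max n"
  have v0: "?v > 0" using C d Q1_ge m2max_pos[of n] by (intro mult_pos_pos) auto
  have to_M: "(\<integral>\<^sup>+x. q x \<partial>\<mu>) = (\<integral>\<^sup>+\<omega>. q (X s \<omega>) \<partial>M)" if "q \<in> borel_measurable borel" for q
    unfolding \<mu>_def by (rule nn_integral_distr[OF Xm]) (use that in simp)
  have v: "(\<integral>\<^sup>+x. (\<integral>\<^sup>+\<omega>. (\<Sum>i<D. ennreal ((\<xi> i x \<omega>)\<^sup>2)) \<partial>M) \<partial>\<mu>) \<le> ennreal ?v"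
  proof -
    have "(\<lambda>z. \<Sum>i<D. ennreal ((\<xi> i (fst z) (snd z))\<^sup>2)) \<in> borel_measurable (borel \<Otimes>\<^sub>M M)"
      by (intro borel_measurable_sum measurable_compose[OF borel_measurable_power[OF \<xi>j] measurable_ennreal])
    from borel_measurable_nn_integral_fst[OF this]
    have "(\<integral>\<^sup>+x. (\<integral>\<^sup>+\<omega>. (\<Sum>i<D. ennreal ((\<xi> i x \<omega>)\<^sup>2)) \<partial>M) \<partial>\<mu>) = (\<integral>\<^sup>+\<omega>'. (\<integral>\<^sup>+\<omega>. (\<Sum>i<D. ennreal ((\<xi> i (X s \<omega>') \<omega>)\<^sup>2)) \<partial>M) \<partial>M)"
      by (intro to_M) simp
    also have "\<dots> \<le> (\<integral>\<^sup>+\<omega>'. ennreal ((C / ?d)\<^sup>2 * Q1) * ennreal ((1 + vnorm D (X s \<omega>'))\<^sup>2) \<partial>M)"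
      by (intro nn_integral_mono sec Xv)
    also have "\<dots> = ennreal ((C / ?d)\<^sup>2 * Q1) * m2 s"
      unfolding m2_def by (rule nn_integral_cmult) (use Xm in measurable)
    also have "\<dots> \<le> ennreal ((C / ?d)\<^sup>2 * Q1) * ennreal (m2max n)"
      unfolding s_def using k by (intro mult_left_mono m2_tsub[OF n m]) auto
    also have "\<dots> = ennreal ?v" using Q1_ge m2max_pos[of n] by (subst ennreal_mult[symmetric]) auto
    finally show ?thesis .
  qed
  \<comment> \<open>The second cost is the growth constant of one sample up to the factor
    \<open>C / dt\<close>. Its mean is controlled through
    \<open>y \<le> 1 + y\<^sup>2\<close>.\<close>
  let ?c2 = "\<lambda>\<omega>. ennreal ((1 + g \<omega>) * nU \<omega>)"
  have S2: "(\<integral>\<^sup>+\<omega>. ?c2 \<omega> \<partial>M) \<le> ennreal (1 + Q1)"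
  proof -
    have "(\<integral>\<^sup>+\<omega>. ?c2 \<omega> \<partial>M) \<le> (\<integral>\<^sup>+\<omega>. 1 + ennreal ((1 + g \<omega>)\<^sup>2 * (nU \<omega>)\<^sup>2) \<partial>M)"
    proof (rule nn_integral_mono)
      fix \<omega>
      have "y \<le> 1 + y\<^sup>2" for y :: real
      proof -
        have "2 * y \<le> 1 + y\<^sup>2" using zero_le_power2[of "y - 1"] by (simp add: power2_diff)
        then show ?thesis using zero_le_power2[of y] by linarith
      qed
      from this[of "(1 + g \<omega>) * nU \<omega>"] have "?c2 \<omega> \<le> ennreal (1 + (1 + g \<omega>)\<^sup>2 * (nU \<omega>)\<^sup>2)" by (intro ennreal_leI) (simp add: power_mult_distrib)
      then show "?c2 \<omega> \<le> 1 + ennreal ((1 + g \<omega>)\<^sup>2 * (nU \<omega>)\<^sup>2)" by (simp add: ennreal_plus)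
    qed
    also have "\<dots> = 1 + (\<integral>\<^sup>+\<omega>. ennreal ((1 + g \<omega>)\<^sup>2 * (nU \<omega>)\<^sup>2) \<partial>M)"
      by (subst nn_integral_add) (auto simp: emeasure_space_1)
    also have "\<dots> \<le> 1 + ennreal Q1" by (intro add_left_mono Q)
    also have "\<dots> = ennreal (1 + Q1)" using Q1_ge by (simp add: ennreal_plus)
    finally show ?thesis .
  qed
  have c1m: "(\<lambda>\<omega>. ran_size I (w \<omega>)) \<in> borel_measurable M" by (rule ran_size_measurable[OF w(1)])
  have c2m: "?c2 \<in> borel_measurable M" by measurable
  have p\<mu>: "prob_space \<mu>" unfolding \<mu>_def by (rule prob_space_distr[OF Xm])
  have "\<exists>\<omega> :: nat \<Rightarrow> 'w. (\<forall>j<Suc r. \<omega> j \<in> space M \<and> P (\<omega> j))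
     \<and> (\<integral>\<^sup>+x. (\<Sum>i<D. ennreal ((\<Sum>j<Suc r. \<xi> i x (\<omega> j) - (\<integral>\<omega>. \<xi> i x \<omega> \<partial>M))\<^sup>2)) \<partial>\<mu>) \<le> ennreal (3 * ?R * ?v)
     \<and> (\<Sum>j<Suc r. ran_size I (w (\<omega> j))) \<le> ennreal (3 * ?R * K) \<and> (\<Sum>j<Suc r. ?c2 (\<omega> j)) \<le> ennreal (3 * ?R * (1 + Q1))"
    by (rule greedy_sampling[OF p\<mu> \<xi>\<mu> c1m c2m w(3) S2 K0 _ v v0 PAE]) (use Q1_ge in simp)
  then obtain \<omega> :: "nat \<Rightarrow> 'w" where \<omega>: "\<And>j. j < Suc r \<Longrightarrow> \<omega> j \<in> space M \<and> P (\<omega> j)"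
    and err: "(\<integral>\<^sup>+x. (\<Sum>i<D. ennreal ((\<Sum>j<Suc r. \<xi> i x (\<omega> j) - (\<integral>\<omega>. \<xi> i x \<omega> \<partial>M))\<^sup>2)) \<partial>\<mu>) \<le> ennreal (3 * ?R * ?v)"
    and cs1: "(\<Sum>j<Suc r. ran_size I (w (\<omega> j))) \<le> ennreal (3 * ?R * K)"
    and cs2: "(\<Sum>j<Suc r. ?c2 (\<omega> j)) \<le> ennreal (3 * ?R * (1 + Q1))" by blast
  define cd where "cd j = card {(l, m, i). l \<le> I \<and> w (\<omega> j) l m i \<noteq> 0}" for j
  have "ran_size I (w (\<omega> j)) = ennreal (real (cd j))" if "j < Suc r" for j
    using \<omega>[OF that] by (simp add: ran_size_def cd_def P_def)
  then have "(\<Sum>j<Suc r. ennreal (real (cd j))) \<le> ennreal (3 * ?R * K)" using cs1 by simp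
  then have cdsum: "(\<Sum>j<Suc r. real (cd j)) \<le> 3 * ?R * K"
    using K0 by (subst (asm) sum_ennreal) (auto simp: ennreal_le_iff)
  have c2sum: "(\<Sum>j<Suc r. (1 + g (\<omega> j)) * nU (\<omega> j)) \<le> 3 * ?R * (1 + Q1)"
  proof -
    have nn: "0 \<le> (1 + g \<omega>) * nU \<omega>" for \<omega> using g(2)[of \<omega>] by (simp add: nU_def)
    have "ennreal (\<Sum>j<Suc r. (1 + g (\<omega> j)) * nU (\<omega> j)) \<le> ennreal (3 * ?R * (1 + Q1))"
      using cs2 by (subst (asm) sum_ennreal) (use nn in auto)
    then show ?thesis using Q1_ge by (subst (asm) ennreal_le_iff) auto
  qed
  \<comment> \<open>The depth \<open>I\<close> belongs to the representation and not to the sample,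
    so all summands have equal depth and may be added; \<open>+ 1 - 1\<close> is the merge with the
    output layer of depth one.\<close>
  let ?nl = "Suc I + LV - 1 + 1 - 1"
  have "\<exists>pr. j < Suc r \<longrightarrow> (fst pr \<le> (D + 1) * ((SV + 1) * (cd j + 1)) \<and> relu_fun ?nl D D (fst pr) (snd pr)
     \<and> (\<forall>x\<in>vspace D. \<forall>i<D. snd pr x i = \<xi> i x (\<omega> j) / ?R))" for j
  proof (cases "j < Suc r")
    case True
    have "finite {(l, m, i). l \<le> I \<and> w (\<omega> j) l m i \<noteq> 0}" using \<omega>[OF True] by (simp add: P_def)
    moreover have "\<forall>m. w (\<omega> j) I m \<in> vspace D" using w(2)[of "\<omega> j"] \<omega>[OF True] by (simp add: ran_valid_def)
    ultimately obtain SF Fn where F: "SF \<le> cd j" "relu_fun (Suc I) D D SF Fn" "\<And>x. x \<in> vspace D \<Longrightarrow> Fn x = f x (\<omega> j)"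
      unfolding cd_def f_def using ran_eval_relu_fun by blast
    obtain S12 where S12: "S12 \<le> SV * SF + SV + SF" "relu_fun (Suc I + LV - 1) D 1 S12 (\<lambda>x. Vh (Fn x))"
      using relu_fun_comp[OF F(2) Vh] by blast
    let ?c = "\<lambda>i. U i (\<omega> j) / ?d / ?R"
    obtain SA where SA: "SA \<le> D" "relu_fun 1 1 D SA (\<lambda>y i. if i < D then ?c i * y 0 else 0)"
      using relu_fun_scale_vector[of D ?c] by blast
    obtain S13 where S13: "S13 \<le> SA * S12 + SA + S12" "relu_fun ?nl D D S13 (\<lambda>x i. if i < D then ?c i * Vh (Fn x) 0 else 0)"
      using relu_fun_comp[OF S12(2) SA(2)] by blast
    \<comment> \<open>In terms of size plus one the composition bound is multiplicative:
      \<open>S2 * S1 + S2 + S1 + 1 = (S2 + 1) * (S1 + 1)\<close>.\<close>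
    have "S12 + 1 \<le> (SV + 1) * (SF + 1)" using S12(1) by (simp add: algebra_simps)
    also have "\<dots> \<le> (SV + 1) * (cd j + 1)" using F(1) by (intro mult_le_mono2) simp
    finally have "S12 + 1 \<le> (SV + 1) * (cd j + 1)" .
    then have "(SA + 1) * (S12 + 1) \<le> (D + 1) * ((SV + 1) * (cd j + 1))" using SA(1) by (intro mult_le_mono) auto
    moreover have "S13 \<le> (SA + 1) * (S12 + 1)" using S13(1) by (simp add: algebra_simps)
    ultimately have "S13 \<le> (D + 1) * ((SV + 1) * (cd j + 1))" by linarith
    then show ?thesis using S13(2) F(3)
      by (intro exI[of _ "(S13, \<lambda>x i. if i < D then ?c i * Vh (Fn x) 0 else 0)"]) (auto simp: \<xi>_def)
  qed simp
  then obtain pr where pr: "\<And>j. j < Suc r \<Longrightarrow> fst (pr j) \<le> (D + 1) * ((SV + 1) * (cd j + 1)) \<and> relu_fun ?nl D D (fst (pr j)) (snd (pr j))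
     \<and> (\<forall>x\<in>vspace D. \<forall>i<D. snd (pr j) x i = \<xi> i x (\<omega> j) / ?R)"
    using choice[of "\<lambda>j pr. j < Suc r \<longrightarrow> (fst pr \<le> (D + 1) * ((SV + 1) * (cd j + 1)) \<and> relu_fun ?nl D D (fst pr) (snd pr)
     \<and> (\<forall>x\<in>vspace D. \<forall>i<D. snd pr x i = \<xi> i x (\<omega> j) / ?R))"] by blast
  obtain S where S: "S \<le> (\<Sum>j<Suc r. fst (pr j))" "relu_fun ?nl D D S (\<lambda>x i. \<Sum>j<Suc r. snd (pr j) x i)"
    using relu_fun_sum[of r ?nl D D "\<lambda>j. fst (pr j)" "\<lambda>j. snd (pr j)"] pr by blast
  define G where "G x i = (\<Sum>j<Suc r. snd (pr j) x i)" for x i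
  have G: "G x i = (\<Sum>j<Suc r. \<xi> i x (\<omega> j)) / ?R" if "x \<in> vspace D" "i < D" for x i
    unfolding G_def sum_divide_distrib using pr that by (intro sum.cong) auto
  show ?thesis
  proof (intro exI conjI ballI)
    show "relu_fun ?nl D D S G" using S(2) unfolding G_def .
    have "real S \<le> real (\<Sum>j<Suc r. (D + 1) * ((SV + 1) * (cd j + 1)))"
      using S(1) pr by (intro of_nat_mono order_trans[OF S(1)] sum_mono) auto
    also have "\<dots> = (real D + 1) * (real SV + 1) * ((\<Sum>j<Suc r. real (cd j)) + ?R)"
    proof -
      have "real ((D + 1) * ((SV + 1) * (cd j + 1))) = (real D + 1) * (real SV + 1) * (real (cd j) + 1)" for j by (simp add: algebra_simps)
      then show ?thesis unfolding of_nat_sum by (simp only: sum_distrib_left[symmetric] sum.distrib sum_constant card_lessThan mult_1_right)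
    qed
    also have "\<dots> \<le> (real D + 1) * (real SV + 1) * (?R * (1 + 3 * K))"
    proof -
      have "(\<Sum>j<Suc r. real (cd j)) + ?R \<le> ?R * (1 + 3 * K)" using cdsum by (simp only: distrib_left mult_ac mult_1_right mult_1_left)
      then show ?thesis by (intro mult_left_mono) auto
    qed
    finally show "real S \<le> (real D + 1) * (real SV + 1) * (?R * (1 + 3 * K))" .
  next
    fix x assume x: "x \<in> vspace D"
    have "vnorm D (G x) = vnorm D (\<lambda>i. \<Sum>j<Suc r. (Vh (f x (\<omega> j)) 0 / ?d / ?R) * U i (\<omega> j))"
      by (rule vnorm_cong) (simp add: G[OF x] \<xi>_def sum_divide_distrib del: sum.lessThan_Suc)
    also have "\<dots> \<le> (\<Sum>j<Suc r. vnorm D (\<lambda>i. (Vh (f x (\<omega> j)) 0 / ?d / ?R) * U i (\<omega> j)))" by (rule vnorm_sum_le)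
    also have "\<dots> \<le> (\<Sum>j<Suc r. C * (1 + vnorm D x) / ?d / ?R * ((1 + g (\<omega> j)) * nU (\<omega> j)))"
    proof (rule sum_mono)
      fix j assume "j \<in> {..<Suc r}"
      then have j: "j < Suc r" by simp
      have "vnorm D (\<lambda>i. (Vh (f x (\<omega> j)) 0 / ?d / ?R) * U i (\<omega> j)) = \<bar>Vh (f x (\<omega> j)) 0\<bar> / ?d / ?R * nU (\<omega> j)"
        unfolding vnorm_scale nU_def using d by simp
      also have "\<dots> \<le> (C * ((1 + g (\<omega> j)) * (1 + vnorm D x))) / ?d / ?R * nU (\<omega> j)"
        using Vb[of "\<omega> j" x] \<omega>[OF j] x d by (intro mult_right_mono divide_right_mono) (auto simp: nU_def)
      also have "\<dots> = C * (1 + vnorm D x) / ?d / ?R * ((1 + g (\<omega> j)) * nU (\<omega> j))" by simp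
      finally show "vnorm D (\<lambda>i. (Vh (f x (\<omega> j)) 0 / ?d / ?R) * U i (\<omega> j)) \<le> C * (1 + vnorm D x) / ?d / ?R * ((1 + g (\<omega> j)) * nU (\<omega> j))" .
    qed
    also have "\<dots> = C * (1 + vnorm D x) / ?d / ?R * (\<Sum>j<Suc r. (1 + g (\<omega> j)) * nU (\<omega> j))" by (simp only: sum_distrib_left)
    also have "\<dots> \<le> C * (1 + vnorm D x) / ?d / ?R * (3 * ?R * (1 + Q1))"
      using C d vnorm_nonneg[of D x] by (intro mult_left_mono c2sum divide_nonneg_nonneg mult_nonneg_nonneg) auto
    also have "\<dots> = 3 * C * (1 + Q1) / ?d * (1 + vnorm D x)"
    proof -
      have "c * y / dd / R * (3 * R * q) = 3 * c * q / dd * y" if "R > 0" for c y dd R q :: real using that by simp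
      from this[of ?R] show ?thesis by simp
    qed
    finally show "vnorm D (G x) \<le> 3 * C * (1 + Q1) / ?d * (1 + vnorm D x)" .
  next
    let ?q = "\<lambda>x. \<Sum>i<D. ennreal ((\<Sum>j<Suc r. \<xi> i x (\<omega> j) - (\<integral>\<omega>. \<xi> i x \<omega> \<partial>M))\<^sup>2)"
    have hx: "(\<integral>\<omega>. \<xi> i x \<omega> \<partial>M) = h i x" for i x
      unfolding \<xi>_def h_def f_def U_def s_def by simp
    have \<xi>\<omega>: "(\<lambda>x. \<xi> i x (\<omega> j)) \<in> borel_measurable borel" if "j < Suc r" for i j
      using measurable_Pair1[OF \<xi>j, of "\<omega> j" i] \<omega>[OF that] by simp
    have hm: "h i \<in> borel_measurable borel" for i
      unfolding hx[symmetric] using \<xi>j[of i] by (intro borel_measurable_lebesgue_integral) (simp add: split_def)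
    have qm: "?q \<in> borel_measurable borel"
      unfolding hx by (intro borel_measurable_sum measurable_compose[OF _ measurable_ennreal] borel_measurable_power borel_measurable_diff \<xi>\<omega> hm) simp
    have "(\<integral>\<^sup>+\<omega>'. (\<Sum>i<D. ennreal ((h i (X s \<omega>') - G (X s \<omega>') i)\<^sup>2)) \<partial>M) = (\<integral>\<^sup>+\<omega>'. ennreal (1 / ?R\<^sup>2) * ?q (X s \<omega>') \<partial>M)"
    proof (rule nn_integral_cong)
      fix \<omega>' assume w': "\<omega>' \<in> space M"
      let ?x = "X s \<omega>'"
      \<comment> \<open>The summed deviation is \<open>- ?R\<close> times the error of the mean, so
        the sampled bound \<open>3 * ?R * ?v\<close> is divided by \<open>?R\<^sup>2\<close>, which
        gives the rate \<open>3 * ?v / ?R\<close>.\<close>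
      have "(h i ?x - G ?x i)\<^sup>2 = 1 / ?R\<^sup>2 * (\<Sum>j<Suc r. \<xi> i ?x (\<omega> j) - h i ?x)\<^sup>2" if "i < D" for i
      proof -
        have "(\<Sum>j<Suc r. \<xi> i ?x (\<omega> j) - h i ?x) = (\<Sum>j<Suc r. \<xi> i ?x (\<omega> j)) - ?R * h i ?x"
          by (simp only: sum_subtractf sum_constant card_lessThan)
        also have "\<dots> = - ?R * (h i ?x - G ?x i)" unfolding G[OF Xv[OF w'] that] by (simp add: field_simps del: sum.lessThan_Suc)
        finally have eq: "(\<Sum>j<Suc r. \<xi> i ?x (\<omega> j) - h i ?x) = - ?R * (h i ?x - G ?x i)" .
        have "y\<^sup>2 = 1 / R\<^sup>2 * (- R * y)\<^sup>2" if "R > 0" for R y :: real using that by (simp add: power_mult_distrib)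
        from this[of ?R "h i ?x - G ?x i"] show ?thesis unfolding eq by (simp only: of_nat_0_less_iff zero_less_Suc)
      qed
      then have "(\<Sum>i<D. ennreal ((h i ?x - G ?x i)\<^sup>2)) = (\<Sum>i<D. ennreal (1 / ?R\<^sup>2) * ennreal ((\<Sum>j<Suc r. \<xi> i ?x (\<omega> j) - h i ?x)\<^sup>2))"
        by (intro sum.cong refl) (simp only: lessThan_iff ennreal_mult[symmetric] zero_le_power2 zero_le_divide_1_iff)
      then show "(\<Sum>i<D. ennreal ((h i ?x - G ?x i)\<^sup>2)) = ennreal (1 / ?R\<^sup>2) * ?q ?x"
        unfolding hx by (simp only: sum_distrib_left)
    qed
    also have "\<dots> = ennreal (1 / ?R\<^sup>2) * (\<integral>\<^sup>+\<omega>'. ?q (X s \<omega>') \<partial>M)" by (rule nn_integral_cmult[OF measurable_compose[OF Xm qm]])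
    also have "(\<integral>\<^sup>+\<omega>'. ?q (X s \<omega>') \<partial>M) = (\<integral>\<^sup>+x. ?q x \<partial>\<mu>)" by (rule to_M[OF qm, symmetric])
    also have "ennreal (1 / ?R\<^sup>2) * \<dots> \<le> ennreal (1 / ?R\<^sup>2) * ennreal (3 * ?R * ?v)" by (intro mult_left_mono err) simp
    also have "\<dots> = ennreal (3 * ?v / ?R)"
    proof -
      have "1 / R\<^sup>2 * (3 * R * y) = 3 * y / R" if "R > 0" for R y :: real using that by (simp add: power2_eq_square)
      from this[of ?R ?v] show ?thesis using v0 by (subst ennreal_mult[symmetric]) auto
    qed
    finally show "(\<integral>\<^sup>+\<omega>. (\<Sum>i<D. ennreal ((h i (X s \<omega>) - G (X s \<omega>) i)\<^sup>2)) \<partial>M) \<le> ennreal (3 * ?v / ?R)" .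
  qed
qed

end

lemma relu_fun_square_lipschitz:
  assumes "relu_fun n D e S F"
  obtains \<Lambda> where "\<Lambda> \<ge> 0" "\<And>x y. (F x j - F y j)\<^sup>2 \<le> \<Lambda> * (\<Sum>i<D. (x i - y i)\<^sup>2)"
proof -
  obtain \<Lambda> where \<Lambda>: "\<Lambda> \<ge> 0" "\<And>x y j. \<bar>F x j - F y j\<bar> \<le> \<Lambda> * (\<Sum>i<D. \<bar>x i - y i\<bar>)"
    using relu_fun_lipschitz[OF assms] by blast
  show ?thesis
  proof (rule that[of "\<Lambda>\<^sup>2 * real D"])
    fix x y
    have "\<bar>F x j - F y j\<bar>\<^sup>2 \<le> (\<Lambda> * (\<Sum>i<D. \<bar>x i - y i\<bar>))\<^sup>2" by (rule power_mono[OF \<Lambda>(2)]) simp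
    also have "\<dots> = \<Lambda>\<^sup>2 * (\<Sum>i<D. \<bar>x i - y i\<bar>)\<^sup>2" by (simp add: power_mult_distrib)
    also have "\<dots> \<le> \<Lambda>\<^sup>2 * ((\<Sum>i<D. \<bar>x i - y i\<bar>\<^sup>2) * real (card {..<D}))"
      by (intro mult_left_mono sum_squared_le_sum_of_squares) auto
    finally show "(F x j - F y j)\<^sup>2 \<le> \<Lambda>\<^sup>2 * real D * (\<Sum>i<D. (x i - y i)\<^sup>2)" by (simp add: mult_ac)
  qed simp
qed

context flow_model
begin

text \<open>The squared error is at most twice the squared distance from \<open>Z\<close> to
  \<open>h\<close> plus twice that from \<open>h\<close> to the network, with
  \<open>e\<^sup>2 / 2\<close> for each part. The tolerance \<open>e * sqrt dt / 2\<close>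
  compensates the loss \<open>1 / dt\<close> in the first; in the second the weights
  \<open>dt\<close> sum to at most \<open>T\<close>. \<open>Y\<close> dominates every quantity in
  the size bound, which turns the result into a single power. It is demanded for positive size only,
  since otherwise \<open>P\<close> may fall below 1.\<close>

lemma network_approximation:
  assumes n: "n < N" and m: "m \<ge> 1" and e: "e > 0"
    and V': "V' \<in> borel_measurable borel" "\<And>x. x \<in> vspace D \<Longrightarrow> V x = V' x"
    and \<Phi>: "valid_net D 1 \<Phi>" and P: "P > 0" "growth D 1 (realize \<Phi>) \<le> ennreal P" "real (net_size \<Phi>) \<le> P"
    and \<rho>: "(\<integral>\<^sup>+x. ennreal ((V x - realize \<Phi> x 0)\<^sup>2) \<partial>rho_meas M D W X T N m n) \<le> ennreal ((e * sqrt (dt T N m) / 2)\<^sup>2)"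
    and Z: "is_Zstar M D W X V T N m n Z"
    and B: "B \<ge> 0" and Y: "net_size \<Phi> \<ge> 1 \<Longrightarrow> real D \<le> Y \<and> P \<le> Y \<and> K \<le> Y \<and> Q1 \<le> Y \<and> m2max n \<le> Y \<and> 1 / e \<le> Y \<and> T \<le> Y
       \<and> 1 / dt T N m \<le> Y \<and> 224 * Y ^ 12 \<le> B"
  shows "\<exists>\<gamma> :: nat \<Rightarrow> relu_net. (\<forall>k<m. valid_net D D (\<gamma> k))
     \<and> (\<exists>zh :: real \<Rightarrow> vec \<Rightarrow> vec. (\<forall>k<m. \<forall>x\<in>vspace D. zh (tsub T N m n k) x = realize (\<gamma> k) x)
        \<and> (\<integral>\<^sup>+tx. ennreal ((vnorm D (Z (fst tx) (snd tx) - zh (fst tx) (snd tx)))\<^sup>2) \<partial>mu_meas M X T N m n) \<le> ennreal (e\<^sup>2))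
     \<and> (\<forall>k<m. growth D D (realize (\<gamma> k)) \<le> ennreal B \<and> real (net_size (\<gamma> k)) \<le> B)"
proof -
  let ?d = "dt T N m" and ?s = "\<lambda>k. tsub T N m n k" and ?t = "tgrid T N (Suc n)"
  define Vh where "Vh = realize \<Phi>"
  define SV where "SV = net_size \<Phi>"
  have d: "?d > 0" by (rule dt_pos[OF m])
  have md: "real m * ?d \<le> T"
  proof -
    have "real m * ?d = T / real N" using m by (simp add: dt_def)
    also have "\<dots> \<le> T / 1" using T0 N_ge by (intro divide_left_mono) auto
    finally show ?thesis by simp
  qed
  have R: "relu_fun (length (snd \<Phi>)) D 1 SV Vh" unfolding Vh_def SV_def by (rule net_imp_relu_fun[OF \<Phi>])
  have V0: "(\<lambda>y. Vh y 0) \<in> borel_measurable borel" by (rule measurable_compose[OF relu_fun_measurable[OF R] coord_measurable])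
  have Vb: "\<bar>Vh y 0\<bar> \<le> P * (1 + vnorm D y)" if "y \<in> vspace D" for y
    using vnorm_le_of_growth[OF P(2) less_imp_le[OF P(1)] that] by (simp add: vnorm_def Vh_def)
  obtain \<Lambda> where \<Lambda>: "\<Lambda> \<ge> 0" "\<And>x y. (Vh x 0 - Vh y 0)\<^sup>2 \<le> \<Lambda> * (\<Sum>i<D. (x i - y i)\<^sup>2)"
    using relu_fun_square_lipschitz[OF R, of 0] by blast
  have srange: "tgrid T N n \<le> ?s k" "?s k < ?t" if "k < m" for k
  proof -
    show "tgrid T N n \<le> ?s k" using d by (simp add: tsub_def)
    have "?s k < ?s m" using that d by (simp add: tsub_def)
    then show "?s k < ?t" using tsub_end[OF m] by simp
  qed
  \<comment> \<open>Bundles a representation at one time into a predicate, so that depth, parameters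
    and growth can be chosen for all \<open>k\<close> simultaneously.\<close>
  define rep where "rep k I w g \<longleftrightarrow> (\<forall>l m j. (\<lambda>\<omega>. w \<omega> l m j) \<in> borel_measurable M) \<and> (\<forall>\<omega>\<in>space M. ran_valid D I (w \<omega>))
    \<and> (AE \<omega> in M. \<forall>x\<in>vspace D. fl x (?s k) ?t \<omega> = ran_eval (w \<omega>) I x)
    \<and> (\<integral>\<^sup>+\<omega>. ran_size I (w \<omega>) \<partial>M) \<le> ennreal K
    \<and> g \<in> borel_measurable M \<and> (\<forall>\<omega>. g \<omega> \<ge> (0::real)) \<and> (\<integral>\<^sup>+\<omega>. ennreal (g \<omega> powr p) \<partial>M) \<le> ennreal (K powr p)
    \<and> (AE \<omega> in M. finite {(l, m, j). l \<le> I \<and> w \<omega> l m j \<noteq> 0} \<and>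
       (\<forall>x\<in>vspace D. vnorm D (ran_eval (w \<omega>) I x) \<le> g \<omega> * (1 + vnorm D x)))" for k I w g
  have ex: "\<exists>I w g. rep k I w g" if "k < m" for k
    unfolding rep_def by (rule flow_rep[OF n srange[OF that] order_refl]) blast
  then have "\<forall>k. \<exists>q. k < m \<longrightarrow> rep k (fst q) (fst (snd q)) (snd (snd q))" by (metis fst_conv snd_conv)
  then obtain q where q: "\<And>k. k < m \<Longrightarrow> rep k (fst (q k)) (fst (snd (q k))) (snd (snd (q k)))"
    using choice[of "\<lambda>k q. k < m \<longrightarrow> rep k (fst q) (fst (snd q)) (snd (snd q))"] by blast
  define I where "I k = fst (q k)" for k
  \<comment> \<open>Default parameters outside the range keep \<open>w k\<close> measurable for
    every \<open>k\<close>.\<close>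
  define w where "w k = (if k < m then fst (snd (q k)) else (\<lambda>_ _ _ _. 0))" for k
  define g where "g k = snd (snd (q k))" for k
  have rp: "rep k (I k) (w k) (g k)" if "k < m" for k using q[OF that] that by (simp add: I_def w_def g_def)
  have wm: "(\<lambda>\<omega>. w k \<omega> l m' j) \<in> borel_measurable M" for k l m' j
    using rp[of k] by (cases "k < m") (auto simp: rep_def, simp add: w_def)
  define h where "h k i x = (\<integral>\<omega>'. Vh (ran_eval (w k \<omega>') (I k) x) 0 * \<Delta> (?s k) (?s (Suc k)) i \<omega>' \<partial>M) / ?d" for k i x
  have e1: "(\<Sum>k<m. ennreal ?d * (\<integral>\<^sup>+\<omega>. (\<Sum>i<D. ennreal ((Z (?s k) (X (?s k) \<omega>) i - h k i (X (?s k) \<omega>))\<^sup>2)) \<partial>M))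
    \<le> ennreal ((e * sqrt ?d / 2)\<^sup>2 / ?d)"
    unfolding h_def
    by (rule Zstar_error[OF n m V' V0 less_imp_le[OF P(1)] Vb \<Lambda>(1) \<Lambda>(2) wm _ _ Z])
       (use rp \<rho> in \<open>auto simp: rep_def Vh_def\<close>)
  also have "(e * sqrt ?d / 2)\<^sup>2 / ?d = e\<^sup>2 / 4" using d by (simp add: power_mult_distrib power_divide)
  finally have e1: "(\<Sum>k<m. ennreal ?d * (\<integral>\<^sup>+\<omega>. (\<Sum>i<D. ennreal ((Z (?s k) (X (?s k) \<omega>) i - h k i (X (?s k) \<omega>))\<^sup>2)) \<partial>M)) \<le> ennreal (e\<^sup>2 / 4)" .
  have net: "\<exists>nl S G. relu_fun nl D D S G \<and> real S \<le> B \<and> (\<forall>x\<in>vspace D. vnorm D (G x) \<le> B * (1 + vnorm D x))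
      \<and> (\<integral>\<^sup>+\<omega>. (\<Sum>i<D. ennreal ((h k i (X (?s k) \<omega>) - G (X (?s k) \<omega>) i)\<^sup>2)) \<partial>M) \<le> ennreal (e\<^sup>2 / (4 * T))" if k: "k < m" for k
  proof (cases "SV = 0")
    case True
    then have "Vh x = (\<lambda>_. 0)" for x using relu_fun_size_0[OF R] by simp
    then have "h k i x = 0" for i x by (simp add: h_def)
    then show ?thesis using relu_fun_zero[of D D] B vnorm_nonneg
      by (intro exI[of _ 1] exI[of _ 0] exI[of _ "\<lambda>_ _. 0"]) (auto simp: vnorm_def intro!: mult_nonneg_nonneg add_nonneg_nonneg sum_nonneg)
  next
    case False
    then have y: "real D \<le> Y" "P \<le> Y" "K \<le> Y" "Q1 \<le> Y" "m2max n \<le> Y" "1 / e \<le> Y" "T \<le> Y" "1 / ?d \<le> Y" "224 * Y ^ 12 \<le> B"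
      using Y unfolding SV_def by auto
    have Y1: "Y \<ge> 1" using y(1) D0 by linarith
    let ?v = "(P / ?d)\<^sup>2 * Q1 * m2max n"
    have v0: "?v \<ge> 0" using Q1_ge m2max_pos[of n] by (intro mult_nonneg_nonneg) auto
    have vY: "?v \<le> Y ^ 6"
    proof -
      have "P / ?d \<le> Y * Y" using mult_mono[OF y(2,8)] P d Y1 by simp
      then have "(P / ?d)\<^sup>2 \<le> (Y * Y)\<^sup>2" using P d by (intro power_mono) auto
      then have "?v \<le> (Y * Y)\<^sup>2 * Y * Y" using y Q1_ge m2max_pos[of n] Y1 by (intro mult_mono) auto
      also have "\<dots> = Y ^ 6" by (simp add: power2_eq_square eval_nat_numeral)
      finally show ?thesis .
    qed
    \<comment> \<open>Makes the sampling error \<open>3 * ?v / Suc r\<close> at most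
      \<open>e\<^sup>2 / (4 * T)\<close>.\<close>
    define r where "r = nat \<lceil>12 * T * ?v / e\<^sup>2\<rceil>"
    have r1: "12 * T * ?v / e\<^sup>2 \<le> real (Suc r)"
      using real_nat_ceiling_ge[of "12 * T * ?v / e\<^sup>2"] unfolding r_def by linarith
    \<comment> \<open>The quotient \<open>T * ?v / e\<^sup>2\<close> costs
      \<open>Y * Y ^ 6 * Y\<^sup>2\<close>; rounding up and the successor add at most 2, and
      \<open>12 + 2 = 14\<close>.\<close>
    have r2: "real (Suc r) \<le> 14 * Y ^ 9"
    proof -
      have x0: "12 * T * ?v / e\<^sup>2 \<ge> 0" using T0 v0 by (intro divide_nonneg_nonneg mult_nonneg_nonneg[of "12 * T"]) auto
      have "real r \<le> 12 * T * ?v / e\<^sup>2 + 1" unfolding r_def using x0 by linarith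
      moreover have "12 * T * ?v / e\<^sup>2 \<le> 12 * Y ^ 9"
      proof -
        have "12 * T * ?v / e\<^sup>2 = 12 * (T * ?v * (1 / e)\<^sup>2)" by (simp add: power_divide)
        also have "\<dots> \<le> 12 * (Y * Y ^ 6 * Y\<^sup>2)"
          using T0 v0 vY y e Y1 by (intro mult_left_mono mult_mono power_mono) auto
        also have "\<dots> = 12 * Y ^ 9" by (simp add: power2_eq_square eval_nat_numeral)
        finally show ?thesis .
      qed
      moreover have "1 \<le> Y ^ 9" using Y1 by (rule one_le_power)
      ultimately show ?thesis by simp
    qed
    have rk: "\<And>l m j. (\<lambda>\<omega>. w k \<omega> l m j) \<in> borel_measurable M" "\<And>\<omega>. \<omega> \<in> space M \<Longrightarrow> ran_valid D (I k) (w k \<omega>)"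
      "(\<integral>\<^sup>+\<omega>. ran_size (I k) (w k \<omega>) \<partial>M) \<le> ennreal K" "g k \<in> borel_measurable M" "\<And>\<omega>. g k \<omega> \<ge> (0::real)"
      "(\<integral>\<^sup>+\<omega>. ennreal (g k \<omega> powr p) \<partial>M) \<le> ennreal (K powr p)"
      "AE \<omega> in M. finite {(l, m, j). l \<le> I k \<and> w k \<omega> l m j \<noteq> 0} \<and> (\<forall>x\<in>vspace D. vnorm D (ran_eval (w k \<omega>) (I k) x) \<le> g k \<omega> * (1 + vnorm D x))"
      using rp[OF k] unfolding rep_def by blast+
    obtain nl S G where G: "relu_fun nl D D S G" "real S \<le> (real D + 1) * (real SV + 1) * (real (Suc r) * (1 + 3 * K))"
      "\<And>x. x \<in> vspace D \<Longrightarrow> vnorm D (G x) \<le> 3 * P * (1 + Q1) / ?d * (1 + vnorm D x)"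
      "(\<integral>\<^sup>+\<omega>. (\<Sum>i<D. ennreal ((h k i (X (?s k) \<omega>) - G (X (?s k) \<omega>) i)\<^sup>2)) \<partial>M) \<le> ennreal (3 * ?v / real (Suc r))"
      using mc_network[OF n m k R P(1) Vb rk(1) rk(2) rk(3) rk(4) rk(5) rk(6) rk(7), of r] unfolding h_def by blast
    have pw: "Y ^ i \<le> Y ^ j" if "i \<le> j" for i j :: nat using that Y1 by (rule power_increasing)
    have "real S \<le> B"
    proof -
      have "real SV \<le> Y" using P(3) y(2) unfolding SV_def by linarith
      \<comment> \<open>The factors \<open>D + 1\<close> and \<open>SV + 1\<close> are at most
        \<open>2 * Y\<close> each, the number of samples at most \<open>14 * Y ^ 9\<close>, and
        \<open>1 + 3 * K\<close> at most \<open>4 * Y\<close>: this is the origin of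
        \<open>224 * Y ^ 12\<close>.\<close>
      then have "(real D + 1) * (real SV + 1) * (real (Suc r) * (1 + 3 * K)) \<le> (2 * Y) * (2 * Y) * ((14 * Y ^ 9) * (4 * Y))"
        using y(1,3) r2 Y1 K0 by (intro mult_mono) auto
      also have "\<dots> = 224 * Y ^ 12" by (simp add: eval_nat_numeral)
      finally show ?thesis using G(2) y(9) by linarith
    qed
    moreover have "vnorm D (G x) \<le> B * (1 + vnorm D x)" if "x \<in> vspace D" for x
    proof -
      have "3 * P * (1 + Q1) / ?d = 3 * (P * (1 + Q1) * (1 / ?d))" by simp
      also have "\<dots> \<le> 3 * (Y * (2 * Y) * Y)" using y P Q1_ge Y1 d by (intro mult_left_mono mult_mono) auto
      also have "\<dots> = 6 * Y ^ 3" by (simp add: eval_nat_numeral)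
      also have "\<dots> \<le> 224 * Y ^ 12" using pw[of 3 12] Y1 by (intro mult_mono) auto
      also have "\<dots> \<le> B" by (rule y)
      finally have "3 * P * (1 + Q1) / ?d * (1 + vnorm D x) \<le> B * (1 + vnorm D x)" using vnorm_nonneg[of D x] by (intro mult_right_mono) auto
      then show ?thesis using G(3)[OF that] by linarith
    qed
    moreover have "(\<integral>\<^sup>+\<omega>. (\<Sum>i<D. ennreal ((h k i (X (?s k) \<omega>) - G (X (?s k) \<omega>) i)\<^sup>2)) \<partial>M) \<le> ennreal (e\<^sup>2 / (4 * T))"
    proof (rule order_trans[OF G(4)], rule ennreal_leI)
      have "12 * T * ?v \<le> real (Suc r) * e\<^sup>2" using r1 e by (simp add: pos_divide_le_eq)
      moreover have "3 * v / R \<le> E / (4 * T)" if "12 * T * v \<le> R * E" "R > 0" for v R E :: real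
        using that T0 by (simp add: field_simps)
      ultimately show "3 * ?v / real (Suc r) \<le> e\<^sup>2 / (4 * T)" by simp
    qed
    ultimately show ?thesis using G(1) by blast
  qed
  then have "\<forall>k. \<exists>\<Gamma>. k < m \<longrightarrow> (valid_net D D \<Gamma> \<and> real (net_size \<Gamma>) \<le> B \<and> (\<forall>x\<in>vspace D. vnorm D (realize \<Gamma> x) \<le> B * (1 + vnorm D x))
      \<and> realize \<Gamma> \<in> measurable borel borel
      \<and> (\<integral>\<^sup>+\<omega>. (\<Sum>i<D. ennreal ((h k i (X (?s k) \<omega>) - realize \<Gamma> (X (?s k) \<omega>) i)\<^sup>2)) \<partial>M) \<le> ennreal (e\<^sup>2 / (4 * T)))"
  proof (intro allI)
    fix k
    show "\<exists>\<Gamma>. k < m \<longrightarrow> (valid_net D D \<Gamma> \<and> real (net_size \<Gamma>) \<le> B \<and> (\<forall>x\<in>vspace D. vnorm D (realize \<Gamma> x) \<le> B * (1 + vnorm D x))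
      \<and> realize \<Gamma> \<in> measurable borel borel
      \<and> (\<integral>\<^sup>+\<omega>. (\<Sum>i<D. ennreal ((h k i (X (?s k) \<omega>) - realize \<Gamma> (X (?s k) \<omega>) i)\<^sup>2)) \<partial>M) \<le> ennreal (e\<^sup>2 / (4 * T)))"
    proof (cases "k < m")
      case True
      obtain nl S G where G: "relu_fun nl D D S G" "real S \<le> B" "\<forall>x\<in>vspace D. vnorm D (G x) \<le> B * (1 + vnorm D x)"
        "(\<integral>\<^sup>+\<omega>. (\<Sum>i<D. ennreal ((h k i (X (?s k) \<omega>) - G (X (?s k) \<omega>) i)\<^sup>2)) \<partial>M) \<le> ennreal (e\<^sup>2 / (4 * T))"
        using net[OF True] by blast
      obtain \<Gamma> where "valid_net D D \<Gamma>" "net_size \<Gamma> = S" "realize \<Gamma> = G" using relu_fun_imp_net[OF G(1)] by blast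
      then show ?thesis using G relu_fun_measurable[OF G(1)] by (intro exI[of _ \<Gamma>]) simp
    qed simp
  qed
  from choice[OF this] obtain \<gamma> where \<gamma>: "\<And>k. k < m \<Longrightarrow> valid_net D D (\<gamma> k)" "\<And>k. k < m \<Longrightarrow> real (net_size (\<gamma> k)) \<le> B"
      "\<And>k x. k < m \<Longrightarrow> x \<in> vspace D \<Longrightarrow> vnorm D (realize (\<gamma> k) x) \<le> B * (1 + vnorm D x)"
      "\<And>k. k < m \<Longrightarrow> realize (\<gamma> k) \<in> measurable borel borel"
      "\<And>k. k < m \<Longrightarrow> (\<integral>\<^sup>+\<omega>. (\<Sum>i<D. ennreal ((h k i (X (?s k) \<omega>) - realize (\<gamma> k) (X (?s k) \<omega>) i)\<^sup>2)) \<partial>M) \<le> ennreal (e\<^sup>2 / (4 * T))"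
    by blast
  \<comment> \<open>At most one summand is present, because the grid times are distinct, and off the
    grid the function is zero. As a finite sum it is Borel in time and space, which integration
    against \<open>mu_meas\<close> requires.\<close>
  define zh where "zh t x = (\<lambda>i. \<Sum>k<m. if t = ?s k then realize (\<gamma> k) x i else 0)" for t x
  have inj: "?s k = ?s k' \<longleftrightarrow> k = k'" for k k' using d by (simp add: tsub_def)
  have zh: "zh (?s k) x = realize (\<gamma> k) x" if "k < m" for k x
    unfolding zh_def inj using that by (simp add: eq_commute[of k])
  have Zb: "(\<lambda>(t, x). Z t x) \<in> measurable borel borel" using Z unfolding is_Zstar_def by blast
  have Zi: "(\<lambda>z. Z (fst z) (snd z) i) \<in> borel_measurable borel" for i
    using measurable_compose[OF Zb coord_measurable[of i]] by (simp add: split_def)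
  have zi: "(\<lambda>z. zh (fst z) (snd z) i) \<in> borel_measurable borel" for i
    unfolding zh_def
  proof (rule borel_measurable_sum)
    fix k assume "k \<in> {..<m}"
    then have [measurable]: "realize (\<gamma> k) \<in> measurable borel borel" using \<gamma>(4) by simp
    show "(\<lambda>z. if fst z = ?s k then realize (\<gamma> k) (snd z) i else 0) \<in> borel_measurable (borel :: (real \<times> vec) measure)"
      unfolding borel_prod[symmetric] by measurable
  qed
  let ?f = "\<lambda>z. ennreal ((vnorm D (Z (fst z) (snd z) - zh (fst z) (snd z)))\<^sup>2)"
  have fm: "?f \<in> borel_measurable borel"
    unfolding vnorm_square fun_diff_def
    by (intro measurable_compose[OF _ measurable_ennreal] borel_measurable_sum borel_measurable_power borel_measurable_diff Zi zi)
  have Xs: "X (?s k) \<in> measurable M borel" if "k < m" for k using X.Y_meas tsub_range[OF n m, of k] that by auto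
  have hm: "h k i \<in> borel_measurable borel" if k: "k < m" for k i
  proof -
    have "(\<lambda>z. ran_eval (w k (snd z)) (I k) (fst z)) \<in> measurable (borel \<Otimes>\<^sub>M M) borel"
      by (rule ran_eval_measurable) (use wm in \<open>auto intro: measurable_compose[OF measurable_snd]\<close>)
    from measurable_compose[OF this V0]
    have a: "(\<lambda>z. Vh (ran_eval (w k (snd z)) (I k) (fst z)) 0) \<in> borel_measurable (borel \<Otimes>\<^sub>M M)" .
    have "\<Delta> (?s k) (?s (Suc k)) i \<in> borel_measurable M"
      using tsub_range[OF n m, of k] tsub_range[OF n m, of "Suc k"] k by (intro borel_measurable_diff W_meas) auto
    from measurable_compose[OF measurable_snd this]
    have "(\<lambda>z. \<Delta> (?s k) (?s (Suc k)) i (snd z)) \<in> borel_measurable (borel \<Otimes>\<^sub>M M)" .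
    from borel_measurable_times[OF a this]
    have "(\<lambda>z. Vh (ran_eval (w k (snd z)) (I k) (fst z)) 0 * \<Delta> (?s k) (?s (Suc k)) i (snd z)) \<in> borel_measurable (borel \<Otimes>\<^sub>M M)" .
    then have "case_prod (\<lambda>x \<omega>'. Vh (ran_eval (w k \<omega>') (I k) x) 0 * \<Delta> (?s k) (?s (Suc k)) i \<omega>') \<in> borel_measurable (borel \<Otimes>\<^sub>M M)"
      unfolding split_beta' .
    from borel_measurable_divide[OF borel_measurable_lebesgue_integral[OF this] borel_measurable_const]
    show ?thesis unfolding h_def .
  qed
  have "(\<integral>\<^sup>+z. ?f z \<partial>mu_meas M X T N m n) = (\<Sum>k<m. ennreal ?d * (\<integral>\<^sup>+\<omega>. ?f (?s k, X (?s k) \<omega>) \<partial>M))"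
    using nn_integral_mu_meas[of M m X T N n ?f, OF prob_space_axioms Xs fm] by simp
  also have "\<dots> \<le> (\<Sum>k<m. 2 * (ennreal ?d * (\<integral>\<^sup>+\<omega>. (\<Sum>i<D. ennreal ((Z (?s k) (X (?s k) \<omega>) i - h k i (X (?s k) \<omega>))\<^sup>2)) \<partial>M))
      + ennreal (?d * (e\<^sup>2 / (2 * T))))"
  proof (rule sum_mono)
    fix k assume "k \<in> {..<m}"
    then have k: "k < m" by simp
    let ?a = "\<lambda>\<omega>. \<Sum>i<D. ennreal ((Z (?s k) (X (?s k) \<omega>) i - h k i (X (?s k) \<omega>))\<^sup>2)"
    let ?b = "\<lambda>\<omega>. \<Sum>i<D. ennreal ((h k i (X (?s k) \<omega>) - realize (\<gamma> k) (X (?s k) \<omega>) i)\<^sup>2)"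
    have ZX: "(\<lambda>\<omega>. Z (?s k) (X (?s k) \<omega>) i) \<in> borel_measurable M" for i
    proof -
      have "(\<lambda>\<omega>. (?s k, X (?s k) \<omega>)) \<in> measurable M borel"
        unfolding borel_prod[symmetric] using Xs[OF k] by (intro measurable_Pair) auto
      from measurable_compose[OF this Zi[of i]] show ?thesis by simp
    qed
    have am: "?a \<in> borel_measurable M"
      by (intro borel_measurable_sum measurable_compose[OF _ measurable_ennreal] borel_measurable_power borel_measurable_diff ZX measurable_compose[OF Xs[OF k] hm[OF k]])
    have bm: "?b \<in> borel_measurable M"
      by (intro borel_measurable_sum measurable_compose[OF _ measurable_ennreal] borel_measurable_power borel_measurable_diff measurable_compose[OF Xs[OF k] hm[OF k]]
         measurable_compose[OF Xs[OF k] measurable_compose[OF \<gamma>(4)[OF k] coord_measurable]])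
    have "(\<integral>\<^sup>+\<omega>. ?f (?s k, X (?s k) \<omega>) \<partial>M) \<le> (\<integral>\<^sup>+\<omega>. 2 * ?a \<omega> + 2 * ?b \<omega> \<partial>M)"
    proof (rule nn_integral_mono)
      fix \<omega>
      let ?x = "X (?s k) \<omega>"
      have "(vnorm D (Z (?s k) ?x - zh (?s k) ?x))\<^sup>2 = (\<Sum>i<D. ((Z (?s k) ?x i - h k i ?x) + (h k i ?x - realize (\<gamma> k) ?x i))\<^sup>2)"
        unfolding vnorm_square zh[OF k] by simp
      also have "\<dots> \<le> (\<Sum>i<D. 2 * ((Z (?s k) ?x i - h k i ?x)\<^sup>2 + (h k i ?x - realize (\<gamma> k) ?x i)\<^sup>2))"
        by (intro sum_mono square_add_le)
      also have "\<dots> = 2 * (\<Sum>i<D. (Z (?s k) ?x i - h k i ?x)\<^sup>2) + 2 * (\<Sum>i<D. (h k i ?x - realize (\<gamma> k) ?x i)\<^sup>2)"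
        by (simp add: sum.distrib sum_distrib_left)
      finally have "?f (?s k, ?x) \<le> ennreal (2 * (\<Sum>i<D. (Z (?s k) ?x i - h k i ?x)\<^sup>2) + 2 * (\<Sum>i<D. (h k i ?x - realize (\<gamma> k) ?x i)\<^sup>2))"
        by (intro ennreal_leI) simp
      also have "\<dots> = 2 * ?a \<omega> + 2 * ?b \<omega>"
        by (subst (1 2) sum_ennreal) (auto simp: ennreal_plus ennreal_mult sum_nonneg)
      finally show "?f (?s k, ?x) \<le> 2 * ?a \<omega> + 2 * ?b \<omega>" .
    qed
    also have "\<dots> = 2 * (\<integral>\<^sup>+\<omega>. ?a \<omega> \<partial>M) + 2 * (\<integral>\<^sup>+\<omega>. ?b \<omega> \<partial>M)"
      unfolding nn_integral_add[OF borel_measurable_times_ennreal[OF borel_measurable_const am] borel_measurable_times_ennreal[OF borel_measurable_const bm]]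
        nn_integral_cmult[OF am] nn_integral_cmult[OF bm] ..
    also have "\<dots> \<le> 2 * (\<integral>\<^sup>+\<omega>. ?a \<omega> \<partial>M) + 2 * ennreal (e\<^sup>2 / (4 * T))" by (intro add_left_mono mult_left_mono \<gamma>(5) k) simp
    also have "2 * ennreal (e\<^sup>2 / (4 * T)) = ennreal (e\<^sup>2 / (2 * T))"
      using T0 by (simp add: ennreal_mult[symmetric] flip: ennreal_numeral)
    finally have "ennreal ?d * (\<integral>\<^sup>+\<omega>. ?f (?s k, X (?s k) \<omega>) \<partial>M) \<le> ennreal ?d * (2 * (\<integral>\<^sup>+\<omega>. ?a \<omega> \<partial>M) + ennreal (e\<^sup>2 / (2 * T)))"
      by (rule mult_left_mono) simp
    also have "\<dots> = 2 * (ennreal ?d * (\<integral>\<^sup>+\<omega>. ?a \<omega> \<partial>M)) + ennreal (?d * (e\<^sup>2 / (2 * T)))"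
    proof -
      have eq: "ennreal (?d * (e\<^sup>2 / (2 * T))) = ennreal ?d * ennreal (e\<^sup>2 / (2 * T))" using d T0 by (intro ennreal_mult) auto
      show ?thesis unfolding eq distrib_left by (simp only: mult.left_commute)
    qed
    finally show "ennreal ?d * (\<integral>\<^sup>+\<omega>. ?f (?s k, X (?s k) \<omega>) \<partial>M) \<le> 2 * (ennreal ?d * (\<integral>\<^sup>+\<omega>. ?a \<omega> \<partial>M)) + ennreal (?d * (e\<^sup>2 / (2 * T)))" .
  qed
  also have "\<dots> = 2 * (\<Sum>k<m. ennreal ?d * (\<integral>\<^sup>+\<omega>. (\<Sum>i<D. ennreal ((Z (?s k) (X (?s k) \<omega>) i - h k i (X (?s k) \<omega>))\<^sup>2)) \<partial>M))
      + ennreal (real m * (?d * (e\<^sup>2 / (2 * T))))"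
  proof -
    have "(\<Sum>k<m. ennreal (?d * (e\<^sup>2 / (2 * T)))) = ennreal (real m * (?d * (e\<^sup>2 / (2 * T))))"
      using d T0 by (subst sum_ennreal) auto
    then show ?thesis unfolding sum.distrib sum_distrib_left by simp
  qed
  also have "\<dots> \<le> 2 * ennreal (e\<^sup>2 / 4) + ennreal (e\<^sup>2 / 2)"
  proof (intro add_mono mult_left_mono e1 ennreal_leI)
    have "real m * (?d * (e\<^sup>2 / (2 * T))) = (real m * ?d) * (e\<^sup>2 / (2 * T))" by simp
    also have "\<dots> \<le> T * (e\<^sup>2 / (2 * T))" using md T0 by (intro mult_right_mono) auto
    also have "\<dots> = e\<^sup>2 / 2" using T0 by simp
    finally show "real m * (?d * (e\<^sup>2 / (2 * T))) \<le> e\<^sup>2 / 2" .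
  qed simp
  also have "\<dots> = ennreal (e\<^sup>2)"
  proof -
    have "2 * ennreal (e\<^sup>2 / 4) = ennreal (e\<^sup>2 / 2)" by (simp add: ennreal_mult[symmetric] flip: ennreal_numeral)
    then show ?thesis by (simp add: ennreal_plus[symmetric] del: ennreal_plus)
  qed
  finally have fin: "(\<integral>\<^sup>+z. ?f z \<partial>mu_meas M X T N m n) \<le> ennreal (e\<^sup>2)" .
  show ?thesis
    by (rule exI[of _ \<gamma>], intro conjI exI[of _ zh] allI impI ballI growth_leI)
       (use \<gamma> zh fin in auto)
qed

end

section \<open>Uniformity in the dimension\<close>

text \<open>Nonnegativity is included to close the class under products, and a nonnegative exponent
  to compare powers of \<open>D \<ge> 1\<close> in sums.\<close>

definition poly_bounded :: "(nat \<Rightarrow> real) \<Rightarrow> bool" where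
  "poly_bounded f \<longleftrightarrow> (\<exists>A \<alpha>. A \<ge> 0 \<and> \<alpha> \<ge> 0 \<and> (\<forall>D\<ge>1. 0 \<le> f D \<and> f D \<le> A * real D powr \<alpha>))"

lemma poly_boundedI:
  "A \<ge> 0 \<Longrightarrow> \<alpha> \<ge> 0 \<Longrightarrow> (\<And>D. D \<ge> 1 \<Longrightarrow> 0 \<le> f D) \<Longrightarrow> (\<And>D. D \<ge> 1 \<Longrightarrow> f D \<le> A * real D powr \<alpha>) \<Longrightarrow> poly_bounded f"
  unfolding poly_bounded_def by blast

lemma poly_bounded_const: "c \<ge> 0 \<Longrightarrow> poly_bounded (\<lambda>_. c)"
  by (rule poly_boundedI[of c 0]) auto

lemma poly_bounded_monomial: "c \<ge> 0 \<Longrightarrow> q \<ge> 0 \<Longrightarrow> poly_bounded (\<lambda>D. c * real D powr q)"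
  by (rule poly_boundedI[of c q]) auto

lemma poly_bounded_add:
  assumes "poly_bounded f" "poly_bounded g" shows "poly_bounded (\<lambda>D. f D + g D)"
proof -
  obtain A \<alpha> where f: "A \<ge> 0" "\<alpha> \<ge> 0" "\<And>D. D \<ge> 1 \<Longrightarrow> 0 \<le> f D \<and> f D \<le> A * real D powr \<alpha>"
    using assms(1) unfolding poly_bounded_def by blast
  obtain B \<beta> where g: "B \<ge> 0" "\<beta> \<ge> 0" "\<And>D. D \<ge> 1 \<Longrightarrow> 0 \<le> g D \<and> g D \<le> B * real D powr \<beta>"
    using assms(2) unfolding poly_bounded_def by blast
  show ?thesis
  proof (rule poly_boundedI[of "A + B" "\<alpha> + \<beta>"])
    fix D :: nat assume D: "D \<ge> 1"
    have "A * real D powr \<alpha> \<le> A * real D powr (\<alpha> + \<beta>)" "B * real D powr \<beta> \<le> B * real D powr (\<alpha> + \<beta>)"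
      using f(1,2) g(1,2) D by (auto intro!: mult_left_mono powr_mono)
    then show "f D + g D \<le> (A + B) * real D powr (\<alpha> + \<beta>)" using f(3)[OF D] g(3)[OF D] unfolding distrib_right by linarith
    show "0 \<le> f D + g D" using f(3)[OF D] g(3)[OF D] by simp
  qed (use f g in auto)
qed

lemma poly_bounded_mult:
  assumes "poly_bounded f" "poly_bounded g" shows "poly_bounded (\<lambda>D. f D * g D)"
proof -
  obtain A \<alpha> where f: "A \<ge> 0" "\<alpha> \<ge> 0" "\<And>D. D \<ge> 1 \<Longrightarrow> 0 \<le> f D \<and> f D \<le> A * real D powr \<alpha>"
    using assms(1) unfolding poly_bounded_def by blast
  obtain B \<beta> where g: "B \<ge> 0" "\<beta> \<ge> 0" "\<And>D. D \<ge> 1 \<Longrightarrow> 0 \<le> g D \<and> g D \<le> B * real D powr \<beta>"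
    using assms(2) unfolding poly_bounded_def by blast
  show ?thesis
  proof (rule poly_boundedI[of "A * B" "\<alpha> + \<beta>"])
    fix D :: nat assume D: "D \<ge> 1"
    have "f D * g D \<le> (A * real D powr \<alpha>) * (B * real D powr \<beta>)"
      using f(1) f(3)[OF D] g(3)[OF D] by (intro mult_mono) auto
    then show "f D * g D \<le> A * B * real D powr (\<alpha> + \<beta>)" by (simp add: powr_add mult_ac)
    show "0 \<le> f D * g D" using f(3)[OF D] g(3)[OF D] by simp
  qed (use f g in auto)
qed

lemma poly_bounded_power: "poly_bounded f \<Longrightarrow> poly_bounded (\<lambda>D. f D ^ k)"
  by (induction k) (auto intro: poly_bounded_const poly_bounded_mult)

lemma poly_bounded_monomial_powr:
  assumes "c > 0" "q \<ge> 0" "p \<ge> 0" shows "poly_bounded (\<lambda>D. (c * real D powr q) powr p)"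
proof -
  have "(\<lambda>D. (c * real D powr q) powr p) = (\<lambda>D. c powr p * real D powr (q * p))"
    using assms by (simp add: powr_mult powr_powr fun_eq_iff)
  then show ?thesis using assms by (simp add: poly_bounded_monomial)
qed

lemma poly_bounded_of_nat: "poly_bounded real"
  by (rule poly_boundedI[of 1 1]) auto

text \<open>The tolerance for the approximation of \<open>V\<close> is
  \<open>e * sqrt dt / 2\<close> with \<open>dt = 1 / (\<kappa> * m)\<close>; its negative power
  contributes \<open>m powr (t / 2)\<close>, one of the sources of powers of
  \<open>N0\<close>.\<close>

lemma scaled_tolerance_powr:
  assumes "e > 0" "\<kappa> > 0" "m > (0::real)"
  shows "(e * sqrt (1 / (\<kappa> * m)) / 2) powr (- t) = 2 powr t * \<kappa> powr (t / 2) * e powr (- t) * m powr (t / 2)"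
proof -
  have "sqrt (1 / (\<kappa> * m)) = (\<kappa> * m) powr (- (1 / 2))"
    using assms by (simp add: powr_minus powr_half_sqrt real_sqrt_divide inverse_eq_divide)
  then have "(e * sqrt (1 / (\<kappa> * m)) / 2) powr (- t) = (e * (\<kappa> * m) powr (- (1 / 2)) * 2 powr (- 1)) powr (- t)"
    by (simp add: powr_minus)
  also have "\<dots> = e powr (- t) * (\<kappa> * m) powr (t / 2) * 2 powr t"
    using assms by (simp only: powr_mult powr_powr) simp
  also have "(\<kappa> * m) powr (t / 2) = \<kappa> powr (t / 2) * m powr (t / 2)" using assms by (simp add: powr_mult)
  finally show ?thesis by simp
qed

text \<open>Bookkeeping for \<open>Y ^ 12\<close>: the factor \<open>m\<close> of \<open>Y\<close>
  and the factor \<open>m powr (t / 2)\<close> from the tolerance combine to the exponent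
  \<open>12 + 6 * t\<close>.\<close>

lemma power12_bound:
  assumes "e > 0" "m > (0::real)" "x > 0"
  shows "(A * x powr s * m * (c * x powr q * e powr (- t) * m powr (t / 2))) ^ 12
     = A ^ 12 * c ^ 12 * x powr (12 * s + 12 * q) * e powr (- (12 * t)) * m powr (12 + 6 * t)"
proof -
  have pw: "(y powr r) ^ 12 = y powr (12 * r)" if "y > 0" for y r :: real
    using that by (simp add: powr_power mult.commute)
  have m12: "m ^ 12 = m powr 12" using assms by simp
  show ?thesis unfolding power_mult_distrib pw[OF assms(1)] pw[OF assms(2)] pw[OF assms(3)] m12 powr_add by simp
qed

text \<open>A network of positive size satisfies \<open>1 \<le> P\<close>, which allows bounding \<open>1 / e\<close> also when \<open>e\<close> is large.\<close>
lemma inverse_tolerance_le: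
  assumes "e > 0" "c' > 0" "x \<ge> 1" "m \<ge> (1::real)" "q \<ge> 0" "t \<ge> 1"
    and P: "P = c' * x powr q * e powr (- t) * m powr (t / 2)" "P \<ge> 1"
  shows "1 / e \<le> (1 + 1 / c') * P"
proof (cases "1 / e \<le> 1")
  case True
  have "1 * 1 \<le> (1 + 1 / c') * P" using assms by (intro mult_mono) auto
  with True show ?thesis by simp
next
  case False
  then have e1: "e \<le> 1" "1 / e \<ge> 1" using assms by (auto simp: field_simps)
  have "1 / e = (1 / e) powr 1" using assms(1) by simp
  also have "\<dots> \<le> (1 / e) powr t" using e1 assms by (intro powr_mono) auto
  also have "\<dots> = e powr (- t)" using assms by (simp add: powr_divide powr_minus inverse_eq_divide)
  finally have 1: "1 / e \<le> e powr (- t)" .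
  have "1 * 1 \<le> x powr q * m powr (t / 2)" using assms by (intro mult_mono ge_one_powr_ge_zero) auto
  then have "e powr (- t) * 1 \<le> e powr (- t) * (x powr q * m powr (t / 2))" by (intro mult_left_mono) auto
  also have "\<dots> = 1 / c' * P" unfolding P using assms by simp
  also have "\<dots> \<le> (1 + 1 / c') * P" using P(2) by (intro mult_right_mono) auto
  finally show ?thesis using 1 by simp
qed

lemma flow_modelI:
  assumes "T > 0" "N \<ge> 1" "D \<ge> 1" "p > 2" "cb > 0" "is_BM M D T W" "sde_coeffs D T a b" "sde_sol M D W a b 0 x0 T X"
    "x0 \<in> vspace D" "cond_C4 M D W a b T N fl p cb qb"
  shows "\<exists>L. flow_model M D T W a b L X x0 fl N p (cb * real D powr qb)"
proof -
  obtain L where L: "L \<ge> 0" "\<And>i. lip_coeff T D L (\<lambda>t x. a t x i)" "\<And>i j. lip_coeff T D L (\<lambda>t x. b t x i j)"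
    using sde_coeffs_lip[OF assms(7)] by blast
  interpret prob_space M using assms(6) unfolding is_BM_def by blast
  have C: "\<And>s x. s \<in> {0..T} \<Longrightarrow> x \<in> vspace D \<Longrightarrow> sde_sol M D W a b s x T (fl x s)"
    "\<And>n s t. n < N \<Longrightarrow> tgrid T N n \<le> s \<and> s < t \<and> t \<le> tgrid T N (Suc n) \<Longrightarrow>
        (\<integral>\<^sup>+\<omega>. ennpow (growth D D (\<lambda>x. fl x s t \<omega>)) p \<partial>M) \<le> ennreal ((cb * real D powr qb) powr p)
      \<and> (\<exists>(I::nat) (w :: 'a \<Rightarrow> nat \<Rightarrow> nat \<Rightarrow> vec).
            real I \<le> cb * real D powr qb
          \<and> (\<forall>l m j. (\<lambda>\<omega>. w \<omega> l m j) \<in> borel_measurable M)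
          \<and> (\<forall>\<omega>\<in>space M. ran_valid D I (w \<omega>))
          \<and> (AE \<omega> in M. \<forall>x\<in>vspace D. fl x s t \<omega> = ran_eval (w \<omega>) I x)
          \<and> (\<integral>\<^sup>+\<omega>. ran_size I (w \<omega>) \<partial>M) \<le> ennreal (cb * real D powr qb))"
    using assms(10) unfolding cond_C4_def by blast+
  have "flow_model M D T W a b L X x0 fl N p (cb * real D powr qb)"
  proof unfold_locales
    show "\<And>t x. a t x \<in> vspace D" "\<And>t x i j. i \<ge> D \<Longrightarrow> b t x i j = 0" using assms(7) unfolding sde_coeffs_def by blast+
    show "0 < cb * real D powr qb" using assms(3,5) by simp
    fix s t n assume "n < N" "tgrid T N n \<le> s" "s < t" "t \<le> tgrid T N (Suc n)"
    then show "(\<integral>\<^sup>+\<omega>. ennpow (growth D D (\<lambda>x. fl x s t \<omega>)) p \<partial>M) \<le> ennreal ((cb * real D powr qb) powr p)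
      \<and> (\<exists>(I::nat) (w :: 'a \<Rightarrow> nat \<Rightarrow> nat \<Rightarrow> vec).
            real I \<le> cb * real D powr qb
          \<and> (\<forall>l m j. (\<lambda>\<omega>. w \<omega> l m j) \<in> borel_measurable M)
          \<and> (\<forall>\<omega>\<in>space M. ran_valid D I (w \<omega>))
          \<and> (AE \<omega> in M. \<forall>x\<in>vspace D. fl x s t \<omega> = ran_eval (w \<omega>) I x)
          \<and> (\<integral>\<^sup>+\<omega>. ran_size I (w \<omega>) \<partial>M) \<le> ennreal (cb * real D powr qb))" using C(2) by simp
  qed (use assms L C(1) in auto)
  then show ?thesis ..
qed

theorem theorem8:
  fixes T :: real and N :: nat
    and M :: "nat \<Rightarrow> 'w measure"
    and W X :: "nat \<Rightarrow> real \<Rightarrow> 'w \<Rightarrow> vec"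
    and a :: "nat \<Rightarrow> real \<Rightarrow> vec \<Rightarrow> vec"
    and b :: "nat \<Rightarrow> real \<Rightarrow> vec \<Rightarrow> nat \<Rightarrow> nat \<Rightarrow> real"
    and x0 :: "nat \<Rightarrow> vec"
    and g :: "nat \<Rightarrow> real \<Rightarrow> vec \<Rightarrow> real"
    and fl :: "nat \<Rightarrow> vec \<Rightarrow> real \<Rightarrow> real \<Rightarrow> 'w \<Rightarrow> vec"
    and fmap :: "nat \<Rightarrow> nat \<Rightarrow> vec \<Rightarrow> 'w \<Rightarrow> vec"
    and ptil p c q :: real
  assumes T_pos: "T > 0" and N_pos: "N \<ge> 1"
    and BM: "\<forall>D\<ge>1. is_BM (M D) D T (W D)"
    and coeffs: "\<forall>D\<ge>1. sde_coeffs D T (a D) (b D)"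
    and sol: "\<forall>D\<ge>1. sde_sol (M D) D (W D) (a D) (b D) 0 (x0 D) T (X D)"
    and C4: "ptil > 2"
      "\<exists>cb qb. cb > 0 \<and> qb > 0 \<and> (\<forall>D\<ge>1. cond_C4 (M D) D (W D) (a D) (b D) T N (fl D) ptil cb qb)"
    and C3: "p \<ge> 2" "c > 0" "q > 0"
      "\<forall>D\<ge>1. cond_C3_1 (M D) D (W D) (X D) T N (fmap D)
          \<and> (\<forall>n<N. (\<integral>\<^sup>+\<omega>. ennpow (growth D D (\<lambda>x. fmap D n x \<omega>)) p \<partial>M D)
                     \<le> ennreal ((c * real D powr q) powr p))"
    and x0: "\<forall>D\<ge>1. x0 D \<in> vspace D \<and> vnorm D (x0 D) \<le> c * real D powr q"
    and payoff: "\<forall>D\<ge>1. \<forall>n\<le>N. g D (tgrid T N n) \<in> borel_measurable borel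
        \<and> integrable (M D) (\<lambda>\<omega>. (g D (tgrid T N n) (X D (tgrid T N n) \<omega>))^2)"
    and C5: "\<exists>c5 q5 r5. c5 > 0 \<and> q5 > 0 \<and> r5 > 0 \<and> (\<forall>D\<ge>1. cond_C5 D T N (g D) c5 q5 r5)"
    and Vapprox: "\<forall>n<N. \<exists>cn qn \<tau>n. cn \<ge> 1 \<and> qn \<ge> 1 \<and> \<tau>n \<ge> 1 \<and>
        (\<forall>D\<ge>1. \<forall>\<epsilon>>0. \<forall>N0\<ge>1. \<exists>\<Phi>. valid_net D 1 \<Phi>
           \<and> (\<integral>\<^sup>+x. ennreal ((Vfun (M D) (g D) (fl D) T N (Suc n) x - realize \<Phi> x 0)^2)
                 \<partial>rho_meas (M D) D (W D) (X D) T N N0 n) \<le> ennreal (\<epsilon>^2)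
           \<and> growth D 1 (realize \<Phi>) \<le> ennreal (cn * real D powr qn * \<epsilon> powr (- \<tau>n))
           \<and> real (net_size \<Phi>) \<le> cn * real D powr qn * \<epsilon> powr (- \<tau>n))"
  shows "\<forall>n<N. \<exists>ch qh \<tau>h mh. ch \<ge> 1 \<and> qh \<ge> 1 \<and> \<tau>h \<ge> 1 \<and> mh \<ge> 1 \<and>
     (\<forall>D\<ge>1. \<forall>\<epsilon>>0. \<forall>N0\<ge>1. \<forall>Z.
        is_Zstar (M D) D (W D) (X D) (Vfun (M D) (g D) (fl D) T N (Suc n)) T N N0 n Z \<longrightarrow>
        (\<exists>\<gamma> :: nat \<Rightarrow> relu_net.
           (\<forall>k<N0. valid_net D D (\<gamma> k))
         \<and> (\<exists>zh :: real \<Rightarrow> vec \<Rightarrow> vec.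
              (\<forall>k<N0. \<forall>x\<in>vspace D. zh (tsub T N N0 n k) x = realize (\<gamma> k) x)
            \<and> (\<integral>\<^sup>+tx. ennreal ((vnorm D (Z (fst tx) (snd tx) - zh (fst tx) (snd tx)))^2)
                  \<partial>mu_meas (M D) (X D) T N N0 n) \<le> ennreal (\<epsilon>^2))
         \<and> (\<forall>k<N0. growth D D (realize (\<gamma> k)) \<le> ennreal (ch * real D powr qh * \<epsilon> powr (- \<tau>h) * real N0 powr mh)
                 \<and> real (net_size (\<gamma> k)) \<le> ch * real D powr qh * \<epsilon> powr (- \<tau>h) * real N0 powr mh)))"
proof (intro allI impI)
  fix n assume n: "n < N"
  obtain cb qb where cb: "cb > 0" "qb > 0" "\<And>D. D \<ge> 1 \<Longrightarrow> cond_C4 (M D) D (W D) (a D) (b D) T N (fl D) ptil cb qb"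
    using C4(2) by blast
  obtain cn qn t where cn: "cn \<ge> 1" "qn \<ge> 1" "t \<ge> 1" and
    V: "\<And>D \<epsilon> N0. D \<ge> 1 \<Longrightarrow> \<epsilon> > 0 \<Longrightarrow> N0 \<ge> 1 \<Longrightarrow> \<exists>\<Phi>. valid_net D 1 \<Phi>
           \<and> (\<integral>\<^sup>+x. ennreal ((Vfun (M D) (g D) (fl D) T N (Suc n) x - realize \<Phi> x 0)^2)
                 \<partial>rho_meas (M D) D (W D) (X D) T N N0 n) \<le> ennreal (\<epsilon>^2)
           \<and> growth D 1 (realize \<Phi>) \<le> ennreal (cn * real D powr qn * \<epsilon> powr (- t))
           \<and> real (net_size \<Phi>) \<le> cn * real D powr qn * \<epsilon> powr (- t)"
    using Vapprox[rule_format, OF n] by (elim exE conjE) blast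
  \<comment> \<open>Then \<open>1 / dt T N N0 = \<kappa> * N0\<close>, with \<open>\<kappa>\<close>
    independent of the dimension.\<close>
  define \<kappa> where "\<kappa> = real N / T"
  have \<kappa>: "\<kappa> > 0" using T_pos N_pos by (simp add: \<kappa>_def)
  \<comment> \<open>What becomes of \<open>cn\<close> when the tolerance is rescaled by
    \<open>sqrt dt / 2\<close>.\<close>
  define c' where "c' = cn * (2 powr t * \<kappa> powr (t / 2))"
  have c': "c' > 0" using cn \<kappa> by (simp add: c'_def)
  \<comment> \<open>The exponent \<open>jexp\<close> of the locale; it depends on
    \<open>ptil\<close> alone and can be fixed before the dimension.\<close>
  define j where "j = nat \<lceil>2 + 4 / (ptil - 2)\<rceil>"
  let ?K = "\<lambda>D. cb * real D powr qb"
  let ?Q = "\<lambda>D. 1 + 2 powr ptil * (1 + ?K D powr ptil) + real D ^ Suc j * (fact (2 * j) / (2 ^ j * fact j) * T ^ j)"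
  let ?m2 = "\<lambda>D. (10 + 4 * ?K D powr ptil) ^ Suc n * (1 + c * real D powr q)\<^sup>2"
  have "poly_bounded (\<lambda>D. ?K D + ?Q D + ?m2 D + (1 + T + \<kappa> + (1 + 1 / c')))"
    \<comment> \<open>All quantities that vary with the dimension are put into one sum, so that a
      single monomial bounds each of them; the constant summands make its coefficient
      \<open>A\<close> itself large.\<close>
    using cb C4(1) C3 T_pos \<kappa> c'
    by (intro poly_bounded_add poly_bounded_mult poly_bounded_power poly_bounded_monomial_powr poly_bounded_monomial
        poly_bounded_of_nat poly_bounded_const) auto
  then obtain A \<alpha> where A: "A \<ge> 0" "\<alpha> \<ge> 0"
    "\<And>D. D \<ge> 1 \<Longrightarrow> ?K D + ?Q D + ?m2 D + (1 + T + \<kappa> + (1 + 1 / c')) \<le> A * real D powr \<alpha>"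
    unfolding poly_bounded_def by blast
  have nonneg: "?K D \<ge> 0" "?Q D \<ge> 0" "?m2 D \<ge> 0" for D using cb T_pos C3 by (auto intro!: add_nonneg_nonneg mult_nonneg_nonneg)
  have A1: "1 + T + \<kappa> + (1 + 1 / c') \<le> A"
  proof -
    have "A * real (1::nat) powr \<alpha> = A" by simp
    then show ?thesis using A(3)[OF order_refl] nonneg[of 1] by linarith
  qed
  have A_le: "?K D \<le> A * real D powr \<alpha>" "?Q D \<le> A * real D powr \<alpha>" "?m2 D \<le> A * real D powr \<alpha>" if "D \<ge> 1" for D
    using A(3)[OF that] nonneg[of D] T_pos \<kappa> c' zero_le_divide_1_iff[of c'] by linarith+
  have A_ge: "A \<ge> 1" "A \<ge> T" "A \<ge> \<kappa>" "A \<ge> 1 + 1 / c'" using A1 T_pos \<kappa> c' zero_le_divide_1_iff[of c'] by linarith+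
  \<comment> \<open>The final constants are read off \<open>224 * Y ^ 12\<close>; the maximum
    provides \<open>ch \<ge> 1\<close>.\<close>
  define ch where "ch = max 1 (224 * (A ^ 12 * c' ^ 12))"
  define qh where "qh = 12 * (\<alpha> + 1) + 12 * qn"
  let ?B = "\<lambda>D \<epsilon> N0. ch * real D powr qh * \<epsilon> powr (- (12 * t)) * real N0 powr (12 + 6 * t)"
  have main: "\<exists>\<gamma> :: nat \<Rightarrow> relu_net. (\<forall>k<N0. valid_net D D (\<gamma> k))
         \<and> (\<exists>zh :: real \<Rightarrow> vec \<Rightarrow> vec.
              (\<forall>k<N0. \<forall>x\<in>vspace D. zh (tsub T N N0 n k) x = realize (\<gamma> k) x)
            \<and> (\<integral>\<^sup>+tx. ennreal ((vnorm D (Z (fst tx) (snd tx) - zh (fst tx) (snd tx)))^2)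
                  \<partial>mu_meas (M D) (X D) T N N0 n) \<le> ennreal (\<epsilon>^2))
         \<and> (\<forall>k<N0. growth D D (realize (\<gamma> k)) \<le> ennreal (?B D \<epsilon> N0) \<and> real (net_size (\<gamma> k)) \<le> ?B D \<epsilon> N0)"
    if D: "D \<ge> 1" and e: "\<epsilon> > 0" and m: "N0 \<ge> 1"
      and Z: "is_Zstar (M D) D (W D) (X D) (Vfun (M D) (g D) (fl D) T N (Suc n)) T N N0 n Z" for D \<epsilon> N0 Z
  proof -
    have x0D: "x0 D \<in> vspace D" "vnorm D (x0 D) \<le> c * real D powr q" using x0 D by auto
    obtain L where "flow_model (M D) D T (W D) (a D) (b D) L (X D) (x0 D) (fl D) N ptil (?K D)"
      using flow_modelI[OF T_pos N_pos D C4(1) cb(1) BM[rule_format, OF D] coeffs[rule_format, OF D] sol[rule_format, OF D] x0D(1) cb(3)[OF D]]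
      by blast
    then interpret fm: flow_model "M D" D T "W D" "a D" "b D" L "X D" "x0 D" "fl D" N ptil "?K D" .
    have dt: "dt T N N0 = 1 / (\<kappa> * real N0)" using T_pos by (simp add: dt_def \<kappa>_def)
    have d0: "dt T N N0 > 0" unfolding dt using \<kappa> m by simp
    let ?e = "\<epsilon> * sqrt (dt T N N0) / 2"
    have e0: "?e > 0" using e d0 by simp
    define P where "P = c' * real D powr qn * \<epsilon> powr (- t) * real N0 powr (t / 2)"
    have P0: "P > 0" unfolding P_def using c' D e m by simp
    have Peq: "cn * real D powr qn * ?e powr (- t) = P"
      unfolding dt P_def c'_def using scaled_tolerance_powr[OF e \<kappa>, of "real N0" t] m by simp
    obtain \<Phi> where \<Phi>: "valid_net D 1 \<Phi>" "growth D 1 (realize \<Phi>) \<le> ennreal P" "real (net_size \<Phi>) \<le> P"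
      "(\<integral>\<^sup>+x. ennreal ((Vfun (M D) (g D) (fl D) T N (Suc n) x - realize \<Phi> x 0)^2)
                 \<partial>rho_meas (M D) D (W D) (X D) T N N0 n) \<le> ennreal (?e^2)"
      using V[OF D e0 m] unfolding Peq by blast
    obtain V' where V': "V' \<in> borel_measurable borel" "\<And>x. x \<in> vspace D \<Longrightarrow> Vfun (M D) (g D) (fl D) T N (Suc n) x = V' x"
      using fm.Vfun_measurable[of "g D" "Suc n"] payoff D by blast
    \<comment> \<open>The exponent \<open>\<alpha> + 1\<close> leaves room for \<open>D\<close>
      itself, \<open>N0\<close> accounts for \<open>1 / dt\<close>, and \<open>P\<close> for the
      size of the network and for \<open>1 / \<epsilon>\<close>. A network of positive size has
      \<open>P \<ge> 1\<close>, so every single factor is below the product.\<close>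
    define Y where "Y = A * real D powr (\<alpha> + 1) * real N0 * P"
    have B0: "?B D \<epsilon> N0 \<ge> 0" by (simp add: ch_def)
    show ?thesis
    proof (rule fm.network_approximation[OF n m e V' \<Phi>(1) P0 \<Phi>(2,3,4) Z B0])
      assume "1 \<le> net_size \<Phi>"
      then have P1: "P \<ge> 1" using \<Phi>(3) by linarith
      have E: "real D powr (\<alpha> + 1) \<ge> 1" "real D powr \<alpha> \<le> real D powr (\<alpha> + 1)" "real D \<le> real D powr (\<alpha> + 1)"
        using D A(2) powr_mono[of 1 "\<alpha> + 1" "real D"] by (auto intro!: ge_one_powr_ge_zero powr_mono)
      have mN: "real N0 \<ge> 1" using m by simp
      have Y: "u \<le> Y" if "u \<le> x1 * x2 * x3 * x4" "0 \<le> x1" "x1 \<le> A" "0 \<le> x2" "x2 \<le> real D powr (\<alpha> + 1)" "0 \<le> x3" "x3 \<le> real N0" "0 \<le> x4" "x4 \<le> P"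
        for u x1 x2 x3 x4
      proof -
        have "x1 * x2 * x3 * x4 \<le> Y" unfolding Y_def using that A(1) by (intro mult_mono mult_nonneg_nonneg) auto
        then show ?thesis using that(1) by linarith
      qed
      have YD: "u \<le> Y" if "u \<le> A * real D powr \<alpha>" for u
        by (rule Y[of u A "real D powr \<alpha>" 1 1]) (use that A E mN P1 in auto)
      have "fm.Q1 = ?Q D" unfolding fm.Q1_def fm.jexp_def j_def ..
      moreover have "fm.m2max n \<le> ?m2 D"
        unfolding fm.m2max_def using x0D(2) vnorm_nonneg[of D "x0 D"] by (intro mult_left_mono power_mono) auto
      moreover have "real D \<le> Y" by (rule Y[of _ 1 "real D powr (\<alpha> + 1)" 1 1]) (use E A_ge mN P1 in auto)
      moreover have "P \<le> Y" by (rule Y[of _ 1 1 1 P]) (use E A_ge mN P1 in auto)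
      moreover have "1 / \<epsilon> \<le> Y"
      proof (rule Y[of _ "1 + 1 / c'" 1 1 P])
        show "1 / \<epsilon> \<le> (1 + 1 / c') * 1 * 1 * P"
          using inverse_tolerance_le[OF e c' _ mN _ cn(3) P_def P1] D cn by simp
      qed (use E A_ge mN P1 c' in auto)
      moreover have "T \<le> Y" by (rule Y[of _ T 1 1 1]) (use E A_ge mN P1 T_pos in auto)
      moreover have "1 / dt T N N0 \<le> Y" by (rule Y[of _ \<kappa> 1 "real N0" 1]) (use E A_ge mN P1 \<kappa> in \<open>auto simp: dt\<close>)
      moreover have "224 * Y ^ 12 \<le> ?B D \<epsilon> N0"
      proof -
        have "224 * Y ^ 12 = 224 * (A ^ 12 * c' ^ 12) * real D powr qh * \<epsilon> powr (- (12 * t)) * real N0 powr (12 + 6 * t)"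
          unfolding Y_def P_def qh_def using power12_bound[OF e, of "real N0" "real D" A "\<alpha> + 1" c' qn t] m D by simp
        also have "\<dots> \<le> ?B D \<epsilon> N0" unfolding ch_def by (intro mult_right_mono) auto
        finally show ?thesis .
      qed
      ultimately show "real D \<le> Y \<and> P \<le> Y \<and> ?K D \<le> Y \<and> fm.Q1 \<le> Y \<and> fm.m2max n \<le> Y \<and> 1 / \<epsilon> \<le> Y \<and> T \<le> Y
         \<and> 1 / dt T N N0 \<le> Y \<and> 224 * Y ^ 12 \<le> ?B D \<epsilon> N0"
        using YD[OF A_le(1)[OF D]] YD[OF A_le(2)[OF D]] YD[OF A_le(3)[OF D]] by linarith
    qed
  qed
  show "\<exists>ch qh \<tau>h mh. ch \<ge> 1 \<and> qh \<ge> 1 \<and> \<tau>h \<ge> 1 \<and> mh \<ge> 1 \<and>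
     (\<forall>D\<ge>1. \<forall>\<epsilon>>0. \<forall>N0\<ge>1. \<forall>Z.
        is_Zstar (M D) D (W D) (X D) (Vfun (M D) (g D) (fl D) T N (Suc n)) T N N0 n Z \<longrightarrow>
        (\<exists>\<gamma> :: nat \<Rightarrow> relu_net.
           (\<forall>k<N0. valid_net D D (\<gamma> k))
         \<and> (\<exists>zh :: real \<Rightarrow> vec \<Rightarrow> vec.
              (\<forall>k<N0. \<forall>x\<in>vspace D. zh (tsub T N N0 n k) x = realize (\<gamma> k) x)
            \<and> (\<integral>\<^sup>+tx. ennreal ((vnorm D (Z (fst tx) (snd tx) - zh (fst tx) (snd tx)))^2)
                  \<partial>mu_meas (M D) (X D) T N N0 n) \<le> ennreal (\<epsilon>^2))
         \<and> (\<forall>k<N0. growth D D (realize (\<gamma> k)) \<le> ennreal (ch * real D powr qh * \<epsilon> powr (- \<tau>h) * real N0 powr mh)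
                 \<and> real (net_size (\<gamma> k)) \<le> ch * real D powr qh * \<epsilon> powr (- \<tau>h) * real N0 powr mh)))"
  proof (rule exI[of _ ch], rule exI[of _ qh], rule exI[of _ "12 * t"], rule exI[of _ "12 + 6 * t"], intro conjI)
    show "ch \<ge> 1" by (simp add: ch_def)
    show "qh \<ge> 1" "12 * t \<ge> 1" "12 + 6 * t \<ge> 1" using A(2) cn by (simp_all add: qh_def)
  qed (intro allI impI main; assumption)
qed

end
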